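(* Let $X^{\mathbb{R}}_{E_7}$ and $X^{\mathbb{R}}_{E_8}$ be the real toric varieties associated to the Weyl chambers of the root systems of types $E_7$ and $E_8$, respectively, and let $\beta_k(X;\mathbb{Q}) = \dim_{\mathbb{Q}} H_k(X;\mathbb{Q})$ denote the $k$th rational Betti number. Then $$\beta_{k}(X^{\mathbb{R}}_{E_7};\mathbb{Q})= \begin{cases} 1, & k=0,\\ 63, & k=1,\\ 8127, & k=2,\\ 131041, & k=3,\\ 122976, & k=4,\\ 0, & \text{otherwise,}\end{cases}$$ and $$\beta_{k}(X^{\mathbb{R}}_{E_8};\mathbb{Q})= \begin{cases} 1, & k=0,\\ 120, & k=1,\\ 103815, & k=2,\\ 6925200, & k=3,\\ 23932800, & k=4,\\ 0, & \text{otherwise.}\end{cases}$$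
   Context: Let $\Phi_R$ be an irreducible (reduced, crystallographic) root system of type $R$ spanning a finite-dimensional Euclidean space $E$ of dimension $n$, with Weyl group $W_R$ and simple roots $\alpha_1,\dots,\alpha_n$. The Weyl chambers are the (closures of the) connected components of the complement in $E$ of the reflecting hyperplanes. The fundamental co-weights $\omega_1,\dots,\omega_n$ are the basis of $E$ dual to the simple roots, $\langle \alpha_i,\omega_j\rangle=\delta_{ij}$; they span the rays of the fundamental Weyl chamber. The co-weight lattice is $\mathbb{Z}\omega_1\oplus\cdots\oplus\mathbb{Z}\omega_n$. The Weyl chambers together with all their faces form a complete fan $\Sigma_R$ in $E$ which is non-singular with respect to the co-weight lattice. Let $X_R$ be the smooth compact complex toric variety of the fan $\Sigma_R$ with this lattice. The real toric variety associated to the Weyl chambers of type $R$, denoted $X_R^{\mathbb{R}}$, is the real locus (set of real points) of $X_R$, with its usual (Euclidean) topology. *)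

theory Defs
  imports
    "HOL-Analysis.Analysis"
    "HOL-Homology.Homology"
    "Jordan_Normal_Form.Missing_VectorSpace"
begin

section \<open>Root systems\<close>

definition root_reflection :: "'a::euclidean_space \<Rightarrow> 'a \<Rightarrow> 'a" where
  "root_reflection \<alpha> x = x - (2 * (x \<bullet> \<alpha>) / (\<alpha> \<bullet> \<alpha>)) *\<^sub>R \<alpha>"

definition cartan_number :: "'a::euclidean_space \<Rightarrow> 'a \<Rightarrow> real" where
  "cartan_number \<alpha> \<beta> = 2 * (\<alpha> \<bullet> \<beta>) / (\<beta> \<bullet> \<beta>)"

text \<open>Reduced crystallographic root systems spanning the whole space.\<close>

definition root_system :: "'a::euclidean_space set \<Rightarrow> bool" where
  "root_system \<Phi> \<longleftrightarrow>
     finite \<Phi> \<and> 0 \<notin> \<Phi> \<and> span \<Phi> = UNIV \<and>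
     (\<forall>\<alpha>\<in>\<Phi>. root_reflection \<alpha> ` \<Phi> = \<Phi>) \<and>
     (\<forall>\<alpha>\<in>\<Phi>. \<forall>\<beta>\<in>\<Phi>. cartan_number \<alpha> \<beta> \<in> \<int>) \<and>
     (\<forall>\<alpha>\<in>\<Phi>. \<forall>c. c *\<^sub>R \<alpha> \<in> \<Phi> \<longrightarrow> c = 1 \<or> c = - 1)"

definition irreducible_root_system :: "'a::euclidean_space set \<Rightarrow> bool" where
  "irreducible_root_system \<Phi> \<longleftrightarrow>
     root_system \<Phi> \<and> \<Phi> \<noteq> {} \<and>
     \<not> (\<exists>A B. A \<noteq> {} \<and> B \<noteq> {} \<and> A \<union> B = \<Phi> \<and> (\<forall>\<alpha>\<in>A. \<forall>\<beta>\<in>B. \<alpha> \<bullet> \<beta> = 0))"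

definition simple_roots :: "'a::euclidean_space set \<Rightarrow> (nat \<Rightarrow> 'a) \<Rightarrow> bool" where
  "simple_roots \<Phi> \<alpha> \<longleftrightarrow>
     inj_on \<alpha> {1..DIM('a)} \<and> \<alpha> ` {1..DIM('a)} \<subseteq> \<Phi> \<and> independent (\<alpha> ` {1..DIM('a)}) \<and>
     (\<forall>\<beta>\<in>\<Phi>. \<exists>c :: nat \<Rightarrow> int.
        \<beta> = (\<Sum>i = 1..DIM('a). of_int (c i) *\<^sub>R \<alpha> i) \<and>
        ((\<forall>i\<in>{1..DIM('a)}. 0 \<le> c i) \<or> (\<forall>i\<in>{1..DIM('a)}. c i \<le> 0)))"

text \<open>The Cartan matrix of \<open>E\<^sub>n\<close>, for \<open>n\<close> = 6, 7, 8, in Bourbaki's numbering: the Dynkin diagram is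
  the chain 1 - 3 - 4 - 5 - ... - \<open>n\<close> with the node 2 attached to the node 4.\<close>

definition E_cartan :: "nat \<Rightarrow> nat \<Rightarrow> int" where
  "E_cartan i j =
     (if i = j then 2
      else if {i, j} \<in> {{1, 3}, {3, 4}, {2, 4}, {4, 5}, {5, 6}, {6, 7}, {7, 8}} then - 1
      else 0)"

definition root_system_of_type_E :: "nat \<Rightarrow> 'a::euclidean_space set \<Rightarrow> bool" where
  "root_system_of_type_E n \<Phi> \<longleftrightarrow>
     irreducible_root_system \<Phi> \<and> DIM('a) = n \<and>
     (\<exists>\<alpha>. simple_roots \<Phi> \<alpha> \<and>
        (\<forall>i\<in>{1..n}. \<forall>j\<in>{1..n}. cartan_number (\<alpha> i) (\<alpha> j) = of_int (E_cartan i j)))"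

definition fundamental_coweight :: "(nat \<Rightarrow> 'a::euclidean_space) \<Rightarrow> nat \<Rightarrow> 'a" where
  "fundamental_coweight \<alpha> j =
     (THE \<omega>. \<forall>i\<in>{1..DIM('a)}. \<alpha> i \<bullet> \<omega> = (if i = j then 1 else 0))"

definition coweight_lattice :: "(nat \<Rightarrow> 'a::euclidean_space) \<Rightarrow> 'a set" where
  "coweight_lattice \<alpha> =
     {(\<Sum>j = 1..DIM('a). of_int (c j) *\<^sub>R fundamental_coweight \<alpha> j) | c :: nat \<Rightarrow> int. True}"

definition weyl_chambers :: "'a::euclidean_space set \<Rightarrow> 'a set set" where
  "weyl_chambers \<Phi> = closure ` components (UNIV - (\<Union>\<alpha>\<in>\<Phi>. {x. \<alpha> \<bullet> x = 0}))"

text \<open>In the library \<open>{} face_of C\<close> holds, but the empty set is not a cone of the fan.\<close>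

definition weyl_fan :: "'a::euclidean_space set \<Rightarrow> 'a set set" where
  "weyl_fan \<Phi> = {F. F \<noteq> {} \<and> (\<exists>C\<in>weyl_chambers \<Phi>. F face_of C)}"


section \<open>Complex toric varieties and their real loci\<close>

text \<open>The quotient of a space by an equivalence relation on its points, with the final topology.\<close>

definition quotient_topology :: "'a topology \<Rightarrow> ('a \<times> 'a) set \<Rightarrow> 'a set topology" where
  "quotient_topology X r =
     topology (\<lambda>U. U \<subseteq> topspace X // r \<and> openin X {x \<in> topspace X. r `` {x} \<in> U})"

lemma openin_quotient_topology:
  "openin (quotient_topology X r) U \<longleftrightarrow>
     U \<subseteq> topspace X // r \<and> openin X {x \<in> topspace X. r `` {x} \<in> U}"
proof -
  let ?P = "\<lambda>U. {x \<in> topspace X. r `` {x} \<in> U}"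
  have Int: "?P (S \<inter> T) = ?P S \<inter> ?P T" for S T
    by auto
  have Un: "?P (\<Union>\<K>) = (\<Union>K\<in>\<K>. ?P K)" for \<K>
    by auto
  have "istopology (\<lambda>U. U \<subseteq> topspace X // r \<and> openin X (?P U))"
    unfolding istopology_def Int Un by (blast intro: openin_Int openin_Union)
  then show ?thesis
    by (simp add: quotient_topology_def)
qed

definition dual_lattice :: "'a::euclidean_space set \<Rightarrow> 'a set" where
  "dual_lattice N = {m. \<forall>u\<in>N. m \<bullet> u \<in> \<int>}"

text \<open>The semigroup \<open>S\<^sub>\<sigma> = \<sigma>\<^sup>\<or> \<inter> M\<close> of a cone.\<close>

definition cone_semigroup :: "'a::euclidean_space set \<Rightarrow> 'a set \<Rightarrow> 'a set" where
  "cone_semigroup N \<sigma> = {m \<in> dual_lattice N. \<forall>u\<in>\<sigma>. 0 \<le> m \<bullet> u}"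

text \<open>The closed points of \<open>Spec \<complex>[S\<^sub>\<sigma>]\<close> are the monoid homomorphisms from \<open>S\<^sub>\<sigma>\<close> to the
  multiplicative monoid of the complex numbers.\<close>

definition affine_toric_points :: "'a::euclidean_space set \<Rightarrow> 'a set \<Rightarrow> ('a \<Rightarrow> complex) set" where
  "affine_toric_points N \<sigma> =
     {\<gamma> \<in> extensional (cone_semigroup N \<sigma>).
        \<gamma> 0 = 1 \<and>
        (\<forall>m\<in>cone_semigroup N \<sigma>. \<forall>m'\<in>cone_semigroup N \<sigma>. \<gamma> (m + m') = \<gamma> m * \<gamma> m')}"

text \<open>Since \<open>S\<^sub>\<sigma>\<close> is finitely generated for the cones of a fan, the topology of pointwise convergence
  is the Euclidean topology that an embedding of the affine variety in \<open>\<complex>\<^sup>m\<close> induces.\<close>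

definition affine_toric_variety :: "'a::euclidean_space set \<Rightarrow> 'a set \<Rightarrow> ('a \<Rightarrow> complex) topology" where
  "affine_toric_variety N \<sigma> =
     subtopology (product_topology (\<lambda>_. euclidean) (cone_semigroup N \<sigma>)) (affine_toric_points N \<sigma>)"

text \<open>The charts of \<open>\<sigma>\<close> and \<open>\<tau>\<close> are glued along the chart of \<open>\<sigma> \<inter> \<tau>\<close>, whose embeddings into
  them are the restrictions of homomorphisms to \<open>S\<^sub>\<sigma>\<close> and \<open>S\<^sub>\<tau>\<close>.\<close>

definition toric_glueing ::
    "'a::euclidean_space set \<Rightarrow> 'a set set \<Rightarrow>
     (('a set \<times> ('a \<Rightarrow> complex)) \<times> ('a set \<times> ('a \<Rightarrow> complex))) set" where
  "toric_glueing N \<Sigma> =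
     {((\<sigma>, \<gamma>), (\<tau>, \<delta>)) | \<sigma> \<gamma> \<tau> \<delta>.
        \<sigma> \<in> \<Sigma> \<and> \<tau> \<in> \<Sigma> \<and>
        (\<exists>\<epsilon>\<in>affine_toric_points N (\<sigma> \<inter> \<tau>).
           \<gamma> = restrict \<epsilon> (cone_semigroup N \<sigma>) \<and> \<delta> = restrict \<epsilon> (cone_semigroup N \<tau>))}"

definition toric_variety ::
    "'a::euclidean_space set \<Rightarrow> 'a set set \<Rightarrow> ('a set \<times> ('a \<Rightarrow> complex)) set topology" where
  "toric_variety N \<Sigma> =
     quotient_topology (sum_topology (affine_toric_variety N) \<Sigma>) (toric_glueing N \<Sigma>)"

text \<open>Complex conjugation of the coordinates in every chart; it maps a point of the toric variety,
  which is a glueing class, to a glueing class.\<close>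

definition toric_conjugation ::
    "'a::euclidean_space set \<Rightarrow> ('a set \<times> ('a \<Rightarrow> complex)) set \<Rightarrow>
     ('a set \<times> ('a \<Rightarrow> complex)) set" where
  "toric_conjugation N x =
     (\<lambda>(\<sigma>, \<gamma>). (\<sigma>, restrict (\<lambda>m. cnj (\<gamma> m)) (cone_semigroup N \<sigma>))) ` x"

definition real_toric_variety ::
    "'a::euclidean_space set \<Rightarrow> 'a set set \<Rightarrow> ('a set \<times> ('a \<Rightarrow> complex)) set topology" where
  "real_toric_variety N \<Sigma> =
     subtopology (toric_variety N \<Sigma>) {x. toric_conjugation N x = x}"

definition weyl_real_toric_variety ::
    "'a::euclidean_space set \<Rightarrow> (nat \<Rightarrow> 'a) \<Rightarrow> ('a set \<times> ('a \<Rightarrow> complex)) set topology" where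
  "weyl_real_toric_variety \<Phi> \<alpha> = real_toric_variety (coweight_lattice \<alpha>) (weyl_fan \<Phi>)"


section \<open>Rational singular homology\<close>

text \<open>The library's singular homology has integer coefficients. This is the same construction, on
  the library's singular simplices and their faces, with rational coefficients.\<close>

type_synonym 'a rat_chain = "((nat \<Rightarrow> real) \<Rightarrow> 'a) \<Rightarrow>\<^sub>0 rat"

definition rat_singular_chains :: "nat \<Rightarrow> 'a topology \<Rightarrow> 'a rat_chain set" where
  "rat_singular_chains p X = {c. Poly_Mapping.keys c \<subseteq> singular_simplex_set p X}"

definition rat_chain_scale :: "rat \<Rightarrow> 'a rat_chain \<Rightarrow> 'a rat_chain" where
  "rat_chain_scale q c = Poly_Mapping.map ((*) q) c"

definition rat_chain_boundary :: "nat \<Rightarrow> 'a rat_chain \<Rightarrow> 'a rat_chain" where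
  "rat_chain_boundary p c =
     (if p = 0 then 0 else
      (\<Sum>f\<in>Poly_Mapping.keys c. \<Sum>k\<le>p.
         Poly_Mapping.single (singular_face p k f) ((- 1) ^ k * Poly_Mapping.lookup c f)))"

definition rat_cycles :: "nat \<Rightarrow> 'a topology \<Rightarrow> 'a rat_chain set" where
  "rat_cycles p X = {c \<in> rat_singular_chains p X. rat_chain_boundary p c = 0}"

definition rat_boundaries :: "nat \<Rightarrow> 'a topology \<Rightarrow> 'a rat_chain set" where
  "rat_boundaries p X = rat_chain_boundary (Suc p) ` rat_singular_chains (Suc p) X"

definition rat_field :: "rat ring" where
  "rat_field = \<lparr>carrier = UNIV, monoid.mult = (*), one = 1, zero = 0, add = (+)\<rparr>"

definition rat_coset :: "'a rat_chain set \<Rightarrow> 'a rat_chain \<Rightarrow> 'a rat_chain set" where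
  "rat_coset B z = {z + b | b. b \<in> B}"

text \<open>The rational vector space of cosets of \<open>B\<^sub>p\<close> in \<open>Z\<^sub>p\<close>. The fields \<open>mult\<close> and \<open>one\<close> of the record
  play no role in a module. Scaling by 0 has to give the coset \<open>B\<^sub>p\<close>, hence the summand \<open>b\<close>.\<close>

definition rational_homology :: "nat \<Rightarrow> 'a topology \<Rightarrow> (rat, 'a rat_chain set) module" where
  "rational_homology p X =
     \<lparr>carrier = rat_coset (rat_boundaries p X) ` rat_cycles p X,
      monoid.mult = undefined, one = undefined,
      zero = rat_boundaries p X,
      add = (\<lambda>A B. {a + b | a b. a \<in> A \<and> b \<in> B}),
      smult = (\<lambda>q A. {rat_chain_scale q a + b | a b. a \<in> A \<and> b \<in> rat_boundaries p X})\<rparr>"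

context
begin

private lemma lookup_scale:
  "Poly_Mapping.lookup (rat_chain_scale q c) f = q * Poly_Mapping.lookup c f"
  unfolding rat_chain_scale_def by (auto simp: Poly_Mapping.map.rep_eq when_def)

private lemma scale_simps:
  "rat_chain_scale q (c + d) = rat_chain_scale q c + rat_chain_scale q d"
  "rat_chain_scale (q + r) c = rat_chain_scale q c + rat_chain_scale r c"
  "rat_chain_scale (q * r) c = rat_chain_scale q (rat_chain_scale r c)"
  "rat_chain_scale 1 c = c" "rat_chain_scale q 0 = 0"
  by (auto intro!: poly_mapping_eqI simp: lookup_scale lookup_add algebra_simps)

private lemma boundary_eq_sum:
  assumes "finite S" "Poly_Mapping.keys c \<subseteq> S" "p \<noteq> 0"
  shows "rat_chain_boundary p c = (\<Sum>f\<in>S. \<Sum>k\<le>p.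
    Poly_Mapping.single (singular_face p k f) ((- 1) ^ k * Poly_Mapping.lookup c f))"
  unfolding rat_chain_boundary_def using assms
  by (auto intro!: sum.mono_neutral_left sum.neutral simp: in_keys_iff)

private lemma boundary_add:
  "rat_chain_boundary p (c + d) = rat_chain_boundary p c + rat_chain_boundary p d"
proof (cases "p = 0")
  case False
  let ?S = "Poly_Mapping.keys c \<union> Poly_Mapping.keys d"
  have "Poly_Mapping.keys (c + d) \<subseteq> ?S"
    by (rule keys_add)
  then show ?thesis
    using False
    by (simp add: boundary_eq_sum[of ?S] lookup_add distrib_left single_add sum.distrib)
qed (simp add: rat_chain_boundary_def)

private lemma scale_single: "rat_chain_scale q (Poly_Mapping.single f r) = Poly_Mapping.single f (q * r)"
  by (rule poly_mapping_eqI) (simp add: lookup_scale lookup_single when_def)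

private lemma scale_sum: "rat_chain_scale q (sum g A) = (\<Sum>x\<in>A. rat_chain_scale q (g x))"
  by (induction A rule: infinite_finite_induct) (simp_all add: scale_simps)

private lemma keys_scale: "Poly_Mapping.keys (rat_chain_scale q c) \<subseteq> Poly_Mapping.keys c"
  by (auto simp: in_keys_iff lookup_scale)

private lemma boundary_scale:
  "rat_chain_boundary p (rat_chain_scale q c) = rat_chain_scale q (rat_chain_boundary p c)"
proof (cases "p = 0")
  case False
  then show ?thesis
    using keys_scale[of q c]
    by (simp add: boundary_eq_sum[of "Poly_Mapping.keys c"] lookup_scale scale_sum scale_single
        mult.left_commute)
qed (simp add: rat_chain_boundary_def scale_simps)

private lemma boundary_zero: "rat_chain_boundary p 0 = 0"
  by (simp add: rat_chain_boundary_def)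

private lemma chains_closed:
  "0 \<in> rat_singular_chains p X"
  "c \<in> rat_singular_chains p X \<Longrightarrow> d \<in> rat_singular_chains p X \<Longrightarrow> c + d \<in> rat_singular_chains p X"
  "c \<in> rat_singular_chains p X \<Longrightarrow> rat_chain_scale q c \<in> rat_singular_chains p X"
  unfolding rat_singular_chains_def using keys_add[of c d] keys_scale[of q c] by auto

private lemma cycles_closed:
  "0 \<in> rat_cycles p X"
  "c \<in> rat_cycles p X \<Longrightarrow> d \<in> rat_cycles p X \<Longrightarrow> c + d \<in> rat_cycles p X"
  "c \<in> rat_cycles p X \<Longrightarrow> rat_chain_scale q c \<in> rat_cycles p X"
  unfolding rat_cycles_def
  by (auto simp: chains_closed boundary_zero boundary_add boundary_scale scale_simps)

private lemma boundaries_closed: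
  "0 \<in> rat_boundaries p X"
  "c \<in> rat_boundaries p X \<Longrightarrow> d \<in> rat_boundaries p X \<Longrightarrow> c + d \<in> rat_boundaries p X"
  "c \<in> rat_boundaries p X \<Longrightarrow> rat_chain_scale q c \<in> rat_boundaries p X"
proof -
  show "0 \<in> rat_boundaries p X"
    unfolding rat_boundaries_def using boundary_zero chains_closed(1) by (metis imageI)
  show "c \<in> rat_boundaries p X \<Longrightarrow> d \<in> rat_boundaries p X \<Longrightarrow> c + d \<in> rat_boundaries p X"
    unfolding rat_boundaries_def by clarsimp (metis boundary_add chains_closed(2) imageI)
  show "c \<in> rat_boundaries p X \<Longrightarrow> rat_chain_scale q c \<in> rat_boundaries p X"
    unfolding rat_boundaries_def by clarsimp (metis boundary_scale chains_closed(3) imageI)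
qed

private lemma scale_minus_one: "rat_chain_scale (- 1) c = - c"
  by (rule poly_mapping_eqI) (simp add: lookup_scale)

private lemma coset_ops:
  fixes p :: nat and X :: "'a topology"
  defines "B \<equiv> rat_boundaries p X"
  shows "{a + b | a b. a \<in> rat_coset B y \<and> b \<in> rat_coset B z} = rat_coset B (y + z)"
    and "{rat_chain_scale q a + b | a b. a \<in> rat_coset B z \<and> b \<in> B} = rat_coset B (rat_chain_scale q z)"
    and "rat_coset B 0 = B"
proof -
  have zero: "0 \<in> B" and add: "\<And>c d. c \<in> B \<Longrightarrow> d \<in> B \<Longrightarrow> c + d \<in> B"
    and scale: "\<And>q c. c \<in> B \<Longrightarrow> rat_chain_scale q c \<in> B"
    unfolding B_def by (auto intro: boundaries_closed)
  show "{a + b | a b. a \<in> rat_coset B y \<and> b \<in> rat_coset B z} = rat_coset B (y + z)" (is "?L = ?R")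
  proof
    show "?L \<subseteq> ?R"
    proof
      fix x assume "x \<in> ?L"
      then obtain b c where "b \<in> B" "c \<in> B" "x = (y + b) + (z + c)"
        by (auto simp: rat_coset_def)
      then have "x = (y + z) + (b + c)" "b + c \<in> B"
        by (simp_all add: ac_simps add)
      then show "x \<in> ?R"
        unfolding rat_coset_def by blast
    qed
    show "?R \<subseteq> ?L"
    proof
      fix x assume "x \<in> ?R"
      then obtain b where "b \<in> B" "x = (y + 0) + (z + b)"
        by (auto simp: rat_coset_def add.assoc)
      then show "x \<in> ?L"
        unfolding rat_coset_def using zero by blast
    qed
  qed
  show "{rat_chain_scale q a + b | a b. a \<in> rat_coset B z \<and> b \<in> B} = rat_coset B (rat_chain_scale q z)"
    (is "?L = ?R")
  proof
    show "?L \<subseteq> ?R"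
    proof
      fix x assume "x \<in> ?L"
      then obtain b c where "b \<in> B" "c \<in> B" "x = rat_chain_scale q (z + b) + c"
        by (auto simp: rat_coset_def)
      then have "x = rat_chain_scale q z + (rat_chain_scale q b + c)" "rat_chain_scale q b + c \<in> B"
        by (auto simp: scale_simps ac_simps intro: add scale)
      then show "x \<in> ?R"
        unfolding rat_coset_def by blast
    qed
    show "?R \<subseteq> ?L"
    proof
      fix x assume "x \<in> ?R"
      then obtain b where "b \<in> B" "x = rat_chain_scale q (z + 0) + b"
        by (auto simp: rat_coset_def)
      then show "x \<in> ?L"
        unfolding rat_coset_def using zero by blast
    qed
  qed
  show "rat_coset B 0 = B"
    by (simp add: rat_coset_def)
qed

lemma vectorspace_rational_homology: "vectorspace rat_field (rational_homology p X)"
proof -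
  let ?H = "rational_homology p X" and ?c = "rat_coset (rat_boundaries p X)"
  have carrier: "carrier ?H = ?c ` rat_cycles p X"
    by (simp add: rational_homology_def)
  have zero: "\<zero>\<^bsub>?H\<^esub> = ?c 0"
    by (simp add: rational_homology_def coset_ops)
  have add: "?c y \<oplus>\<^bsub>?H\<^esub> ?c z = ?c (y + z)" for y z
    by (simp add: rational_homology_def coset_ops)
  have smult: "q \<odot>\<^bsub>?H\<^esub> ?c z = ?c (rat_chain_scale q z)" for q z
    by (simp add: rational_homology_def coset_ops)
  have field: "field rat_field"
  proof (rule cring.cring_fieldI2)
    show "cring rat_field"
    proof (rule cringI)
      show "abelian_group rat_field"
      proof (rule abelian_groupI)
        show "\<exists>y\<in>carrier rat_field. y \<oplus>\<^bsub>rat_field\<^esub> x = \<zero>\<^bsub>rat_field\<^esub>" for x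
          by (rule bexI[of _ "- x"]) (simp_all add: rat_field_def)
      qed (simp_all add: rat_field_def)
      show "comm_monoid rat_field"
        by (rule comm_monoidI) (auto simp: rat_field_def)
    qed (auto simp: rat_field_def algebra_simps)
    show "\<exists>b\<in>carrier rat_field. a \<otimes>\<^bsub>rat_field\<^esub> b = \<one>\<^bsub>rat_field\<^esub>"
      if "a \<in> carrier rat_field" "a \<noteq> \<zero>\<^bsub>rat_field\<^esub>" for a
      using that by (intro bexI[of _ "inverse a"]) (simp_all add: rat_field_def)
  qed (simp add: rat_field_def)
  have group: "abelian_group ?H"
  proof (rule abelian_groupI)
    fix A assume "A \<in> carrier ?H"
    then obtain z where z: "z \<in> rat_cycles p X" "A = ?c z"
      by (auto simp: carrier)
    then have "?c (- z) \<oplus>\<^bsub>?H\<^esub> A = \<zero>\<^bsub>?H\<^esub>" "?c (- z) \<in> carrier ?H"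
      using cycles_closed(3)[of z p X "- 1"] by (auto simp: add zero carrier scale_minus_one)
    then show "\<exists>C\<in>carrier ?H. C \<oplus>\<^bsub>?H\<^esub> A = \<zero>\<^bsub>?H\<^esub>"
      by blast
  qed (auto simp: carrier zero add ac_simps cycles_closed)
  have "module rat_field ?H"
  proof (rule moduleI)
    show "cring rat_field"
      using field by (simp add: field_def domain_def)
  qed (auto simp: group carrier smult add cycles_closed scale_simps rat_field_def)
  with field show ?thesis
    by (simp add: vectorspace_def)
qed

end

definition rational_betti :: "nat \<Rightarrow> 'a topology \<Rightarrow> enat" where
  "rational_betti p X =
     (if vectorspace.fin_dim rat_field (rational_homology p X)
      then enat (vectorspace.dim rat_field (rational_homology p X)) else \<infinity>)"

end

(* The maximal cones of the fan are indexed by the bases of the root system; each of them gives a chart R^n of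
   the real variety, and the sign vectors (+-1)^n act on it. Averaging over this action splits the rational
   homology into parts indexed by the classes of M / 2M, where M is the root lattice. Let K be the simplicial
   complex of the cones. For a class mu and a subcomplex A of K, the mu-part of the homology of the union of the
   strata of A is a homology theory in A: it has exact sequences and excision, and a simplex has the homology
   of a point if all of its vertices are even (pair evenly with mu) and is acyclic otherwise. This determines the
   mu-part of the whole variety by combinatorics. Under the Weyl group the classes are 0, those of roots, those
   of frames (orthogonal vectors of norm 4, congruent modulo 2M) and, for E7, the radical. In every case K is cut
   by walls of even roots into regions that a generic linear functional shells. A cell contributes only if its
   descents are exactly its odd vertices; there the functional is dominant up to a perturbation, and
   inclusion-exclusion over the orders of parabolic subgroups counts these cells. *)
theory Submission
  imports Defs
begin

text \<open>In general a shelling only bounds Betti numbers from above. Equality holds here because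
  all bases that dominate the chosen point p of a region have the same odd nodes, so its critical
  cells lie in a single degree. That critical cells are dominant rests on one fact: the simple roots
  of a connected component of the odd nodes sum to an even root. For the class of a root the regions
  are two half-spaces that meet in even cells. A frame of m vectors is the real obstacle: its even
  roots form a D_m, apart from roots orthogonal to the frame, and its 2^(m-1) regions also meet in
  odd cells. Their common boundaries form a star of 2^(m-1) acyclic arms around the even cells, and
  each region meets the rest in a star of m arms. This gives only the difference of the Betti
  numbers in degrees 2 and 1. A second shelling, of all of K, makes the latter 0, because the class
  of a frame is neither 0 nor that of a root. Hence 128 * 7 - 127 = 769 for E8 and 32 * 5 - 31 = 129
  for E7.\<close>

abbreviation "sc == rat_chain_scale"
abbreviation "bnd == rat_chain_boundary"
abbreviation "RC == rat_singular_chains"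
abbreviation "subtop == subtopology"
abbreviation "kys == Poly_Mapping.keys"
abbreviation "lkp == Poly_Mapping.lookup"
abbreviation "sngl == Poly_Mapping.single"
notation scaleR (infixr "*r" 75)
abbreviation (input) iff_ascii :: "bool=>bool=>bool" (infixr "<->" 25) where "a <-> b == a = b"


section \<open>Dimensions of quotients\<close>

locale quot_space = vector_space
begin

abbreviation vlin :: "('b=>'b)=>bool" where
 "vlin == Vector_Spaces.linear scale scale"

definition "edim V = (if EX S. finite S & ~dependent S & span S = V then enat (dim V) else \<infinity>)"

text \<open>The dimension of Z / B without a quotient type: Z is mapped by an endomorphism with
  kernel B, and \<open>qd_edim\<close> shows that its choice does not matter. Values in
  \<open>enat\<close> keep the infinite case apart, since finiteness of homology is proved only
  later.\<close>

definition "qdim Z B = edim ((SOME P. vlin P & {x. P x = 0} = B) ` Z)"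

sublocale vp:vector_space_pair scale scale ..

lemma edim_eq_enat:"edim V = enat n <-> (EX S. finite S & card S = n & ~dependent S & span S = V)"
proof
 assume e:"edim V = enat n"
 then obtain S where S:"finite S" "~dependent S" "span S = V"
  unfolding edim_def by (cases "EX S. finite S & ~dependent S & span S = V") auto
 thus "EX S. finite S & card S = n & ~dependent S & span S = V"
  using e dim_span_eq_card_independent[of S] exI[of _ S] by (auto simp:edim_def)
next
 assume "EX S. finite S & card S = n & ~dependent S & span S = V"
 then obtain S where S:"finite S" "card S = n" "~dependent S" "span S = V" by (elim exE conjE)
 thus "edim V = enat n" using dim_span_eq_card_independent[of S] by (auto simp:edim_def)
qed

text \<open>With a basis of B extended to one of the whole space, \<open>Q\<close> is the projection
  to B and the map sought is 1 - \<open>Q\<close>.\<close>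

lemma ex_kernel:
 assumes "subspace B"
 shows "EX P. vlin P & {x. P x = 0} = B"
proof -
 obtain S where S:"S <= B" "~dependent S" "B <= span S" using basis_exists[of B] by metis
 obtain T where T:"S <= T" "~dependent T" "UNIV <= span T" using maximal_independent_subset_extend[of S UNIV] S by auto
 define Q where "Q = vp.construct T (%b. if b:S then b else 0)"
 have lQ:"vlin Q" unfolding Q_def using T by (intro vp.linear_construct)
 have QB:"Q x:B" for x
 proof -
  have "Q x:span ((%b. if b:S then b else 0) ` T)" unfolding Q_def by (rule vp.construct_in_span[OF T(2)])
  also have "... <= B" using S assms by (intro span_minimal) (auto simp:subspace_0)
  finally show ?thesis .
 qed
 have Qid:"Q x = x" if "x:B" for x
 proof -
  have "Q b = b" if "b:S" for b unfolding Q_def using T that by (subst vp.construct_basis) auto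
  thus ?thesis using vp.linear_eq_on[OF lQ linear_ident, of x S] that S by auto
 qed
 have "vlin (%x. x - Q x)" by (rule vp.linear_compose_sub[OF linear_ident lQ])
 moreover have "x - Q x = 0 <-> x:B" for x using QB[of x] Qid[of x] by auto
 hence "{x. x - Q x = 0} = B" by blast
 ultimately show ?thesis by blast
qed

lemma edim_image_cong_aux:
 assumes f:"vlin f" and g:"vlin g" and Z:"subspace Z"
  and eq:"!!z. z:Z ==> f z = 0 <-> g z = 0"
  and "edim (f ` Z) = enat n"
 shows "edim (g ` Z) = enat n"
proof -
 obtain S where S:"finite S" "card S = n" "~dependent S" "span S = f ` Z" using assms(5) by (auto simp:edim_eq_enat)
 hence "S <= f ` Z" using span_superset[of S] by simp
 hence "!s:S. EX z:Z. f z = s" by blast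
 then obtain c where c:"!!s. s:S ==> c s:Z & f (c s) = s" by metis
 define h where "h = vp.construct S (%s. g (c s))"
 define k where "k = vp.construct S c"
 have lh:"vlin h" and lk:"vlin k" unfolding h_def k_def using S by (auto intro:vp.linear_construct)
 have hs:"h s = g (c s)" and ks:"k s = c s" if "s:S" for s
  unfolding h_def k_def using S that by (auto simp:vp.construct_basis)
 have kZ:"k x:Z" for x
 proof -
  have "k x:span (c ` S)" unfolding k_def by (rule vp.construct_in_span[OF S(3)])
  also have "... <= Z" using c Z by (intro span_minimal) auto
  finally show ?thesis .
 qed
 have fk:"f (k x) = x" if "x:span S" for x
  using vp.linear_eq_on[OF Vector_Spaces.linear_compose[OF lk f] linear_ident, of x S] that c ks by (simp add:o_def)
 have gk:"g (k x) = h x" if "x:span S" for x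
  using vp.linear_eq_on[OF Vector_Spaces.linear_compose[OF lk g] lh, of x S] that c ks hs by (simp add:o_def)
 have hf:"h (f z) = g z" if "z:Z" for z
 proof -
  have "f z:span S" using that S by auto
  hence "f (z - k (f z)) = 0" by (simp add:vp.linear_diff[OF f] fk)
  hence "g (z - k (f z)) = 0" using eq[of "z - k (f z)"] that kZ Z by (simp add:subspace_diff)
  thus ?thesis using gk[OF \<open>f z : span S\<close>] by (simp add:vp.linear_diff[OF g])
 qed
 have inj:"inj_on h (span S)"
 proof (subst vp.linear_inj_on_iff_eq_0[OF lh subspace_span], intro ballI impI)
  fix x assume x:"x:span S" "h x = 0"
  then obtain z where "z:Z" "x = f z" using S by auto
  thus "x = 0" using hf eq x by auto
 qed
 have "h ` span S = g ` Z" unfolding S(4) image_image using hf by (auto intro!:image_cong)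
 hence "span (h ` S) = g ` Z" by (simp add:vp.linear_span_image[OF lh])
 moreover have "~dependent (h ` S)" using vp.linear_independent_injective_image[OF lh S(3) inj] .
 moreover have "card (h ` S) = n" using card_image inj inj_on_subset S span_superset by metis
 ultimately show ?thesis unfolding edim_eq_enat using S(1) by blast
qed

lemma edim_image_cong:
 assumes f:"vlin f" and g:"vlin g" and Z:"subspace Z"
  and eq:"!!z. z:Z ==> f z = 0 <-> g z = 0"
 shows "edim (f ` Z) = edim (g ` Z)"
  using assms edim_image_cong_aux[OF assms] edim_image_cong_aux[OF g f Z, of _] by (cases "edim (f ` Z)") force+

lemma qd_edim:
 assumes f:"vlin f" and "subspace Z" "subspace B" "!!z. z:Z ==> f z = 0 <-> z:B"
 shows "qdim Z B = edim (f ` Z)"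
proof -
 let ?P = "SOME P. vlin P & {x. P x = 0} = B"
 have P:"vlin ?P & {x. ?P x = 0} = B" by (rule someI_ex[OF ex_kernel[OF assms(3)]])
 show ?thesis unfolding qdim_def
 proof (rule edim_image_cong)
  show "vlin ?P" using P by blast
  have "?P z = 0 <-> z:B" for z using P by blast
  thus "!!z. z:Z ==> ?P z = 0 <-> f z = 0" using assms(4) by simp
 qed (use assms in auto)
qed

lemma fin_span_edim:
 assumes "finite T" "V <= span T" "subspace V"
 shows "edim V ~= \<infinity>"
proof -
 obtain S where S:"S <= V" "~dependent S" "V <= span S" using basis_exists[of V] by metis
 hence "finite S" using independent_span_bound[OF assms(1), of S] assms by blast
 moreover have "span S = V" using S assms(3) by (simp add:span_minimal subset_antisym)
 ultimately show ?thesis unfolding edim_def using S by auto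
qed

lemma edim_tower:
 assumes "subspace Y" "subspace Z" "Y <= Z"
 shows "edim Z = edim Y + qdim Z Y"
proof -
 obtain P where P:"vlin P" "!!x. P x = 0 <-> x:Y" using ex_kernel[OF assms(1)] by blast
 have q:"qdim Z Y = edim (P ` Z)" by (rule qd_edim) (use P assms in auto)
 have PZ:"subspace (P ` Z)" by (rule vp.linear_subspace_image[OF P(1) assms(2)])
 show ?thesis
 proof (cases "edim Y = \<infinity> \<or> edim (P ` Z) = \<infinity>")
  case True
  have "edim Z = \<infinity>"
  proof (rule ccontr)
   assume "edim Z ~= \<infinity>"
   then obtain T where T:"finite T" "span T = Z" unfolding edim_def by (auto split:if_splits)
   have "edim Y ~= \<infinity>" using fin_span_edim[OF T(1)] T assms by auto
   moreover have "edim (P ` Z) ~= \<infinity>"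
    using fin_span_edim[of "P ` T" "P ` Z"] T vp.linear_span_image[OF P(1), of T] PZ by simp
   ultimately show False using True by auto
  qed
  thus ?thesis using True q by auto
 next
  case False
  then obtain a b where ab:"edim Y = enat a" "edim (P ` Z) = enat b" by auto
  obtain S where S:"finite S" "card S = a" "~dependent S" "span S = Y" using ab by (auto simp:edim_eq_enat)
  obtain T where T:"finite T" "card T = b" "~dependent T" "span T = P ` Z" using ab by (auto simp:edim_eq_enat)
  have "!t:T. EX z:Z. P z = t" using T span_superset[of T] by (auto simp:image_iff subset_iff)
  then obtain c where c:"!!t. t:T ==> c t:Z & P (c t) = t" by metis
  define k where "k = vp.construct T c"
  have lk:"vlin k" unfolding k_def using T by (auto intro:vp.linear_construct)
  have kt:"k t = c t" if "t:T" for t unfolding k_def using T that by (auto simp:vp.construct_basis)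
  have Pk:"P (k x) = x" if "x:span T" for x
   using vp.linear_eq_on[OF Vector_Spaces.linear_compose[OF lk P(1)] linear_ident, of x T] that c kt by (simp add:o_def)
  have injk:"inj_on k (span T)" using Pk by (metis inj_onI)
  have indk:"~dependent (k ` T)" using vp.linear_independent_injective_image[OF lk T(3) injk] .
  have spk:"span (k ` T) = k ` span T" by (simp add:vp.linear_span_image[OF lk])
  have cap:"span S Int span (k ` T) <= {0}"
  proof
   fix x assume x:"x:span S Int span (k ` T)"
   then obtain t where t:"t:span T" "x = k t" using spk by auto
   have "P x = 0" using x S P by auto
   hence "t = 0" using Pk t by auto
   thus "x:{0}" using t vp.linear_0[OF lk] by simp
  qed
  have disj:"S Int k ` T = {}"
  proof (rule ccontr)
   assume "S Int k ` T ~= {}"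
   then obtain x where x:"x:S" "x:k ` T" by blast
   hence "x:span S Int span (k ` T)" by (simp add:span_base)
   hence "x = 0" using cap by blast
   thus False using x(1) S(3) dependent_zero by blast
  qed
  have ind:"~dependent (S Un k ` T)"
  proof (rule independent_if_scalars_zero)
   show "finite (S Un k ` T)" using S T by simp
   fix u x assume sum:"(SUM x:S Un k ` T. scale (u x) x) = 0" and x:"x:S Un k ` T"
   let ?A = "SUM x:S. scale (u x) x" and ?B = "SUM x:k ` T. scale (u x) x"
   have AB:"?A + ?B = 0" using sum disj S T by (simp add:sum.union_disjoint)
   have "?A:span S" "?B:span (k ` T)" by (intro span_sum span_scale, erule span_base)+
   moreover have "?B = - ?A" using AB by (simp add:eq_neg_iff_add_eq_0 add.commute)
   ultimately have "?B:span S Int span (k ` T)" by (auto simp:span_neg)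
   hence "?B = 0" using cap by blast
   moreover from this have "?A = 0" using AB by simp
   ultimately show "u x = 0" using x S(1,3) T(1) indk independentD[of S S u x] independentD[of "k ` T" "k ` T" u x] by blast
  qed
  have "span (S Un k ` T) = Z"
  proof
   have "k ` T <= Z" using kt c by auto
   moreover have "S <= Z" using S assms span_superset by blast
   ultimately show "span (S Un k ` T) <= Z" using assms by (simp add:span_minimal)
   show "Z <= span (S Un k ` T)"
   proof
    fix z assume z:"z:Z"
    hence "P z:span T" using T by auto
    hence "P (z - k (P z)) = 0" using Pk by (simp add:vp.linear_diff[OF P(1)])
    hence "z - k (P z):span S" using P S by auto
    moreover have "k (P z):span (k ` T)" using \<open>P z : span T\<close> spk by auto
    ultimately have "(z - k (P z)) + k (P z):span (S Un k ` T)" by (meson span_add span_mono Un_upper1 Un_upper2 subsetD)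
    thus "z:span (S Un k ` T)" by simp
   qed
  qed
  moreover have "card (S Un k ` T) = a + b"
   using card_Un_disjoint[OF _ _ disj] S T card_image[OF inj_on_subset[OF injk span_superset]] by simp
  moreover have "finite (S Un k ` T)" using S T by simp
  ultimately have "edim Z = enat (a + b)" using ind by (auto simp:edim_eq_enat)
  thus ?thesis using ab q by simp
 qed
qed

text \<open>The conditions on \<open>f\<close> say that it induces a well-defined, injective and
  surjective map from Z / B to Z' / B'. Most comparisons of homology groups below go through this
  rule.\<close>

lemma qd_transfer:
 assumes f:"vlin f" and sub:"subspace Z" "subspace B" "subspace Z'" "subspace B'" "B' <= Z'"
  and Z:"!!z. z:Z ==> f z:Z'" and B:"!!z. z:Z ==> f z:B' <-> z:B"
  and surj:"!!y. y:Z' ==> EX z:Z. y - f z:B'"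
 shows "qdim Z B = qdim Z' B'"
proof -
 obtain P where P:"vlin P" "!!x. P x = 0 <-> x:B'" using ex_kernel[OF sub(4)] by blast
 have "qdim Z B = edim ((P \<circ> f) ` Z)"
  by (rule qd_edim) (use P f sub B in \<open>auto intro:Vector_Spaces.linear_compose\<close>)
 also have "(P \<circ> f) ` Z = P ` Z'" using Z surj P by (force simp:vp.linear_diff)
 also have "edim (P ` Z') = qdim Z' B'" by (rule qd_edim[symmetric]) (use P sub in auto)
 finally show ?thesis .
qed

lemma quot_dim_tower:
 assumes "subspace B" "subspace Y" "subspace Z" "B <= Y" "Y <= Z"
 shows "qdim Z B = qdim Y B + qdim Z Y"
proof -
 obtain P where P:"vlin P" "!!x. P x = 0 <-> x:B" using ex_kernel[OF assms(1)] by blast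
 have sub:"subspace (P ` Y)" "subspace (P ` Z)" using vp.linear_subspace_image[OF P(1)] assms by auto
 have "qdim Z B = edim (P ` Z)" "qdim Y B = edim (P ` Y)" by (rule qd_edim; use P assms in auto)+
 moreover have "qdim Z Y = qdim (P ` Z) (P ` Y)"
 proof (rule qd_transfer[OF P(1)])
  show "P z:P ` Y <-> z:Y" if "z:Z" for z
  proof
   assume "P z:P ` Y"
   then obtain y where y:"y:Y" "P z = P y" by blast
   hence "P (z - y) = 0" by (simp add:vp.linear_diff[OF P(1)])
   hence "(z - y) + y:Y" using y assms subspace_add P(2) by blast
   thus "z:Y" by simp
  qed auto
  show "EX z:Z. y - P z:P ` Y" if y:"y:P ` Z" for y using that y subspace_0[OF sub(1)] bexI by fastforce
 qed (use assms sub in auto)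
 ultimately show ?thesis using edim_tower[OF sub] assms(5) by (simp add:image_mono)
qed

lemma quot_dim_eq_0:
 assumes "subspace Z" "subspace B"
 shows "qdim Z B = 0 <-> Z <= B"
proof -
 obtain P where P:"vlin P" "!!x. P x = 0 <-> x:B" using ex_kernel[OF assms(2)] by blast
 have "edim (P ` Z) = enat 0 <-> P ` Z = {0}"
  by (metis (no_types, lifting) card_0_eq edim_eq_enat finite.emptyI independent_empty span_empty)
 also have "... <-> (!z:Z. P z = 0)" using subspace_0[OF assms(1)] by force
 also have "... <-> Z <= B" by (simp only:P(2) subset_eq)
 finally show ?thesis using qd_edim[OF P(1) assms P(2)] by (simp add:zero_enat_def)
qed

text \<open>Representatives of a basis of the quotient, in the form in which
  \<open>rational_betti_eq\<close> hands them to the module-theoretic notion of dimension.\<close>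

lemma quot_dim_eq_enat_imp:
 assumes "subspace Z" "subspace B" "qdim Z B = enat n"
 obtains S where "finite S" "card S = n" "S <= Z" "!z:Z. EX u. z - (SUM s:S. scale (u s) s):B"
  "!u. (SUM s:S. scale (u s) s):B --> (!s:S. u s = 0)"
proof -
 obtain P where P:"vlin P" "!!x. P x = 0 <-> x:B" using ex_kernel[OF assms(2)] by blast
 obtain T where T:"finite T" "card T = n" "~dependent T" "span T = P ` Z"
  by (metis qd_edim[OF P(1) assms(1,2) P(2)] assms(3) edim_eq_enat)
 have "!t:T. EX z:Z. P z = t" using T span_superset[of T] by auto
 then obtain c where c:"!!t. t:T ==> c t:Z & P (c t) = t" by metis
 have injc:"inj_on c T" by (rule inj_onI) (metis c)
 have Psum:"P (SUM s:c ` T. scale (u s) s) = (SUM t:T. scale (u (c t)) t)" for u unfolding sum.reindex[OF injc]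
  by (simp add:vp.linear_sum[OF P(1)] vp.linear_scale[OF P(1)] c)
 show ?thesis
 proof (rule that[of "c ` T"])
  show "finite (c ` T)" "card (c ` T) = n" "c ` T <= Z" using T c injc by (auto simp:card_image)
  show "!z:Z. EX u. z - (SUM s:c ` T. scale (u s) s):B"
  proof
   fix z assume "z:Z"
   then obtain v where v:"P z = (SUM t:T. scale (v t) t)" using T span_finite[OF T(1)] by auto
   define u where "u = (%s. v (P s))"
   have "P (z - (SUM s:c ` T. scale (u s) s)) = 0" unfolding vp.linear_diff[OF P(1)] Psum v by (simp add:u_def c)
   thus "EX u. z - (SUM s:c ` T. scale (u s) s):B" using exI[of _ u] by (simp only:P(2))
  qed
  show "!u. (SUM s:c ` T. scale (u s) s):B --> (!s:c ` T. u s = 0)"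
  proof (intro allI impI)
   fix u assume "(SUM s:c ` T. scale (u s) s):B"
   hence *: "(SUM t:T. scale (u (c t)) t) = 0" by (metis P(2) Psum)
   have "u (c t) = 0" if "t:T" for t by (rule independentD[OF T(3) T(1) subset_refl * that])
   thus "!s:c ` T. u s = 0" by auto
  qed
 qed
qed

lemma quot_dim_eq_1:
 assumes "subspace Z" "subspace B" "z:Z" "z ~: B" "!!x. x:Z ==> EX a. x - scale a z:B"
 shows "qdim Z B = 1"
proof -
 obtain P where P:"vlin P" "!!x. P x = 0 <-> x:B" using ex_kernel[OF assms(2)] by blast
 have "span {P z} = P ` Z"
 proof
  show "span {P z} <= P ` Z" using assms vp.linear_subspace_image[OF P(1) assms(1)] by (intro span_minimal) auto
  show "P ` Z <= span {P z}"
  proof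
   fix w assume "w:P ` Z"
   then obtain x where x:"x:Z" "w = P x" by auto
   then obtain a where "x - scale a z:B" using assms by blast
   thus "w:span {P z}" using P x by (force simp:vp.linear_diff vp.linear_scale span_base span_scale)
  qed
 qed
 moreover have "~dependent {P z}" using P assms by simp
 ultimately show ?thesis
  using exI[of _ "{P z}"] qd_edim[OF P(1) assms(1,2) P(2)] by (auto simp:edim_eq_enat one_enat_def)
qed

end

section \<open>Rational singular chains\<close>

lemma lookup_rat_chain_scale [simp]:
 "lkp (sc q c) f = q * lkp c f"
 unfolding rat_chain_scale_def by (auto simp:Poly_Mapping.map.rep_eq when_def)

interpretation rc:quot_space "sc :: rat=>'a rat_chain=>'a rat_chain"
 by unfold_locales (auto intro!:poly_mapping_eqI simp:lookup_add algebra_simps)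

lemma rat_chain_scale_single [simp]:"sc q (sngl f r) = sngl f (q * r)"
 by (rule poly_mapping_eqI) (simp add:lookup_single when_def)

lemma keys_rat_chain_scale:"kys (sc q c) <= kys c" by (auto simp:in_keys_iff)

definition rext :: "(((nat=>real)=>'a)=>'b rat_chain)=>'a rat_chain=>'b rat_chain" where
 "rext F c = (SUM f:kys c. sc (lkp c f) (F f))"

lemma rext_sup:
 assumes "finite S" "kys c <= S"
 shows "rext F c = (SUM f:S. sc (lkp c f) (F f))" unfolding rext_def using assms
 by (intro sum.mono_neutral_left) (auto simp:in_keys_iff)

lemma rext_add:"rext F (c + d) = rext F c + rext F d"
proof -
 let ?S = "kys c Un kys d"
 have "rext F (c + d) = (SUM f:?S. sc (lkp (c + d) f) (F f))"
  by (rule rext_sup) (auto simp:keys_add)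
 moreover have "rext F c = (SUM f:?S. sc (lkp c f) (F f))" by (rule rext_sup) auto
 moreover have "rext F d = (SUM f:?S. sc (lkp d f) (F f))" by (rule rext_sup) auto
 ultimately show ?thesis by (simp add:lookup_add rc.scale_left_distrib sum.distrib)
qed

lemma rext_scale:"rext F (sc q c) = sc q (rext F c)"
proof -
 have "rext F (sc q c) =
   (SUM f:kys c. sc (lkp (sc q c) f) (F f))"
  by (rule rext_sup) (auto simp:keys_rat_chain_scale)
 thus ?thesis by (simp add:rext_def rc.scale_sum_right)
qed

lemma rat_extend_single [simp]:"rext F (sngl f q) = sc q (F f)"
 by (cases "q = 0") (auto simp:rext_def)

lemma linear_rat_extend:"Vector_Spaces.linear sc sc (rext F)"
 by (rule Vector_Spaces.linear_iff[THEN iffD2])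
  (auto simp:rext_add rext_scale intro:rc.vector_space_axioms)

lemma rat_extend_0 [simp]:"rext F 0 = 0" by (simp add:rext_def)

lemma rext_sum:"rext F (sum g A) = (SUM x:A. rext F (g x))"
 by (induction A rule:infinite_finite_induct) (simp_all add:rext_add)

lemma rat_extend_cong:
 "(!!f. f:kys c ==> F f = G f) ==> rext F c = rext G c" by (simp add:rext_def)

lemma rext_rext:"rext F (rext G c) = rext (%f. rext F (G f)) c"
 by (simp add:rext_def[of G] rext_sum rext_scale)
  (simp add:rext_def[of "%f. rext F (G f)"])

lemma rat_extend_ident:"rext (%f. sngl f 1) c = c"
proof (rule poly_mapping_eqI)
 fix f
 show "lkp (rext (%f. sngl f 1) c) f = lkp c f"
  by (cases "f:kys c")
   (auto simp:rext_def lookup_sum lookup_single when_def in_keys_iff)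
qed

definition bd_simplex :: "nat=>((nat=>real)=>'a)=>'a rat_chain" where
 "bd_simplex p f = (if p = 0 then 0 else SUM k<=p. sngl (singular_face p k f) ((- 1) ^ k))"

lemma bnd_eq:"bnd p = rext (bd_simplex p)"
 by (rule ext) (auto simp:rat_chain_boundary_def rext_def bd_simplex_def rc.scale_sum_right mult.commute)

definition "rcmap p g = rext (%f. sngl (simplex_map p g f) 1)"

lemmas bd_linear = linear_rat_extend[of "bd_simplex p" for p, folded bnd_eq]
lemmas map_linear = linear_rat_extend[of "%f. sngl (simplex_map p g f) 1" for p g, folded rcmap_def]

lemma bd_add:"bnd p (c + d) = bnd p c + bnd p d"
 and bd_scale:"bnd p (sc q c) = sc q (bnd p c)"
 and boundary_0 [simp]:"bnd p 0 = 0"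
 and boundary_sum:"bnd p (sum g A) = (SUM x:A. bnd p (g x))"
 by (simp_all add:bnd_eq rext_add rext_scale rext_sum)

lemma boundary_diff:"bnd p (c - d) = bnd p c - bnd p d"
 by (rule rc.vp.linear_diff[OF bd_linear])

lemma map_add:"rcmap p g (c + d) = rcmap p g c + rcmap p g d"
 and map_scale:"rcmap p g (sc q c) = sc q (rcmap p g c)"
 and map_sum:"rcmap p g (sum h A) = (SUM x:A. rcmap p g (h x))"
 by (simp_all add:rcmap_def rext_add rext_scale rext_sum)

lemma boundary_map:"bnd p (rcmap p g c) = rcmap (p - 1) g (bnd p c)"
proof (cases "p = 0")
 case False
 have [simp]:"simplex_map (p - Suc 0) g (singular_face p k f) = simplex_map (p - Suc 0) g (f \<circ> simplical_face k)" for k f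
  by (rule ext) (simp add:simplex_map_def singular_face_def)
 have "rext (bd_simplex p) (sngl (simplex_map p g f) 1)
   = rext (%f. sngl (simplex_map (p - 1) g f) 1) (bd_simplex p f)" for f
  by (simp add:bd_simplex_def rext_sum singular_face_simplex_map)
 thus ?thesis unfolding bnd_eq rcmap_def rext_rext by simp
qed (simp add:rat_chain_boundary_def rcmap_def)

subsection \<open>Clearing denominators\<close>

definition rcof :: "'a chain=>'a rat_chain" where
 "rcof c = Poly_Mapping.map of_int c"

lemma lookup_rat_of_chain [simp]:"lkp (rcof c) f = of_int (lkp c f)"
 unfolding rcof_def by (auto simp:Poly_Mapping.map.rep_eq when_def)

lemma keys_rat_of_chain [simp]:"kys (rcof c) = kys c" by (auto simp:in_keys_iff)

lemma rcof_add:"rcof (c + d) = rcof c + rcof d"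
 and rat_of_chain_diff:"rcof (c - d) = rcof c - rcof d"
 and rat_of_chain_0 [simp]:"rcof 0 = 0" by (auto intro!:poly_mapping_eqI simp:lookup_add lookup_minus)

lemma rcof_cmul:"rcof (frag_cmul k c) = sc (of_int k) (rcof c)"
 by (auto intro!:poly_mapping_eqI)

lemma rat_of_chain_of:"rcof (frag_of f) = sngl f 1" by (rule poly_mapping_eqI) (simp add:lookup_single)

lemma rat_of_chain_sum:"rcof (sum g A) = (SUM x:A. rcof (g x))"
 by (induction A rule:infinite_finite_induct) (simp_all add:rcof_add)

lemma rat_of_chain_extend:"rcof (frag_extend G c) = rext (%f. rcof (G f)) (rcof c)"
 by (simp add:frag_extend_def rext_def rat_of_chain_sum rcof_cmul)

lemma bd_rcof:"bnd p (rcof c) = rcof (chain_boundary p c)"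
 unfolding chain_boundary_def bnd_eq
 by (auto simp:rat_of_chain_extend rat_of_chain_sum rcof_cmul rat_of_chain_of bd_simplex_def
   rext_def)

lemma map_rat_of_chain:"rcmap p g (rcof c) = rcof (chain_map p g c)"
 unfolding chain_map_def rcmap_def by (simp add:rat_of_chain_extend rat_of_chain_of)

text \<open>Excision and homotopy invariance are imported from integral homology by this device:
  multiply by the common denominator, apply the integral statement, divide again.\<close>

lemma clear_denominators:
 obtains N c' where "N > 0" "sc (of_nat N) c = rcof c'" "kys c' <= kys c"
proof -
 have "EX N>0. !f:S. of_nat N * lkp c f:\<int>" if "finite S" for S using that
 proof induction
  case empty
  show ?case by auto
 next
  case (insert f S)
  then obtain N where N:"N > 0" "!f:S. of_nat N * lkp c f:\<int>" by blast
  obtain a b where ab:"lkp c f = of_int a / of_int b" "b > 0"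
   by (metis quotient_of_div quotient_of_denom_pos surj_pair)
  have "of_nat (N * nat b) * lkp c f = of_int (int N * a)" using ab by simp
  moreover have "of_nat (N * nat b) * lkp c g:\<int>" if "g:S" for g
  using that ab N(2) by (simp add:field_simps)
  ultimately show ?case
   using N(1) ab(2) by (intro exI[of _ "N * nat b"]) (metis Ints_of_int insert_iff mult_pos_pos zero_less_nat_eq)
 qed
 then obtain N where N:"N > 0" "!f:kys c. of_nat N * lkp c f:\<int>" using finite_keys by blast
 define c' where "c' = Poly_Mapping.map (%q. \<lfloor>of_nat N * q\<rfloor>) c"
 have l:"lkp c' f = \<lfloor>of_nat N * lkp c f\<rfloor>" for f
  unfolding c'_def by (auto simp:Poly_Mapping.map.rep_eq when_def)
 show ?thesis
 proof (rule that[of N c'])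
  show "sc (of_nat N) c = rcof c'"
  proof (rule poly_mapping_eqI)
   fix f
   have "of_nat N * lkp c f:\<int>" using N(2) by (cases "f:kys c") (auto simp:in_keys_iff)
   thus "lkp (sc (of_nat N) c) f = lkp (rcof c') f" by (auto simp:l)
  qed
  show "kys c' <= kys c" by (auto simp:in_keys_iff l)
 qed (rule N)
qed

abbreviation chin :: "nat=>'a topology=>'a set=>'a rat_chain set" where
 "chin p X A == RC p (subtop X A)"

lemma ss_chains:"rc.subspace (RC p X)" unfolding rc.subspace_def rat_singular_chains_def
 using keys_rat_chain_scale keys_add by fastforce

lemma rcof_in:"rcof c:RC p X <-> singular_chain p X c"
 by (auto simp:rat_singular_chains_def singular_chain_def)

lemma chain_clear:
 assumes "c:RC p X"
 obtains N c' where "N > 0" "c = sc (1 / of_nat N) (rcof c')" "singular_chain p X c'"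
  "sc (of_nat N) c = rcof c'"
proof -
 obtain N c' where N:"N > 0" "sc (of_nat N) c = rcof c'" "kys c' <= kys c"
  using clear_denominators[of c] by blast
 show ?thesis
 proof (rule that[OF N(1) _ _ N(2)])
  show "c = sc (1 / of_nat N) (rcof c')" unfolding N(2)[symmetric] using N(1) by simp
  show "singular_chain p X c'" using assms N(3) by (auto simp:rat_singular_chains_def singular_chain_def)
 qed
qed

lemma chains_in_mono:"A <= B ==> chin p X A <= chin p X B"
 unfolding rat_singular_chains_def using singular_simplex_mono by fastforce

lemma chains_in_Int:"chin p X A Int chin p X B = chin p X (A Int B)"
 unfolding rat_singular_chains_def by (fastforce simp:singular_simplex_subtopology subset_iff)

lemma boundary_in_chains:
 assumes "c:RC p X" "p > 0 ==> q = p - 1"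
 shows "bnd p c:RC q X"
proof (cases "p = 0")
 case True
 thus ?thesis by (simp add:rat_chain_boundary_def rat_singular_chains_def)
next
 case False
 have "bd_simplex p f:RC q X" if "f:kys c" for f
 proof -
  have "sngl (singular_face p k f) ((- 1) ^ k):RC q X" if "k <= p" for k
   using that assms False \<open>f : Poly_Mapping.keys c\<close> singular_simplex_singular_face[of p X f k]
   by (auto simp:rat_singular_chains_def)
  thus ?thesis using False by (auto simp:bd_simplex_def intro!:rc.subspace_sum[OF ss_chains])
 qed
 thus ?thesis unfolding bnd_eq rext_def
  by (intro rc.subspace_sum[OF ss_chains] rc.subspace_scale[OF ss_chains])
qed

lemma boundary_boundary:
 assumes "c:RC (Suc p) X"
 shows "bnd p (bnd (Suc p) c) = 0"
proof -
 obtain N c' where c:"c = sc (1 / of_nat N) (rcof c')" "singular_chain (Suc p) X c'"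
  using chain_clear[OF assms] by blast
 thus ?thesis using chain_boundary_boundary[of "Suc p" X c'] by (simp add:bd_scale bd_rcof)
qed

text \<open>Surjectivity of the excision map, unfolded to chains: modulo A, the relative cycle c is
  homologous to one that lies in B.\<close>

lemma excision_surj_int:
 assumes A:"openin X A" and B:"openin X B"
  and c:"singular_chain p (subtop X (A Un B)) c" "singular_chain (p - 1) (subtop X A) (chain_boundary p c)"
 obtains b d a where "singular_chain p (subtop X B) b" "singular_chain (Suc p) (subtop X (A Un B)) d"
  "singular_chain p (subtop X A) a" "c = b + chain_boundary (Suc p) d + a"
proof -
 let ?Y = "subtop X (A Un B)"
 have top:"topspace ?Y = A Un B" using openin_subset[OF A] openin_subset[OF B] by auto
 have oA:"openin ?Y A" and oB:"openin ?Y B" using A B by (auto simp:openin_open_subtopology openin_Un)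
 \<comment> \<open>Since B is open, A - B is closed in the union, so its closure lies in A, which is
   its own interior. This is the hypothesis of the excision axiom.\<close>
 have cl:"closedin ?Y (A - B)"
 proof -
  have "closedin ?Y (topspace ?Y - B)" using oB by blast
  moreover have "topspace ?Y - B = A - B" using top by auto
  ultimately show ?thesis by simp
 qed
 have ex:"?Y closure_of (A - B) <= ?Y interior_of A" using cl oA by (simp add:closure_of_closedin interior_of_openin)
 have YY:"subtop ?Y (A Un B) = ?Y" "subtop ?Y A = subtop X A" "subtop ?Y B = subtop X B"
  by (simp_all add:subtopology_subtopology)
 have rel:"singular_relcycle p (subtop ?Y (A Un B)) A c" unfolding YY singular_relcycle_def mod_subset_def using c by simp
 obtain c' where c':"singular_relcycle p (subtop ?Y (A Un B - (A - B))) (A - (A - B)) c'"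
  "homologous_rel p (subtop ?Y (A Un B)) A c c'" using excised_relcycle_exists[OF ex _ rel] by blast
 have BB:"A Un B - (A - B) = B" by auto
 obtain d where d:"singular_chain (Suc p) ?Y d" "singular_chain p (subtop ?Y A) (chain_boundary (Suc p) d - (c - c'))"
  using c'(2) unfolding YY homologous_rel_def singular_relboundary_def mod_subset_def by auto
 show ?thesis
 proof (rule that[of c' d "- (chain_boundary (Suc p) d - (c - c'))"])
  show "singular_chain p (subtop X B) c'" using c'(1) unfolding BB YY singular_relcycle_def by blast
  show "singular_chain p (subtop X A) (- (chain_boundary (Suc p) d - (c - c')))"
   using d(2) unfolding YY by (simp only:singular_chain_minus)
 qed (use d in auto)
qed

text \<open>Injectivity of the same map: b and 0 have equal images in the homology of the union
  relative to A, hence equal classes relative to the intersection.\<close>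

lemma excision_inj_int:
 assumes A:"openin X A" and B:"openin X B"
  and b:"singular_chain p (subtop X B) b" "singular_chain (p - 1) (subtop X (A Int B)) (chain_boundary p b)"
  and e:"singular_chain (Suc p) (subtop X (A Un B)) e" "singular_chain p (subtop X A) a"
  and eq:"b = chain_boundary (Suc p) e + a"
 obtains d a' where "singular_chain (Suc p) (subtop X B) d" "singular_chain p (subtop X (A Int B)) a'"
  "b = chain_boundary (Suc p) d + a'"
proof -
 let ?Y = "subtop X (A Un B)"
 have top:"topspace ?Y = A Un B" using openin_subset[OF A] openin_subset[OF B] by auto
 have oA:"openin ?Y A" and oB:"openin ?Y B" using A B by (auto simp:openin_open_subtopology openin_Un)
 have cl:"closedin ?Y (A - B)"
 proof -
  have "closedin ?Y (topspace ?Y - B)" using oB by blast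
  moreover have "topspace ?Y - B = A - B" using top by auto
  ultimately show ?thesis by simp
 qed
 have ex:"?Y closure_of (A - B) <= ?Y interior_of A" using cl oA by (simp add:closure_of_closedin interior_of_openin)
 have YY:"subtop ?Y (A Un B) = ?Y" "subtop ?Y A = subtop X A" "subtop ?Y B = subtop X B"
  "subtop (subtop X B) (A Int B) = subtop X (A Int B)" by (simp_all add:subtopology_subtopology Int_absorb1)
 have BB:"A Un B - (A - B) = B" "A - (A - B) = A Int B" by auto
 let ?h = "hom_induced p (subtop X B) (A Int B) ?Y A id"
 have rb:"singular_relcycle p (subtop X B) (A Int B) b" unfolding singular_relcycle_def mod_subset_def using b YY by simp
 have r0:"singular_relcycle p (subtop X B) (A Int B) 0" by simp
 have cont:"continuous_map (subtop X B) ?Y id" by (auto simp:continuous_map_in_subtopology)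
 have im:"?h (homologous_rel_set p (subtop X B) (A Int B) c) = homologous_rel_set p ?Y A c"
  if "singular_relcycle p (subtop X B) (A Int B) c" for c
  using that hom_induced_chain_map[OF cont _ that] by (fastforce simp:singular_relcycle_def chain_map_id_gen)
 have "singular_relboundary p ?Y A b" unfolding singular_relboundary_alt YY using e eq
  by (intro exI[of _ e] exI[of _ "- a"]) (simp add:singular_chain_minus)
 hence "homologous_rel_set p ?Y A b = homologous_rel_set p ?Y A 0" by (subst homologous_rel_set_eq) (simp add:homologous_rel_def)
 hence "?h (homologous_rel_set p (subtop X B) (A Int B) b) = ?h (homologous_rel_set p (subtop X B) (A Int B) 0)"
  using im[OF rb] im[OF r0] by simp
 moreover have inj:"inj_on ?h (carrier (relative_homology_group p (subtop X B) (A Int B)))"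
  using homology_excision_axiom[OF ex, of "A Un B" "int p"] by (auto simp:iso_def bij_betw_def BB YY)
 moreover have "homologous_rel_set p (subtop X B) (A Int B) c:carrier (relative_homology_group p (subtop X B) (A Int B))"
  if "singular_relcycle p (subtop X B) (A Int B) c" for c unfolding carrier_relative_homology_group using that by blast
 ultimately have "homologous_rel_set p (subtop X B) (A Int B) b = homologous_rel_set p (subtop X B) (A Int B) 0"
  using rb r0 inj_onD by metis
 hence "homologous_rel p (subtop X B) (A Int B) b 0" using homologous_rel_set_eq by metis
 then obtain d where d:"singular_chain (Suc p) (subtop X B) d"
  "singular_chain p (subtop X (A Int B)) (chain_boundary (Suc p) d - b)"
  by (auto simp:homologous_rel_def singular_relboundary_def mod_subset_def YY)
 show ?thesis
 proof (rule that[OF d(1)])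
  show "singular_chain p (subtop X (A Int B)) (- (chain_boundary (Suc p) d - b))"
   using d(2) by (simp only:singular_chain_minus)
 qed auto
qed

lemma excision_surj:
 assumes A:"openin X A" and B:"openin X B"
  and c:"c:chin p X (A Un B)" "bnd p c:chin (p - 1) X A"
 obtains b d a where "b:chin p X B" "d:chin (Suc p) X (A Un B)" "a:chin p X A"
  "c = b + bnd (Suc p) d + a"
proof -
 obtain N c' where N:"N > 0" "c = sc (1 / of_nat N) (rcof c')"
  "singular_chain p (subtop X (A Un B)) c'" "sc (of_nat N) c = rcof c'"
  using chain_clear[OF c(1)] by blast
 have bd:"singular_chain (p - 1) (subtop X A) (chain_boundary p c')"
  by (metis c(2) rcof_in rc.subspace_scale ss_chains N(4)[symmetric] bd_scale bd_rcof)
 obtain b d a where *: "singular_chain p (subtop X B) b" "singular_chain (Suc p) (subtop X (A Un B)) d"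
  "singular_chain p (subtop X A) a" "c' = b + chain_boundary (Suc p) d + a" by (rule excision_surj_int[OF A B N(3) bd]) blast
 let ?s = "%x. sc (1 / of_nat N) (rcof x)"
 show ?thesis
 proof (rule that[of "?s b" "?s d" "?s a"])
  show "c = ?s b + bnd (Suc p) (?s d) + ?s a" unfolding N(2) *(4)
   by (simp add:rcof_add rc.scale_right_distrib bd_scale bd_rcof)
 qed (use * in \<open>simp_all add:rc.subspace_scale[OF ss_chains] rcof_in\<close>)
qed

lemma excision_inj:
 assumes A:"openin X A" and B:"openin X B"
  and b:"b:chin p X B" "bnd p b:chin (p - 1) X (A Int B)"
  and e:"e:chin (Suc p) X (A Un B)" "a:chin p X A" and eq:"b = bnd (Suc p) e + a"
 obtains d a' where "d:chin (Suc p) X B" "a':chin p X (A Int B)" "b = bnd (Suc p) d + a'"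
proof -
 obtain N1 e' where N1:"N1 > 0" "singular_chain (Suc p) (subtop X (A Un B)) e'" "sc (of_nat N1) e = rcof e'"
  by (rule chain_clear[OF e(1)], rule that)
 obtain N2 a' where N2:"N2 > 0" "singular_chain p (subtop X A) a'" "sc (of_nat N2) a = rcof a'"
  by (rule chain_clear[OF e(2)], rule that)
 define N where "N = N1 * N2"
 define e2 where "e2 = frag_cmul (int N2) e'"
 define a2 where "a2 = frag_cmul (int N1) a'"
 \<comment> \<open>Defining \<open>b2\<close> through \<open>e2\<close> and \<open>a2\<close>,
   instead of clearing the denominators of b, makes the integral equation hold by
   definition.\<close>
 define b2 where "b2 = chain_boundary (Suc p) e2 + a2"
 have e2:"rcof e2 = sc (of_nat N) e"
  unfolding e2_def rcof_cmul N1(3)[symmetric] by (simp add:N_def)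
 have a2:"rcof a2 = sc (of_nat N) a"
  unfolding a2_def rcof_cmul N2(3)[symmetric] by (simp add:N_def)
 have b2:"rcof b2 = sc (of_nat N) b"
  unfolding b2_def eq by (simp add:rcof_add rc.scale_right_distrib a2 e2 bd_scale flip:bd_rcof)
 have in_scale:"sc q x:RC k Y" if "x:RC k Y" for q x k and Y :: "'a topology"
  using that by (rule rc.subspace_scale[OF ss_chains])
 have s:"singular_chain p (subtop X B) b2"
  "singular_chain (p - 1) (subtop X (A Int B)) (chain_boundary p b2)"
  "singular_chain (Suc p) (subtop X (A Un B)) e2" "singular_chain p (subtop X A) a2"
  unfolding rcof_in[symmetric] bd_rcof[symmetric] b2 e2 a2 bd_scale by (intro in_scale b e)+
 obtain d a'' where *: "singular_chain (Suc p) (subtop X B) d" "singular_chain p (subtop X (A Int B)) a''"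
  "b2 = chain_boundary (Suc p) d + a''" by (rule excision_inj_int[OF A B s b2_def]) blast
 let ?s = "%x. sc (1 / of_nat N) (rcof x)"
 have "b = ?s b2" using N1 N2 by (auto simp:b2 N_def)
 hence "b = bnd (Suc p) (?s d) + ?s a''"
  unfolding *(3) by (simp add:rcof_add rc.scale_right_distrib bd_scale bd_rcof)
 thus ?thesis by (rule that[rotated 2]) (use * in \<open>simp_all add:in_scale rcof_in\<close>)
qed

section \<open>Isotypic homology of a space with an action of an elementary abelian 2-group\<close>

lemma simplex_map_id_on:
 assumes "singular_simplex p X f" "!!x. x:topspace X ==> g x = x"
 shows "simplex_map p g f = f"
proof -
 have "f:extensional (standard_simplex p)" "!!z. z:standard_simplex p ==> f z:topspace X"
  using assms(1) by (auto simp:singular_simplex_def continuous_map_def)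
 thus ?thesis by (intro ext) (auto simp:simplex_map_def assms(2) extensional_def)
qed

lemma simplex_map_cong_on:
 assumes "singular_simplex p X f" "!!x. x:topspace X ==> g x = h x"
 shows "simplex_map p g f = simplex_map p h f"
proof -
 have "!!z. z:standard_simplex p ==> f z:topspace X" using assms(1) by (auto simp:singular_simplex_def continuous_map_def)
 thus ?thesis by (intro ext) (auto simp:simplex_map_def assms(2))
qed

text \<open>The characters of the group of subsets under symmetric difference. They are again
  indexed by subsets, and their values 1 and -1 are rational, so homology over the rationals
  splits.\<close>

definition sgch :: "nat set=>nat set=>rat" where
 "sgch m s = (- 1) ^ card (m Int s)"

lemma sgn_char_cases:"sgch m s = 1 \<or> sgch m s = - 1" unfolding sgch_def by (metis minus_one_power_iff)

lemma sgn_char_square [simp]:"sgch m s * sgch m s = 1" using sgn_char_cases[of m s] by auto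

lemma sgn_char_empty [simp]:"sgch m {} = 1" "sgch {} s = 1" by (simp_all add:sgch_def)

lemma sgn_char_commute:"sgch m s = sgch s m" by (simp add:sgch_def Int_commute)

lemma sgn_char_sym_diff:
 assumes "finite m"
 shows "sgch m (sym_diff s t) = sgch m s * sgch m t"
proof -
 have "card (m Int s) + card (m Int t) = card (m Int sym_diff s t) + 2 * card (m Int s Int t)"
 proof -
  have "card (m Int s) = card (m Int (s - t)) + card (m Int s Int t)"
   by (subst card_Un_disjoint[symmetric]) (use assms in \<open>auto intro:arg_cong[where f = card]\<close>)
  moreover have "card (m Int t) = card (m Int (t - s)) + card (m Int s Int t)"
   by (subst card_Un_disjoint[symmetric]) (use assms in \<open>auto intro:arg_cong[where f = card]\<close>)
  moreover have "card (m Int sym_diff s t) = card (m Int (s - t)) + card (m Int (t - s))"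
   by (subst card_Un_disjoint[symmetric]) (use assms in \<open>auto intro:arg_cong[where f = card]\<close>)
  ultimately show ?thesis by simp
 qed
 hence "(- 1 :: rat) ^ (card (m Int s) + card (m Int t)) = (- 1) ^ (card (m Int sym_diff s t) + 2 * card (m Int s Int t))" by simp
 thus ?thesis by (simp add:sgch_def power_add)
qed

lemma sym_diff_cancel [simp]:"sym_diff (sym_diff a t) t = a" "sym_diff t (sym_diff t a) = a" by auto

text \<open>Pairing m with its symmetric difference with {i}, for some i in s, reverses every
  sign.\<close>

lemma sum_sgn_char:
 assumes "finite I" "s <= I"
 shows "(SUM m:Pow I. sgch m s) = (if s = {} then 2 ^ card I else 0)"
proof (cases "s = {}")
 case True
 thus ?thesis using assms by (simp add:card_Pow)
next
 case False
 then obtain i where i:"i:s" by blast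
 have "(SUM m:Pow I. sgch m s) = (SUM m:Pow I. sgch (sym_diff m {i}) s)"
  by (rule sum.reindex_bij_witness[of _ "%m. sym_diff m {i}" "%m. sym_diff m {i}"]) (use i assms in auto)
 also have "... = (SUM m:Pow I. - sgch m s)"
 proof (rule sum.cong)
  fix m assume "m:Pow I"
  have "sgch s (sym_diff m {i}) = sgch s m * sgch s {i}"
   using assms by (intro sgn_char_sym_diff) (auto dest:finite_subset)
  moreover have "sgch s {i} = - 1" using i by (simp add:sgch_def)
  ultimately show "sgch (sym_diff m {i}) s = - sgch m s" by (simp add:sgn_char_commute[of _ s])
 qed simp
 also have "... = - (SUM m:Pow I. sgch m s)" by (simp add:sum_negf)
 finally show ?thesis using False by simp
qed

locale signed_action =
 fixes X :: "'x topology" and I :: "nat set" and act :: "nat set=>'x=>'x"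
 assumes finite_I:"finite I"
  and act_continuous:"s <= I ==> continuous_map X X (act s)"
  and act_empty:"x:topspace X ==> act {} x = x"
  and act_act:"s <= I ==> t <= I ==> x:topspace X ==> act s (act t x) = act (sym_diff s t) x"
begin

definition stable :: "'x set=>bool" where
 "stable A <-> A <= topspace X & (!s. s <= I --> act s ` A <= A)"

definition "ichains m p A = {c:chin p X A. !s. s <= I --> rcmap p (act s) c = sc (sgch m s) c}"

text \<open>The idempotent of the rational group algebra that belongs to the character m.\<close>

definition "proj m p c = sc (1 / 2 ^ card I) (SUM s:Pow I. sc (sgch m s) (rcmap p (act s) c))"

definition "cycs m p A = {c:ichains m p A. bnd p c = 0}"

definition "bds m p A = bnd (Suc p) ` ichains m (Suc p) A"

text \<open>For p = 0 the truncated degree \<open>p - 1\<close> does no harm, because the boundary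
  of a 0-chain is 0.\<close>

definition "rcyc m p B A = {c:ichains m p B. bnd p c:ichains m (p - 1) A}"

definition "rbds m p B A = {b + a |b a. b:bds m p B & a:ichains m p A}"

definition "hdim m A p = rc.qdim (cycs m p A) (bds m p A)"

definition "rdim m B A p = rc.qdim (rcyc m p B A) (rbds m p B A)"

lemma map_in_chains:
 assumes "stable A" "c:chin p X A" "s <= I"
 shows "rcmap p (act s) c:chin p X A"
proof -
 have cont:"continuous_map (subtop X A) (subtop X A) (act s)"
  using continuous_map_from_subtopology[OF act_continuous[OF assms(3)]] assms(1,3) by (auto simp:continuous_map_in_subtopology stable_def image_subset_iff)
 have "sngl (simplex_map p (act s) f) 1:chin p X A" if "f:kys c" for f
  using singular_simplex_simplex_map[OF _ cont, of p f] that assms(2) by (auto simp:rat_singular_chains_def)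
 thus ?thesis unfolding rcmap_def rext_def
  by (intro rc.subspace_sum[OF ss_chains] rc.subspace_scale[OF ss_chains])
qed

lemma chains_top:"A <= topspace X ==> c:chin p X A ==> c:RC p X"
 unfolding rat_singular_chains_def by (auto simp:singular_simplex_subtopology)

lemma map_map:
 assumes "c:RC p X" "s <= I" "t <= I"
 shows "rcmap p (act s) (rcmap p (act t) c) = rcmap p (act (sym_diff s t)) c"
proof -
 have "simplex_map p (act s) (simplex_map p (act t) f) = simplex_map p (act (sym_diff s t)) f"
  if "f:kys c" for f
 proof -
  have f:"singular_simplex p X f" using that assms by (auto simp:rat_singular_chains_def)
  have "simplex_map p (act s) (simplex_map p (act t) f) = simplex_map p (act s \<circ> act t) f"
   by (simp add:simplex_map_compose)
  also have "... = simplex_map p (act (sym_diff s t)) f" by (rule simplex_map_cong_on[OF f]) (simp add:act_act assms)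
  finally show ?thesis .
 qed
 thus ?thesis unfolding rcmap_def rext_rext by (intro rat_extend_cong) simp
qed

lemma map_empty:
 assumes "c:RC p X"
 shows "rcmap p (act {}) c = c"
proof -
 have "rcmap p (act {}) c = rext (%f. sngl f 1) c"
  unfolding rcmap_def using assms simplex_map_id_on[OF _ act_empty]
  by (intro rat_extend_cong) (auto simp:rat_singular_chains_def)
 thus ?thesis by (simp add:rat_extend_ident)
qed

lemma ss_iso:"rc.subspace (ichains m p A)"
proof (rule rc.subspaceI)
 show "0:ichains m p A" by (simp add:ichains_def rc.subspace_0[OF ss_chains] rcmap_def)
next
 fix c d assume "c:ichains m p A" "d:ichains m p A"
 thus "c + d:ichains m p A" by (simp add:ichains_def rc.subspace_add[OF ss_chains] map_add rc.scale_right_distrib)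
next
 fix q c assume "c:ichains m p A"
 thus "sc q c:ichains m p A" by (simp add:ichains_def rc.subspace_scale[OF ss_chains] map_scale)
qed

lemma ss_cyc:"rc.subspace (cycs m p A)" using ss_iso[of m p A] unfolding rc.subspace_def cycs_def
 by (auto simp:bd_add bd_scale)

lemma ss_bds:"rc.subspace (bds m p A)"
 unfolding bds_def by (rule rc.vp.linear_subspace_image[OF bd_linear ss_iso])

lemma ss_rcyc:"rc.subspace (rcyc m p B A)"
 using ss_iso[of m p B] ss_iso[of m "p - 1" A] unfolding rc.subspace_def rcyc_def
 by (auto simp:bd_add bd_scale)

lemma ss_rbds:"rc.subspace (rbds m p B A)"
 unfolding rbds_def by (rule rc.subspace_sums[OF ss_bds ss_iso])

lemma iso_mono:"A <= B ==> ichains m p A <= ichains m p B" unfolding ichains_def using chains_in_mono by blast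

lemma iso_Int:"ichains m p A Int ichains m p B = ichains m p (A Int B)"
 unfolding ichains_def using chains_in_Int by blast

lemma ich_in:"c:ichains m p A ==> c:chin p X A" by (simp add:ichains_def)

lemma boundary_iso:
 assumes "c:ichains m p A"
 shows "bnd p c:ichains m (p - 1) A" unfolding ichains_def
proof (intro CollectI conjI allI impI)
 show "bnd p c:chin (p - 1) X A" using assms by (intro boundary_in_chains) (auto simp:ichains_def)
 fix s assume "s <= I"
 thus "rcmap (p - 1) (act s) (bnd p c) = sc (sgch m s) (bnd p c)"
  using assms by (metis (mono_tags, lifting) boundary_map bd_scale ichains_def mem_Collect_eq)
qed

lemma bds_cyc:"bds m p A <= cycs m p A" unfolding bds_def cycs_def
 using boundary_iso[of _ m "Suc p" A] boundary_boundary ich_in by fastforce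

lemma proj_add:"proj m p (c + d) = proj m p c + proj m p d"
 and proj_scale:"proj m p (sc q c) = sc q (proj m p c)"
 by (simp_all add:proj_def map_add map_scale rc.scale_right_distrib sum.distrib rc.scale_sum_right mult.commute)

lemma proj_linear:"rc.vlin (proj m p)"
 by (rule Vector_Spaces.linear_iff[THEN iffD2]) (auto simp:proj_add proj_scale intro:rc.vector_space_axioms)

lemma proj_boundary:"proj m (p - 1) (bnd p c) = bnd p (proj m p c)"
 by (simp add:proj_def bd_scale boundary_sum boundary_map)

lemma proj_in_iso:
 assumes A:"stable A" and m:"m <= I" and c:"c:chin p X A"
 shows "proj m p c:ichains m p A" unfolding ichains_def
proof (intro CollectI conjI allI impI)
 show "proj m p c:chin p X A" unfolding proj_def using map_in_chains[OF A c]
  by (intro rc.subspace_sum[OF ss_chains] rc.subspace_scale[OF ss_chains]) auto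
 fix s assume s:"s <= I"
 have cX:"c:RC p X" using A c chains_top by (auto simp:stable_def)
 have fm:"finite m" using m finite_I finite_subset by blast
 have "rcmap p (act s) (SUM t:Pow I. sc (sgch m t) (rcmap p (act t) c))
   = (SUM t:Pow I. sc (sgch m t) (rcmap p (act (sym_diff s t)) c))"
  using s by (simp add:map_sum map_scale map_map[OF cX])
 also have "... = (SUM t:Pow I. sc (sgch m (sym_diff s t)) (rcmap p (act t) c))"
  by (rule sum.reindex_bij_witness[of _ "%t. sym_diff s t" "%t. sym_diff s t"])
   (use s in \<open>auto intro!:arg_cong[where f = "%t. rcmap p (act t) c"]\<close>)
 also have "... = sc (sgch m s) (SUM t:Pow I. sc (sgch m t) (rcmap p (act t) c))"
  by (simp add:sgn_char_sym_diff[OF fm] rc.scale_sum_right)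
 finally show "rcmap p (act s) (proj m p c) = sc (sgch m s) (proj m p c)"
  unfolding proj_def by (simp add:map_scale)
qed

lemma proj_iso:
 assumes "c:ichains m p A"
 shows "proj m p c = c"
proof -
 have "proj m p c = sc (1 / 2 ^ card I) (SUM s:Pow I. c)" unfolding proj_def using assms
  by (intro arg_cong2[where f = rat_chain_scale] sum.cong) (auto simp:ichains_def)
 also have "... = c" by (auto intro!:poly_mapping_eqI simp:lookup_sum card_Pow finite_I)
 finally show ?thesis .
qed

lemma sum_proj:
 assumes "c:RC p X"
 shows "(SUM m:Pow I. proj m p c) = c"
proof -
 have "(SUM m:Pow I. proj m p c)
   = sc (1 / 2 ^ card I) (SUM s:Pow I. sc (SUM m:Pow I. sgch m s) (rcmap p (act s) c))"
  unfolding proj_def rc.scale_sum_right[symmetric] rc.scale_sum_left by (subst sum.swap) simp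
 also have "(SUM s:Pow I. sc (SUM m:Pow I. sgch m s) (rcmap p (act s) c))
  = (SUM s:Pow I. if s = {} then sc (2 ^ card I) c else 0)"
  by (intro sum.cong) (auto simp:sum_sgn_char finite_I map_empty[OF assms])
 also have "... = sc (2 ^ card I) c" using finite_I by simp
 finally show ?thesis by simp
qed

subsection \<open>Exactness and excision\<close>

text \<open>The long exact sequence of the pair, recorded by ranks: \<open>u (Suc k)\<close>,
  \<open>v k\<close> and \<open>w k\<close> are the ranks of the maps from H_(k+1)(B,A) to H_k(A),
  from there to H_k(B), and from there to H_k(B,A). Sums of ranks avoid subtraction in
  \<open>enat\<close>.\<close>

theorem hdim_exact:
 assumes AB:"A <= B"
 shows "EX u v w. u 0 = 0 & (!k. hdim m A k = u (Suc k) + v k & hdim m B k = v k + w k & rdim m B A k = w k + u k)"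
proof -
 \<comment> \<open>Modulo the boundaries in B, \<open>V\<close> is the image of the homology of A in
   that of B; modulo the boundaries in A, \<open>U\<close> is the kernel of this map;
   \<open>Y\<close> consists of the relative cycles that are cycles up to a chain in A.\<close>
 define V where "V k = {z + b |z b. z:cycs m k A & b:bds m k B}" for k
 define U where "U k = cycs m k A Int bds m k B" for k
 define Y where "Y k = {z + a |z a. z:cycs m k B & a:ichains m k A}" for k
 define v where "v k = rc.qdim (V k) (bds m k B)" for k
 define w where "w k = rc.qdim (cycs m k B) (V k)" for k
 define u where "u k = (case k of 0=>0 | Suc j=>rc.qdim (U j) (bds m j A))" for k
 note sub = ss_cyc ss_bds ss_iso ss_rcyc ss_rbds
 have sV:"rc.subspace (V k)" and sU:"rc.subspace (U k)" and sY:"rc.subspace (Y k)" for k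
  unfolding V_def U_def Y_def by (intro rc.subspace_sums rc.subspace_inter sub)+
 have zero:"0:cycs m k A'" "0:bds m k A'" "0:ichains m k A'" for k A' using sub rc.subspace_0 by blast+
 have cAB:"cycs m k A <= cycs m k B" and bAB:"bds m k A <= bds m k B" for k
  using iso_mono[OF AB] unfolding cycs_def bds_def by blast+
 have 1:"hdim m A k = u (Suc k) + v k" for k
 proof -
  have "hdim m A k = rc.qdim (U k) (bds m k A) + rc.qdim (cycs m k A) (U k)" unfolding hdim_def
   by (rule rc.quot_dim_tower) (use sub sU bds_cyc[of m k A] bAB[of k] in \<open>auto simp:U_def\<close>)
  moreover have "rc.qdim (cycs m k A) (U k) = v k" unfolding v_def
  proof (rule rc.qd_transfer[OF rc.linear_ident])
   show "bds m k B <= V k" using zero(1) by (force simp:V_def)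
   show "z:V k" if "z:cycs m k A" for z using that zero(2) by (force simp:V_def)
   show "EX z:cycs m k A. y - z:bds m k B" if "y:V k" for y using that unfolding V_def by (auto intro!:bexI)
  qed (use sub sU sV in \<open>auto simp:U_def\<close>)
  ultimately show ?thesis by (simp add:u_def)
 qed
 have VB:"V k <= cycs m k B" for k
  using cAB[of k] bds_cyc[of m k B] rc.subspace_add[OF ss_cyc[of m k B]] unfolding V_def by blast
 have bV:"bds m k B <= V k" for k using zero(1) by (force simp:V_def)
 have 2:"hdim m B k = v k + w k" for k unfolding hdim_def v_def w_def by (rule rc.quot_dim_tower[OF sub(2) sV sub(1) bV VB])
 have relY:"rbds m k B A <= Y k" for k using bds_cyc[of m k B] unfolding rbds_def Y_def by blast
 have Yrel:"Y k <= rcyc m k B A" for k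
  using iso_mono[OF AB, of m k] boundary_iso rc.subspace_add[OF ss_iso[of m k B]] by (auto simp:Y_def rcyc_def cycs_def bd_add)
 have 3:"rdim m B A k = w k + u k" for k
 proof -
  have "rdim m B A k = rc.qdim (Y k) (rbds m k B A) + rc.qdim (rcyc m k B A) (Y k)"
   unfolding rdim_def by (rule rc.quot_dim_tower[OF sub(5) sY sub(4) relY Yrel])
  moreover have "w k = rc.qdim (Y k) (rbds m k B A)" unfolding w_def
  proof (rule rc.qd_transfer[OF rc.linear_ident sub(1) sV sY sub(5) relY])
   show "z:Y k" if "z:cycs m k B" for z using that zero(3) by (force simp:Y_def)
   show "z:rbds m k B A <-> z:V k" if z:"z:cycs m k B" for z
  using that bds_cyc z by (fastforce simp:rbds_def cycs_def bd_add V_def add.commute)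
   show "EX z:cycs m k B. y - z:rbds m k B A" if "y:Y k" for y
  using that \<open>y : Y k\<close> zero(2) by (force simp:Y_def rbds_def)
  qed
  moreover have "u k = rc.qdim (rcyc m k B A) (Y k)"
  proof (cases k)
   case 0
   have "rcyc m 0 B A <= Y 0" unfolding Y_def rcyc_def cycs_def rat_chain_boundary_def by force
   thus ?thesis using 0 rc.quot_dim_eq_0[OF sub(4) sY] by (simp add:u_def)
  next
   case (Suc j)
   have "rc.qdim (rcyc m k B A) (Y k) = rc.qdim (U j) (bds m j A)"
   proof (rule rc.qd_transfer[OF bd_linear[of k]])
    show "bds m j A <= U j" using bds_cyc[of m j A] bAB[of j] by (auto simp:U_def)
    show bU:"bnd k z:U j" if "z:rcyc m k B A" for z
    proof -
     have "bnd j (bnd (Suc j) z) = 0"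
      using that Suc by (intro boundary_boundary[of _ _ "subtop X B"]) (auto simp:rcyc_def ichains_def)
     thus ?thesis using that Suc by (auto simp:rcyc_def U_def cycs_def bds_def)
    qed
    show "bnd k z:bds m j A <-> z:Y k" if z:"z:rcyc m k B A" for z
    proof
     assume "bnd k z:bds m j A"
     then obtain a where a:"a:ichains m k A" "bnd k z = bnd k a"
      using Suc by (auto simp:bds_def)
     have "z - a:ichains m k B"
      using z a(1) iso_mono[OF AB, of m k] rc.subspace_diff[OF ss_iso[of m k B]] by (auto simp:rcyc_def)
     thus "z:Y k" using a by (force simp:cycs_def boundary_diff Y_def)
    next
     assume "z:Y k"
     thus "bnd k z:bds m j A" using Suc unfolding Y_def cycs_def bds_def by (auto simp:bd_add)
    qed
    show "EX z:rcyc m k B A. y - bnd k z:bds m j A" if "y:U j" for y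
  using that Suc zero(2) by (auto simp:U_def bds_def rcyc_def cycs_def)
   qed (use sub sU sY in auto)
   thus ?thesis using Suc by (simp add:u_def)
  qed
  ultimately show ?thesis by simp
 qed
 have "u 0 = 0" by (simp add:u_def)
 thus ?thesis using 1 2 3 by blast
qed

text \<open>Both halves of ordinary excision apply to the underlying chains. The projector
  \<open>proj m\<close> commutes with the boundary and preserves stable sets, so it turns the chains
  that they produce into isotypic ones.\<close>

theorem rdim_excision:
 assumes A:"openin X A" "stable A" and B:"openin X B" "stable B" and m:"m <= I"
 shows "rdim m (A Un B) A k = rdim m B (A Int B) k"
proof -
 have st:"stable (A Un B)" "stable (A Int B)" using A B by (auto simp:stable_def image_subset_iff)
 note pin = proj_in_iso[OF _ m]
 note sub = ss_rcyc ss_rbds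
 have bsub:"rbds m k (A Un B) A <= rcyc m k (A Un B) A"
 proof
  fix c assume "c:rbds m k (A Un B) A"
  then obtain b a where *: "b:bds m k (A Un B)" "a:ichains m k A" "c = b + a" by (auto simp:rbds_def)
  hence "b:cycs m k (A Un B)" using bds_cyc by blast
  thus "c:rcyc m k (A Un B) A" using * iso_mono[of A "A Un B" m k] boundary_iso[OF *(2)] rc.subspace_add[OF ss_iso]
   by (auto simp:rcyc_def cycs_def bd_add)
 qed
 have "rc.qdim (rcyc m k B (A Int B)) (rbds m k B (A Int B))
   = rc.qdim (rcyc m k (A Un B) A) (rbds m k (A Un B) A)"
 proof (rule rc.qd_transfer[OF rc.linear_ident sub sub bsub])
  show "z:rcyc m k (A Un B) A" if "z:rcyc m k B (A Int B)" for z
   using that iso_mono[of B "A Un B" m k] iso_mono[of "A Int B" A m "k - 1"] by (auto simp:rcyc_def)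
  show "z:rbds m k (A Un B) A <-> z:rbds m k B (A Int B)" if z:"z:rcyc m k B (A Int B)" for z
  proof
   assume "z:rbds m k (A Un B) A"
   then obtain e a where ea:"e:ichains m (Suc k) (A Un B)" "a:ichains m k A"
    "z = bnd (Suc k) e + a" by (auto simp:rbds_def bds_def)
   have zB:"z:chin k X B" "bnd k z:chin (k - 1) X (A Int B)"
    using z by (auto simp:rcyc_def ichains_def)
   obtain d a' where d:"d:chin (Suc k) X B" "a':chin k X (A Int B)" "z = bnd (Suc k) d + a'"
    by (rule excision_inj[OF A(1) B(1) zB ich_in[OF ea(1)] ich_in[OF ea(2)] ea(3)])
   have "z = proj m k z" using z proj_iso[of z m k B] by (simp add:rcyc_def)
   also have "... = bnd (Suc k) (proj m (Suc k) d) + proj m k a'"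
    unfolding d(3) proj_add using proj_boundary[of m "Suc k" d] by simp
   finally show "z:rbds m k B (A Int B)"
    unfolding rbds_def bds_def using pin[OF B(2) d(1)] pin[OF st(2) d(2)] by blast
  next
   assume "z:rbds m k B (A Int B)"
   thus "z:rbds m k (A Un B) A" unfolding rbds_def bds_def
    using iso_mono[of B "A Un B" m "Suc k"] iso_mono[of "A Int B" A m k] by blast
  qed
  show "EX z:rcyc m k B (A Int B). y - z:rbds m k (A Un B) A" if y:"y:rcyc m k (A Un B) A" for y
  proof -
   have yc:"y:chin k X (A Un B)" "bnd k y:chin (k - 1) X A"
    using y by (auto simp:rcyc_def ichains_def)
   obtain b d a where *: "b:chin k X B" "d:chin (Suc k) X (A Un B)" "a:chin k X A"
    "y = b + bnd (Suc k) d + a" by (rule excision_surj[OF A(1) B(1) yc])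
   have "y = proj m k y" using y proj_iso[of y m k "A Un B"] by (simp add:rcyc_def)
   also have "... = proj m k b + bnd (Suc k) (proj m (Suc k) d) + proj m k a"
    unfolding *(4) proj_add using proj_boundary[of m "Suc k" d] by simp
   finally have eq:"y = proj m k b + (bnd (Suc k) (proj m (Suc k) d) + proj m k a)" by simp
   have pb:"proj m k b:ichains m k B" and pa:"proj m k a:ichains m k A"
    and pd:"proj m (Suc k) d:ichains m (Suc k) (A Un B)" using pin * A B st by auto
   have yb:"y - proj m k b:rbds m k (A Un B) A" using eq pa pd unfolding rbds_def bds_def by auto
   hence "y - (y - proj m k b):rcyc m k (A Un B) A" using bsub y rc.subspace_diff[OF sub(1)] by blast
   thus ?thesis using boundary_iso[OF pb] pb iso_Int[of m "k - 1" A B] yb by (auto simp:rcyc_def)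
  qed
 qed
 thus ?thesis by (simp add:rdim_def)
qed

end

definition "psx p x = restrict (%_. x) (standard_simplex p)"

definition vertex0 :: "nat=>real" where
 "vertex0 = (%j. if j = 0 then 1 else 0)"

lemma vertex0_in [simp]:"vertex0:standard_simplex p" by (simp add:vertex0_def)

lemma simplex0:"standard_simplex 0 = {vertex0}" by (simp add:standard_simplex_0 vertex0_def)

lemma point_simplex_vertex0 [simp]:"psx p x vertex0 = x" by (simp add:psx_def)

lemma sing_psx:"x:topspace X ==> singular_simplex p X (psx p x)"
 by (simp add:singular_simplex_def psx_def)

lemma singular_simplex_0_eq:
 assumes "singular_simplex 0 X f"
 shows "f = psx 0 (f vertex0)" using assms unfolding singular_simplex_def psx_def
 by (intro ext) (auto simp:extensional_def simplex0)

lemma singular_simplex_in_topspace:"singular_simplex p X f ==> z:standard_simplex p ==> f z:topspace X"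
 by (auto simp:singular_simplex_def continuous_map_def)

lemma smap_psx:"simplex_map p g (psx p x) = psx p (g x)"
 by (auto simp:simplex_map_def psx_def)

lemma singular_face_point_simplex:
 assumes "p > 0" "k <= p"
 shows "singular_face p k (psx p x) = psx (p - 1) x" using assms simplical_face_in_standard_simplex[of p k]
 by (auto simp:singular_face_def psx_def)

lemma alternating_sum:"(SUM k<=p. (- 1 :: rat) ^ k) = (if even p then 1 else 0)" by (induction p) auto

lemma bd_point_simplex:
 assumes "p > 0"
 shows "bd_simplex p (psx p x) = (if even p then sngl (psx (p - 1) x) 1 else 0)"
proof -
 have "bd_simplex p (psx p x) = (SUM k<=p. sngl (psx (p - 1) x) ((- 1) ^ k))"
  using assms by (simp add:bd_simplex_def singular_face_point_simplex)
 also have "... = sngl (psx (p - 1) x) (SUM k<=p. (- 1) ^ k)"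
  by (rule poly_mapping_eqI) (simp add:lookup_sum lookup_single when_def)
 finally show ?thesis by (simp add:alternating_sum)
qed

lemma path_boundary:
 assumes "path_component_of X x y"
 shows "EX d:RC 1 X. bnd 1 d =
  sngl (psx 0 y) 1 - sngl (psx 0 x) 1"
proof -
 obtain g where g:"pathin X g" "g 0 = x" "g 1 = y" using assms by (auto simp:path_component_of_def)
 \<comment> \<open>The coordinate \<open>z 1\<close> identifies the 1-simplex with [0,1]; the face
   opposite to vertex 0 is then the end of the path.\<close>
 define f where "f = restrict (%z. g (z 1)) (standard_simplex 1)"
 have "continuous_map (subtop (powertop_real UNIV) (standard_simplex 1)) (top_of_set {0..1}) (%z. z 1)"
  unfolding continuous_map_in_subtopology
  by (auto intro!:continuous_map_from_subtopology continuous_map_product_projection simp:standard_simplex_def)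
 hence "continuous_map (subtop (powertop_real UNIV) (standard_simplex 1)) X (g \<circ> (%z. z 1))"
  using g(1) unfolding pathin_def by (rule continuous_map_compose)
 hence "continuous_map (subtop (powertop_real UNIV) (standard_simplex 1)) X f" by (rule continuous_map_eq) (simp add:f_def)
 hence f:"singular_simplex 1 X f" by (simp add:singular_simplex_def f_def)
 have face:"singular_face 1 k f = psx 0 (if k = 0 then y else x)" if "k <= 1" for k
  using that simplical_face_in_standard_simplex[of 1 k vertex0] g by (auto simp:simplical_face_def vertex0_def singular_face_def psx_def restrict_def f_def simplex0)
 have "bnd 1 (sngl f 1) = bd_simplex 1 f" by (simp add:bnd_eq)
 also have "... = sngl (psx 0 y) 1 - sngl (psx 0 x) 1"
  using face[of 0] face[of 1] by (simp add:bd_simplex_def flip:single_uminus)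
 finally show ?thesis using f by (intro bexI[of _ "sngl f 1"]) (auto simp:rat_singular_chains_def)
qed

lemma chain_0_induct:
 assumes "c:RC 0 X" and "rc.subspace S"
  and "!!x. x:topspace X ==> sngl (psx 0 x) 1:S"
 shows "c:S"
proof -
 have "c = rext (%f. sngl f 1) c" by (simp add:rat_extend_ident)
 also have "...:S" unfolding rext_def
 proof (intro rc.subspace_sum[OF assms(2)] rc.subspace_scale[OF assms(2)])
  fix f assume "f:kys c"
  hence f:"singular_simplex 0 X f" using assms(1) by (auto simp:rat_singular_chains_def)
  show "sngl f 1:S"
  using singular_simplex_in_topspace[OF f] assms(3)[of "f vertex0"] singular_simplex_0_eq[OF f] by simp
 qed
 finally show ?thesis .
qed

text \<open>The image of a cycle under \<open>f\<close> consists of constant simplices. The boundary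
  of a constant q-simplex is the constant (q-1)-simplex or 0, as q is even or odd, so a cycle of
  constant simplices bounds in positive degree; and c differs from its image by a boundary.\<close>

lemma cycle_bounds_of_retract:
 assumes hom:"homotopic_with (%_. True) Y Y id f"
  and const:"!!p g. singular_simplex p Y g ==> EX x. !z:standard_simplex p. f (g z) = x"
  and c:"c:RC p Y" "bnd p c = 0" and p:"p > 0"
 shows "c:bnd (Suc p) ` RC (Suc p) Y"
proof -
 let ?B = "bnd (Suc p) ` RC (Suc p) Y"
 have sB:"rc.subspace ?B" by (rule rc.vp.linear_subspace_image[OF bd_linear ss_chains])
 have cont:"continuous_map Y Y f" using homotopic_with_imp_continuous_maps[OF hom] by blast
 define L where "L q = rext (%g. sngl (psx q (f (g vertex0))) 1) c" for q
 have fc:"rcmap p f c = L p" unfolding rcmap_def L_def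
 proof (rule rat_extend_cong)
  fix g assume "g:kys c"
  then obtain x where "!z:standard_simplex p. f (g z) = x" using c const rat_singular_chains_def by blast
  hence "simplex_map p f g = psx p (f (g vertex0))" by (intro ext) (auto simp:simplex_map_def psx_def)
  thus "sngl (simplex_map p f g) 1 = sngl (psx p (f (g vertex0))) (1::rat)" by simp
 qed
 have Lin:"L q:RC q Y" for q unfolding L_def rext_def
 proof (intro rc.subspace_sum[OF ss_chains] rc.subspace_scale[OF ss_chains])
  fix g assume "g:kys c"
  thus "sngl (psx q (f (g vertex0))) 1:RC q Y"
  using c singular_simplex_in_topspace[of p Y g vertex0] cont by (force simp:continuous_map_def rat_singular_chains_def sing_psx)
 qed
 have bdL:"bnd q (L q) = (if even q then L (q - 1) else 0)" if "q > 0" for q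
  unfolding L_def bnd_eq rext_rext by (simp add:bd_point_simplex[OF that] rext_def)
 have step:"L p = rext (%g. sngl (psx p (g vertex0)) 1) (L (p - 1))"
  unfolding L_def rext_rext by simp
 have "bnd p (L p) = rcmap (p - 1) f (bnd p c)" by (simp flip:fc add:boundary_map)
 hence bd0:"bnd p (L p) = 0" using c by (simp add:rcmap_def)
 \<comment> \<open>For even p the boundary of \<open>L p\<close> is \<open>L (p - 1)\<close>, which
   must vanish and forces \<open>L p = 0\<close>; for odd p, \<open>L p\<close> is the boundary of
   \<open>L (Suc p)\<close>.\<close>
 have LB:"L p:?B" using bd0 bdL[OF p] step bdL[of "Suc p"] Lin by force
 obtain N c' where N:"N > 0" "c = sc (1 / of_nat N) (rcof c')" "singular_chain p Y c'"
  "sc (of_nat N) c = rcof c'" by (rule chain_clear[OF c(1)], rule that)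
 have "rcof (chain_boundary p c') = 0" using c by (simp flip:bd_rcof N(4) add:bd_scale)
 hence "singular_relcycle p Y {} c'" by (metis keys_eq_empty keys_rat_of_chain N(3) singular_cycle)
 hence "homologous_rel p Y {} (chain_map p id c') (chain_map p f c')"
  by (intro homotopic_imp_homologous_rel_chain_maps) (use hom in auto)
 then obtain d where d:"singular_chain (Suc p) Y d" "chain_boundary (Suc p) d = c' - chain_map p f c'"
  using chain_map_id_gen[OF N(3), of id] by (auto simp:homologous_rel_def singular_boundary)
 let ?s = "%x. sc (1 / of_nat N) (rcof x)"
 have "bnd (Suc p) (?s d) = c - rcmap p f c"
  unfolding N(2) by (simp add:bd_scale bd_rcof d rat_of_chain_diff map_scale map_rat_of_chain rc.scale_right_diff_distrib)
 moreover have "?s d:RC (Suc p) Y"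
  using d(1) by (simp add:rc.subspace_scale[OF ss_chains] rcof_in)
 ultimately have "(c - L p) + L p:?B" by (metis image_eqI LB rc.subspace_add[OF sB] fc[symmetric])
 thus ?thesis by simp
qed

context signed_action
begin

lemma boundary_proj_mem:
 assumes A:"stable A" and m:"m <= I" and c:"c:ichains m p A" and d:"d:chin (Suc p) X A"
  and eq:"c = bnd (Suc p) d"
 shows "c:bds m p A"
  using assms proj_iso[OF c] proj_boundary[of m "Suc p" d] proj_in_iso[OF A m d] by (auto simp:bds_def)

lemma topspace_stable:"stable A ==> topspace (subtop X A) = A" by (auto simp:stable_def)

theorem rdim_0:
 assumes A:"stable A" and B:"stable B" and AB:"A <= B" and m:"m <= I"
  and path:"!!x. x:B ==> EX y:A. path_component_of (subtop X B) x y"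
 shows "rdim m B A 0 = 0"
proof -
 let ?S = "{b + a |b a. b:bnd 1 ` chin 1 X B & a:chin 0 X A}"
 have S:"rc.subspace ?S" by (intro rc.subspace_sums rc.vp.linear_subspace_image[OF bd_linear] ss_chains)
 have all:"c:?S" if "c:chin 0 X B" for c
 proof (rule chain_0_induct[OF that S])
  fix x assume "x:topspace (subtop X B)"
  then obtain y where y:"y:A" "path_component_of (subtop X B) y x" using path path_component_of_sym by force
  obtain d where d:"d:chin 1 X B"
   "bnd 1 d = sngl (psx 0 x) 1 - sngl (psx 0 y) 1"
   using path_boundary[OF y(2)] by blast
  have "bnd 1 d + sngl (psx 0 y) 1:?S"
  using y(1) topspace_stable[OF A] d(1) by (force simp:rat_singular_chains_def sing_psx)
  thus "sngl (psx 0 x) 1:?S" unfolding d(2) by simp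
 qed
 have "rcyc m 0 B A <= rbds m 0 B A"
 proof
  fix c assume "c:rcyc m 0 B A"
  hence c:"c:ichains m 0 B" by (simp add:rcyc_def)
  then obtain d a where da:"d:chin 1 X B" "a:chin 0 X A" "c = bnd 1 d + a"
   using all[OF ich_in[OF c]] by blast
  have "c = proj m 0 c" using proj_iso[OF c] by simp
  also have "... = bnd (Suc 0) (proj m (Suc 0) d) + proj m 0 a"
   unfolding da(3) proj_add using proj_boundary[of m "Suc 0" d] by simp
  finally have eq:"c = bnd (Suc 0) (proj m (Suc 0) d) + proj m 0 a" .
  show "c:rbds m 0 B A"
  using proj_in_iso[OF B m, of d "Suc 0"] da(1) eq proj_in_iso[OF A m da(2)] by (auto simp:bds_def rbds_def)
 qed
 thus ?thesis unfolding rdim_def by (simp add:rc.quot_dim_eq_0 ss_rcyc ss_rbds)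
qed

theorem hdim_retract:
 assumes A:"stable A" and m:"m <= I"
  and "homotopic_with (%_. True) (subtop X A) (subtop X A) id f"
  and "!!p g. singular_simplex p (subtop X A) g ==> EX x. !z:standard_simplex p. f (g z) = x"
  and "k > 0"
 shows "hdim m A k = 0"
proof -
 have "cycs m k A <= bds m k A"
 proof
  fix c assume "c:cycs m k A"
  hence c:"c:ichains m k A" "bnd k c = 0" by (auto simp:cycs_def)
  thus "c:bds m k A"
  using cycle_bounds_of_retract[OF assms(3,4) ich_in[OF c(1)] c(2) assms(5)] boundary_proj_mem[OF A m c(1)] by blast
 qed
 thus ?thesis unfolding hdim_def by (simp add:rc.quot_dim_eq_0 ss_cyc ss_bds)
qed

text \<open>The element s acts on the isotypic part by -1 but trivially on path components; hence 2
  c bounds, and so does c.\<close>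

theorem hdim_0_odd:
 assumes A:"stable A" and m:"m <= I" and s:"s <= I" "sgch m s = - 1"
  and path:"!!x. x:A ==> path_component_of (subtop X A) x (act s x)"
 shows "hdim m A 0 = 0"
proof -
 let ?B = "bnd 1 ` chin 1 X A"
 have sB:"rc.subspace ?B" by (rule rc.vp.linear_subspace_image[OF bd_linear ss_chains])
 have S:"rc.subspace {c. rcmap 0 (act s) c - c:?B}"
  using rc.vp.linear_compose_sub[OF map_linear rc.linear_ident] rc.vp.linear_subspace_vimage[OF _ sB] by (auto simp:vimage_def)
 have all:"rcmap 0 (act s) c - c:?B" if "c:chin 0 X A" for c
 proof -
  have "c:{c. rcmap 0 (act s) c - c:?B}"
  proof (rule chain_0_induct[OF that S])
   fix x assume "x:topspace (subtop X A)"
   then obtain d where "d:chin 1 X A"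
    "bnd 1 d = sngl (psx 0 (act s x)) 1 - sngl (psx 0 x) 1"
  using path_boundary[OF path] by auto
   thus "sngl (psx 0 x) 1:{c. rcmap 0 (act s) c - c:?B}"
    unfolding rcmap_def by (simp add:smap_psx) (metis image_eqI)
  qed
  thus ?thesis by simp
 qed
 have "cycs m 0 A <= bds m 0 A"
 proof
  fix c assume "c:cycs m 0 A"
  hence c:"c:ichains m 0 A" by (simp add:cycs_def)
  hence "rcmap 0 (act s) c - c = sc (- 2) c"
  using s by (auto simp:ichains_def poly_mapping_eqI lookup_minus)
  hence "sc (- 1 / 2) (sc (- 2) c):?B"
   using all[OF ich_in[OF c]] rc.subspace_scale[OF sB] by metis
  thus "c:bds m 0 A" using boundary_proj_mem[OF A m c] by auto
 qed
 thus ?thesis unfolding hdim_def by (simp add:rc.quot_dim_eq_0 ss_cyc ss_bds)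
qed

lemma proj_map:
 assumes "c:RC p X" "s <= I" "m <= I"
 shows "proj m p (rcmap p (act s) c) = sc (sgch m s) (proj m p c)"
proof -
 have fm:"finite m" using assms finite_I finite_subset by blast
 have "(SUM t:Pow I. sc (sgch m t) (rcmap p (act t) (rcmap p (act s) c)))
  = (SUM t:Pow I. sc (sgch m t) (rcmap p (act (sym_diff t s)) c))" using assms by (simp add:map_map)
 also have "... = (SUM t:Pow I. sc (sgch m (sym_diff t s)) (rcmap p (act t) c))"
 proof (rule sum.reindex_bij_witness[of _ "%t. sym_diff t s" "%t. sym_diff t s"])
  show "sym_diff (sym_diff t s) s = t" for t :: "nat set" by auto
  thus "sc (sgch m (sym_diff (sym_diff t s) s)) (rcmap p (act (sym_diff t s)) c)
   = sc (sgch m t) (rcmap p (act (sym_diff t s)) c)" for t by simp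
 qed (use assms in auto)
 also have "... = sc (sgch m s) (SUM t:Pow I. sc (sgch m t) (rcmap p (act t) c))"
  by (simp add:sgn_char_sym_diff[OF fm] rc.scale_sum_right mult.commute)
 finally show ?thesis by (simp add:proj_def)
qed

text \<open>The path components form one orbit, so the projection of a single point spans. The
  locally constant function \<open>ph\<close>, which transforms by the character m, shows that this
  class is not 0.\<close>

theorem hdim_0_even:
 assumes A:"stable A" and m:"m <= I" and x0:"x0:A" "ph x0 ~= (0::rat)"
  and loc:"!!p g z z'. singular_simplex p (subtop X A) g ==> z:standard_simplex p ==>
   z':standard_simplex p ==> ph (g z) = ph (g z')"
  and equi:"!!s x. s <= I ==> x:A ==> ph (act s x) = sgch m s * ph x"
  and path:"!!x. x:A ==> EX s. s <= I & path_component_of (subtop X A) x (act s x0)"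
 shows "hdim m A 0 = 1"
proof -
 let ?x = "sngl (psx 0 x0) (1::rat)"
 define z0 where "z0 = proj m 0 ?x"
 \<comment> \<open>The functional that \<open>ph\<close> induces on 0-chains. Its values are
   multiples of one fixed simplex, so that the linear extension \<open>rext\<close> applies.\<close>
 define aug where "aug = rext (%g. sngl (psx 0 x0) (ph (g vertex0)))"
 have xA:"sngl (psx 0 x) (1::rat):chin 0 X A" if "x:A" for x
  using that topspace_stable[OF A] by (simp add:rat_singular_chains_def sing_psx)
 have xX:"sngl (psx 0 x) (1::rat):RC 0 X" if "x:A" for x
  using chains_top[OF _ xA[OF that]] A by (auto simp:stable_def)
 have z0:"z0:ichains m 0 A" unfolding z0_def by (rule proj_in_iso[OF A m xA[OF x0(1)]])
 have cyc:"c:cycs m 0 A" if "c:ichains m 0 A" for c using that by (simp add:cycs_def rat_chain_boundary_def)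
 have aug_bd:"aug (bnd (Suc 0) d) = 0" if d:"d:chin (Suc 0) X A" for d
 proof -
  have "aug (bd_simplex (Suc 0) g) = 0" if "g:kys d" for g
  proof -
   have g:"singular_simplex (Suc 0) (subtop X A) g" using d that by (auto simp:rat_singular_chains_def)
   have "simplical_face k vertex0:standard_simplex (Suc 0)" if "k <= 1" for k
    using simplical_face_in_standard_simplex[of 1 k vertex0] that by simp
   hence "ph (g (simplical_face 0 vertex0)) = ph (g (simplical_face (Suc 0) vertex0))" by (intro loc[OF g]) auto
   thus ?thesis by (simp add:aug_def bd_simplex_def rext_add singular_face_def flip:single_add)
  qed
  hence "rext (%g. aug (bd_simplex (Suc 0) g)) d = 0" by (simp add:rext_def[of _ d])
  thus ?thesis by (simp add:aug_def bnd_eq rext_rext)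
 qed
 have aug_z0:"aug z0 = sngl (psx 0 x0) (ph x0)"
 proof -
  have "aug z0 = sc (1 / 2 ^ card I) (SUM s:Pow I. sc (sgch m s)
   (sngl (psx 0 x0) (ph (act s x0))))" unfolding z0_def proj_def aug_def rcmap_def
   by (simp add:rext_scale rext_sum smap_psx)
  also have "... = sc (1 / 2 ^ card I) (SUM s:Pow I. sngl (psx 0 x0) (ph x0))"
   using equi x0 by (intro arg_cong2[where f = rat_chain_scale] sum.cong) (auto simp flip:mult.assoc)
  also have "... = sngl (psx 0 x0) (ph x0)"
   by (auto intro!:poly_mapping_eqI simp:lookup_sum card_Pow finite_I)
  finally show ?thesis .
 qed
 have "z0 ~: bds m 0 A"
 proof
  assume "z0:bds m 0 A"
  hence "aug z0 = 0" using aug_bd by (auto simp:bds_def ichains_def)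
  thus False using aug_z0 x0(2) by (metis lookup_single_eq lookup_zero)
 qed
 moreover have "EX a. c - sc a z0:bds m 0 A" if c:"c:cycs m 0 A" for c
 proof -
  have ci:"c:ichains m 0 A" using c by (simp add:cycs_def)
  let ?T = "{b + x |b x. b:bds m 0 A & x:rc.span {z0}}"
  have T:"rc.subspace ?T" by (intro rc.subspace_sums ss_bds rc.subspace_span)
  have S:"rc.subspace (proj m 0 -` ?T)" by (rule rc.vp.linear_subspace_vimage[OF proj_linear T])
  have "c:proj m 0 -` ?T"
  proof (rule chain_0_induct[OF ich_in[OF ci] S])
   fix x assume "x:topspace (subtop X A)"
   hence x:"x:A" by simp
   then obtain s where s:"s <= I" "path_component_of (subtop X A) (act s x0) x" using path path_component_of_sym by metis
   let ?y = "sngl (psx 0 x) (1::rat)"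
   let ?y' = "sngl (psx 0 (act s x0)) (1::rat)"
   obtain d where d:"d:chin 1 X A" "bnd 1 d = ?y - ?y'" using path_boundary[OF s(2)] by blast
   have "proj m 0 ?y' = sc (sgch m s) z0"
  using proj_map[OF xX[OF x0(1)] s(1) m] by (auto simp:rcmap_def smap_psx z0_def)
   moreover have "proj m 0 ?y = bnd (Suc 0) (proj m (Suc 0) d) + proj m 0 ?y'"
   proof -
    have "?y = bnd 1 d + ?y'" using d(2) by simp
    thus ?thesis using proj_add proj_boundary[of m "Suc 0" d] by simp
   qed
   moreover have "bnd (Suc 0) (proj m (Suc 0) d):bds m 0 A"
    using proj_in_iso[OF A m, of d "Suc 0"] d(1) by (auto simp:bds_def)
   moreover have "sc (sgch m s) z0:rc.span {z0}" by (simp add:rc.span_base rc.span_scale)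
   ultimately show "?y:proj m 0 -` ?T" by auto
  qed
  then obtain b x where bx:"b:bds m 0 A" "x:rc.span {z0}" "proj m 0 c = b + x" by auto
  then obtain a where "x = sc a z0" by (auto simp:rc.span_singleton)
  hence "c - sc a z0 = b" using bx proj_iso[OF ci] by simp
  thus ?thesis using bx(1) by metis
 qed
 ultimately show ?thesis unfolding hdim_def by (intro rc.quot_dim_eq_1[OF ss_cyc ss_bds cyc[OF z0]])
qed

subsection \<open>The isotypic decomposition\<close>

lemma proj_iso_other:
 assumes c:"c:ichains m' p A" and m:"m <= I" "m' <= I" "m ~= m'"
 shows "proj m p c = 0"
proof -
 have "proj m p c = sc (1 / 2 ^ card I) (SUM s:Pow I. sc (sgch m s * sgch m' s) c)"
  using c ichains_def proj_def by auto
 also have "(SUM s:Pow I. sc (sgch m s * sgch m' s) c)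
   = sc (SUM s:Pow I. sgch s (sym_diff m m')) c"
 proof -
  have "sgch s (sym_diff m m') = sgch m s * sgch m' s" if "s:Pow I" for s
   using that finite_I finite_subset by (subst sgn_char_sym_diff) (auto simp:sgn_char_commute)
  thus ?thesis by (simp add:rc.scale_sum_left)
 qed
 also have "(SUM s:Pow I. sgch s (sym_diff m m')) = 0"
 proof -
  have "sym_diff m m' ~= {}" "sym_diff m m' <= I" using m by auto
  thus ?thesis using sum_sgn_char[OF finite_I, of "sym_diff m m'"] by simp
 qed
 finally show ?thesis by simp
qed

text \<open>By orthogonality of characters the projectors are orthogonal idempotents with sum 1. The
  induction adds one character m to M at a time and compares dimensions along the tower of
  \<open>B ?M\<close>, \<open>Z M + B ?M\<close> and \<open>Z ?M\<close>.\<close>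

theorem quot_dim_decomposition:
 "rc.qdim (rat_cycles p X) (rat_boundaries p X) = (SUM m:Pow I. hdim m (topspace X) p)"
proof -
 have st:"stable (topspace X)" unfolding stable_def using act_continuous by (auto simp:continuous_map_def)
 define Z where "Z M = {c:rat_cycles p X. (SUM m:M. proj m p c) = c}" for M
 define B where "B M = {c:rat_boundaries p X. (SUM m:M. proj m p c) = c}" for M
 have sC:"rc.subspace (rat_cycles p X)"
  using ss_chains[of p X] unfolding rc.subspace_def rat_cycles_def by (auto simp:bd_add bd_scale)
 have sBd:"rc.subspace (rat_boundaries p X)"
  unfolding rat_boundaries_def by (rule rc.vp.linear_subspace_image[OF bd_linear ss_chains])
 have sZ:"rc.subspace (Z M)" and sB:"rc.subspace (B M)" for M using sC sBd unfolding Z_def B_def rc.subspace_def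
  by (auto simp:proj_add proj_scale sum.distrib rc.vp.linear_0[OF proj_linear] simp flip:rc.scale_sum_right)
 have BC:"rat_boundaries p X <= rat_cycles p X"
  unfolding rat_boundaries_def rat_cycles_def using boundary_boundary boundary_in_chains[of _ "Suc p" X p] by fastforce
 hence BZ:"B M <= Z M" for M unfolding B_def Z_def by blast
 have pC:"proj m p c:cycs m p (topspace X)" if "c:rat_cycles p X" "m <= I" for c m
  using that proj_in_iso[OF st that(2), of c p] proj_boundary[of m p c] rc.vp.linear_0[OF proj_linear]
  by (auto simp:rat_cycles_def cycs_def)
 have pB:"proj m p c:bds m p (topspace X)" if c:"c:rat_boundaries p X" and m:"m <= I" for c m
 proof -
  obtain d where d:"d:RC (Suc p) X" "c = bnd (Suc p) d"
   using c by (auto simp:rat_boundaries_def)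
  thus ?thesis using proj_in_iso[OF st m, of d "Suc p"] proj_boundary[of m "Suc p" d] by (auto simp:bds_def)
 qed
 have cC:"cycs m p (topspace X) <= rat_cycles p X" for m unfolding cycs_def rat_cycles_def ichains_def by auto
 have bB:"bds m p (topspace X) <= rat_boundaries p X" for m unfolding bds_def rat_boundaries_def ichains_def by auto
 have main:"rc.qdim (Z M) (B M) = (SUM m:M. hdim m (topspace X) p)" if "finite M" "M <= Pow I" for M using that
 proof (induction M rule:finite_induct)
  case empty
  have "Z {} <= B {}" unfolding Z_def B_def using rc.subspace_0[OF sBd] by auto
  thus ?case using rc.quot_dim_eq_0[OF sZ sB] by simp
 next
  case (insert m M)
  have m:"m <= I" and M:"M <= Pow I" using insert by auto
  let ?M = "insert m M"
  have orth:"proj m p z = 0" if "z:Z M" for z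
  proof -
   have "proj m p z = proj m p (SUM m':M. proj m' p z)" using that by (simp add:Z_def)
   also have "... = (SUM m':M. proj m p (proj m' p z))" by (rule rc.vp.linear_sum[OF proj_linear])
   also have "... = 0"
   proof (intro sum.neutral ballI)
    fix m' assume "m':M"
    thus "proj m p (proj m' p z) = 0"
  using that M insert.hyps pC[of z m'] proj_iso_other[of "proj m' p z" m' p "topspace X" m] m by (auto simp:Z_def cycs_def)
   qed
   finally show ?thesis .
  qed
  have sumM:"(SUM m':?M. proj m' p c) = proj m p c + (SUM m':M. proj m' p c)" for c using insert.hyps by simp
  have ZM:"Z M <= Z ?M" using orth by (auto simp:Z_def sumM)
  have part:"(SUM m':M. proj m' p z):Z M & proj m p z:cycs m p (topspace X)
    & z = (SUM m':M. proj m' p z) + proj m p z" if z:"z:Z ?M" for z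
  proof -
   let ?y = "SUM m':M. proj m' p z"
   have zc:"z:rat_cycles p X" using z by (simp add:Z_def)
   have pc:"proj m' p z:cycs m' p (topspace X)" if "m':?M" for m' using pC[OF zc] that m M by blast
   have "?y:rat_cycles p X" using pc cC by (intro rc.subspace_sum[OF sC]) blast
   moreover have "proj m' p ?y = proj m' p z" if "m':M" for m'
   proof -
    have "proj m' p ?y = (SUM m'':M. proj m' p (proj m'' p z))" by (rule rc.vp.linear_sum[OF proj_linear])
    also have "... = (SUM m'':M. if m'' = m' then proj m' p z else 0)"
    proof (rule sum.cong)
     fix m'' assume m'':"m'':M"
     have *: "proj m'' p z:ichains m'' p (topspace X)" using pc[of m''] m'' by (simp add:cycs_def)
     show "proj m' p (proj m'' p z) = (if m'' = m' then proj m' p z else 0)"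
      using proj_iso[OF *] proj_iso_other[OF *, of m'] m'' that M by auto
    qed simp
    also have "... = proj m' p z" using that insert.hyps by simp
    finally show ?thesis .
   qed
   ultimately have "?y:Z M" by (simp add:Z_def)
   moreover have "z = ?y + proj m p z" using z by (simp add:Z_def sumM add.commute)
   ultimately show ?thesis using pc[of m] by blast
  qed
  let ?Y = "{z + b |z b. z:Z M & b:B ?M}"
  have sY:"rc.subspace ?Y" by (intro rc.subspace_sums sZ sB)
  have YZ:"?Y <= Z ?M" using ZM BZ[of ?M] rc.subspace_add[OF sZ[of ?M]] by blast
  have BY:"B ?M <= ?Y" using rc.subspace_0[OF sZ[of M]] by force
  have "rc.qdim (Z ?M) (B ?M) = rc.qdim ?Y (B ?M) + rc.qdim (Z ?M) ?Y" by (rule rc.quot_dim_tower[OF sB sY sZ BY YZ])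
  moreover have "rc.qdim (Z M) (B M) = rc.qdim ?Y (B ?M)"
  proof (rule rc.qd_transfer[OF rc.linear_ident sZ sB sY sB BY])
   show "z:?Y" if "z:Z M" for z using that rc.subspace_0[OF sB[of ?M]] by force
   show "z:B ?M <-> z:B M" if "z:Z M" for z using that ZM unfolding B_def Z_def by auto
   show "EX z:Z M. y - z:B ?M" if y:"y:?Y" for y
   proof -
    obtain z b where "z:Z M" "b:B ?M" "y = z + b" using y by blast
    thus ?thesis by (intro bexI[of _ z]) simp_all
   qed
  qed
  moreover have "rc.qdim (Z ?M) ?Y = hdim m (topspace X) p" unfolding hdim_def
  proof (rule rc.qd_transfer[OF proj_linear sZ sY ss_cyc ss_bds bds_cyc])
   show "proj m p z:cycs m p (topspace X)" if "z:Z ?M" for z using part[OF that] by blast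
   show "proj m p z:bds m p (topspace X) <-> z:?Y" if z:"z:Z ?M" for z
   proof
    assume b:"proj m p z:bds m p (topspace X)"
    have pz:"proj m p z:Z ?M" using part[OF z] ZM rc.subspace_diff[OF sZ[of ?M] z] by (metis add_diff_cancel_left' subsetD)
    thus "z:?Y" using b bB part[OF z] by (auto simp:B_def Z_def)
   next
    assume "z:?Y"
    then obtain y b where "y:Z M" "b:B ?M" "z = y + b" by auto
    thus "proj m p z:bds m p (topspace X)" using orth pB[OF _ m] by (simp add:proj_add B_def)
   qed
   show "EX z:Z ?M. y - proj m p z:bds m p (topspace X)" if y:"y:cycs m p (topspace X)" for y
   proof -
    have yi:"y:ichains m p (topspace X)" using y by (simp add:cycs_def)
    have "(SUM m':M. proj m' p y) = 0" using proj_iso_other[OF yi _ m] M insert.hyps by (intro sum.neutral) blast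
    hence "y:Z ?M" using y cC proj_iso[OF yi] by (auto simp:Z_def sumM)
    moreover have "y - proj m p y:bds m p (topspace X)" using proj_iso[OF yi] rc.subspace_0[OF ss_bds] by simp
    ultimately show ?thesis by blast
   qed
  qed
  ultimately show ?case using insert by simp
 qed
 have "Z (Pow I) = rat_cycles p X" "B (Pow I) = rat_boundaries p X" using sum_proj BC unfolding Z_def B_def rat_cycles_def by auto
 thus ?thesis using main[of "Pow I"] finite_I by simp
qed

end

subsection \<open>Betti numbers\<close>

theorem rational_betti_eq:
 assumes "rc.qdim (rat_cycles p X) (rat_boundaries p X) = enat n"
 shows "rational_betti p X = enat n"
proof -
 let ?H = "rational_homology p X" and ?B = "rat_boundaries p X"
 interpret H:vectorspace rat_field ?H by (rule vectorspace_rational_homology)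
 have sC:"rc.subspace (rat_cycles p X)"
  using ss_chains[of p X] unfolding rc.subspace_def rat_cycles_def by (auto simp:bd_add bd_scale)
 have sB:"rc.subspace ?B" unfolding rat_boundaries_def by (rule rc.vp.linear_subspace_image[OF bd_linear ss_chains])
 obtain S where S:"finite S" "card S = n" "S <= rat_cycles p X"
  "!z:rat_cycles p X. EX u. z - (SUM s:S. sc (u s) s):?B"
  "!u. (SUM s:S. sc (u s) s):?B --> (!s:S. u s = 0)" by (rule rc.quot_dim_eq_enat_imp[OF sC sB assms])
 let ?c = "rat_coset ?B"
 have coset_eq:"?c y = ?c z <-> y - z:?B" for y z
 proof
  assume "?c y = ?c z"
  moreover have "y:?c y" using rc.subspace_0[OF sB] by (force simp:rat_coset_def)
  ultimately obtain b where "b:?B" "y = z + b" by (auto simp:rat_coset_def)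
  thus "y - z:?B" by simp
 next
  assume yz:"y - z:?B"
  have "x:?c y <-> x:?c z" for x
  using rc.subspace_add[OF sB, of "x - y" "y - z"] rc.subspace_diff[OF sB, of "x - z" "y - z"] yz by (force simp:rat_coset_def)
  thus "?c y = ?c z" by blast
 qed
 have carrier:"carrier ?H = ?c ` rat_cycles p X" and zero:"\<zero>\<^bsub>?H\<^esub> = ?c 0"
  by (auto simp:rational_homology_def rat_coset_def)
 have add:"?c y \<oplus>\<^bsub>?H\<^esub> ?c z = ?c (y + z)" for y z
  using rc.subspace_add[OF sB] rc.subspace_0[OF sB] by (auto simp:rat_coset_def ac_simps rational_homology_def)
 have smult:"q \<odot>\<^bsub>?H\<^esub> ?c z = ?c (sc q z)" for q z
  using rc.subspace_add[OF sB] rc.subspace_scale[OF sB] rc.subspace_0[OF sB] by (fastforce simp:rat_coset_def rc.scale_right_distrib rational_homology_def)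
 have inj:"inj_on ?c S"
 proof (rule inj_onI, rule ccontr)
  fix s t assume st:"s:S" "t:S" "?c s = ?c t" "s ~= t"
  define u where "u = (%x. if x = s then 1 else if x = t then - 1 else (0::rat))"
  have "(SUM x:S. sc (u x) x) = (SUM x:{s,t}. sc (u x) x)"
   using st S(1) by (intro sum.mono_neutral_right) (auto simp:u_def)
  also have "... = s - t" using st(4) by (simp add:u_def)
  finally have "(SUM x:S. sc (u x) x):?B" using st(3) coset_eq by simp
  thus False using S(5) st(1) by (force simp:u_def)
 qed
 have lin:"H.module.lincomb a (?c ` T) = ?c (SUM s:T. sc (a (?c s)) s)" if "T <= S" for a T
 proof -
  have "finite T" using that S(1) finite_subset by blast
  thus ?thesis using that
  proof (induction T rule:finite_induct)
   case empty
   show ?case by (simp add:zero)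
  next
   case (insert t T)
   have cl:"?c s:carrier ?H" if "s:S" for s using that S(3) carrier by blast
   have sm:"a (?c s) \<odot>\<^bsub>?H\<^esub> ?c s:carrier ?H" if "s:S" for s
    unfolding smult carrier using that S(3) rc.subspace_scale[OF sC] by blast
   have "?c t ~: ?c ` T" using insert inj by (auto simp:inj_on_def)
   hence "H.module.lincomb a (insert (?c t) (?c ` T)) = a (?c t) \<odot>\<^bsub>?H\<^esub> ?c t \<oplus>\<^bsub>?H\<^esub> H.module.lincomb a (?c ` T)"
    unfolding H.module.lincomb_def by (intro H.module.M.finsum_insert) (use insert sm in \<open>auto simp:Pi_def\<close>)
   thus ?case using insert by (simp add:smult add)
  qed
 qed
 have basis:"H.basis (?c ` S)" unfolding H.basis_def
 proof (intro conjI)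
  show "?c ` S <= carrier ?H" using S(3) carrier by blast
  show "~H.module.lin_dep (?c ` S)"
  proof
   assume "H.module.lin_dep (?c ` S)"
   then obtain A a v where A:"finite A" "A <= ?c ` S" "H.module.lincomb a A = \<zero>\<^bsub>?H\<^esub>" "v:A" "a v ~= 0"
    unfolding H.module.lin_dep_def by (auto simp:rat_field_def)
   obtain T where T:"T <= S" "A = ?c ` T" using A(2) by (meson subset_imageE)
   define u where "u = (%s. if s:T then a (?c s) else 0)"
   have "(SUM s:S. sc (u s) s) = (SUM s:T. sc (a (?c s)) s)"
    by (rule sum.mono_neutral_cong_right) (use S(1) T in \<open>auto simp:u_def\<close>)
   moreover have "?c (SUM s:T. sc (a (?c s)) s) = ?c 0" using lin[OF T(1), of a] A(3) T(2) zero by simp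
   ultimately have "!s:S. u s = 0" using coset_eq S(5) by simp
   moreover obtain t where "t:T" "v = ?c t" using A(4) T by blast
   moreover from this have "t:S" using T(1) by blast
   ultimately show False using A(5) by (auto simp:u_def)
  qed
  show "H.module.gen_set (?c ` S)"
  proof
   show "H.module.span (?c ` S) <= carrier ?H" using H.module.span_is_subset2 S(3) carrier by (metis image_mono)
   show "carrier ?H <= H.module.span (?c ` S)"
   proof
    fix C assume "C:carrier ?H"
    then obtain z where z:"z:rat_cycles p X" "C = ?c z" using carrier by blast
    then obtain u where u:"z - (SUM s:S. sc (u s) s):?B" using S(4) by blast
    define a where "a = (%C. u (the_inv_into S ?c C))"
    have "(SUM s:S. sc (a (?c s)) s) = (SUM s:S. sc (u s) s)"
     using inj by (intro sum.cong) (auto simp:a_def the_inv_into_f_f)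
    hence "C = H.module.lincomb a (?c ` S)" using lin[of S a] z(2) u coset_eq by simp
    thus "C:H.module.span (?c ` S)" unfolding H.module.span_def using S(1) by (auto simp:rat_field_def)
   qed
  qed
 qed
 show ?thesis
  using H.dim_basis[OF _ basis] S(1) basis S(2) card_image[OF inj] by (auto simp:H.fin_dim_def H.basis_def rational_betti_def)
qed

section \<open>Homology functions on simplicial complexes\<close>

definition conc :: "nat=>nat=>nat=>nat" where
 "conc d c k = (if k = d then c else 0)"

lemma conc_add_one:"x = conc d m k + conc d 1 k ==> m' = Suc m ==> x = conc d m' k" by (simp add:conc_def)

lemma conc_pred:"d >= 1 ==> conc d c (d - 1) = 0" by (auto simp:conc_def)

text \<open>The union of the facets of \<open>si\<close> opposite to the vertices in D. A shelling
  attaches a cell along such a set, with D the set of its descents.\<close>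

definition "mfaces D si = {ta. ta <= si & (EX i:D. i ~: ta)}"

text \<open>The empty simplex belongs to every subcomplex: it stands for the open torus orbit, so
  the smallest subcomplex \<open>{{}}\<close> does not stand for the empty space.\<close>

definition "subcx K A <-> A <= K & {}:A & (!si:A. !ta. ta <= si --> ta:A)"

text \<open>The axioms that determine one isotypic part. Exactness is expressed by ranks, and
  relative homology vanishes in degree 0 because every point can be joined to the open orbit, which
  belongs to every subcomplex.\<close>

locale homfun =
 fixes K :: "'v set set" and odd_vertex :: "'v=>bool"
  and h :: "'v set set=>nat=>nat" and r :: "'v set set=>'v set set=>nat=>nat"
 assumes finite_K:"finite K"
  and finite_cell:"si:K ==> finite si"
  and face_K:"si:K ==> ta <= si ==> ta:K"
  and h_simplex:"si:K ==> h (Pow si) k = (if k = 0 & (!v:si. ~odd_vertex v) then 1 else 0)"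
  and exact:"A <= B ==> B <= K ==> {}:A ==> (!!si ta. si:A ==> ta <= si ==> ta:A) ==>
    (!!si ta. si:B ==> ta <= si ==> ta:B) ==>
    EX u v w. u 0 = 0 & (!k. h A k = u (Suc k) + v k & h B k = v k + w k & r B A k = w k + u k)"
  and r_0:"A <= B ==> B <= K ==> {}:A ==> (!!si ta. si:A ==> ta <= si ==> ta:A) ==>
    (!!si ta. si:B ==> ta <= si ==> ta:B) ==> r B A 0 = 0"
  and excision:"A <= K ==> B <= K ==> {}:A ==> {}:B ==>
    (!!si ta. si:A ==> ta <= si ==> ta:A) ==> (!!si ta. si:B ==> ta <= si ==> ta:B) ==>
    r (A Un B) A k = r B (A Int B) k"
begin

abbreviation complex :: "'v set set=>bool" where
 "complex == subcx K"

definition "odds si = {v:si. odd_vertex v}"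

definition "all_even A <-> (!si:A. !v:si. ~odd_vertex v)"

lemma complex_Un:"complex A ==> complex B ==> complex (A Un B)"
 and complex_Int:"complex A ==> complex B ==> complex (A Int B)"
 and complex_Pow:"si:K ==> complex (Pow si)"
 and complex_K:"K ~= {} ==> complex K" unfolding subcx_def using face_K by blast+

lemma complex_UN:"I ~= {} ==> (!!i. i:I ==> complex (F i)) ==> complex (UN i:I. F i)" unfolding subcx_def by blast

lemma finite_complex:"complex A ==> finite A" unfolding subcx_def using finite_K finite_subset by blast

lemma pair_exact:
 assumes "complex A" "complex B" "A <= B"
 obtains u v w where "u 0 = 0" "!!k. h A k = u (Suc k) + v k" "!!k. h B k = v k + w k"
  "!!k. r B A k = w k + u k" "w 0 = 0"
proof -
 have "r B A 0 = 0" by (rule r_0) (use assms in \<open>auto simp:subcx_def\<close>)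
 moreover have "EX u v w. u 0 = 0 & (!k. h A k = u (Suc k) + v k & h B k = v k + w k & r B A k = w k + u k)"
  by (rule exact) (use assms in \<open>auto simp:subcx_def\<close>)
 ultimately show ?thesis using that by (metis add_is_0)
qed

lemma h0_antimono:
 assumes "complex A" "complex B" "A <= B"
 shows "h B 0 <= h A 0" using assms pair_exact[OF assms] by force

lemma excise:"complex A ==> complex B ==> r (A Un B) A k = r B (A Int B) k" by (rule excision) (auto simp:subcx_def)

text \<open>Because \<open>w 0 = 0\<close>, the map from the intersection to B is onto in degree 0,
  hence bijective by equality of dimensions; so the relative terms of both pairs vanish.\<close>

lemma attach_iso:
 assumes A:"complex A" and B:"complex B"
  and eq:"!!k. h B k = conc 0 c k" "!!k. h (A Int B) k = conc 0 c k"
 shows "h (A Un B) k = h A k"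
proof -
 obtain u v w where *: "u 0 = 0" "!!k. h (A Int B) k = u (Suc k) + v k" "!!k. h B k = v k + w k"
  "!!k. r B (A Int B) k = w k + u k" "w 0 = 0" by (rule pair_exact[OF complex_Int[OF A B] B]) auto
 obtain u' v' w' where **: "u' 0 = 0" "!!k. h A k = u' (Suc k) + v' k" "!!k. h (A Un B) k = v' k + w' k"
  "!!k. r (A Un B) A k = w' k + u' k" "w' 0 = 0" by (rule pair_exact[OF A complex_Un[OF A B]]) auto
 have w:"w k = 0" for k using *(3)[of k] *(5) eq(1)[of k] by (cases k) (auto simp:conc_def)
 have "u k = 0" for k
 proof (cases k)
  case (Suc j)
  thus ?thesis using *(2)[of j] *(3)[of j] w[of j] eq[of j] by simp
 qed (use * in simp)
 hence "r B (A Int B) k = 0" for k using * w by simp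
 hence "w' k = 0" "u' k = 0" for k using **(4)[of k] excise[OF A B, of k] by auto
 thus ?thesis using **(2,3) by simp
qed

lemma attach_acyclic:
 assumes A:"complex A" and B:"complex B" and z:"!!k. h B k = 0"
 obtains u v w where "u 0 = 0" "w 0 = 0" "!!k. h A k = u (Suc k) + v k" "!!k. h (A Un B) k = v k + w k"
  "!!k. h (A Int B) k = w (Suc k) + u (Suc k)"
proof -
 obtain u v w where *: "u 0 = 0" "!!k. h (A Int B) k = u (Suc k) + v k" "!!k. h B k = v k + w k"
  "!!k. r B (A Int B) k = w k + u k" "w 0 = 0" by (rule pair_exact[OF complex_Int[OF A B] B]) auto
 obtain u' v' w' where **: "u' 0 = 0" "!!k. h A k = u' (Suc k) + v' k" "!!k. h (A Un B) k = v' k + w' k"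
  "!!k. r (A Un B) A k = w' k + u' k" "w' 0 = 0" by (rule pair_exact[OF A complex_Un[OF A B]]) auto
 have "v k = 0" "w k = 0" for k using *(3) z by auto
 hence "h (A Int B) k = w' (Suc k) + u' (Suc k)" for k
  using *(2)[of k] *(4)[of "Suc k"] **(4)[of "Suc k"] excise[OF A B, of "Suc k"] by simp
 thus ?thesis using that[of u' w' v'] ** by auto
qed

text \<open>The vanishing of \<open>h A j\<close> makes the connecting map 0, so that the classes of
  the intersection survive as new classes one degree higher.\<close>

lemma attach_acyclic_conc:
 assumes A:"complex A" and B:"complex B" and z:"!!k. h B k = 0"
  and c:"!!k. h (A Int B) k = conc j c k" and 0:"h A j = 0"
 shows "h (A Un B) k = h A k + conc (Suc j) c k"
proof -
 obtain u v w where *: "u 0 = 0" "w 0 = 0" "!!k. h A k = u (Suc k) + v k" "!!k. h (A Un B) k = v k + w k"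
  "!!k. h (A Int B) k = w (Suc k) + u (Suc k)" by (rule attach_acyclic[OF A B z]) blast
 have uj:"u (Suc j) = 0" using *(3)[of j] 0 by simp
 have u:"u i = 0" for i
 proof (cases i)
  case (Suc l)
  thus ?thesis using *(5)[of l] c[of l] uj by (cases "l = j") (auto simp:conc_def)
 qed (use * in simp)
 have "w k = conc (Suc j) c k"
 proof (cases k)
  case (Suc l)
  thus ?thesis using *(5)[of l] c[of l] u by (auto simp:conc_def)
 qed (use * in \<open>simp add:conc_def\<close>)
 thus ?thesis using *(3)[of k] *(4)[of k] u by simp
qed

text \<open>The point class of the intersection dies in A and in B, which have nothing in degree 0;
  it reappears as the class in degree 1.\<close>

lemma glue_conc:
 assumes A:"complex A" and B:"complex B"
  and I:"!!k. h (A Int B) k = conc 0 1 k" and hA:"!!k. h A k = conc d a k" and hB:"!!k. h B k = conc d b k"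
  and d:"d >= 2"
 shows "h (A Un B) k = conc 1 1 k + conc d (a + b) k"
proof -
 obtain u v w where *: "u 0 = 0" "!!k. h (A Int B) k = u (Suc k) + v k" "!!k. h B k = v k + w k"
  "!!k. r B (A Int B) k = w k + u k" "w 0 = 0" by (rule pair_exact[OF complex_Int[OF A B] B]) auto
 obtain u' v' w' where **: "u' 0 = 0" "!!k. h A k = u' (Suc k) + v' k" "!!k. h (A Un B) k = v' k + w' k"
  "!!k. r (A Un B) A k = w' k + u' k" "w' 0 = 0" by (rule pair_exact[OF A complex_Un[OF A B]]) auto
 have v:"v k = 0" for k using *(2)[of k] *(3)[of k] I[of k] hB[of k] d by (cases "k = 0") (auto simp:conc_def)
 hence w:"w k = conc d b k" for k using *(3) hB by simp
 have u:"u k = conc 1 1 k" for k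
 proof (cases k)
  case (Suc l)
  thus ?thesis using *(2)[of l] I[of l] v[of l] by (simp add:conc_def)
 qed (use * in \<open>simp add:conc_def\<close>)
 have r:"w' k + u' k = conc d b k + conc 1 1 k" for k using **(4)[of k] excise[OF A B, of k] *(4)[of k] u w by simp
 have u':"u' k = 0" for k
 proof (cases k)
  case (Suc l)
  show ?thesis using Suc d hA[of l] **(2)[of l] r[of k] by (cases "k = 1 \<or> k = d") (auto simp:conc_def)
 qed (use ** in simp)
 thus ?thesis using **(2)[of k] **(3)[of k] r[of k] hA[of k] by (auto simp:conc_def)
qed

text \<open>The shape of A does not matter: already \<open>{{}}\<close> has the homology of a point,
  and a maximal simplex meets the rest in a smaller all-even subcomplex, so that
  \<open>attach_iso\<close> applies.\<close>

lemma h_all_even: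
 assumes "complex A" "all_even A"
 shows "h A k = conc 0 1 k" using assms
proof (induction "card A" arbitrary:A k rule:less_induct)
 case less
 have fin:"finite A" by (rule finite_complex[OF less.prems(1)])
 obtain si where "si:A" "!ta:A. si <= ta --> si = ta"
  using less.prems(1) finite_has_maximal[OF fin] by (auto simp:subcx_def)
 hence si:"si:A" "!!ta. ta:A ==> si <= ta ==> ta = si" by auto
 have siK:"si:K" and sub:"Pow si <= A" using si less.prems by (auto simp:subcx_def)
 show ?case
 proof (cases "A = Pow si")
  case True
  thus ?thesis using h_simplex[OF siK, of k] less.prems by (auto simp:conc_def all_even_def)
 next
  case False
  show ?thesis
  proof (cases "si = {}")
   case True
   thus ?thesis using si False by auto
  next
   case ne:False
   let ?A = "A - {si}"
   have cA:"complex ?A" using less.prems(1) si ne unfolding subcx_def by blast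
   have cP:"complex (Pow si)" by (rule complex_Pow[OF siK])
   have ev:"all_even ?A" "all_even (Pow si)" "all_even (?A Int Pow si)" using less.prems sub by (auto simp:all_even_def)
   have "h ?A k = conc 0 1 k" for k by (rule less.hyps[OF card_Diff1_less[OF fin si(1)] cA ev(1)])
   moreover have "h (Pow si) k = conc 0 1 k" for k using less.hyps[OF _ cP ev(2)] fin sub False by (simp add:psubset_card_mono)
   moreover have "card (?A Int Pow si) < card A" using fin si by (intro psubset_card_mono) auto
   hence "h (?A Int Pow si) k = conc 0 1 k" for k using less.hyps[OF _ complex_Int[OF cA cP] ev(3)] by simp
   moreover have "A = ?A Un Pow si" using sub by blast
   ultimately show ?thesis using attach_iso[OF cA cP, of 1 k] by simp
  qed
 qed
qed

lemma h_simplex_conc:"si:K ==> h (Pow si) k = (if odds si = {} then conc 0 1 k else 0)"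
 using h_simplex[of si k] by (auto simp:conc_def odds_def)

lemma complex_missing_faces:
 assumes "si:K" "D ~= {}"
 shows "complex (mfaces D si)" using assms face_K unfolding subcx_def mfaces_def by blast

text \<open>The facets are united one at a time: a face that does not contain D either does not
  contain D - {i} or does not contain i.\<close>

lemma h_missing_faces:
 assumes "si:K" "D <= si" "D ~= {}"
 shows "h (mfaces D si) k =
  (if odds si = {} then conc 0 1 k else if odds si = D then conc (card D - 1) 1 k else 0)" using assms
proof (induction "card D" arbitrary:D si k)
 case 0
 thus ?case using finite_cell finite_subset by (metis card_0_eq)
next
 case (Suc n)
 have finD:"finite D" using Suc.prems finite_cell finite_subset by blast
 \<comment> \<open>An odd vertex is taken whenever D has one. Otherwise the smaller set
   \<open>D'\<close> could be the set of odd vertices although D is not.\<close>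
 define i where "i = (if odds si Int D = {} then SOME i. i:D else SOME i. i:odds si Int D)"
 have i:"i:D" "odds si Int D ~= {} ==> i:odds si"
 proof -
  have "(SOME i. i:D):D" using Suc.prems(3) by (meson ex_in_conv someI_ex)
  moreover have "(SOME i. i:odds si Int D):odds si Int D" if "odds si Int D ~= {}" using that by (meson ex_in_conv someI_ex)
  ultimately show "i:D" "odds si Int D ~= {} ==> i:odds si" unfolding i_def by auto
 qed
 have sK:"si - {i}:K" using Suc.prems(1) face_K by blast
 have odds':"odds (si - {i}) = odds si - {i}" by (auto simp:odds_def)
 show ?case
 proof (cases "D = {i}")
  case True
  hence "mfaces D si = Pow (si - {i})" by (auto simp:mfaces_def)
  thus ?thesis using h_simplex_conc[OF sK, of k] odds' True by (auto simp:odds_def)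
 next
  case False
  define D' where "D' = D - {i}"
  have D':"D' ~= {}" "D' <= si" "D' <= si - {i}" "card D' = n" "i ~: D'" "D = insert i D'"
   using False i Suc finD by (auto simp:D'_def)
  let ?A = "mfaces D' si" and ?B = "Pow (si - {i})"
  have un:"mfaces D si = ?A Un ?B" and int:"?A Int ?B = mfaces D' (si - {i})"
   using D' by (auto simp:mfaces_def)
  have cA:"complex ?A" and cB:"complex ?B" using complex_missing_faces[OF Suc.prems(1) D'(1)] complex_Pow[OF sK] by auto
  have hA:"h ?A k = (if odds si = {} then conc 0 1 k else if odds si = D' then conc (card D' - 1) 1 k else 0)" for k
   using Suc.hyps(1)[of D' si k] D' Suc.prems by auto
  have hB:"h ?B k = (if odds si - {i} = {} then conc 0 1 k else 0)" for k using h_simplex_conc[OF sK, of k] odds' by simp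
  have hI:"h (?A Int ?B) k = (if odds si - {i} = {} then conc 0 1 k else
    if odds si - {i} = D' then conc (card D' - 1) 1 k else 0)" for k using Suc.hyps(1)[of D' "si - {i}" k] D' sK int odds' by auto
  consider "odds si = {}" | "odds si ~= {}" "odds si - {i} = {}" | "odds si = D" | "odds si - {i} ~= {}" "odds si ~= D" by blast
  thus ?thesis
  proof cases
   case 1
   thus ?thesis using attach_iso[OF cA cB, of 1 k] hA hB hI un by auto
  next
   case 2
   hence "odds si = {i}" by blast
   hence "odds si ~= D'" "odds si ~= D" using D' by auto
   hence "h ?A k = 0" for k using hA 2 by auto
   thus ?thesis using attach_iso[OF cA cB, of 1 k] 2 hB hI un \<open>odds si ~= D\<close> by auto
  next
   case 3
   hence ne:"odds si ~= {}" "odds si - {i} ~= {}" "odds si ~= D'" "odds si - {i} = D'" using D' by auto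
   hence z:"h ?A k = 0" "h ?B k = 0" "h (?A Int ?B) k = conc (card D' - 1) 1 k" for k using hA hB hI by auto
   have "h (?A Un ?B) k = conc (Suc (card D' - 1)) 1 k" using attach_acyclic_conc[OF cA cB z(2) z(3) z(1), of k] z by simp
   moreover have "Suc (card D' - 1) = card D - 1" using D' finD Suc.hyps(2) by (cases n) auto
   ultimately show ?thesis using 3 ne un by simp
  next
   case 4
   have "odds si ~= D'"
   proof
    assume a:"odds si = D'"
    hence "odds si Int D ~= {}" using D' by auto
    hence "i:odds si" using i by blast
    thus False using a D' by simp
   qed
   moreover have "odds si - {i} ~= D'"
   proof
    assume a:"odds si - {i} = D'"
    hence "odds si Int D ~= {}" using D' by auto
    hence "i:odds si" using i by blast
    hence "odds si = D" using a D' by auto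
    thus False using 4 by simp
   qed
   ultimately have "h ?A k = 0" "h ?B k = 0" "h (?A Int ?B) k = 0" for k using 4 hA hB hI by auto
   thus ?thesis using attach_iso[OF cA cB, of 0 k] 4 un by (auto simp:conc_def)
  qed
 qed
qed

lemma attach_cell_noncritical:
 assumes A:"complex A" and C:"C:K" and D:"D <= C" "D ~= {}" and int:"A Int Pow C = mfaces D C"
  and ne:"odds C ~= D"
 shows "h (A Un Pow C) k = h A k" using attach_iso[OF A complex_Pow[OF C], of "if odds C = {} then 1 else 0" k]
  h_simplex_conc[OF C] h_missing_faces[OF C D] int ne by (auto simp:conc_def)

lemma attach_cell_critical:
 assumes A:"complex A" and C:"C:K" and D:"D <= C" "D ~= {}" and int:"A Int Pow C = mfaces D C"
  and eq:"odds C = D" and 0:"h A (card D - 1) = 0"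
 shows "h (A Un Pow C) k = h A k + conc (card D) 1 k"
proof -
 have "finite D" using D finite_cell[OF C] finite_subset by blast
 hence "Suc (card D - 1) = card D" using D by (simp add:card_gt_0_iff)
 moreover have "h (A Int Pow C) k = conc (card D - 1) 1 k" for k using h_missing_faces[OF C D] int eq by auto
 moreover have "h (Pow C) k = 0" for k using h_simplex_conc[OF C] eq D by simp
 ultimately show ?thesis using attach_acyclic_conc[OF A complex_Pow[OF C] _ _ 0] by metis
qed

subsection \<open>Shellings\<close>

text \<open>\<open>D C\<close> is the least face of C that lies in no earlier cell. Cells of equal
  length may come in any order: common faces are therefore controlled for
  \<open>len C' <= len C\<close>, whereas the neighbour across a facet has to be strictly
  shorter.\<close>

definition shelling :: "'v set set=>('v set=>nat)=>('v set=>'v set)=>bool" where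
 "shelling Cs len D <-> finite Cs & Cs <= K & (!C:Cs. D C <= C) &
  (!C:Cs. !C':Cs. !F. F <= C --> F <= C' --> C' ~= C --> len C' <= len C --> (EX i:D C. i ~: F)) &
  (!C:Cs. !i:D C. EX C':Cs. len C' < len C & C - {i} <= C')"

lemma shelling_induct_step:
 assumes sh:"shelling Cs len D" and ne:"Cs ~= {}"
 obtains C where "C:Cs" "shelling (Cs - {C}) len D"
  "Cs - {C} ~= {} ==> D C ~= {} & \<Union> (Pow ` (Cs - {C})) Int Pow C = mfaces (D C) C"
  "Cs - {C} = {} ==> D C = {}"
proof -
 have fin:"finite Cs" using sh by (auto simp:shelling_def)
 obtain C where C:"C:Cs" "!!C'. C':Cs ==> len C' <= len C"
 proof -
  have "Max (len ` Cs):len ` Cs" using fin ne by simp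
  then obtain C where "C:Cs" "len C = Max (len ` Cs)" by auto
  thus ?thesis using that[of C] fin by simp
 qed
 have P1:"EX i:D A. i ~: F" if "A:Cs" "B:Cs" "F <= A" "F <= B" "B ~= A" "len B <= len A" for A B F
  using sh that unfolding shelling_def by blast
 have P2:"EX B:Cs. len B < len A & A - {i} <= B" if "A:Cs" "i:D A" for A i using sh that unfolding shelling_def by blast
 show ?thesis
 proof (rule that[OF C(1)])
  have "EX B:Cs - {C}. len B < len A & A - {i} <= B" if "A:Cs - {C}" "i:D A" for A i using that P2[of A i] C(2)[of A] by auto
  moreover have "finite (Cs - {C})" "Cs - {C} <= K" "!A:Cs - {C}. D A <= A" using sh by (auto simp:shelling_def)
  ultimately show "shelling (Cs - {C}) len D" unfolding shelling_def using P1 by (metis DiffD1)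
 next
  assume ne':"Cs - {C} ~= {}"
  then obtain B where B:"B:Cs" "B ~= C" by blast
  have "D C ~= {}" using P1[OF C(1) B(1), of "{}"] B C by auto
  moreover have "\<Union> (Pow ` (Cs - {C})) Int Pow C = mfaces (D C) C"
  proof (intro equalityI subsetI)
   fix F assume "F:\<Union> (Pow ` (Cs - {C})) Int Pow C"
   then obtain B where "B:Cs" "B ~= C" "F <= B" "F <= C" by blast
   thus "F:mfaces (D C) C" using P1[OF C(1), of B F] C(2) by (auto simp:mfaces_def)
  next
   fix F assume F:"F:mfaces (D C) C"
   then obtain i where i:"i:D C" "i ~: F" "F <= C" by (auto simp:mfaces_def)
   then obtain B where "B:Cs" "len B < len C" "C - {i} <= B" using P2 C(1) by blast
   thus "F:\<Union> (Pow ` (Cs - {C})) Int Pow C" using i by blast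
  qed
  ultimately show "D C ~= {} & \<Union> (Pow ` (Cs - {C})) Int Pow C = mfaces (D C) C" by blast
 next
  assume "Cs - {C} = {}"
  thus "D C = {}" using P2[OF C(1)] by blast
 qed
qed

lemma complex_shelling:"shelling Cs len D ==> Cs ~= {} ==> complex (\<Union> (Pow ` Cs))"
 by (rule complex_UN) (auto simp:shelling_def intro:complex_Pow)

text \<open>A cell with \<open>D C = odds C\<close> adds one class in degree d and any other cell
  adds nothing. As all critical cells share the degree d, none of them can cancel the class of
  another.\<close>

theorem h_shelling:
 assumes "shelling Cs len D" "Cs ~= {}" and "!!C. C:Cs ==> D C = odds C ==> card (D C) = d" and "d >= 1"
 shows "h (\<Union> (Pow ` Cs)) k = conc d (card {C:Cs. D C = odds C}) k" using assms(1,2,3)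
proof (induction "card Cs" arbitrary:Cs k)
 case 0
 thus ?case by (auto simp:shelling_def)
next
 case (Suc n)
 have fin:"finite Cs" using Suc.prems by (auto simp:shelling_def)
 obtain C where C:"C:Cs" "shelling (Cs - {C}) len D"
  "Cs - {C} ~= {} ==> D C ~= {} & \<Union> (Pow ` (Cs - {C})) Int Pow C = mfaces (D C) C"
  "Cs - {C} = {} ==> D C = {}" using shelling_induct_step[OF Suc.prems(1,2)] by blast
 have CK:"C:K" "D C <= C" using C(1) Suc.prems(1) by (auto simp:shelling_def)
 show ?case
 proof (cases "Cs - {C} = {}")
  case True
  hence CC:"Cs = {C}" using C by blast
  show ?thesis using Suc.prems(3)[OF C(1)] C(4)[OF True] assms(4) CC h_simplex_conc[OF CK(1), of k] by (auto simp:conc_def)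
 next
  case False
  let ?A = "\<Union> (Pow ` (Cs - {C}))"
  have cA:"complex ?A" by (rule complex_shelling[OF C(2) False])
  have IH:"h ?A k = conc d (card {B:Cs - {C}. D B = odds B}) k" for k
  proof (rule Suc.hyps(1)[OF _ C(2) False])
   show "n = card (Cs - {C})" using Suc.hyps(2) C(1) by simp
  qed (use Suc.prems(3) in blast)
  have un:"\<Union> (Pow ` Cs) = ?A Un Pow C" using C(1) by blast
  note D = C(3)[OF False]
  show ?thesis
  proof (cases "D C = odds C")
   case True
   hence cd:"card (D C) = d" using Suc.prems(3) C(1) by blast
   have eq:"{B:Cs. D B = odds B} = insert C {B:Cs - {C}. D B = odds B}" using True C(1) by blast
   have 0:"h ?A (card (D C) - 1) = 0" unfolding IH cd by (rule conc_pred[OF assms(4)])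
   have "h (?A Un Pow C) k = conc d (card {B:Cs - {C}. D B = odds B}) k + conc d 1 k"
  using attach_cell_critical[OF cA CK conjunct1[OF D] conjunct2[OF D] True[symmetric] 0, of k] cd by (simp only:IH)
   moreover have "card {B:Cs. D B = odds B} = Suc (card {B:Cs - {C}. D B = odds B})"
    unfolding eq using fin by (subst card_insert_disjoint) auto
   ultimately show ?thesis unfolding un by (rule conc_add_one)
  next
   case False
   hence "{B:Cs. D B = odds B} = {B:Cs - {C}. D B = odds B}" by blast
   moreover have "h (?A Un Pow C) k = h ?A k" using attach_cell_noncritical[OF cA CK, of k] D False by auto
   ultimately show ?thesis unfolding un using IH by simp
  qed
 qed
qed

text \<open>Critical cells may lie in several degrees here, and cancellation above degree 1 is not
  controlled; but they are attached along complexes without homology in degree 0, so degrees 0 and 1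
  stay empty.\<close>

theorem h_shelling_low:
 assumes "shelling Cs len D" "Cs ~= {}" and "!!C. C:Cs ==> D C = odds C ==> card (D C) >= 2"
 shows "h (\<Union> (Pow ` Cs)) 0 = 0 & h (\<Union> (Pow ` Cs)) 1 = 0" using assms
proof (induction "card Cs" arbitrary:Cs)
 case 0
 thus ?case by (auto simp:shelling_def)
next
 case (Suc n)
 have fin:"finite Cs" using Suc.prems by (auto simp:shelling_def)
 obtain C where C:"C:Cs" "shelling (Cs - {C}) len D"
  "Cs - {C} ~= {} ==> D C ~= {} & \<Union> (Pow ` (Cs - {C})) Int Pow C = mfaces (D C) C"
  "Cs - {C} = {} ==> D C = {}" using shelling_induct_step[OF Suc.prems(1,2)] by blast
 have CK:"C:K" "D C <= C" using C(1) Suc.prems(1) by (auto simp:shelling_def)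
 show ?case
 proof (cases "Cs - {C} = {}")
  case True
  hence CC:"Cs = {C}" using C by blast
  show ?thesis using Suc.prems(3)[OF C(1)] C(4)[OF True] CC h_simplex_conc[OF CK(1)] by auto
 next
  case False
  let ?A = "\<Union> (Pow ` (Cs - {C}))"
  have cA:"complex ?A" by (rule complex_shelling[OF C(2) False])
  have IH:"h ?A 0 = 0 & h ?A 1 = 0"
  proof (rule Suc.hyps(1)[OF _ C(2) False])
   show "n = card (Cs - {C})" using Suc.hyps(2) C(1) by simp
  qed (use Suc.prems(3) in blast)
  have un:"\<Union> (Pow ` Cs) = ?A Un Pow C" using C(1) by blast
  note D = C(3)[OF False]
  show ?thesis
  proof (cases "D C = odds C")
   case True
   hence cd:"card (D C) >= 2" using Suc.prems(3) C(1) by blast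
   have "h (?A Int Pow C) k = conc (card (D C) - 1) 1 k" for k using h_missing_faces[OF CK] D True by auto
   hence I0:"h (?A Int Pow C) 0 = 0" using cd by (simp add:conc_def)
   have "h (Pow C) k = 0" for k using h_simplex_conc[OF CK(1)] D True by auto
   then obtain u v w where *: "u 0 = 0" "w 0 = 0" "!!k. h ?A k = u (Suc k) + v k" "!!k. h (?A Un Pow C) k = v k + w k"
    "!!k. h (?A Int Pow C) k = w (Suc k) + u (Suc k)" by (rule attach_acyclic[OF cA complex_Pow[OF CK(1)]]) auto
   show ?thesis unfolding un using IH I0 *(2) *(3)[of 0] *(3)[of 1] *(4)[of 0] *(4)[of 1] *(5)[of 0] by simp
  next
   case False
   moreover have "h (?A Un Pow C) k = h ?A k" for k using attach_cell_noncritical[OF cA CK, of k] D False by auto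
   ultimately show ?thesis unfolding un using IH by simp
  qed
 qed
qed

subsection \<open>Unions of acyclic complexes\<close>

text \<open>A Mayer-Vietoris induction on the number of pieces, applied both to the union of the
  earlier pieces and to its intersection with the next one.\<close>

lemma h_Union_acyclic:
 assumes "finite J" "J ~= {}" "!!j. j:J ==> complex (F j)"
  and "!!I k. I <= J ==> I ~= {} ==> h (INT i:I. F i) k = 0"
 shows "h (UN j:J. F j) k = 0" using assms
proof (induction J arbitrary:F k rule:finite_ne_induct)
 case (singleton j)
 thus ?case using singleton.prems(2)[of "{j}" k] by simp
next
 case (insert j J)
 have cA:"complex (UN i:J. F i)" and cj:"complex (F j)" using complex_UN[of J F] insert by auto
 have A:"h (UN i:J. F i) k = 0" for k
 proof (rule insert.IH)
  fix I k assume "I <= J" "I ~= {}"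
  thus "h (INT i:I. F i) k = 0" by (intro insert.prems(2)) auto
 qed (use insert.prems in auto)
 have j:"h (F j) k = 0" for k using insert.prems(2)[of "{j}" k] by simp
 have "h (UN i:J. F i Int F j) k = 0" for k
 proof (rule insert.IH)
  fix I k assume I:"I <= J" "I ~= {}"
  have *: "(INT i:I. F i Int F j) = (INT i:insert j I. F i)" using I by auto
  show "h (INT i:I. F i Int F j) k = 0" unfolding * by (rule insert.prems(2)) (use I in auto)
 qed (use insert.prems complex_Int in auto)
 moreover have "(UN i:J. F i Int F j) = (UN i:J. F i) Int F j" by blast
 ultimately have "h ((UN i:J. F i) Int F j) k = 0" for k by simp
 thus ?case using attach_iso[OF cA cj, of 0 k] A j by (auto simp:conc_def Un_commute)
qed

text \<open>The first arm kills the point class of E. Every further arm is acyclic and meets what is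
  already there in an all-even complex, whose point class becomes a class in degree 1.\<close>

lemma h_star:
 assumes "complex E" "all_even E" "finite J" "J ~= {}" "!!j. j:J ==> complex (B j)"
  "!!j k. j:J ==> h (B j) k = 0" "!!i j. i:J ==> j:J ==> i ~= j ==> all_even (B i Int B j)"
 shows "h (E Un (UN j:J. B j)) k = conc 1 (card J - 1) k" using assms(3-)
proof (induction J arbitrary:k rule:finite_ne_induct)
 case (singleton j)
 hence cB:"complex (B j)" and z:"!!k. h (B j) k = 0" by auto
 have I:"h (E Int B j) k = conc 0 1 k" for k using assms(2) h_all_even[OF complex_Int[OF assms(1) cB]] all_even_def by blast
 have hE:"h E k = conc 0 1 k" for k by (rule h_all_even[OF assms(1,2)])
 obtain u v w where *: "u 0 = 0" "w 0 = 0" "!!k. h E k = u (Suc k) + v k" "!!k. h (E Un B j) k = v k + w k"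
  "!!k. h (E Int B j) k = w (Suc k) + u (Suc k)" by (rule attach_acyclic[OF assms(1) cB z]) blast
 have h0:"h (E Un B j) 0 = 0" using h0_antimono[OF cB complex_Un[OF assms(1) cB]] z by simp
 have v:"v k = 0" for k
 proof (cases k)
  case 0 thus ?thesis using *(4)[of 0] h0 by simp
 next
  case (Suc l) thus ?thesis using *(3)[of k] hE[of k] by (simp add:conc_def)
 qed
 have "w k = 0" for k
 proof (cases k)
  case 0 thus ?thesis using * by simp
 next
  case (Suc l)
  thus ?thesis using *(5)[of l] I[of l] *(3)[of l] hE[of l] v[of l] by auto
 qed
 thus ?case using *(4) v by (simp add:conc_def)
next
 case (insert j J)
 let ?A = "E Un (UN j:J. B j)"
 have cB:"complex (B j)" and z:"!!k. h (B j) k = 0" using insert.prems by auto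
 have cA:"complex ?A" using complex_Un[OF assms(1) complex_UN[of J B]] insert by auto
 have hA:"h ?A k = conc 1 (card J - 1) k" for k by (rule insert.IH) (use insert.prems in auto)
 have "all_even (?A Int B j)" unfolding all_even_def
 proof (intro ballI)
  fix si v assume si:"si:?A Int B j" "v:si"
  then consider "si:E" | i where "i:J" "si:B i Int B j" by blast
  thus "~odd_vertex v"
  proof cases
   case 1 thus ?thesis using assms(2) si by (auto simp:all_even_def)
  next
   case 2
   thus ?thesis using insert.prems(3)[of i j] insert.hyps si by (auto simp:all_even_def)
  qed
 qed
 hence I:"h (?A Int B j) k = conc 0 1 k" for k by (rule h_all_even[OF complex_Int[OF cA cB]])
 have "h (?A Un B j) k = h ?A k + conc (Suc 0) 1 k" by (rule attach_acyclic_conc[OF cA cB z I]) (simp add:hA conc_def)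
 moreover have "E Un (UN j:insert j J. B j) = ?A Un B j" by blast
 moreover have "Suc (card J - 1) = card J" using insert.hyps by (simp add:card_gt_0_iff)
 ultimately show ?case unfolding hA using insert.hyps by (simp add:conc_def)
qed

text \<open>The second betti number is only determined together with the first one here; the latter is
  found by a shelling.\<close>

lemma attach_bubble:
 assumes A:"complex A" and B:"complex B" and I:"!!k. h (A Int B) k = conc 1 a k"
  and hB:"!!k. h B k = conc 4 b k"
  and hA:"!!k. k ~: {1,2,4} ==> h A k = 0" "h A 4 = c" "int (h A 2) - int (h A 1) = e"
 shows "(!k. k ~: {1,2,4} --> h (A Un B) k = 0) & h (A Un B) 4 = c + b
  & int (h (A Un B) 2) - int (h (A Un B) 1) = e + int a"
proof -
 obtain u v w where *: "u 0 = 0" "!!k. h (A Int B) k = u (Suc k) + v k" "!!k. h B k = v k + w k"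
  "!!k. r B (A Int B) k = w k + u k" "w 0 = 0" by (rule pair_exact[OF complex_Int[OF A B] B]) auto
 obtain u' v' w' where **: "u' 0 = 0" "!!k. h A k = u' (Suc k) + v' k" "!!k. h (A Un B) k = v' k + w' k"
  "!!k. r (A Un B) A k = w' k + u' k" "w' 0 = 0" by (rule pair_exact[OF A complex_Un[OF A B]]) auto
 have v:"v k = 0" for k using *(2)[of k] *(3)[of k] I[of k] hB[of k] by (cases "k = 1") (auto simp:conc_def)
 hence w:"w k = conc 4 b k" for k using *(3) hB by simp
 have u:"u k = conc 2 a k" for k
 proof (cases k)
  case (Suc l)
  thus ?thesis using *(2)[of l] I[of l] v[of l] by (simp add:conc_def)
 qed (use * in \<open>simp add:conc_def\<close>)
 have r:"w' k + u' k = conc 4 b k + conc 2 a k" for k using **(4)[of k] excise[OF A B, of k] *(4)[of k] u w by simp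
 have u4:"u' 4 = 0" using **(2)[of 3] hA(1)[of 3] by simp
 have u':"u' k = 0" if "k ~= 2" for k using r[of k] that u4 by (cases "k = 4") (auto simp:conc_def)
 have w':"w' k = 0" if "k ~: {2,4}" for k using r[of k] that by (auto simp:conc_def)
 have "w' 4 = b" using r[of 4] u4 by (simp add:conc_def)
 moreover have "w' 2 + u' 2 = a" using r[of 2] by (simp add:conc_def)
 moreover have "h A k = v' k" if "k ~= 1" for k using **(2)[of k] u'[of "Suc k"] that by simp
 moreover have "h A 1 = u' 2 + v' 1" using **(2)[of 1] by (simp add:numeral_2_eq_2)
 ultimately show ?thesis using **(3) w' hA by auto
qed

end

text \<open>The dimensions of isotypic homology lie a priori in \<open>enat\<close>. When simplices
  are added one at a time, the exact sequences bound each dimension by finite ones; afterwards all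
  of them may be read as natural numbers.\<close>

lemma homology_function_of_enat:
 fixes K :: "'v set set" and hE :: "'v set set=>nat=>enat" and rE :: "'v set set=>'v set set=>nat=>enat"
 assumes K:"finite K" "!!si. si:K ==> finite si" "!!si ta. si:K ==> ta <= si ==> ta:K"
  and simplex:"!!si k. si:K ==> hE (Pow si) k = (if k = 0 & (!v:si. ~odd_vertex v) then 1 else 0)"
  and exact:"!!A B. subcx K A ==> subcx K B ==> A <= B ==>
   EX u v w. u 0 = 0 & (!k. hE A k = u (Suc k) + v k & hE B k = v k + w k & rE B A k = w k + u k)"
  and r0:"!!A B. subcx K A ==> subcx K B ==> A <= B ==> rE B A 0 = 0"
  and excision:"!!A B k. subcx K A ==> subcx K B ==> rE (A Un B) A k = rE B (A Int B) k"
 shows homology_function_the_enat:"homfun K odd_vertex (%A k. the_enat (hE A k)) (%B A k. the_enat (rE B A k))"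
  and hE_finite:"subcx K A ==> hE A k ~= \<infinity>"
proof -
 have fin:"!k. hE A k ~= \<infinity>" if "subcx K A" for A using that
 proof (induction "card A" arbitrary:A rule:less_induct)
  case less
  have finA:"finite A" using less.prems K(1) finite_subset by (auto simp:subcx_def)
  obtain si where "si:A" "!ta:A. si <= ta --> si = ta"
  using less.prems finite_has_maximal[OF finA] by (auto simp:subcx_def)
  hence si:"si:A" "!!ta. ta:A ==> si <= ta ==> ta = si" by auto
  have siK:"si:K" and sub:"Pow si <= A" using si less.prems by (auto simp:subcx_def)
  have hP:"hE (Pow si) k ~= \<infinity>" for k using simplex[OF siK, of k] by (auto simp:zero_enat_def one_enat_def)
  show ?case
  proof (cases "A = Pow si")
   case True
   thus ?thesis using hP by simp
  next
   case False
   let ?A = "A - {si}"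
   have "si ~= {}" using si False sub by blast
   hence cA:"subcx K ?A" using less.prems si unfolding subcx_def by blast
   have cP:"subcx K (Pow si)" using K(3) siK by (auto simp:subcx_def)
   have cI:"subcx K (?A Int Pow si)" using cA unfolding subcx_def by blast
   have un:"?A Un Pow si = A" using sub by blast
   have fA:"hE ?A k ~= \<infinity>" for k using less.hyps[OF card_Diff1_less[OF finA si(1)] cA] by blast
   have "card (?A Int Pow si) < card A" using finA si by (intro psubset_card_mono) auto
   hence fI:"hE (?A Int Pow si) k ~= \<infinity>" for k using less.hyps cI by blast
   obtain u v w where *: "u 0 = 0" "!!k. hE (?A Int Pow si) k = u (Suc k) + v k"
    "!!k. hE (Pow si) k = v k + w k" "!!k. rE (Pow si) (?A Int Pow si) k = w k + u k" using exact[OF cI cP] by blast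
   have "w k ~= \<infinity>" for k using *(3)[of k] hP[of k] by (metis plus_eq_infty_iff_enat)
   moreover have "u k ~= \<infinity>" for k
   proof (cases k)
    case 0 thus ?thesis using *(1) by simp
   next
    case (Suc j) thus ?thesis using *(2)[of j] fI[of j] by (metis plus_eq_infty_iff_enat)
   qed
   ultimately have "rE (Pow si) (?A Int Pow si) k ~= \<infinity>" for k using *(4)[of k] by (simp add:plus_eq_infty_iff_enat)
   hence fr:"rE A ?A k ~= \<infinity>" for k using excision[OF cA cP, of k] un by simp
   obtain u v w where **: "u 0 = 0" "!!k. hE ?A k = u (Suc k) + v k"
    "!!k. hE A k = v k + w k" "!!k. rE A ?A k = w k + u k" using exact[OF cA less.prems] by blast
   have "v k ~= \<infinity>" "w k ~= \<infinity>" for k using **(2)[of k] **(4)[of k] fA[of k] fr[of k] by (metis plus_eq_infty_iff_enat)+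
   thus ?thesis using **(3) by (simp add:plus_eq_infty_iff_enat)
  qed
 qed
 thus "subcx K A ==> hE A k ~= \<infinity>" by blast
 show "homfun K odd_vertex (%A k. the_enat (hE A k)) (%B A k. the_enat (rE B A k))"
 proof
  show "the_enat (hE (Pow si) k) = (if k = 0 & (!v:si. ~odd_vertex v) then 1 else 0)" if "si:K" for si k
   using simplex[OF that, of k] by (simp add:zero_enat_def one_enat_def)
  fix A B :: "'v set set"
  {
   assume AB:"A <= B" "B <= K" "{}:A" "!!si ta. si:A ==> ta <= si ==> ta:A"
    "!!si ta. si:B ==> ta <= si ==> ta:B"
   hence c:"subcx K A" "subcx K B" unfolding subcx_def by blast+
   obtain u v w where *: "u 0 = 0" "!!k. hE A k = u (Suc k) + v k" "!!k. hE B k = v k + w k" "!!k. rE B A k = w k + u k"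
    using exact[OF c AB(1)] by blast
   have f:"v k ~= \<infinity>" "w k ~= \<infinity>" "u (Suc k) ~= \<infinity>" for k
    using *(2)[of k] *(3)[of k] fin[OF c(1)] fin[OF c(2)] by (metis plus_eq_infty_iff_enat)+
   have fu:"u k ~= \<infinity>" for k using f *(1) by (cases k) auto
   have plus:"the_enat (a + b) = the_enat a + the_enat b" if "a ~= \<infinity>" "b ~= \<infinity>" for a b
    using that by (metis plus_enat_simps(1) the_enat.simps enat.exhaust)
   show "EX u v w. u 0 = 0 & (!k. the_enat (hE A k) = u (Suc k) + v k &
     the_enat (hE B k) = v k + w k & the_enat (rE B A k) = w k + u k)"
    by (rule exI[of _ "%k. the_enat (u k)"], rule exI[of _ "%k. the_enat (v k)"], rule exI[of _ "%k. the_enat (w k)"])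
     (simp add:* f fu plus zero_enat_def)
   show "the_enat (rE B A 0) = 0" using r0[OF c AB(1)] by (simp add:zero_enat_def)
  }
  assume "A <= K" "B <= K" "{}:A" "{}:B" "!!si ta. si:A ==> ta <= si ==> ta:A"
   "!!si ta. si:B ==> ta <= si ==> ta:B"
  thus "the_enat (rE (A Un B) A k) = the_enat (rE B (A Int B) k)" for k by (auto simp:subcx_def excision)
 qed (use K in auto)
qed

section \<open>Root systems of type \<open>E\<close>\<close>

text \<open>Twice the inverse of the Cartan matrix.\<close>

definition E_inverse :: "nat=>int list list" where
 "E_inverse n = (if n = 7 then
  [[4,4,6,8,6,4,2],
[4,7,8,12,9,6,3],
[6,8,12,16,12,8,4],
[8,12,16,24,18,12,6],
[6,9,12,18,15,10,5],
[4,6,8,12,10,8,4],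
[2,3,4,6,5,4,3]]
 else
  [[8,10,14,20,16,12,8,4],
[10,16,20,30,24,18,12,6],
[14,20,28,40,32,24,16,8],
[20,30,40,60,48,36,24,12],
[16,24,32,48,40,30,20,10],
[12,18,24,36,30,24,16,8],
[8,12,16,24,20,16,12,6],
[4,6,8,12,10,8,6,4]])"

definition "E_inv n i j = E_inverse n ! (i - 1) ! (j - 1)"

definition nodes :: "nat=>nat set" where
 "nodes n = {1..n}"

lemma finite_nodes [simp]:"finite (nodes n)" and card_nodes [simp]:"card (nodes n) = n" by (simp_all add:nodes_def)

lemma nodes8:"nodes 8 = {1,2,3,4,5,6,7,8}" and nodes7:"nodes 7 = {1,2,3,4,5,6,7}" by (auto simp:nodes_def)

definition E_edges :: "(nat \<times> nat) list" where
 "E_edges = [(1,3),(3,4),(2,4),(4,5),(5,6),(6,7),(7,8)]"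

lemma cartan_code:
 "E_cartan i j = (if i = j then 2 else if (i,j):set E_edges \<or> (j,i):set E_edges then - 1 else 0)"
 unfolding E_cartan_def E_edges_def by (auto simp:doubleton_eq_iff)

lemma E_cartan_sym:"E_cartan i j = E_cartan j i" by (auto simp:cartan_code)

lemma E_cartan_diag [simp]:"E_cartan i i = 2" by (simp add:E_cartan_def)

lemma nodes_set:"nodes n = set [1..<Suc n]" by (auto simp:nodes_def)

lemma sum_nodes:"(SUM k:nodes n. f k) = sum_list (map f [1..<Suc n])"
 unfolding nodes_set by (rule sum.distinct_set_conv_list) simp

lemma E_tables:
 "list_all (%n. list_all (%i. list_all (%j.
  sum_list (map (%k. E_inv n i k * E_cartan k j) [1..<Suc n]) = (if i = j then 2 else 0) &
  E_inv n i j = E_inv n j i & (i ~= j --> E_inv n i i ~= E_inv n j j)) [1..<Suc n]) [1..<Suc n]) [7,8]"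
 unfolding cartan_code by code_simp

text \<open>The diagonal of \<open>E_inv\<close> carries twice the norms of the fundamental weights.
  That these differ is what later tells the node of a vertex from its norm.\<close>

lemma
 assumes "n = 7 \<or> n = 8" "i:nodes n" "j:nodes n"
 shows E_inv_cartan:"(SUM k:nodes n. E_inv n i k * E_cartan k j) = (if i = j then 2 else 0)"
  and E_inv_sym:"E_inv n i j = E_inv n j i"
  and E_inv_diag_inj:"E_inv n i i = E_inv n j j ==> i = j"
proof -
 have "n:set [7,8]" "i:set [1..<Suc n]" "j:set [1..<Suc n]" using assms by (auto simp:nodes_def)
 note * = E_tables[unfolded list_all_iff, THEN bspec, THEN bspec, THEN bspec, OF this]
 show "(SUM k:nodes n. E_inv n i k * E_cartan k j) = (if i = j then 2 else 0)"
  "E_inv n i j = E_inv n j i" "E_inv n i i = E_inv n j j ==> i = j" unfolding sum_nodes using * by blast+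
qed

definition "int_span n b = {(SUM i:nodes n. of_int (k i) *r b i) |k :: nat=>int. True}"

lemma int_spanI:"(SUM i:nodes n. of_int (k i) *r b i):int_span n b"
 unfolding int_span_def by (intro CollectI exI[of _ k] conjI refl TrueI)

text \<open>The form in which the proof uses the root system: all roots have squared length
  \<open>c\<close>, and under the inner product scaled to give them norm 2 they are exactly the
  vectors of norm 2 in the lattice spanned by \<open>a0\<close>. The locale
  \<open>E_simple_roots\<close> derives this from the original definition.\<close>

locale E_roots =
 fixes Ph :: "'a::euclidean_space set" and n :: nat and c :: real and a0 :: "nat=>'a"
 assumes n:"n = 7 \<or> n = 8" and dim:"DIM('a) = n" and c:"c > 0" and finite_Ph:"finite Ph"
  and a0_gram:"i :nodes n ==> j :nodes n ==> 2 / c * (a0 i \<bullet> a0 j) = of_int (E_cartan i j)"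
  and Ph_eq:"Ph = {v:int_span n a0. 2 / c * (v \<bullet> v) = 2}"
  and a0_coherent:"be:Ph ==> EX k :: nat=>int. be = (SUM i:nodes n. of_int (k i) *r a0 i) &
    ((!i:nodes n. 0 <= k i) \<or> (!i:nodes n. k i <= 0))"
  and a0_ext:"a0:extensional (nodes n)"
begin

abbreviation "NN == nodes n"

definition ip :: "'a=>'a=>real" where
 "ip x y = 2 / c * (x \<bullet> y)"

lemma ip_addl:"ip (x + y) z = ip x z + ip y z"
 and ip_addr:"ip x (y + z) = ip x y + ip x z"
 and ip_sl:"ip (r *r x) y = r * ip x y"
 and ip_sr:"ip x (r *r y) = r * ip x y"
 and ip_dl:"ip (x - y) z = ip x z - ip y z"
 and ip_dr:"ip x (y - z) = ip x y - ip x z"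
 and ip_ml:"ip (- x) y = - ip x y"
 and ip_mr:"ip x (- y) = - ip x y"
 and ip_0_left:"ip 0 y = 0"
 and ip_0_right:"ip x 0 = 0" by (simp_all add:ip_def inner_add inner_diff distrib_left right_diff_distrib)

lemma ip_suml:"ip (SUM i:A. f i) y = (SUM i:A. ip (f i) y)"
 and ip_sumr:"ip x (SUM i:A. f i) = (SUM i:A. ip x (f i))"
 by (simp_all add:ip_def inner_sum_left inner_sum_right sum_distrib_left)

lemma ip_sum_sum:"ip (SUM i:A. f i *r u i) (SUM j:B. g j *r v j) = (SUM i:A. f i * (SUM j:B. g j * ip (u i) (v j)))"
 by (simp only:ip_suml ip_sl, simp only:ip_sumr ip_sr)

lemmas ip_simps = ip_addl ip_addr ip_sl ip_sr ip_dl ip_dr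
 ip_ml ip_mr ip_0_left ip_0_right ip_suml ip_sumr

lemma ip_com:"ip x y = ip y x" by (simp add:ip_def inner_commute)

lemma ip_pos:"x ~= 0 ==> ip x x > 0" using c by (simp add:ip_def)

lemma ip_eq_0:"ip x x = 0 <-> x = 0" using ip_pos[of x] by (cases "x = 0") (simp_all add:ip_0_left)

text \<open>An isometry that permutes the roots takes \<open>a0\<close> to any such tuple. Since the
  diagrams of E7 and E8 have no symmetries, the tuples correspond to the chambers one to one and
  stand for the elements of the Weyl group.\<close>

definition "bases = {b:(NN) \<rightarrow>\<^sub>E Ph. !i:NN. !j:NN. ip (b i) (b j) = of_int (E_cartan i j)}"

definition om :: "(nat=>'a)=>nat=>'a" where
 "om b j = (SUM k:NN. (of_int (E_inv n j k) / 2) *r b k)"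

lemma finite_bases:"finite bases" unfolding bases_def using finite_Ph finite_PiE[of "(NN)" "%_. Ph"] by auto

lemma gram:"b:bases ==> i :NN ==> j :NN ==> ip (b i) (b j) = of_int (E_cartan i j)" by (simp add:bases_def)

lemma b_root:"b:bases ==> i :NN ==> b i:Ph" by (auto simp:bases_def)

lemma b_om:
 assumes "b:bases" "i :NN" "j :NN"
 shows "ip (b i) (om b j) = (if i = j then 1 else 0)"
proof -
 have "ip (b i) (om b j) = (SUM k:NN. of_int (E_inv n j k * E_cartan k i)) / 2"
  using assms by (simp add:om_def ip_simps gram E_cartan_sym[of i] sum_divide_distrib)
 also have "... = of_int (SUM k:NN. E_inv n j k * E_cartan k i) / 2" by simp
 also have "... = (if i = j then 1 else 0)" unfolding E_inv_cartan[OF n assms(3,2)] by simp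
 finally show ?thesis .
qed

lemma om_b:"b:bases ==> i :NN ==> j :NN ==> ip (om b j) (b i) = (if i = j then 1 else 0)" using b_om ip_com by metis

lemma om_om:
 assumes "b:bases" "i :NN" "j :NN"
 shows "ip (om b i) (om b j) = of_int (E_inv n i j) / 2"
proof -
 have "ip (om b i) (om b j) = (SUM k:NN. (of_int (E_inv n i k) / 2) * ip (b k) (om b j))" by (simp add:om_def[of b i] ip_simps)
 also have "... = (SUM k:NN. if k = j then of_int (E_inv n i k) / 2 else 0)" using assms by (intro sum.cong) (auto simp:b_om)
 finally show ?thesis using assms by simp
qed

lemma om_sum_base:
 assumes "b:bases" "i:NN"
 shows "ip (om b i) (SUM j:NN. k j *r b j) = k i"
proof -
 have "ip (om b i) (SUM j:NN. k j *r b j) = (SUM j:NN. if j = i then k j else 0)"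
  unfolding ip_sumr ip_sr using assms by (intro sum.cong) (auto simp:om_b)
 thus ?thesis using assms by simp
qed

lemma base_sum_om:
 assumes "b:bases" "i:NN"
 shows "ip (b i) (SUM j:NN. k j *r om b j) = k i"
proof -
 have "ip (b i) (SUM j:NN. k j *r om b j) = (SUM j:NN. if j = i then k j else 0)"
  unfolding ip_sumr ip_sr using assms by (intro sum.cong) (auto simp:b_om)
 thus ?thesis using assms by simp
qed

lemma base_inj:
 assumes "b:bases"
 shows "inj_on b (NN)" using assms inj_onI om_b zero_neq_one by (metis zero_neq_one)

lemma base_span:
 assumes "b:bases"
 shows "independent (b ` NN)" and "span (b ` NN) = UNIV"
proof -
 have inj:"inj_on b (NN)" by (rule base_inj[OF assms])
 show ind:"independent (b ` NN)"
 proof (rule independent_if_scalars_zero)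
  fix f x assume f:"(SUM x:b ` NN. f x *r x) = 0" and x:"x:b ` NN"
  then obtain i where i:"i:NN" "x = b i" by blast
  show "f x = 0" using f inj om_sum_base[OF assms i(1), of "%j. f (b j)"] i by (auto simp:sum.reindex ip_0_right)
 qed simp
 show "span (b ` NN) = UNIV" using inj dim card_ge_dim_independent[of "b ` NN" UNIV] ind by (auto simp:card_image)
qed

lemma b_exp:
 assumes "b:bases"
 shows "x = (SUM i:NN. ip (b i) x *r om b i)" and "x = (SUM i:NN. ip (om b i) x *r b i)"
proof -
 show e:"x = (SUM i:NN. ip (om b i) x *r b i)" for x
 proof -
  obtain f where "x = (SUM y:b ` NN. f y *r y)" using base_span(2)[OF assms] by (auto simp:span_finite)
  hence k:"x = (SUM j:NN. f (b j) *r b j)" using base_inj[OF assms] by (simp add:sum.reindex)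
  have "ip (om b i) x = f (b i)" if "i:NN" for i unfolding k using om_sum_base[OF assms that, of "%j. f (b j)"] by simp
  thus ?thesis using k by (metis (no_types, lifting) sum.cong)
 qed
 let ?y = "x - (SUM i:NN. ip (b i) x *r om b i)"
 have b0:"ip (b j) ?y = 0" if "j:NN" for j using base_sum_om[OF assms that] by (simp add:ip_dr)
 have "ip z ?y = 0" for z by (subst e[of z]) (simp add:ip_suml ip_sl b0)
 hence "?y = 0" using ip_eq_0 by blast
 thus "x = (SUM i:NN. ip (b i) x *r om b i)" by simp
qed

lemma ip_expand:"b:bases ==> ip x y = (SUM i:NN. ip (om b i) x * ip (b i) y)"
 by (subst b_exp(2)[of b x]) (simp_all add:ip_suml ip_sl)

lemma base_eqI:"b:bases ==> (!!i. i :NN ==> ip (b i) x = ip (b i) y) ==> x = y"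
 using b_exp(1)[of b x] b_exp(1)[of b y] by (metis (no_types, lifting) sum.cong)

lemma a0_base:"a0:bases"
proof -
 have "a0 i:Ph" if i:"i :NN" for i
 proof -
  have "(SUM j:NN. of_int (if j = i then 1 else 0) *r a0 j) = (SUM j:NN. if j = i then a0 j else 0)"
   by (intro sum.cong) auto
  hence "a0 i = (SUM j:NN. of_int (if j = i then 1 else 0) *r a0 j)" using i by simp
  thus ?thesis using exI[of _ "%j. if j = i then 1 else 0"] a0_gram[OF i i] by (force simp:int_span_def Ph_eq)
 qed
 thus ?thesis unfolding bases_def using a0_ext a0_gram by (auto simp:ip_def extensional_def)
qed

lemma root_norm:"be:Ph ==> ip be be = 2" using Ph_eq by (simp add:ip_def)

lemma root_nonzero:"be:Ph ==> be ~= 0" using root_norm[of be] by (auto simp:ip_0_left)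

definition "M = int_span n a0"

lemma M_eq:"M = {x. !i:NN. ip (om a0 i) x:\<int>}"
proof (intro equalityI subsetI CollectI ballI)
 fix x i assume x:"x:M" and i:"i :NN"
 then obtain k :: "nat=>int" where "x = (SUM j:NN. of_int (k j) *r a0 j)" by (auto simp:M_def int_span_def)
 thus "ip (om a0 i) x:\<int>" using om_sum_base[OF a0_base i, of "%j. of_int (k j)"] by simp
next
 fix x assume "x:{x. !i:NN. ip (om a0 i) x:\<int>}"
 hence "ip (om a0 i) x = of_int \<lfloor>ip (om a0 i) x\<rfloor>" if "i :NN" for i using that by (simp add:of_int_floor)
 hence "x = (SUM i:NN. of_int \<lfloor>ip (om a0 i) x\<rfloor> *r a0 i)"
  using b_exp(2)[OF a0_base, of x] by (metis (no_types, lifting) sum.cong)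
 thus "x:M" unfolding M_def using int_spanI by metis
qed

lemma M_add:"x:M ==> y:M ==> x + y:M" and M_diff:"x:M ==> y:M ==> x - y:M"
 and M_minus:"x:M ==> - x:M" and M_0:"0:M" and M_scale:"x:M ==> of_int k *r x:M"
 by (simp_all add:M_eq ip_simps)

lemma M_sum:"(!!i. i:A ==> f i:M) ==> (SUM i:A. f i):M"
 by (induction A rule:infinite_finite_induct) (auto intro:M_add M_0)

lemma root_M:"be:Ph ==> be:M" using Ph_eq by (simp add:M_def)

lemma root_iff:"be:Ph <-> be:M & ip be be = 2" using Ph_eq by (auto simp:M_def ip_def)

lemma int_span_M:"b:bases ==> int_span n b <= M" unfolding int_span_def using b_root root_M by (auto intro!:M_sum M_scale)

text \<open>The isometry \<open>w\<close> that takes \<open>a0\<close> to b permutes the finite set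
  of roots, so the coefficients of a root over b are those of its preimage over
  \<open>a0\<close>.\<close>

lemma root_coherent:
 assumes b:"b:bases" and be:"be:Ph"
 shows "EX k :: nat=>int. (!i:NN. ip (om b i) be = of_int (k i)) &
  ((!i:NN. 0 <= k i) \<or> (!i:NN. k i <= 0))"
proof -
 define w where "w x = (SUM i:NN. ip (om a0 i) x *r b i)" for x
 have wip:"ip (w x) (w y) = ip x y" for x y
 proof -
  have "ip (w x) (w y) = (SUM i:NN. ip (om a0 i) x * (SUM j:NN. ip (om a0 j) y * ip (b i) (b j)))"
   unfolding w_def by (rule ip_sum_sum)
  also have "... = (SUM i:NN. ip (om a0 i) x * (SUM j:NN. ip (om a0 j) y * ip (a0 i) (a0 j)))"
   using gram[OF b] gram[OF a0_base] by (intro sum.cong arg_cong2[where f = "(*)"] refl) auto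
  also have "... = ip (SUM i:NN. ip (om a0 i) x *r a0 i) (SUM i:NN. ip (om a0 i) y *r a0 i)"
   by (rule ip_sum_sum[symmetric])
  finally show ?thesis using b_exp(2)[OF a0_base] by metis
 qed
 have omw:"ip (om b i) (w x) = ip (om a0 i) x" if "i :NN" for i x unfolding w_def by (rule om_sum_base[OF b that])
 have "inj w"
 proof (rule injI)
  fix x y assume "w x = w y"
  hence "ip (om a0 i) x = ip (om a0 i) y" if "i :NN" for i using omw that by metis
  thus "x = y" using b_exp(2)[OF a0_base, of x] b_exp(2)[OF a0_base, of y] by (metis (no_types, lifting) sum.cong)
 qed
 have "w ` Ph <= Ph"
 proof
  fix y assume "y:w ` Ph"
  then obtain x where x:"x:Ph" "y = w x" by blast
  have "of_int \<lfloor>ip (om a0 i) x\<rfloor> = ip (om a0 i) x" if "i:NN" for i using root_M[OF x(1)] that by (simp add:M_eq)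
  hence "y = (SUM i:NN. of_int \<lfloor>ip (om a0 i) x\<rfloor> *r b i)"
   unfolding x(2) w_def by (metis (no_types, lifting) sum.cong)
  hence "y:int_span n b" using int_spanI by metis
  thus "y:Ph" using int_span_M[OF b] wip root_norm[OF x(1)] x(2) by (auto simp:root_iff)
 qed
 hence "w ` Ph = Ph" using finite_Ph \<open>inj w\<close> by (simp add:endo_inj_surj inj_on_subset)
 then obtain x where x:"x:Ph" "be = w x" using be by blast
 obtain k :: "nat=>int" where k:"x = (SUM i:NN. of_int (k i) *r a0 i)"
  "(!i:NN. 0 <= k i) \<or> (!i:NN. k i <= 0)" using a0_coherent[OF x(1)] by blast
 have "ip (om b i) be = of_int (k i)" if "i :NN" for i
  unfolding x(2) omw[OF that] using om_sum_base[OF a0_base that, of "%j. of_int (k j)"] k(1) by simp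
 thus ?thesis using k(2) by blast
qed

lemma ip_Ints:
 assumes "b:bases" "!!i. i:NN ==> ip (om b i) x:\<int>" "!!i. i:NN ==> ip (b i) y:\<int>"
 shows "ip x y:\<int>" unfolding ip_expand[OF assms(1), of x y] by (intro Ints_sum Ints_mult assms)

lemma M_iff:
 assumes b:"b:bases"
 shows "x:M <-> (!i:NN. ip (om b i) x:\<int>)"
proof
 assume x:"x:M"
 show "!i:NN. ip (om b i) x:\<int>"
 proof
  fix i assume i:"i:NN"
  have "ip x (om b i):\<int>"
  proof (rule ip_Ints[OF a0_base])
   fix j assume j:"j:NN"
   show "ip (om a0 j) x:\<int>" using x j by (simp add:M_eq)
   show "ip (a0 j) (om b i):\<int>" using root_coherent[OF b b_root[OF a0_base j]] i ip_com by (metis Ints_of_int)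
  qed
  thus "ip (om b i) x:\<int>" using ip_com by metis
 qed
next
 assume x:"!i:NN. ip (om b i) x:\<int>"
 have "ip (om b i) x *r b i:M" if "i:NN" for i
  using M_scale[OF root_M[OF b_root[OF b that]], of "\<lfloor>ip (om b i) x\<rfloor>"] x that by simp
 thus "x:M" using M_sum b_exp(2)[OF b, of x] by force
qed

text \<open>The dual of the root lattice \<open>M\<close> under \<open>ip\<close>. Up to the factor
  between \<open>ip\<close> and the inner product it is the coweight lattice.\<close>

definition "N = {x. !be:Ph. ip be x:\<int>}"

lemma N_iff:
 assumes b:"b:bases"
 shows "x:N <-> (!i:NN. ip (b i) x:\<int>)"
proof
 assume x:"!i:NN. ip (b i) x:\<int>"
 have "ip be x:\<int>" if "be:Ph" for be using that ip_Ints[OF b] root_M[OF that] x by (simp add:M_iff[OF b])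
 thus "x:N" by (simp add:N_def)
qed (auto simp:N_def b_root[OF b])

lemma M_N_int:"m:M ==> x:N ==> ip m x:\<int>" by (rule ip_Ints[OF a0_base]) (auto simp:M_eq N_iff[OF a0_base])

lemma om_N:"b:bases ==> j :NN ==> om b j:N" by (simp add:N_iff b_om)

lemma M_M_int:
 assumes "m:M" "x:M"
 shows "ip m x:\<int>"
proof (rule ip_Ints[OF a0_base])
 fix i assume i:"i:NN"
 have "a0 i:N" using gram[OF a0_base _ i] by (simp add:N_iff[OF a0_base])
 thus "ip (a0 i) x:\<int>" using M_N_int[OF assms(2)] ip_com by metis
qed (use assms in \<open>simp add:M_eq\<close>)

lemma M_N:"M <= N" using M_M_int root_M by (auto simp:N_def)

definition refl :: "'a=>'a=>'a" where
 "refl be x = x - ip be x *r be"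

lemma refl_ip:"be:Ph ==> ip (refl be x) (refl be y) = ip x y"
 using root_norm[of be] by (simp add:refl_def ip_simps ip_com[of x be])

lemma refl_linear:"refl be (SUM i:A. k i *r f i) = (SUM i:A. k i *r refl be (f i))"
 by (simp add:refl_def ip_simps scaleR_diff_right sum_subtractf scaleR_sum_left)

lemma refl_M:"be:Ph ==> x:M ==> refl be x:M"
proof -
 assume "be:Ph" "x:M"
 then obtain k where "ip be x = of_int k" using M_M_int[OF root_M] by (blast elim:Ints_cases)
 thus ?thesis using \<open>be : Ph\<close> \<open>x : M\<close> by (simp add:refl_def M_diff M_scale root_M)
qed

lemma refl_root:"be:Ph ==> ga:Ph ==> refl be ga:Ph" using refl_M[of be ga] refl_ip[of be ga ga] by (simp add:root_iff)

lemma root_minus:"be:Ph ==> - be:Ph" by (simp add:root_iff M_minus ip_simps)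

definition "rbase be b = restrict (%i. refl be (b i)) (NN)"

lemma rbase:"be:Ph ==> b:bases ==> rbase be b:bases"
 unfolding bases_def rbase_def by (auto simp:refl_ip intro!:refl_root)

lemma om_rbase:"om (rbase be b) j = refl be (om b j)" by (simp add:om_def refl_linear rbase_def)

text \<open>Among the finitely many bases in B take one that maximises the product of x with the sum
  of its fundamental weights. Reflection in \<open>b i\<close> changes this product by
  \<open>- ip (b i) x\<close>, so \<open>ip (b i) x\<close> is not negative.\<close>

lemma exists_dominant:
 assumes "B <= bases" "B ~= {}" "I <= (NN)" and closed:"!!b i. b:B ==> i:I ==> rbase (b i) b:B"
 shows "EX b:B. !i:I. ip (b i) x >= 0"
proof -
 define f where "f b = (SUM j:NN. ip (om b j) x)" for b
 have "finite B" using assms(1) finite_bases finite_subset by blast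
 hence "Max (f ` B):f ` B" "!b':B. f b' <= Max (f ` B)" using assms(2) by (intro Max_in, auto)
 then obtain b where b:"b:B" "!b':B. f b' <= f b" by (metis (no_types, lifting) imageE)
 have "ip (b i) x >= 0" if i:"i:I" for i
 proof -
  have bb:"b:bases" "i :NN" using b i assms by auto
  have "f (rbase (b i) b) = (SUM j:NN. ip (om b j) x - (if j = i then ip (b i) x else 0))"
   unfolding f_def om_rbase refl_def ip_simps using b_om[OF bb(1,2)] by (intro sum.cong) auto
  also have "... = f b - ip (b i) x" using bb by (simp add:sum_subtractf f_def)
  finally show ?thesis using b closed[OF b(1) i] by fastforce
 qed
 thus ?thesis using b by blast
qed

lemma dominant_base:"EX b:bases. !i:NN. ip (b i) x >= 0" by (rule exists_dominant) (use a0_base rbase b_root in auto)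

text \<open>The roots \<open>b' k\<close> with k other than j are orthogonal to the vertex and, by
  coherence, combinations of those \<open>b i\<close> that are orthogonal to it; by dimension only
  one \<open>b i\<close> is not. So the vertex is a nonnegative integral multiple of a fundamental
  weight of b; primitivity makes the factor 1, and the norm tells the node.\<close>

lemma dom_vertex:
 assumes b:"b:bases" and b':"b':bases" and j:"j :NN"
  and dom:"!!i. i :NN ==> ip (b i) (om b' j) >= 0"
 shows "om b' j = om b j"
proof -
 let ?v = "om b' j"
 define Z where "Z = {i:NN. ip (b i) ?v = 0}"
 have "b' k:span (b ` Z)" if k:"k:NN - {j}" for k
 proof -
  obtain e :: "nat=>int" where e:"!!i. i :NN ==> ip (om b i) (b' k) = of_int (e i)"
   "(!i:NN. 0 <= e i) \<or> (!i:NN. e i <= 0)" using root_coherent[OF b b_root[OF b']] k by blast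
  have "0 = ip (b' k) ?v" using b_om[OF b' _ j] k by auto
  also have "... = (SUM i:NN. of_int (e i) * ip (b i) ?v)"
   unfolding ip_expand[OF b, of "b' k" ?v] using e(1) by (intro sum.cong) auto
  finally have s:"(SUM i:NN. of_int (e i) * ip (b i) ?v) = 0" by simp
  have "of_int (e i) * ip (b i) ?v = 0" if i:"i :NN" for i
  using that e(2) s dom sum_nonneg_eq_0_iff[of "(NN)" "%i. of_int (e i) * ip (b i) ?v"] sum_nonneg_eq_0_iff[of "(NN)" "%i. - (of_int (e i) * ip (b i) ?v)"] by (auto simp:sum_negf mult_nonpos_nonneg)
  hence "e i = 0" if "i:(NN) - Z" for i using that by (force simp:Z_def)
  hence "b' k = (SUM i:Z. of_int (e i) *r b i)" using e(1)
   by (subst b_exp(2)[OF b, of "b' k"]) (rule sum.mono_neutral_cong_right, auto simp:Z_def)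
  also have "...:span (b ` Z)" by (intro span_sum span_scale span_base imageI)
  finally show ?thesis .
 qed
 hence sub:"b' ` (NN - {j}) <= span (b ` Z)" by blast
 have "independent (b' ` (NN - {j}))" using base_span(1)[OF b'] by (rule independent_mono) auto
 hence "card (b' ` (NN - {j})) <= card (b ` Z)" using independent_span_bound[OF _ _ sub] by (simp add:Z_def)
 moreover have "card (b' ` (NN - {j})) = n - 1" using inj_on_subset[OF base_inj[OF b']] j by (subst card_image) auto
 ultimately have cZ:"n - 1 <= card Z" using card_image_le[of Z b] by (simp add:Z_def)
 obtain i where i:"i :NN" "i ~: Z" using base_eqI[OF b, of ?v 0] b_om[OF b' j j] by (force simp:ip_simps Z_def)
 have "Z = NN - {i}"
 proof (rule card_subset_eq)
  show "card Z = card (NN - {i})" using cZ i card_mono[of "NN - {i}" Z] by (auto simp:Z_def)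
 qed (use i in \<open>auto simp:Z_def\<close>)
 hence "?v = (SUM k:NN. if k = i then ip (b k) ?v *r om b k else 0)"
  by (subst b_exp(1)[OF b, of ?v]) (intro sum.cong, auto simp:Z_def)
 hence ve:"?v = ip (b i) ?v *r om b i" using i(1) by simp
 obtain q where q:"ip (b i) ?v = of_int q" using N_iff[OF b, of ?v] om_N[OF b' j] i by (auto elim:Ints_cases)
 obtain r where r:"ip (b' j) (om b i) = of_int r" using N_iff[OF b', of "om b i"] om_N[OF b i(1)] j by (auto elim:Ints_cases)
 have "1 = ip (b' j) ?v" using b_om[OF b' j j] by simp
 also have "... = of_int (q * r)" by (subst ve) (simp add:ip_simps q r)
 finally have "q * r = 1" by linarith
 moreover have "q >= 0" using dom[OF i(1)] q by simp
 ultimately have v:"?v = om b i" using ve q by (simp add:zmult_eq_1_iff)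
 show ?thesis using om_om[OF b' j j] om_om[OF b i(1) i(1)] v E_inv_diag_inj[OF n j i(1)] by simp
qed

end

lemma sum_coherent:
 fixes f g :: "'v=>real"
 assumes "finite A" and f:"!!v. v:A ==> f v > 0" and "(!v:A. g v >= 0) \<or> (!v:A. g v <= 0)"
 shows "(SUM v:A. f v * g v) >= 0 <-> (!v:A. g v >= 0)"
  and "(SUM v:A. f v * g v) = 0 <-> (!v:A. g v = 0)"
  and "(SUM v:A. f v * g v) > 0 <-> (EX v:A. g v > 0)"
proof -
 have nonneg:"(SUM v:A. f v * h v) >= 0 & ((SUM v:A. f v * h v) = 0 <-> (!v:A. h v = 0))"
  if "!v:A. h v >= 0" for h
 proof -
  have "!v:A. f v * h v >= 0" using f that by (simp add:less_imp_le)
  moreover have "f v * h v = 0 <-> h v = 0" if "v:A" for v using f[OF that] by simp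
  ultimately show ?thesis using assms(1) by (simp add:sum_nonneg sum_nonneg_eq_0_iff)
 qed
 have "((SUM v:A. f v * g v) >= 0 <-> (!v:A. g v >= 0)) & ((SUM v:A. f v * g v) = 0 <-> (!v:A. g v = 0))
  & ((SUM v:A. f v * g v) > 0 <-> (EX v:A. g v > 0))" using assms(3)
 proof
  assume g:"!v:A. g v >= 0"
  hence "(EX v:A. g v > 0) <-> ~(!v:A. g v = 0)" by force
  moreover have "(SUM v:A. f v * g v) > 0 <-> ~(SUM v:A. f v * g v) = 0" using nonneg[OF g] by linarith
  ultimately show ?thesis using nonneg[OF g] g by simp
 next
  assume g:"!v:A. g v <= 0"
  hence "!v:A. - g v >= 0" by simp
  from nonneg[OF this] have s:"(SUM v:A. f v * g v) <= 0" "(SUM v:A. f v * g v) = 0 <-> (!v:A. g v = 0)"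
   by (simp_all add:sum_negf)
  have "(!v:A. g v >= 0) <-> (!v:A. g v = 0)" "~(EX v:A. g v > 0)" using g by force+
  thus ?thesis using s by force
 qed
 thus "(SUM v:A. f v * g v) >= 0 <-> (!v:A. g v >= 0)"
  and "(SUM v:A. f v * g v) = 0 <-> (!v:A. g v = 0)"
  and "(SUM v:A. f v * g v) > 0 <-> (EX v:A. g v > 0)" by blast+
qed

section \<open>The Coxeter complex, its regions and their shellings\<close>

context E_roots
begin

definition "verts b = om b ` NN"

text \<open>The fan as a simplicial complex: a cone is given by the fundamental weights on its rays.
  The empty simplex is the cone {0}.\<close>

definition "K = {ta. EX b:bases. ta <= verts b}"

definition "dominant b x <-> (!i:NN. ip (b i) x >= 0)"

lemma verts_K:"b:bases ==> verts b:K" by (auto simp:K_def)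

lemma K_face:"ta:K ==> rh <= ta ==> rh:K" unfolding K_def by blast

lemma finite_verts:"finite (verts b)" by (simp add:verts_def)

lemma K_cfin:"ta:K ==> finite ta" unfolding K_def using finite_verts finite_subset by blast

lemma K_finite:"finite K" using finite_bases finite_verts by (auto simp:K_def)

lemma K_nonempty:"{}:K" using a0_base by (auto simp:K_def)

lemma om_inj:
 assumes "b:bases"
 shows "inj_on (om b) (NN)"
proof (rule inj_onI)
 fix i j assume ij:"i:NN" "j:NN" "om b i = om b j"
 thus "i = j" using b_om[OF assms ij(1) ij(1)] b_om[OF assms ij(1) ij(2)] by (metis zero_neq_one)
qed

lemma root_om:
 assumes "b:bases" "be:Ph"
 shows "(!i:NN. ip be (om b i) >= 0) \<or> (!i:NN. ip be (om b i) <= 0)" using root_coherent[OF assms] by (auto simp:ip_com)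

text \<open>This replaces convex geometry in what follows: the sign of a root on a cone can be read
  off at any positive combination of its vertices.\<close>

lemma cell_coherent:
 assumes "ta:K" "be:Ph"
 shows "(!v:ta. ip be v >= 0) \<or> (!v:ta. ip be v <= 0)" using assms root_om[OF _ assms(2)] unfolding K_def verts_def by blast

lemma root_comb:
 assumes ta:"ta:K" and be:"be:Ph" and c:"!v:ta. f v > 0"
 shows "ip be (SUM v:ta. f v *r v) >= 0 <-> (!v:ta. ip be v >= 0)"
  and "ip be (SUM v:ta. f v *r v) = 0 <-> (!v:ta. ip be v = 0)"
  and "ip be (SUM v:ta. f v *r v) > 0 <-> (EX v:ta. ip be v > 0)"
 using sum_coherent[OF K_cfin[OF ta] bspec[OF c] cell_coherent[OF ta be]] by (simp_all only:ip_sumr ip_sr)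

text \<open>A positive combination determines its cell: if b dominates it, its coefficients are its
  products with the roots of b.\<close>

lemma cone_rep:
 assumes ta:"ta:K" and f:"!v:ta. f v > 0" and b:"b:bases"
  and dom:"dominant b (SUM v:ta. f v *r v)"
 shows "ta = {om b i |i. i:NN & ip (b i) (SUM v:ta. f v *r v) > 0}"
  and "!!i. i:NN ==> ip (b i) (SUM v:ta. f v *r v) = (if om b i:ta then f (om b i) else 0)"
proof -
 have sub:"ta <= verts b"
 proof
  fix v assume v:"v:ta"
  obtain b' j where b':"b':bases" "j:NN" "v = om b' j" using ta v unfolding K_def verts_def by blast
  have "ip (b i) v >= 0" if "i:NN" for i
   using dom root_comb(1)[OF ta b_root[OF b that] f] v that unfolding dominant_def by blast
  thus "v:verts b" using dom_vertex[OF b b'(1,2)] b'(3) b'(2) by (simp add:verts_def)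
 qed
 show *: "ip (b i) (SUM v:ta. f v *r v) = (if om b i:ta then f (om b i) else 0)" if i:"i:NN" for i
 proof -
  have "ip (b i) v = (if v = om b i then 1 else 0)" if "v:ta" for v
  proof -
   have "v:verts b" using sub that by blast
   then obtain j where j:"j:NN" "v = om b j" by (auto simp:verts_def)
   thus ?thesis using b_om[OF b i j(1)] inj_onD[OF om_inj[OF b] _ j(1) i] by auto
  qed
  hence "ip (b i) (SUM v:ta. f v *r v) = (SUM v:ta. if v = om b i then f v else 0)"
   unfolding ip_sumr ip_sr by (intro sum.cong) auto
  thus ?thesis using K_cfin[OF ta] by simp
 qed
 show "ta = {om b i |i. i:NN & ip (b i) (SUM v:ta. f v *r v) > 0}" (is "_ = ?R")
 proof
  show "ta <= ?R"
  proof
   fix v assume v:"v:ta"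
   then obtain j where j:"j:NN" "v = om b j" using sub by (auto simp:verts_def)
   thus "v:?R" using *[OF j(1)] bspec[OF f v] v by auto
  qed
  show "?R <= ta"
  proof
   fix v assume "v:?R"
   then obtain j where j:"j:NN" "v = om b j" "ip (b j) (SUM v:ta. f v *r v) > 0" by blast
   thus "v:ta" using *[OF j(1)] by (cases "om b j:ta") auto
  qed
 qed
qed

definition center :: "'a set=>'a" where
 "center ta = (SUM v:ta. v)"

lemma center_eq:"center ta = (SUM v:ta. 1 *r v)" by (simp add:center_def)

lemma root_center:
 assumes "ta:K" "be:Ph"
 shows "ip be (center ta) >= 0 <-> (!v:ta. ip be v >= 0)"
  and "ip be (center ta) = 0 <-> (!v:ta. ip be v = 0)"
  and "ip be (center ta) > 0 <-> (EX v:ta. ip be v > 0)" unfolding center_eq using root_comb[OF assms, of "%_. 1"] by simp_all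

definition "carrc b x = {om b i |i. i:NN & ip (b i) x > 0}"

lemma carrier_cell_K:"b:bases ==> carrc b x:K" unfolding K_def carrc_def verts_def by blast

lemma carrier_cell_sum:
 assumes b:"b:bases" and dom:"dominant b x"
 obtains f where "!v:carrc b x. f v > (0::real)" "x = (SUM v:carrc b x. f v *r v)"
proof
 let ?g = "the_inv_into (NN) (om b)"
 let ?f = "%v. ip (b (?g v)) x"
 let ?I = "{i:NN. ip (b i) x > 0}"
 have g:"?g (om b i) = i" if "i:NN" for i using the_inv_into_f_f[OF om_inj[OF b] that] .
 have cc:"carrc b x = om b ` ?I" by (auto simp:carrc_def)
 show "!v:carrc b x. ?f v > 0" using g by (auto simp:carrc_def)
 have "(SUM v:carrc b x. ?f v *r v) = (SUM i:?I. ?f (om b i) *r om b i)"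
  unfolding cc using om_inj[OF b] by (subst sum.reindex) (auto intro:inj_on_subset)
 also have "... = (SUM i:?I. ip (b i) x *r om b i)" using g by (intro sum.cong) auto
 also have "... = (SUM i:NN. ip (b i) x *r om b i)" using dom by (intro sum.mono_neutral_left) (auto simp:dominant_def)
 also have "... = x" using b_exp(1)[OF b] by simp
 finally show "x = (SUM v:carrc b x. ?f v *r v)" by simp
qed

lemma root_perturb:
 obtains ep :: real where "ep > 0" "!!be. be:Ph ==> ip be x > 0 ==> ip be (x + ep *r y) > 0"
  "!!be. be:Ph ==> ip be x < 0 ==> ip be (x + ep *r y) < 0"
proof -
 have "\<forall>\<^sub>F ep in at_right (0::real). ip be x > 0 --> ip be (x + ep *r y) > 0" if "be:Ph" for be
 proof (cases "ip be x > 0")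
  case True
  have "((%ep. ip be x + ep * ip be y) \<longlongrightarrow> ip be x + 0 * ip be y) (at_right 0)" by (intro tendsto_intros)
  thus ?thesis using True order_tendstoD(1) by (simp add:ip_addr ip_sr)
 qed simp
 hence "\<forall>\<^sub>F ep in at_right (0::real). !be:Ph. ip be x > 0 --> ip be (x + ep *r y) > 0"
  using finite_Ph by (intro eventually_ball_finite) auto
 then obtain u where u:"u > 0" "!!ep. ep > 0 ==> ep < u ==> !be:Ph. ip be x > 0 --> ip be (x + ep *r y) > 0"
  by (auto simp:eventually_at_right_field)
 have e:"!be:Ph. ip be x > 0 --> ip be (x + (u/2) *r y) > 0" using u by simp
 show ?thesis
 proof
  show "u / 2 > 0" using u by simp
  show "ip be (x + (u / 2) *r y) > 0" if "be:Ph" "ip be x > 0" for be using e that by blast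
  show "ip be (x + (u / 2) *r y) < 0" if "be:Ph" "ip be x < 0" for be
   using e[THEN bspec[of _ _ "- be"], OF root_minus[OF that(1)]] that(2) by (simp add:ip_ml)
 qed
qed

definition "region Gm = {x. !ga:Gm. ip ga x >= 0}"

definition "rcells Gm = {ta:K. ta <= region Gm}"

text \<open>The regions that serve as walls lie inside hyperplanes of roots; a generic point avoids
  all hyperplanes but those.\<close>

definition "generic Gm x <-> (!be:Ph. ip be x = 0 --> (!y:region Gm. ip be y = 0))"

definition "gcells Gm = {C:rcells Gm. generic Gm (center C)}"

text \<open>The hyperplanes that separate C from l, each represented by its root that is positive on
  C. Their number is the gallery distance to l and orders the shelling.\<close>

definition "seps l C = {be:Ph. ip be (center C) > 0 & ip be l < 0}"

text \<open>The vertices opposite to the facets through which C is left on the way to l.\<close>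

definition "descs l C = {v:C. EX b:bases. C <= verts b & (EX i:NN. v = om b i & ip (b i) l < 0)}"

lemma region_add:"x:region Gm ==> y:region Gm ==> x + y:region Gm"
 and region_scale:"x:region Gm ==> t >= 0 ==> t *r x:region Gm"
 and region_0:"0:region Gm" by (auto simp:region_def ip_simps)

lemma region_sum:"(!!i. i:A ==> f i:region Gm) ==> sum f A:region Gm"
 by (induction A rule:infinite_finite_induct) (auto intro:region_add region_0)

lemma center_region:"ta:rcells Gm ==> center ta:region Gm"
 unfolding center_def rcells_def by (intro region_sum) auto

lemma exists_generic:
 assumes p:"p:region Gm"
 obtains l where "l:region Gm" "generic Gm l" "!!be. be:Ph ==> ip be p > 0 ==> ip be l > 0"
proof -
 have "EX l:region Gm. (!be:Ph. ip be p > 0 --> ip be l > 0) &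
   (!be:B. ip be l = 0 --> (!y:region Gm. ip be y = 0))" if "finite B" "B <= Ph" for B using that
 proof (induction B rule:finite_induct)
  case empty
  thus ?case using p by blast
 next
  case (insert be B)
  then obtain l where l:"l:region Gm" "!be:Ph. ip be p > 0 --> ip be l > 0"
   "!be:B. ip be l = 0 --> (!y:region Gm. ip be y = 0)" by blast
  show ?case
  proof (cases "ip be l = 0 & (EX y:region Gm. ip be y ~= 0)")
   case False
   thus ?thesis using l by blast
  next
   case True
   then obtain y where y:"y:region Gm" "ip be y ~= 0" and 0:"ip be l = 0" by blast
   obtain ep :: real where ep:"ep > 0" "!!be. be:Ph ==> ip be l > 0 ==> ip be (l + ep *r y) > 0"
    "!!be. be:Ph ==> ip be l < 0 ==> ip be (l + ep *r y) < 0" by (rule root_perturb[of l y], rule that)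
   have z:"ip ga (l + ep *r y) = 0 ==> ip ga l = 0" if "ga:Ph" for ga using ep(2,3)[OF that] by force
   have nb:"ip be (l + ep *r y) ~= 0" using ep(1) y(2) 0 by (simp add:ip_addr ip_sr)
   have mem:"l + ep *r y:region Gm" using region_add[OF l(1) region_scale[OF y(1)]] ep(1) by simp
   show ?thesis using l(2) ep(2) mem nb z l(3) insert.prems by blast
  qed
 qed
 from this[OF finite_Ph subset_refl] show ?thesis using that unfolding generic_def by blast
qed

text \<open>C contains a small displacement of the centre of \<open>ta\<close> towards l. It is the
  gate of the star of \<open>ta\<close>, the cell around \<open>ta\<close> nearest to l: every root
  that separates it from l is positive already on \<open>ta\<close>.\<close>

lemma generic_step:
 assumes Gm:"Gm <= Ph" and l:"l:region Gm" "generic Gm l" and ta:"ta:rcells Gm"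
 obtains C where "C:gcells Gm" "ta <= C" "!!be. be:seps l C ==> ip be (center ta) > 0"
proof -
 let ?x = "center ta"
 have taK:"ta:K" using ta by (simp add:rcells_def)
 obtain ep :: real where ep:"ep > 0" "!!be. be:Ph ==> ip be ?x > 0 ==> ip be (?x + ep *r l) > 0"
  "!!be. be:Ph ==> ip be ?x < 0 ==> ip be (?x + ep *r l) < 0" by (rule root_perturb[of ?x l], rule that)
 let ?y = "?x + ep *r l"
 have yg:"generic Gm ?y" unfolding generic_def
 proof (intro ballI impI)
  fix be z assume *: "be:Ph" "ip be ?y = 0" "z:region Gm"
  hence "ip be l = 0" using ep(2,3)[OF *(1)] ep(1) by (force simp:ip_addr ip_sr)
  thus "ip be z = 0" using l(2) * unfolding generic_def by blast
 qed
 obtain b where b:"b:bases" "dominant b ?y" using dominant_base unfolding dominant_def by blast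
 let ?C = "carrc b ?y"
 obtain f where f:"!v:?C. f v > (0::real)" "?y = (SUM v:?C. f v *r v)" using carrier_cell_sum[OF b] by blast
 have CK:"?C:K" by (rule carrier_cell_K[OF b(1)])
 note comb = root_comb[OF CK _ f(1), folded f(2)]
 have "ip ga v >= 0" if "ga:Gm" "v:?C" for ga v
  using that comb(1)[of ga] Gm region_add[OF center_region[OF ta] region_scale[OF l(1)]] ep(1) by (auto simp:region_def)
 hence CQ:"?C:rcells Gm" using CK by (auto simp:rcells_def region_def)
 have "generic Gm (center ?C)" unfolding generic_def
 proof (intro ballI impI)
  fix be z assume *: "be:Ph" "ip be (center ?C) = 0" "z:region Gm"
  thus "ip be z = 0" using root_center(2)[OF CK *(1)] comb(2)[OF *(1)] yg by (auto simp:generic_def)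
 qed
 hence C:"?C:gcells Gm" using CQ by (simp add:gcells_def)
 have dx:"dominant b ?x" unfolding dominant_def
 proof
  fix i assume i:"i:NN"
  show "0 <= ip (b i) ?x" using ep(3)[OF b_root[OF b(1) i]] b(2) i unfolding dominant_def by force
 qed
 have "ta = carrc b ?x"
  unfolding carrc_def center_eq by (rule cone_rep(1)[OF taK _ b(1)]) (use dx in \<open>simp_all add:center_eq\<close>)
 hence sub:"ta <= ?C" unfolding carrc_def using ep(2)[OF b_root[OF b(1)]] by blast
 have "ip be ?x > 0" if "be:seps l ?C" for be
 proof -
  have be:"be:Ph" "ip be (center ?C) > 0" "ip be l < 0" using that by (auto simp:seps_def)
  hence "ip be ?y > 0" using root_center(3)[OF CK be(1)] comb(3)[OF be(1)] by blast
  moreover have "ep * ip be l < 0" using ep(1) be(3) by (simp add:mult_pos_neg)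
  ultimately show ?thesis by (simp add:ip_addr ip_sr)
 qed
 thus ?thesis using that[OF C sub] by blast
qed

lemma Union_generic_cells:
 assumes Gm:"Gm <= Ph" and l:"l:region Gm" "generic Gm l"
 shows "\<Union> (Pow ` gcells Gm) = rcells Gm"
proof
 show "\<Union> (Pow ` gcells Gm) <= rcells Gm" unfolding gcells_def rcells_def using K_face by blast
 show "rcells Gm <= \<Union> (Pow ` gcells Gm)" using generic_step[OF assms] by force
qed

lemma gcells_ne:
 assumes "Gm <= Ph" "l:region Gm" "generic Gm l"
 shows "gcells Gm ~= {}" using generic_step[OF assms, of "{}"] K_nonempty by (auto simp:rcells_def)

lemma cell_base_off:
 assumes C:"C:gcells Gm" and b:"b:bases" "C <= verts b" and i:"i:NN" "om b i ~: C"
  and l:"l:region Gm"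
 shows "ip (b i) l = 0"
proof -
 have CK:"C:K" using C by (auto simp:gcells_def rcells_def)
 have "ip (b i) v = 0" if "v:C" for v
 proof -
  have "v:verts b" using b(2) that by blast
  then obtain j where j:"j:NN" "v = om b j" by (auto simp:verts_def)
  thus ?thesis using that i(2) b_om[OF b(1) i(1) j(1)] by auto
 qed
 thus ?thesis
  using root_center(2)[OF CK b_root[OF b(1) i(1)]] C l b_root[OF b(1) i(1)] by (auto simp:gcells_def generic_def)
qed

text \<open>Expanded over a base, a root that separates C from l is seen to be positive at some
  descent of C, hence at a vertex of C'. So every root separating C from l separates C' as well; as
  C' has no more of them, all signs agree and the cells coincide.\<close>

lemma region_shelling_P1:
 assumes Gm:"Gm <= Ph" and l:"l:region Gm" "generic Gm l"
  and C:"C:gcells Gm" and C':"C':gcells Gm" and F:"F <= C" "F <= C'"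
  and len:"card (seps l C') <= card (seps l C)" and D:"descs l C <= F"
 shows "C' = C"
proof -
 have CK:"C:K" "C':K" and CQ:"C:rcells Gm" "C':rcells Gm"
  using C C' by (auto simp:gcells_def rcells_def)
 obtain b where b:"b:bases" "C <= verts b" using CK by (auto simp:K_def)
 have sub:"seps l C <= seps l C'"
 proof
  fix be assume "be:seps l C"
  hence be:"be:Ph" "ip be (center C) > 0" "ip be l < 0" by (auto simp:seps_def)
  then obtain v where "v:C" "ip be v > 0" using root_center(3)[OF CK(1)] by blast
  hence nn:"!i:NN. ip be (om b i) >= 0" using root_om[OF b(1) be(1)] b(2) unfolding verts_def by force
  have "ip be l = (SUM i:NN. ip be (om b i) * ip (b i) l)"
   unfolding ip_expand[OF b(1), of be l] using ip_com by (metis (no_types, lifting))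
  hence "~(!i:NN. ip be (om b i) * ip (b i) l >= 0)" using be(3) sum_nonneg[of "NN" "%i. ip be (om b i) * ip (b i) l"] by force
  then obtain i where i:"i:NN" "ip be (om b i) * ip (b i) l < 0" by force
  hence pn:"ip be (om b i) > 0" "ip (b i) l < 0" using nn i(1) by (auto simp:mult_less_0_iff)
  have "om b i:C" using cell_base_off[OF C b i(1) _ l(1)] pn(2) by force
  hence "om b i:descs l C" unfolding descs_def using b i(1) pn(2) by blast
  hence "om b i:C'" using D F(2) by blast
  hence "ip be (center C') > 0" using root_center(3)[OF CK(2) be(1)] pn(1) by blast
  thus "be:seps l C'" using be by (simp add:seps_def)
 qed
 have eq:"seps l C = seps l C'" using card_seteq[OF _ sub len] finite_Ph by (simp add:seps_def)
 have pos:"ip be (center C') > 0" if be:"be:Ph" "ip be (center C) > 0" for be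
 proof (cases "ip be l < 0")
  case True
  hence "be:seps l C" using be by (simp add:seps_def)
  hence "be:seps l C'" using eq by simp
  thus ?thesis by (simp add:seps_def)
 next
  case False
  have nz:"~(!y:region Gm. ip be y = 0)" using be(2) center_region[OF CQ(1)] by force
  hence "ip be l ~= 0" using l(2) be(1) unfolding generic_def by blast
  hence l0:"ip be l > 0" using False by simp
  have c0:"ip be (center C') ~= 0" using C' nz be(1) unfolding gcells_def generic_def by blast
  have "- be ~: seps l C" using be(2) by (simp add:seps_def ip_ml)
  hence "- be ~: seps l C'" using eq by simp
  thus ?thesis using c0 l0 root_minus[OF be(1)] by (auto simp:seps_def ip_ml)
 qed
 have zero:"ip be (center C') = 0" if be:"be:Ph" "ip be (center C) = 0" for be
  using C center_region[OF CQ(2)] be unfolding gcells_def generic_def by blast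
 obtain b where b:"b:bases" "dominant b (center C)" using dominant_base unfolding dominant_def by blast
 have sgn:"ip (b i) (center C') > 0 <-> ip (b i) (center C) > 0" "ip (b i) (center C') >= 0" if i:"i:NN" for i
 proof -
  have "ip (b i) (center C) > 0 \<or> ip (b i) (center C) = 0" using b(2) i unfolding dominant_def by force
  thus "ip (b i) (center C') > 0 <-> ip (b i) (center C) > 0" "ip (b i) (center C') >= 0"
   using pos[OF b_root[OF b(1) i]] zero[OF b_root[OF b(1) i]] by force+
 qed
 hence d':"dominant b (center C')" by (simp add:dominant_def)
 have "C = carrc b (center C)"
  unfolding carrc_def center_eq by (rule cone_rep(1)[OF CK(1) _ b(1)]) (use b in \<open>simp_all add:center_eq\<close>)
 moreover have "C' = carrc b (center C')"
  unfolding carrc_def center_eq by (rule cone_rep(1)[OF CK(2) _ b(1)]) (use d' in \<open>simp_all add:center_eq\<close>)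
 moreover have "carrc b (center C) = carrc b (center C')" unfolding carrc_def using sgn(1) by blast
 ultimately show ?thesis by simp
qed

text \<open>The gate of the face \<open>C - {v}\<close> is separated from l by no new root, and no
  longer by \<open>b i\<close>, which vanishes on that face.\<close>

lemma region_shelling_P2:
 assumes Gm:"Gm <= Ph" and l:"l:region Gm" "generic Gm l"
  and C:"C:gcells Gm" and v:"v:descs l C"
 shows "EX C':gcells Gm. card (seps l C') < card (seps l C) & C - {v} <= C'"
proof -
 have CK:"C:K" and CQ:"C:rcells Gm" using C by (auto simp:gcells_def rcells_def)
 obtain b i where b:"b:bases" "C <= verts b" and i:"i:NN" "v = om b i" "ip (b i) l < 0" and vC:"v:C"
  using v unfolding descs_def by blast
 have ta:"C - {v}:rcells Gm" using CQ K_face[of C "C - {v}"] unfolding rcells_def by blast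
 hence taK:"C - {v}:K" by (simp add:rcells_def)
 obtain C' where C':"C':gcells Gm" "C - {v} <= C'"
  "!!be. be:seps l C' ==> ip be (center (C - {v})) > 0" using generic_step[OF Gm l ta] by blast
 have bei:"b i:Ph" by (rule b_root[OF b(1) i(1)])
 have "seps l C' <= seps l C"
 proof
  fix be assume s:"be:seps l C'"
  hence be:"be:Ph" "ip be l < 0" by (auto simp:seps_def)
  have "ip be (center C) > 0" using C'(3)[OF s] root_center(3)[OF taK be(1)] root_center(3)[OF CK be(1)] by blast
  thus "be:seps l C" using be by (simp add:seps_def)
 qed
 moreover have "b i:seps l C"
  using root_center(3)[OF CK bei] vC b_om[OF b(1) i(1) i(1)] i bei unfolding seps_def by force
 moreover have "b i ~: seps l C'"
 proof
  assume "b i:seps l C'"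
  then obtain w where w:"w:C - {v}" "ip (b i) w > 0" using C'(3) root_center(3)[OF taK bei] by blast
  then obtain j where j:"j:NN" "w = om b j" using b(2) by (auto simp:verts_def)
  hence "i ~= j" using w(1) i(2) by blast
  thus False using b_om[OF b(1) i(1) j(1)] j(2) w(2) by simp
 qed
 ultimately have "seps l C' \<subset> seps l C" by blast
 hence "card (seps l C') < card (seps l C)" using finite_Ph by (intro psubset_card_mono) (auto simp:seps_def)
 thus ?thesis using C' by blast
qed

end

section \<open>Parities, classes modulo 2M and the homology of one region\<close>

definition ev :: "real=>bool" where
 "ev x <-> (EX k::int. x = 2 * of_int k)"

lemma ev_add:"ev x ==> ev y ==> ev (x + y)" unfolding ev_def by (metis distrib_left of_int_add)

lemma ev_minus:"ev x ==> ev (- x)" unfolding ev_def by (metis mult_minus_right of_int_minus)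

lemma ev_minus_iff:"ev (- x) <-> ev x" using ev_minus[of x] ev_minus[of "- x"] by auto

lemma ev_diff:"ev x ==> ev y ==> ev (x - y)" using ev_add[of x "- y"] ev_minus[of y] by simp

lemma ev_0:"ev 0" and ev_2:"ev 2" unfolding ev_def by (metis mult_zero_right of_int_0, metis mult.right_neutral of_int_1)

lemma ev_sum:"(!!i. i:A ==> ev (f i)) ==> ev (SUM i:A. f i)"
 by (induction A rule:infinite_finite_induct) (auto intro:ev_add ev_0)

lemma ev_mult:"ev x ==> y:\<int> ==> ev (x * y)" unfolding ev_def by (metis Ints_cases mult.assoc of_int_mult)

lemma ev_double:"x:\<int> ==> ev (2 * x)" using ev_mult[OF ev_2] .

lemma ev_cong:"ev (x - y) ==> ev x <-> ev y" using ev_add[of "x - y" y] ev_diff[of x "x - y"] by auto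

lemma not_ev:"x:\<int> ==> ~ev x ==> ev (x - 1)"
proof -
 assume "x:\<int>" "~ev x"
 then obtain k where k:"x = of_int k" by (auto elim:Ints_cases)
 obtain l where "k = 2 * l + 1" by (metis \<open>~ev x\<close> k dvdE of_int_mult of_int_numeral oddE ev_def)
 thus ?thesis using k by (auto simp:ev_def)
qed

lemma ev_of_int [simp]:"ev (of_int k) <-> even k"
proof
 assume "ev (of_int k)"
 then obtain l where "of_int k = (of_int (2 * l) :: real)" unfolding ev_def by auto
 hence "k = 2 * l" by linarith
 thus "even k" by simp
next
 assume "even k"
 then obtain l where "k = 2 * l" by (rule evenE)
 thus "ev (of_int k)" unfolding ev_def by auto
qed

lemma not_ev_1:"~ev 1" using ev_of_int[of 1] by simp

context E_roots
begin

definition nsum :: "(nat=>'a)=>nat set=>'a" where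
 "nsum b S = (SUM i:S. b i)"

lemma E_cartan_nonpos:"i ~= j ==> E_cartan i j <= 0" by (simp add:cartan_code)

lemma node_sum_om:
 assumes b:"b:bases" and C:"C <= NN" and i:"i:NN"
 shows "ip (nsum b C) (om b i) = (if i:C then 1 else 0)"
proof -
 have "ip (nsum b C) (om b i) = (SUM k:C. if k = i then 1 else 0)"
  unfolding nsum_def ip_suml using b_om[OF b _ i] C by (intro sum.cong) auto
 thus ?thesis using finite_subset[OF C] by simp
qed

text \<open>Take C maximal among the sets whose simple roots sum to a root. If \<open>b k\<close>
  had nonzero, hence negative, product t with this sum, adding it would give a vector of norm 4 + 2
  t > 0; so t = -1, and the larger sum would be a root too.\<close>

lemma component:
 assumes b:"b:bases" and S:"S <= NN" and i:"i:S"
 obtains C where "C <= S" "i:C" "nsum b C:Ph" "!!k. k:S - C ==> ip (b k) (nsum b C) = 0"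
proof -
 let ?Cs = "{C. C <= S & i:C & nsum b C:Ph}"
 have finS:"finite S" using finite_subset[OF S] by simp
 hence "finite ?Cs" by simp
 moreover have "{i}:?Cs" using i b_root[OF b] S by (auto simp:nsum_def)
 ultimately obtain C where C:"C:?Cs" "!!C'. C':?Cs ==> C <= C' ==> C = C'"
  using finite_has_maximal[of ?Cs] by (metis (no_types, lifting) empty_iff)
 have CS:"C <= NN" "finite C" using C(1) S finS finite_subset by auto
 have "ip (b k) (nsum b C) = 0" if k:"k:S - C" for k
 proof (rule ccontr)
  assume nz:"ip (b k) (nsum b C) ~= 0"
  define t where "t = (SUM l:C. E_cartan k l)"
  have kn:"k:NN" using k S by blast
  have t:"ip (b k) (nsum b C) = of_int t"
   unfolding nsum_def ip_sumr t_def of_int_sum using gram[OF b kn] CS by (intro sum.cong) auto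
  have "t <= 0" unfolding t_def using k by (intro sum_nonpos E_cartan_nonpos) auto
  let ?x = "nsum b (insert k C)"
  have x:"?x = b k + nsum b C" using k CS by (simp add:nsum_def)
  have "ip ?x ?x = 4 + 2 * of_int t" using t root_norm[OF b_root[OF b kn]] root_norm[of "nsum b C"] C(1)
   by (simp add:x ip_addl ip_addr ip_com[of "nsum b C" "b k"])
  moreover have "?x ~= 0" using node_sum_om[OF b _ kn, of "insert k C"] CS kn by (auto simp:ip_0_left)
  ultimately have "t > - 2" using ip_pos[of ?x] by linarith
  hence "ip ?x ?x = 2" using \<open>t <= 0\<close> nz t \<open>ip ?x ?x = 4 + 2 * of_int t\<close> by simp
  moreover have "?x:M" unfolding x using b_root[OF b kn] C(1) by (intro M_add root_M) auto
  ultimately show False using C(1) k C(2)[of "insert k C"] by (auto simp:root_iff)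
 qed
 thus ?thesis using that C(1) by blast
qed

lemma strict_unique:
 assumes b:"b:bases" and b':"b':bases"
  and y:"!!i. i:NN ==> ip (b i) y > 0" and y':"!!i. i:NN ==> ip (b' i) y >= 0"
 shows "b = b'"
proof -
 have "ip (b' i) (om b j) >= 0" if i:"i:NN" and j:"j:NN" for i j
 proof -
  have "(SUM j:NN. ip (b j) y * ip (b' i) (om b j)) >= 0"
   using y'[OF i] by (subst (asm) b_exp(1)[OF b, of y]) (simp add:ip_sumr ip_sr)
  thus ?thesis
   using sum_coherent(1)[of "NN" "%j. ip (b j) y" "%j. ip (b' i) (om b j)", OF finite_nodes y root_om[OF b b_root[OF b' i]]] j by simp
 qed
 hence om:"om b j = om b' j" if "j:NN" for j using dom_vertex[OF b' b that] that by blast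
 have "b k = b' k" if k:"k:NN" for k
 proof -
  have "b k = (SUM i:NN. ip (om b' i) (b k) *r b' i)" by (rule b_exp(2)[OF b'])
  also have "... = (SUM i:NN. if i = k then b' i else 0)"
   using om_b[OF b k] om by (intro sum.cong refl) (metis scaleR_one scaleR_zero_left)
  finally show ?thesis using k by simp
 qed
 moreover have "b:extensional (NN)" "b':extensional (NN)" using b b' by (auto simp:bases_def PiE_def)
 ultimately show ?thesis by (metis extensionalityI)
qed

lemma sum_verts:
 assumes b:"b:bases"
 shows "(SUM v:verts b. g v) = (SUM i:NN. g (om b i))"
 unfolding verts_def by (rule sum.reindex[OF om_inj[OF b], unfolded comp_def])

lemma base_center_verts:
 assumes b:"b:bases" and i:"i:NN"
 shows "ip (b i) (center (verts b)) = 1" unfolding center_def sum_verts[OF b] using base_sum_om[OF b i, of "%_. 1"] by simp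

lemma verts_inj:
 assumes "b:bases" "b':bases" "verts b <= verts b'"
 shows "b = b'"
  using om_inj assms card_subset_eq[OF finite_verts assms(3)] strict_unique[OF assms(1,2), of "center (verts b)"] base_center_verts[OF assms(1)] base_center_verts[OF assms(2)] by (auto simp:verts_def card_image)

lemma descents_verts:
 assumes b:"b:bases"
 shows "descs l (verts b) = {om b i |i. i:NN & ip (b i) l < 0}"
  using assms verts_inj[OF b] by (auto simp:descs_def verts_def)

lemma generic_cell_verts:
 assumes g:"!!be. be:Ph ==> EX y:region Gm. ip be y ~= 0"
 shows "gcells Gm = verts ` {b:bases. verts b <= region Gm}"
proof
 show "gcells Gm <= verts ` {b:bases. verts b <= region Gm}"
 proof
  fix C assume C:"C:gcells Gm"
  hence CK:"C:K" "C <= region Gm" by (auto simp:gcells_def rcells_def)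
  then obtain b where b:"b:bases" "C <= verts b" by (auto simp:K_def)
  have "om b i:C" if i:"i:NN" for i using cell_base_off[OF C b i] g[OF b_root[OF b(1) i]] by blast
  thus "C:verts ` {b:bases. verts b <= region Gm}" using b CK by (auto simp:verts_def)
 qed
 show "verts ` {b:bases. verts b <= region Gm} <= gcells Gm"
 proof
  fix C assume "C:verts ` {b:bases. verts b <= region Gm}"
  then obtain b where b:"b:bases" "C = verts b" "verts b <= region Gm" by blast
  have "ip be (center C) ~= 0" if be:"be:Ph" for be
  proof
   assume "ip be (center C) = 0"
   hence "!i:NN. ip be (om b i) = 0" using root_center(2)[OF verts_K[OF b(1)] be] b(2) by (auto simp:verts_def)
   thus False using root_norm[OF be] by (simp add:ip_expand[OF b(1), of be be] ip_com)
  qed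
  thus "C:gcells Gm" using b verts_K[OF b(1)] by (auto simp:gcells_def rcells_def generic_def)
 qed
qed

end

locale E_class = E_roots +
 fixes mu :: 'a and h :: "'a set set=>nat=>nat" and r :: "'a set set=>'a set set=>nat=>nat"
 assumes mu:"mu:M" and hf:"homfun K (%v. ~ev (ip mu v)) h r"
begin

sublocale homfun K "%v. ~ev (ip mu v)" h r by (rule hf)

definition "oddn b = {i:NN. ~ev (ip mu (om b i))}"

lemma shelling_region:
 assumes Gm:"Gm <= Ph" and l:"l:region Gm" "generic Gm l"
 shows "shelling (gcells Gm) (%C. card (seps l C)) (descs l)" unfolding shelling_def
proof (intro conjI ballI allI impI)
 show "gcells Gm <= K" by (auto simp:gcells_def rcells_def)
 thus "finite (gcells Gm)" using K_finite finite_subset by blast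
 show "descs l C <= C" for C by (auto simp:descs_def)
 show "EX i:descs l C. i ~: F" if "C:gcells Gm" "C':gcells Gm" "F <= C" "F <= C'"
  "C' ~= C" "card (seps l C') <= card (seps l C)" for C C' F
  using region_shelling_P1[OF Gm l that(1-4,6)] that(5) by blast
 show "EX C':gcells Gm. card (seps l C') < card (seps l C) & C - {i} <= C'"
  if "C:gcells Gm" "i:descs l C" for C i by (rule region_shelling_P2[OF Gm l that])
qed

lemma cplx_rc:"complex (rcells Gm)" unfolding subcx_def rcells_def using K_face K_nonempty by blast

text \<open>Modulo 2, mu is the sum of the simple roots at its odd nodes, and those outside C are
  orthogonal to the root of C; so its product with mu has the parity of its own norm 2.\<close>

lemma even_component:
 assumes b:"b:bases" and C:"C <= oddn b" "nsum b C:Ph"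
  and orth:"!!k. k:oddn b - C ==> ip (b k) (nsum b C) = 0"
 shows "ev (ip (nsum b C) mu)"
proof -
 let ?ga = "nsum b C"
 have Cn:"C <= NN" using C(1) by (auto simp:oddn_def)
 have int:"ip (b k) ?ga:\<int>" if "k:NN" for k using M_M_int root_M b_root[OF b that] C(2) by blast
 have "ip mu ?ga = (SUM k:NN. ip (om b k) mu * ip (b k) ?ga)" by (rule ip_expand[OF b])
 moreover have "ip ?ga ?ga = (SUM k:NN. (if k:C then 1 else 0) * ip (b k) ?ga)"
  unfolding ip_expand[OF b, of ?ga ?ga] using node_sum_om[OF b Cn] ip_com by (intro sum.cong) auto
 ultimately have "ip mu ?ga - ip ?ga ?ga = (SUM k:NN. (ip (om b k) mu - (if k:C then 1 else 0)) * ip (b k) ?ga)"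
  by (simp add:sum_subtractf left_diff_distrib)
 moreover have "ev ((ip (om b k) mu - (if k:C then 1 else 0)) * ip (b k) ?ga)" if k:"k:NN" for k
  using that orth mu k M_iff[OF b] C(1) not_ev int[OF k] ev_mult by (cases "k:oddn b - C") (auto simp:ev_0 oddn_def ip_com)
 ultimately have "ev (ip mu ?ga - ip ?ga ?ga)" by (simp add:ev_sum)
 thus ?thesis using root_norm[OF C(2)] ev_add[OF _ ev_2] by (fastforce simp:ip_com)
qed

text \<open>The region of these roots is the closed cell around p in the arrangement of those even
  walls that do not contain p.\<close>

definition "evab p = {ga:Ph. ev (ip ga mu) & ip ga p > 0}"

lemma evab_roots:"evab p <= Ph" by (auto simp:evab_def)

lemma p_region:"p:region (evab p)" by (auto simp:region_def evab_def)

lemma region_full: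
 assumes "be:Ph"
 shows "EX y:region (evab p). ip be y ~= 0"
proof (cases "ip be p = 0")
 case True
 obtain ep :: real where ep:"ep > 0" "!!ga. ga:Ph ==> ip ga p > 0 ==> ip ga (p + ep *r be) > 0"
  by (rule root_perturb[of p be], rule that)
 have "p + ep *r be:region (evab p)" using ep(2) by (auto simp:region_def evab_def less_imp_le)
 moreover have "ip be (p + ep *r be) ~= 0" using True ep(1) root_norm[OF assms] by (simp add:ip_addr ip_sr)
 ultimately show ?thesis by blast
qed (use p_region in blast)

text \<open>If p were negative on \<open>b i\<close>, then i would be a descent and hence an odd
  node, while p is nonpositive on all odd nodes. The root of the component of i is then even and
  negative at p, but positive at the vertex \<open>om b i\<close>, which lies in the region.\<close>

lemma critical_dominant:
 assumes par:"!!be. be:Ph ==> ev (ip be p - ip be mu)"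
  and l:"!!be. be:Ph ==> ip be p > 0 ==> ip be l > 0"
  and b:"b:bases" "verts b <= region (evab p)" and crit:"{i:NN. ip (b i) l < 0} = oddn b"
 shows "dominant b p" unfolding dominant_def
proof (rule ccontr)
 assume "~(!i:NN. 0 <= ip (b i) p)"
 then obtain i where i:"i:NN" "ip (b i) p < 0" by force
 have neg:"ip (b k) l < 0" if "k:NN" "ip (b k) p < 0" for k
  using l[OF root_minus[OF b_root[OF b(1) that(1)]]] that(2) by (simp add:ip_ml)
 have nonpos:"ip (b k) p <= 0" if "k:oddn b" for k using l[OF b_root[OF b(1)], of k] that crit by force
 have iS:"i:oddn b" using neg[OF i] i(1) crit by blast
 have Sn:"oddn b <= NN" by (auto simp:oddn_def)
 obtain C where C:"C <= oddn b" "i:C" "nsum b C:Ph"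
  "!!k. k:oddn b - C ==> ip (b k) (nsum b C) = 0" by (rule component[OF b(1) Sn iS], rule that)
 let ?ga = "nsum b C"
 have "(SUM k:C. - ip (b k) p) > 0" using C(1,2) i nonpos finite_subset[of C "NN"] Sn by (intro sum_pos2[of _ i]) auto
 hence lt:"ip (- ?ga) p > 0" by (simp add:nsum_def ip_ml ip_suml sum_negf)
 have "- ?ga:evab p"
  using even_component[OF b(1) C(1,3,4)] lt root_minus[OF C(3)] by (simp add:evab_def ip_ml ev_minus)
 moreover have "om b i:verts b" using i(1) by (simp add:verts_def)
 ultimately show False using b(2) node_sum_om[OF b(1) _ i(1), of C] C(1,2) Sn by (force simp:region_def ip_ml)
qed

text \<open>Critical chambers are dominant for p, and all chambers dominant for p share the odd
  nodes S. So the critical ones are those dominant chambers whose negative nodes at l are exactly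
  S.\<close>

theorem h_region:
 assumes par:"!!be. be:Ph ==> ev (ip be p - ip be mu)"
  and S:"!!b. b:bases ==> dominant b p ==> oddn b = S" and d:"card S >= 1"
 obtains l where "!!be. be:Ph ==> ip be l ~= 0" "!!be. be:Ph ==> ip be p > 0 ==> ip be l > 0"
  "!!k. h (rcells (evab p)) k =
   conc (card S) (card {b:bases. dominant b p & {i:NN. ip (b i) l < 0} = S}) k"
proof -
 let ?Gm = "evab p"
 obtain l where l:"l:region ?Gm" "generic ?Gm l" "!!be. be:Ph ==> ip be p > 0 ==> ip be l > 0"
  by (rule exists_generic[OF p_region[of p]], rule that)
 have nz:"ip be l ~= 0" if "be:Ph" for be using l(2) region_full[OF that] that unfolding generic_def by blast
 let ?B = "{b:bases. dominant b p & {i:NN. ip (b i) l < 0} = S}"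
 have cells:"gcells ?Gm = verts ` {b:bases. verts b <= region ?Gm}" by (rule generic_cell_verts[OF region_full])
 have crit:"descs l (verts b) = odds (verts b) <-> {i:NN. ip (b i) l < 0} = oddn b"
  if b:"b:bases" for b
 proof -
  have "odds (verts b) = om b ` oddn b" by (auto simp:odds_def oddn_def verts_def)
  moreover have "descs l (verts b) = om b ` {i:NN. ip (b i) l < 0}" unfolding descents_verts[OF b] by blast
  moreover have "oddn b <= NN" "{i:NN. ip (b i) l < 0} <= NN" by (auto simp:oddn_def)
  ultimately show ?thesis using inj_on_image_eq_iff[OF om_inj[OF b], of "{i:NN. ip (b i) l < 0}" "oddn b"] by simp
 qed
 have dom:"b:?B <-> b:bases & verts b <= region ?Gm & descs l (verts b) = odds (verts b)" for b
 proof
  assume "b:?B"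
  hence b:"b:bases" "dominant b p" "{i:NN. ip (b i) l < 0} = S" by auto
  have "ip ga (om b i) >= 0" if g:"ga:?Gm" and i:"i:NN" for ga i
  proof -
   have ga:"ga:Ph" "ip ga p > 0" using g by (auto simp:evab_def)
   have "ip ga p = (SUM i:NN. ip ga (om b i) * ip (b i) p)"
    unfolding ip_expand[OF b(1), of ga p] using ip_com by (metis (no_types, lifting))
   thus ?thesis
  using ga(2) b(2) sum_nonpos[of "NN" "%i. ip ga (om b i) * ip (b i) p"] root_om[OF b(1) ga(1)] i by (force simp:dominant_def mult_nonpos_nonneg)
  qed
  thus "b:bases & verts b <= region ?Gm & descs l (verts b) = odds (verts b)"
  using b S[OF b(1,2)] crit[OF b(1)] by (auto simp:region_def verts_def)
 next
  assume *: "b:bases & verts b <= region ?Gm & descs l (verts b) = odds (verts b)"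
  hence c:"{i:NN. ip (b i) l < 0} = oddn b" using crit by blast
  hence "dominant b p" using critical_dominant[OF par l(3)] * by blast
  thus "b:?B" using S c * by blast
 qed
 have crits:"{C:gcells ?Gm. descs l C = odds C} = verts ` ?B" unfolding cells using dom by blast
 have cB:"card (odds C) = card S" if CB:"C:verts ` ?B" for C
 proof -
  obtain b where b:"b:?B" "C = verts b" using CB by blast
  hence bb:"b:bases" "{i:NN. ip (b i) l < 0} = S" by auto
  have "odds C = om b ` S" using dom[of b] b descents_verts[OF bb(1)] by blast
  moreover have "inj_on (om b) S" using om_inj[OF bb(1)] bb(2) by (auto intro:inj_on_subset)
  ultimately show ?thesis by (simp add:card_image)
 qed
 have inj:"inj_on verts ?B" by (rule inj_onI) (use verts_inj in auto)
 have "h (\<Union> (Pow ` gcells ?Gm)) k = conc (card S) (card {C:gcells ?Gm. descs l C = odds C}) k" for k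
 proof (rule h_shelling[OF shelling_region[OF evab_roots l(1,2)] gcells_ne[OF evab_roots l(1,2)]])
  show "card (descs l C) = card S" if "C:gcells ?Gm" "descs l C = odds C" for C using that crits cB by auto
 qed (rule d)
 hence "h (rcells ?Gm) k = conc (card S) (card ?B) k" for k
  using Union_generic_cells[OF evab_roots l(1,2)] crits card_image[OF inj] by simp
 thus ?thesis using that[OF nz l(3)] by blast
qed

text \<open>Moving l towards q achieves t(l) > 0. In a critical cell, l has negative coordinates at
  the odd vertices, where t is nonnegative, and t vanishes at the even ones; so t(l), expanded over
  the vertices, would be at most 0.\<close>

theorem h_region_acyclic:
 assumes Gm:"Gm <= Ph" and t:"!!x. x:region Gm ==> ip t x >= 0" and q:"q:region Gm" "ip t q > 0"
  and even_v:"!!v. {v}:rcells Gm ==> ev (ip mu v) ==> ip t v = 0"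
 shows "h (rcells Gm) k = 0"
proof -
 obtain l0 where l0:"l0:region Gm" "generic Gm l0" by (rule exists_generic[OF q(1)], rule that)
 obtain ep :: real where ep:"ep > 0" "!!be. be:Ph ==> ip be l0 > 0 ==> ip be (l0 + ep *r q) > 0"
  "!!be. be:Ph ==> ip be l0 < 0 ==> ip be (l0 + ep *r q) < 0" by (rule root_perturb[of l0 q], rule that)
 define l where "l = l0 + ep *r q"
 have l:"l:region Gm" unfolding l_def using ep(1) by (intro region_add l0 region_scale q) simp
 have "generic Gm l" unfolding generic_def
 proof (intro ballI impI)
  fix be y assume *: "be:Ph" "ip be l = 0" "y:region Gm"
  hence "ip be l0 = 0" using ep(2,3)[OF *(1)] unfolding l_def by force
  thus "ip be y = 0" using l0(2) * unfolding generic_def by blast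
 qed
 have tl:"ip t l > 0" unfolding l_def ip_addr ip_sr using t[OF l0(1)] ep(1) q(2) by (simp add:add_nonneg_pos)
 have no:"descs l C ~= odds C" if C:"C:gcells Gm" for C
 proof
  assume D:"descs l C = odds C"
  have CK:"C:K" "C <= region Gm" using C by (auto simp:gcells_def rcells_def)
  then obtain b where b:"b:bases" "C <= verts b" by (auto simp:K_def)
  have "ip (b i) l * ip t (om b i) <= 0" if i:"i:NN" for i
  proof (cases "om b i:C")
   case False
   thus ?thesis using cell_base_off[OF C b i _ l] by simp
  next
   case True
   hence tp:"ip t (om b i) >= 0" using t CK(2) by blast
   show ?thesis
   proof (cases "ev (ip mu (om b i))")
    case ev:True
    show ?thesis using True CK K_face[OF CK(1), of "{om b i}"] even_v ev by (auto simp:rcells_def)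
   next
    case False
    hence "om b i:descs l C" using True D by (simp add:odds_def)
    then obtain b' i' where b':"b':bases" "C <= verts b'" "i':NN" "om b i = om b' i'" "ip (b' i') l < 0"
     unfolding descs_def by blast
    \<comment> \<open>The coordinate of l at a vertex of C does not depend on the base around C,
      since l has no coordinates off the cell.\<close>
    have "ip (b i) l < 0"
    proof -
     have off:"ip (b' k) l = 0" if "k:NN" "om b' k ~: C" for k by (rule cell_base_off[OF C b'(1,2) that l])
     have "ip (b i) l = ip (b i) (SUM k:NN. ip (b' k) l *r om b' k)" using b_exp(1)[OF b'(1)] by auto
     also have "... = (SUM k:NN. ip (b' k) l * ip (b i) (om b' k))" by (simp only:ip_sumr ip_sr)
     also have "(SUM k:NN. ip (b' k) l * ip (b i) (om b' k)) = (SUM k:NN. if k = i' then ip (b' k) l else 0)"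
     proof (intro sum.cong refl)
      fix k assume k:"k:NN"
      show "ip (b' k) l * ip (b i) (om b' k) = (if k = i' then ip (b' k) l else 0)"
      proof (cases "om b' k:C")
       case True
       then obtain m where m:"m:NN" "om b' k = om b m" using b(2) by (auto simp:verts_def)
       show ?thesis using m b'(3,4) k i inj_onD[OF om_inj[OF b(1)]] inj_onD[OF om_inj[OF b'(1)]] b_om[OF b(1) i m(1)] by auto
      next
       case False
       thus ?thesis using off[OF k False] by auto
      qed
     qed
     also have "... = ip (b' i') l" using b'(3) by simp
     finally show ?thesis using b'(5) by simp
    qed
    thus ?thesis using tp by (simp add:mult_nonpos_nonneg)
   qed
  qed
  hence "(SUM i:NN. ip (b i) l * ip t (om b i)) <= 0" by (rule sum_nonpos)
  moreover have "ip t l = (SUM i:NN. ip (b i) l * ip t (om b i))"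
   by (subst b_exp(1)[OF b(1), of l]) (simp add:ip_sumr ip_sr)
  ultimately show False using tl by simp
 qed
 have "h (\<Union> (Pow ` gcells Gm)) k = conc 1 (card {C:gcells Gm. descs l C = odds C}) k"
  by (rule h_shelling[OF shelling_region[OF Gm l \<open>generic Gm l\<close>] gcells_ne[OF Gm l \<open>generic Gm l\<close>]])
   (use no in auto)
 moreover have "{C:gcells Gm. descs l C = odds C} = {}" using no by blast
 ultimately show ?thesis using Union_generic_cells[OF Gm l \<open>generic Gm l\<close>] by (simp add:conc_def)
qed

end

section \<open>Orders of parabolic subgroups by enumeration of orbits\<close>

definition nbrs :: "nat=>nat list" where
 "nbrs i = [[],[3],[4],[1,4],[2,3,5],[4,6],[5,7],[6,8],[7]] ! i"

text \<open>A vector in the orbit of the fundamental weight of j is stored by the combination a of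
  simple roots that is subtracted from that weight; this is its product with the simple root i.
  Entry 0 is a dummy, and for E7 entry 8 stays 0.\<close>

definition pairing :: "nat=>nat=>int list=>int" where
 "pairing j i a = (if i = j then 1 else 0) - 2 * a ! i + sum_list (map (%k. a ! k) (nbrs i))"

definition "reflect j i a = a[i := a ! i + pairing j i a]"

text \<open>Breadth first search from the dominant vector, going down only. The result is not
  trusted: \<open>orbit_ok\<close> checks that it is closed under the reflections and free of
  repetitions.\<close>

primrec search :: "nat=>nat=>nat list=>int list list=>int list list=>int list list" where
 "search 0 j X F S = S"
| "search (Suc m) j X F S = (case F of []=>S | a # F' =>
  (let new = filter (%a'. a' ~: set S) (map (%i. reflect j i a) (filter (%i. pairing j i a > 0) X))
  in search m j X (F' @ new) (S @ new)))"

text \<open>The bound 100 suffices: the largest orbit that occurs has 56 vectors, for the node 7 of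
  E7.\<close>

definition "orbit j X = search 100 j X [replicate 9 0] [replicate 9 0]"

definition "orbit_ok j X L <-> distinct L &
  list_all (%a. length a = 9 & list_all (%k. a ! k = 0 \<or> k:set X) [0..<9] &
   list_all (%i. pairing j i a = 0 \<or> reflect j i a:set L) X) L"

primrec int_length :: "'b list=>int" where
 "int_length [] = 0"
| "int_length (x # xs) = 1 + int_length xs"

lemma int_length:"int_length xs = int (length xs)" by (induction xs) auto

text \<open>Integers, because the code equations of \<open>nat\<close> compute in unary.\<close>

primrec worder :: "nat list=>int" where
 "worder [] = 1"
| "worder (j # X) =
  (let L = orbit j (j # X) in if orbit_ok j (j # X) L then int_length L * worder X else 0)"

inductive_set reachable :: "nat=>nat list=>int list set" for j X where
 zero:"replicate 9 0:reachable j X"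
| reflect:"a:reachable j X ==> i:set X ==> reflect j i a:reachable j X"

lemma search_reachable:
 "set F <= reachable j X ==> set S <= reachable j X ==> set (search m j X F S) <= reachable j X"
 and search_mono:"set S <= set (search m j X F S)"
proof (induction m arbitrary:F S)
 case (Suc m)
 { case 1
  show ?case
  proof (cases F)
   case (Cons a F')
   let ?new = "filter (%a'. a' ~: set S) (map (%i. reflect j i a) (filter (%i. pairing j i a > 0) X))"
   have "set ?new <= reachable j X" using 1(1) Cons by (auto intro:reachable.reflect)
   hence "set (search m j X (F' @ ?new) (S @ ?new)) <= reachable j X" using 1 Cons by (intro Suc.IH(1)) auto
   thus ?thesis using Cons by (simp add:Let_def)
  qed (use 1 in simp)
 next
  case 2
  show ?case using Suc.IH(2) by (cases F) (force simp:Let_def)+ }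
qed auto

lemma orbit_reachable:"set (orbit j X) <= reachable j X" and zero_orbit:"replicate 9 0:set (orbit j X)"
proof -
 show "set (orbit j X) <= reachable j X" unfolding orbit_def by (rule search_reachable) (auto intro:reachable.zero)
 show "replicate 9 0:set (orbit j X)"
  unfolding orbit_def using search_mono[of "[replicate 9 0]" 100 j X "[replicate 9 0]"] by (metis list.set_intros(1) subsetD)
qed

lemma pairing_E_cartan:
 assumes "i:nodes 8"
 shows "pairing j i a = (if i = j then 1 else 0) - (SUM k:nodes 8. a ! k * E_cartan i k)"
 using assms unfolding nodes8 by (elim insertE emptyE; hypsubst) (simp_all add:pairing_def nbrs_def cartan_code E_edges_def)

context E_roots
begin

text \<open>The coset of the parabolic subgroup of X that contains b, seen as the set of chambers
  around a face.\<close>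

definition "fclass b X = {b':bases. !k:NN - X. om b' k = om b k}"

definition "ovec X b j a = om b j - (SUM k:set X. of_int (a ! k) *r b k)"

lemma face_class_self:"b:bases ==> b:fclass b X" by (simp add:fclass_def)

lemma fclass_bases:"fclass b X <= bases" by (auto simp:fclass_def)

lemma fin_fclass:"finite (fclass b X)" using finite_bases fclass_bases finite_subset by blast

lemma refl_om:
 assumes "b:bases" "i:NN" "k:NN"
 shows "refl (b i) (om b k) = om b k - (if i = k then 1 else 0) *r b i" unfolding refl_def using b_om[OF assms] by simp

lemma face_class_refl:
 assumes b':"b':fclass b X" and i:"i:X" "X <= NN"
 shows "rbase (b' i) b':fclass b X"
proof -
 have *: "b':bases" "i:NN" using assms by (auto simp:fclass_def)
 have "om (rbase (b' i) b') k = om b k" if "k:NN - X" for k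
  using that refl_om[OF *, of k] i b' by (auto simp:om_rbase fclass_def)
 thus ?thesis using rbase[OF b_root[OF *] *(1)] by (simp add:fclass_def)
qed

lemma face_class_refl_left:
 assumes b:"b:bases" and b':"b':fclass b X" and i:"i:X" "X <= NN"
 shows "rbase (b i) b':fclass b X"
proof -
 have *: "b':bases" "i:NN" using assms by (auto simp:fclass_def)
 have "om (rbase (b i) b') k = om b k" if k:"k:NN - X" for k
  using that b' refl_om[OF b *(2), of k] i by (auto simp:fclass_def om_rbase)
 thus ?thesis using rbase[OF b_root[OF b *(2)] *(1)] by (simp add:fclass_def)
qed

lemma refl_minus_refl:"be:Ph ==> refl (- be) (refl be x) = x" using root_norm[of be] by (simp add:refl_def ip_simps)

lemma refl_base_invol:
 assumes "b:bases" "i:NN"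
 shows "rbase (rbase (b i) b i) (rbase (b i) b) = b"
  using root_norm[OF b_root[OF assms]] assms refl_minus_refl[OF b_root[OF assms]] by (force simp:refl_def scaleR_2 rbase_def bases_def restrict_def PiE_def extensional_def)

text \<open>Near the sum \<open>q\<close> of the common vertices only the roots of X matter, and a
  small displacement of \<open>q\<close> towards y is strictly dominant for b.\<close>

lemma face_unique:
 assumes b:"b:bases" and b':"b':fclass b X" and X:"X <= NN"
  and y:"!!i. i:X ==> ip (b i) y > 0" and y':"!!i. i:X ==> ip (b' i) y >= 0"
 shows "b = b'"
proof -
 have bb':"b':bases" "!!k. k:NN - X ==> om b' k = om b k" using b' by (auto simp:fclass_def)
 define q where "q = (SUM k:NN - X. om b k)"
 have q:"ip (b'' i) q = (if i:X then 0 else 1)" if "b'':bases" "i:NN" "!k:NN - X. om b'' k = om b k" for b'' i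
 proof -
  have "ip (b'' i) q = (SUM k:NN - X. ip (b'' i) (om b'' k))" unfolding q_def ip_sumr using that(3) by (intro sum.cong) auto
  also have "... = (SUM k:NN - X. if k = i then 1 else 0)" using b_om[OF that(1,2)] by (intro sum.cong) auto
  finally show ?thesis using that(2) by simp
 qed
 obtain ep :: real where ep:"ep > 0" "!!be. be:Ph ==> ip be q > 0 ==> ip be (q + ep *r y) > 0"
  by (rule root_perturb[of q y], rule that)
 show ?thesis
 proof (rule strict_unique[OF b bb'(1)])
  fix i assume i:"i:NN"
  show "ip (b i) (q + ep *r y) > 0"
  using q[OF b i] y ep(1) ep(2)[OF b_root[OF b i]] by (auto simp:ip_addr ip_sr)
  show "ip (b' i) (q + ep *r y) >= 0"
  using q[OF bb'(1) i] bb'(2) y' ep(1) ep(2)[OF b_root[OF bb'(1) i]] by (auto simp:ip_addr ip_sr)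
 qed
qed

lemma refl_orbit_vec:
 assumes b:"b:bases" and X:"set X <= NN" "distinct X" and i:"i:set X"
  and a:"length a = 9" "!!k. k < 9 ==> k ~: set X ==> a ! k = 0" and j:"j:NN"
 shows "refl (b i) (ovec X b j a) = ovec X b j (reflect j i a)"
proof -
 have sub:"NN <= nodes 8" using n by (auto simp:nodes_def)
 have i8:"i:nodes 8" "i < 9" "i:NN" using i X sub by (auto simp:nodes_def)
 have "ip (b i) (ovec X b j a) = (if i = j then 1 else 0) - (SUM k:set X. of_int (a ! k * E_cartan i k))"
  unfolding ovec_def ip_dr ip_sumr ip_sr b_om[OF b i8(3) j]
  using gram[OF b i8(3)] X(1) by (intro arg_cong2[where f = "(-)"] sum.cong refl) auto
 also have "(SUM k:set X. of_int (a ! k * E_cartan i k)) = (of_int (SUM k:set X. a ! k * E_cartan i k) :: real)" by simp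
 also have "(SUM k:set X. a ! k * E_cartan i k) = (SUM k:nodes 8. a ! k * E_cartan i k)"
  using X sub a(2) by (intro sum.mono_neutral_left) (auto simp:nodes_def)
 finally have p:"ip (b i) (ovec X b j a) = of_int (pairing j i a)" by (simp add:pairing_E_cartan[OF i8(1)])
 have "(SUM k:set X. of_int (reflect j i a ! k) *r b k) =
   (SUM k:set X. of_int (a ! k) *r b k + (if k = i then of_int (pairing j i a) *r b i else 0))"
  using i8(2) a(1) by (intro sum.cong) (auto simp:reflect_def scaleR_add_left)
 also have "... = (SUM k:set X. of_int (a ! k) *r b k) + of_int (pairing j i a) *r b i"
  using i by (simp add:sum.distrib)
 finally show ?thesis unfolding refl_def p by (simp add:ovec_def)
qed

lemma orbit_vec_inj:
 assumes b:"b:bases" and X:"set X <= NN"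
  and a:"length a = 9" "!!k. k < 9 ==> k ~: set X ==> a ! k = 0"
  and a':"length a' = 9" "!!k. k < 9 ==> k ~: set X ==> a' ! k = 0"
  and eq:"ovec X b j a = ovec X b j a'"
 shows "a = a'"
proof (rule nth_equalityI)
 fix k assume "k < length a"
 hence k:"k < 9" using a by simp
 show "a ! k = a' ! k"
 proof (cases "k:set X")
  case True
  hence kn:"k:NN" using X by blast
  have "ip (om b k) (SUM i:set X. of_int (w ! i) *r b i) = of_int (w ! k)" for w :: "int list"
  proof -
   have "ip (om b k) (SUM i:set X. of_int (w ! i) *r b i) = (SUM i:set X. if i = k then of_int (w ! i) else 0)"
    unfolding ip_sumr ip_sr using om_b[OF b _ kn] X by (intro sum.cong) auto
   thus ?thesis using True by simp
  qed
  from this[of a] this[of a'] show ?thesis using eq by (simp add:ovec_def)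
 next
  case False
  thus ?thesis using a(2) a'(2) k by simp
 qed
qed (use a a' in simp)

text \<open>Orbit and stabiliser: \<open>om b' j\<close> runs through the enumerated orbit, and the
  bases with a given value of it form a class for X, to which the induction applies.\<close>

theorem card_face_class:
 assumes b:"b:bases" and X:"set X <= NN" "distinct X" and ok:"worder X ~= 0"
 shows "int (card (fclass b (set X))) = worder X" using assms
proof (induction X arbitrary:b)
 case Nil
 have "fclass b {} = {b}" using face_unique[OF Nil(1), of _ "{}"] face_class_self[OF Nil(1)] by auto
 thus ?case by simp
next
 case (Cons j X)
 let ?Y = "j # X" and ?B = "fclass b (set (j # X))"
 define L where "L = orbit j ?Y"
 have b:"b:bases" and Y:"set ?Y <= NN" "distinct ?Y" and j:"j:NN" using Cons.prems by auto
 have ok:"orbit_ok j ?Y L" "worder X ~= 0" and wo:"worder ?Y = int (length L) * worder X"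
  using Cons.prems(4) by (auto simp:L_def Let_def int_length split:if_splits)
 have LL:"distinct L" "!!a. a:set L ==> length a = 9" "!!a k. a:set L ==> k < 9 ==> k ~: set ?Y ==> a ! k = 0"
  "!!a i. a:set L ==> i:set ?Y ==> reflect j i a:set L"
 proof -
  show "reflect j i a:set L" if "a:set L" "i:set ?Y" for a i
   using ok(1) that unfolding orbit_ok_def list_all_iff by (cases "pairing j i a = 0") (auto simp:reflect_def)
 qed (use ok(1) in \<open>unfold orbit_ok_def list_all_iff, blast, blast, fastforce\<close>)
 let ?v = "ovec ?Y b j"
 have v0:"ovec ?Y b' j (replicate 9 0) = om b' j" for b'
 proof -
  have "(SUM k:set ?Y. of_int (replicate 9 0 ! k) *r b' k) = (SUM k:set ?Y. 0)"
   using Y(1) n by (intro sum.cong) (auto simp:nodes_def)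
  thus ?thesis by (simp only:ovec_def sum.neutral_const diff_0_right)
 qed
 have refl_v:"refl (b' i) (ovec ?Y b' j a) = ovec ?Y b' j (reflect j i a)"
  if "b':bases" "i:set ?Y" "a:set L" for b' i a
  by (rule refl_orbit_vec[OF that(1) Y that(2) LL(2)[OF that(3)] LL(3)[OF that(3)] j])
 \<comment> \<open>The vectors that the list describes relative to b' are among those it describes
   relative to b. Simple reflections of b' preserve this.\<close>
 define P where "P b' <-> (!a:set L. ovec ?Y b' j a:?v ` set L)" for b'
 have P_step:"P (rbase (b' i) b')" if "P b'" "b':bases" "i:set ?Y" for b' i unfolding P_def
 proof
  fix a assume a:"a:set L"
  have "(SUM k:set ?Y. of_int (a ! k) *r rbase (b' i) b' k) = refl (b' i) (SUM k:set ?Y. of_int (a ! k) *r b' k)"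
   unfolding refl_linear using Y(1) by (intro sum.cong refl) (auto simp:rbase_def)
  hence "ovec ?Y (rbase (b' i) b') j a = refl (b' i) (ovec ?Y b' j a)"
   unfolding ovec_def om_rbase by (simp add:refl_def ip_dr scaleR_diff_left)
  also have "... = ovec ?Y b' j (reflect j i a)" by (rule refl_v[OF that(2,3) a])
  also have "...:?v ` set L" using that(1) LL(4)[OF a that(3)] unfolding P_def by blast
  finally show "ovec ?Y (rbase (b' i) b') j a:?v ` set L" .
 qed
 have P_all:"P b'" if b':"b':?B" for b'
 proof (rule ccontr)
  assume "~P b'"
  let ?T = "{b'':?B. ~P b''}"
  \<comment> \<open>The bases violating \<open>P\<close> are closed under reflections, so one of
    them would be dominant for the centre of the chamber of b, and hence equal to b.\<close>
  have "EX b'':?T. !i:set ?Y. ip (b'' i) (center (verts b)) >= 0"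
  proof (rule exists_dominant)
   show "?T <= bases" using fclass_bases by blast
   show "?T ~= {}" using b' \<open>~P b'\<close> by blast
   show "set ?Y <= NN" by (rule Y)
   fix b'' i assume t:"b'':?T" "i:set ?Y"
   hence bb:"b'':bases" "i:NN" using fclass_bases Y(1) by auto
   have m:"rbase (b'' i) b'':?B" using face_class_refl[OF _ t(2) Y(1)] t(1) by blast
   moreover have "~P (rbase (b'' i) b'')"
  using P_step[OF _ _ t(2), of "rbase (b'' i) b''"] m fclass_bases refl_base_invol[OF bb] t(1) by auto
   ultimately show "rbase (b'' i) b'':?T" by blast
  qed
  then obtain b'' where b'':"b'':?T" "!i:set ?Y. ip (b'' i) (center (verts b)) >= 0" by blast
  have "b = b''" by (rule face_unique[OF b _ Y(1), of _ "center (verts b)"])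
    (use b'' base_center_verts[OF b] Y(1) in auto)
  moreover have "P b" by (auto simp:P_def)
  ultimately show False using b''(1) by blast
 qed
 have zL:"replicate 9 0:set L" unfolding L_def by (rule zero_orbit)
 have sub1:"om b' j:?v ` set L" if "b':?B" for b' using P_all[OF that] zL v0[of b'] unfolding P_def by metis
 have sub2:"EX b':?B. om b' j = ?v a" if "a:set L" for a
 proof -
  have "a:reachable j ?Y" using orbit_reachable that unfolding L_def by blast
  hence "a:set L & (EX b':?B. om b' j = ?v a)"
  proof (induction rule:reachable.induct)
   case zero
   thus ?case using zL v0 face_class_self[OF b] by metis
  next
   case (reflect a i)
   then obtain b' where b':"b':?B" "om b' j = ?v a" by blast
   have "rbase (b i) b':?B" by (rule face_class_refl_left[OF b b'(1) reflect(2) Y(1)])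
   moreover have "om (rbase (b i) b') j = ?v (reflect j i a)"
    unfolding om_rbase b'(2) using refl_v[OF b reflect(2)] reflect by blast
   ultimately show ?case using LL(4) reflect by blast
  qed
  thus ?thesis by blast
 qed
 have fiber:"int (card {b':?B. om b' j = ?v a}) = worder X" if a:"a:set L" for a
 proof -
  obtain b1 where b1:"b1:?B" "om b1 j = ?v a" using sub2[OF a] by blast
  hence b1b:"b1:bases" "!!k. k:NN - set ?Y ==> om b1 k = om b k" by (auto simp:fclass_def)
  have e:"NN - set X = insert j (NN - set ?Y)" using j Y(2) by auto
  have "{b':?B. om b' j = ?v a} = fclass b1 (set X)" unfolding fclass_def e using b1b(2) b1(2) by auto
  thus ?thesis using Cons.IH[OF b1b(1)] Cons.prems ok(2) by auto
 qed
 have "?B = (UN a:set L. {b':?B. om b' j = ?v a})" using sub1 by blast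
 hence "card ?B = card (UN a:set L. {b':?B. om b' j = ?v a})" by simp
 also have "... = (SUM a:set L. card {b':?B. om b' j = ?v a})"
 proof (rule card_UN_disjoint)
  show "!a:set L. finite {b':?B. om b' j = ?v a}" using fin_fclass by simp
  show "!a:set L. !a':set L. a ~= a' --> {b':?B. om b' j = ?v a} Int {b':?B. om b' j = ?v a'} = {}"
  proof (intro ballI impI)
   fix a a' assume a:"a:set L" "a':set L" "a ~= a'"
   hence "?v a ~= ?v a'" using orbit_vec_inj[OF b Y(1) LL(2)[OF a(1)] LL(3)[OF a(1)] LL(2)[OF a(2)] LL(3)[OF a(2)]] by metis
   thus "{b':?B. om b' j = ?v a} Int {b':?B. om b' j = ?v a'} = {}" by auto
  qed
 qed simp
 finally have "int (card ?B) = (SUM a:set L. int (card {b':?B. om b' j = ?v a}))" by simp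
 also have "... = int (length L) * worder X" using fiber distinct_card[OF LL(1)] by simp
 finally show ?case using wo by simp
qed

definition pos_on :: "'a=>nat set=>(nat=>'a)=>bool" where
 "pos_on l X b <-> (!i:X. ip (b i) l > 0)"

text \<open>Every coset of the parabolic subgroup of X inside the class has exactly one member whose
  roots at X are positive on l.\<close>

lemma card_positive:
 assumes b:"b:bases" and XI:"set X <= I" "I <= NN" and X:"distinct X" and ok:"worder X ~= 0"
  and l:"!!be. be:Ph ==> ip be l ~= 0"
 shows "int (card {b':fclass b I. pos_on l (set X) b'}) * worder X = int (card (fclass b I))"
proof -
 let ?G = "{b':fclass b I. pos_on l (set X) b'}"
 have Xn:"set X <= NN" using XI by blast
 have sub:"fclass b' (set X) <= fclass b I" if "b':fclass b I" for b'
  using that XI(1) \<open>b' : fclass b I\<close> by (force simp:fclass_def)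
 have "fclass b I = (UN b':?G. fclass b' (set X))"
 proof
  show "fclass b I <= (UN b':?G. fclass b' (set X))"
  proof
   fix b1 assume b1:"b1:fclass b I"
   hence b1b:"b1:bases" using fclass_bases by blast
   have "EX b':fclass b1 (set X). !i:set X. ip (b' i) l >= 0"
   proof (rule exists_dominant[OF fclass_bases _ Xn])
    show "fclass b1 (set X) ~= {}" using face_class_self[OF b1b] by blast
    show "rbase (b' i) b':fclass b1 (set X)" if "b':fclass b1 (set X)" "i:set X" for b' i
     by (rule face_class_refl[OF that Xn])
   qed
   then obtain b' where b':"b':fclass b1 (set X)" "!i:set X. ip (b' i) l >= 0" by blast
   have "pos_on l (set X) b'"
    unfolding pos_on_def using b'(2) l b_root fclass_bases b'(1) Xn by (metis less_eq_real_def subsetD)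
   moreover have "b1:fclass b' (set X)" using b'(1) b1b by (auto simp:fclass_def)
   ultimately show "b1:(UN b':?G. fclass b' (set X))" using sub[OF b1] b'(1) by blast
  qed
 qed (use sub in blast)
 hence "card (fclass b I) = card (UN b':?G. fclass b' (set X))" by (rule arg_cong)
 also have "... = (SUM b':?G. card (fclass b' (set X)))"
 proof (rule card_UN_disjoint)
  show "finite ?G" using fin_fclass by simp
  show "!b':?G. finite (fclass b' (set X))" using fin_fclass by simp
  show "!b1:?G. !b2:?G. b1 ~= b2 --> fclass b1 (set X) Int fclass b2 (set X) = {}"
  proof (intro ballI impI)
   fix b1 b2 assume g:"b1:?G" "b2:?G" "b1 ~= b2"
   show "fclass b1 (set X) Int fclass b2 (set X) = {}"
  using g face_unique[of b1 b2 "set X" l] Xn by (auto simp:fclass_def pos_on_def less_imp_le)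
  qed
 qed
 finally have "int (card (fclass b I)) = (SUM b':?G. int (card (fclass b' (set X))))" by simp
 also have "... = (SUM b':?G. worder X)" using card_face_class[OF _ Xn X ok] fclass_bases by (intro sum.cong refl) blast
 also have "... = int (card ?G) * worder X" by simp
 finally show ?thesis by simp
qed

end

text \<open>Removing the largest node first keeps the orbits small, and decreasing lists are those
  for which the orders are computed below.\<close>

definition all_nodes :: "nat list" where
 "all_nodes = [8,7,6,5,4,3,2,1]"

text \<open>Inclusion-exclusion over the nodes required to be negative: as no root vanishes on l,
  negative at j means not positive at j.\<close>

primrec scount :: "int=>nat list=>nat list=>int" where
 "scount w P [] = w div worder (filter (%i. i:set P) all_nodes)"
| "scount w P (j # S) = scount w P S - scount w (j # P) S"

primrec sign_ok :: "nat list=>nat list=>bool" where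
 "sign_ok P [] = (worder (filter (%i. i:set P) all_nodes) ~= 0)"
| "sign_ok P (j # S) = (sign_ok P S & sign_ok (j # P) S)"

context E_roots
begin

theorem card_signs:
 assumes b:"b:bases" and I:"I <= NN" and P:"set P Un set S <= I"
  and ok:"sign_ok P S" and l:"!!be. be:Ph ==> ip be l ~= 0"
 shows "int (card {b':fclass b I. pos_on l (set P) b' & (!i:set S. ip (b' i) l < 0)}) =
  scount (int (card (fclass b I))) P S" using P ok
proof (induction S arbitrary:P)
 case Nil
 let ?X = "filter (%i. i:set P) all_nodes"
 have "NN <= nodes 8" using n by (auto simp:nodes_def)
 hence "set P <= set all_nodes" using Nil.prems(1) I unfolding all_nodes_def nodes8 by auto
 hence X:"set ?X = set P" by auto
 have "int (card {b':fclass b I. pos_on l (set ?X) b'}) * worder ?X = int (card (fclass b I))"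
  by (rule card_positive[OF b _ I _ _ l]) (use Nil.prems X in \<open>auto simp:all_nodes_def\<close>)
 hence "int (card {b':fclass b I. pos_on l (set P) b'}) = int (card (fclass b I)) div worder ?X"
  using Nil.prems(2) X by (metis nonzero_mult_div_cancel_right sign_ok.simps(1))
 thus ?case by simp
next
 case (Cons j S)
 let ?A = "%P S. {b':fclass b I. pos_on l (set P) b' & (!i:set S. ip (b' i) l < 0)}"
 have "?A P S = ?A (j # P) S Un ?A P (j # S)"
 proof -
  have "ip (b' j) l > 0 \<or> ip (b' j) l < 0" if "b':fclass b I" for b'
   using l b_root[of b' j] that fclass_bases Cons.prems(1) I by (metis Un_iff linorder_neqE_linordered_idom list.set_intros(1) subsetD)
  thus ?thesis by (auto simp:pos_on_def)
 qed
 moreover have "?A (j # P) S Int ?A P (j # S) = {}" by (auto simp:pos_on_def)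
 moreover have "finite (?A P S)" for P S using fin_fclass by simp
 ultimately have "card (?A P S) = card (?A (j # P) S) + card (?A P (j # S))"
  using card_Un_disjoint[of "?A (j # P) S" "?A P (j # S)"] by metis
 thus ?case using Cons.IH[of P] Cons.IH[of "j # P"] Cons.prems by auto
qed

end

text \<open>The node sets between {1,3,4,6} and the whole diagram, whose parabolic subgroups the
  inclusion-exclusion calls for. The next three tables arise in the same way.\<close>

lemma weyl_orders_E7:
 "worder [6,4,3,1] = 48"
 "worder [6,4,3,2,1] = 240"
 "worder [6,5,4,3,1] = 720"
 "worder [7,6,4,3,1] = 144"
 "worder [6,5,4,3,2,1] = 51840"
 "worder [7,6,4,3,2,1] = 720"
 "worder [7,6,5,4,3,1] = 5040"
 "worder [7,6,5,4,3,2,1] = 2903040" by code_simp+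

lemma sign_count_E7:"sign_ok [1,3,4,6] [2,5,7]" "scount 2903040 [1,3,4,6] [2,5,7] = 28855"
 by (simp_all add:all_nodes_def weyl_orders_E7 del:worder.simps One_nat_def)

lemma weyl_orders_D6:
 "worder [6,4,2] = 12"
 "worder [6,4,3,2] = 48"
 "worder [6,5,4,2] = 120"
 "worder [7,6,4,2] = 36"
 "worder [6,5,4,3,2] = 1920"
 "worder [7,6,4,3,2] = 144"
 "worder [7,6,5,4,2] = 720"
 "worder [7,6,5,4,3,2] = 23040" by code_simp+

lemma sign_count_D6:"sign_ok [2,4,6] [3,5,7]" "scount 23040 [2,4,6] [3,5,7] = 811"
 by (simp_all add:all_nodes_def weyl_orders_D6 del:worder.simps)

lemma weyl_orders_A7:
 "worder [7,5,3] = 8"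
 "worder [7,5,3,1] = 24"
 "worder [7,5,4,3] = 48"
 "worder [7,6,5,3] = 48"
 "worder [8,7,5,3] = 24"
 "worder [7,5,4,3,1] = 240"
 "worder [7,6,5,3,1] = 144"
 "worder [8,7,5,3,1] = 72"
 "worder [7,6,5,4,3] = 720"
 "worder [8,7,5,4,3] = 144"
 "worder [8,7,6,5,3] = 240"
 "worder [7,6,5,4,3,1] = 5040"
 "worder [8,7,5,4,3,1] = 720"
 "worder [8,7,6,5,3,1] = 720"
 "worder [8,7,6,5,4,3] = 5040"
 "worder [8,7,6,5,4,3,1] = 40320" by code_simp+

text \<open>The nodes 1, 3, 4, 5, 6, 7, 8 form a chain along which the signs alternate, so 1385 is
  the number of alternating permutations of 8 letters.\<close>

lemma sign_count_A7:"sign_ok [3,5,7] [1,4,6,8]" "scount 40320 [3,5,7] [1,4,6,8] = 1385"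
 by (simp_all add:all_nodes_def weyl_orders_A7 del:worder.simps One_nat_def)

lemma weyl_orders_A5:
 "worder [6,4] = 4"
 "worder [6,4,1] = 8"
 "worder [6,4,2] = 12"
 "worder [6,5,4] = 24"
 "worder [7,6,4] = 12"
 "worder [6,4,2,1] = 24"
 "worder [6,5,4,1] = 48"
 "worder [7,6,4,1] = 24"
 "worder [6,5,4,2] = 120"
 "worder [7,6,4,2] = 36"
 "worder [7,6,5,4] = 120"
 "worder [6,5,4,2,1] = 240"
 "worder [7,6,4,2,1] = 72"
 "worder [7,6,5,4,1] = 240"
 "worder [7,6,5,4,2] = 720"
 "worder [7,6,5,4,2,1] = 1440" by code_simp+

text \<open>The signs alternate along the chain 2, 4, 5, 6, 7, which gives the 61 alternating
  permutations of 6 letters; the isolated node 1 contributes a factor 1.\<close>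

lemma sign_count_A5:"sign_ok [4,6] [1,2,5,7]" "scount 1440 [4,6] [1,2,5,7] = 61"
 by (simp_all add:all_nodes_def weyl_orders_A5 del:worder.simps One_nat_def)

section \<open>Frames: their even walls and the regions between them\<close>

context E_roots
begin

lemma root_eqI:"ga:Ph ==> rh:Ph ==> ip ga rh >= 2 ==> ga = rh" using ip_pos[of "ga - rh"] root_norm[of ga] root_norm[of rh]
 by (cases "ga = rh") (auto simp:ip_dl ip_dr ip_com[of rh ga])

lemma half_M:
 assumes "!!x. x:N ==> ev (ip y x)"
 shows "(1/2) *r y:M" unfolding M_iff[OF a0_base]
proof
 fix i assume "i:NN"
 thus "ip (om a0 i) ((1/2) *r y):\<int>" using assms om_N[OF a0_base] by (force simp:ev_def ip_sr ip_com)
qed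

end

context E_class
begin

lemma mu_N_int:"x:N ==> ip mu x:\<int>" by (rule M_N_int[OF mu])

text \<open>Modulo 2M, mu is the sum of the simple roots at its odd nodes; products with
  \<open>N\<close> express this congruence.\<close>

lemma ev_nsum_odd:
 assumes b:"b:bases" and x:"x:N"
 shows "ev (ip mu x - ip (nsum b (oddn b)) x)"
proof -
 have "ip (nsum b (oddn b)) x = (SUM k:NN. (if k:oddn b then 1 else 0) * ip (b k) x)"
  unfolding nsum_def ip_suml by (rule sum.mono_neutral_cong_left) (auto simp:oddn_def)
 hence "ip mu x - ip (nsum b (oddn b)) x =
   (SUM k:NN. (ip (om b k) mu - (if k:oddn b then 1 else 0)) * ip (b k) x)"
  unfolding ip_expand[OF b, of mu x] by (simp add:sum_subtractf left_diff_distrib)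
 moreover have "ev ((ip (om b k) mu - (if k:oddn b then 1 else 0)) * ip (b k) x)" if k:"k:NN" for k
  using that ev_mult mu M_iff[OF b] not_ev x N_iff[OF b] by (auto simp:oddn_def ip_com)
 ultimately show ?thesis by (simp add:ev_sum)
qed

end

text \<open>A frame: orthogonal vectors \<open>f i\<close> of norm 4, all congruent to \<open>mu\<close> modulo \<open>2M\<close>. A vertex is odd if and
  only if its inner products with the \<open>f i\<close> are odd.\<close>

locale E_frame = E_class +
 fixes m :: nat and f :: "nat=>'a" and b0 :: "nat=>'a" and j0 :: nat
 assumes m:"m >= 2" and f_M:"i < m ==> f i:M"
  and f_ip:"i < m ==> j < m ==> ip (f i) (f j) = (if i = j then 4 else 0)"
  and f_half:"i < m ==> j < m ==> i ~= j ==> (1/2) *r (f i + f j):M"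
  and f_mu:"x:N ==> ev (ip mu x - ip (f 0) x)"
  and b0:"b0:bases" and j0:"j0:nodes n" and p0:"(1/2) *r (SUM i<m. f i) = om b0 j0"
  and par0:"be:Ph ==> ev (ip be (om b0 j0) - ip be mu)"
begin

definition sg :: "nat set=>nat=>real" where
 "sg T i = (if i:T then - 1 else 1)"

text \<open>For even T this is a vertex, around which one of the regions lies; for odd T its half is
  in \<open>N\<close> and serves as a test vector on the walls.\<close>

definition "cvec T = (1/2) *r (SUM i<m. sg T i *r f i)"

lemma sg_cases:"sg T i = 1 \<or> sg T i = - 1" by (simp add:sg_def)

lemma sg_sq [simp]:"sg T i * sg T i = 1" by (simp add:sg_def)

lemma f_half_diff:
 assumes "i < m" "j < m" "i ~= j"
 shows "(1/2) *r (f i - f j):M"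
proof -
 have "(1/2) *r (f i - f j) = (1/2) *r ((f i + f j) - 2 *r f j)" by (simp add:scaleR_2)
 also have "... = (1/2) *r (f i + f j) - f j" by (simp only:scaleR_diff_right) simp
 finally show ?thesis using M_diff[OF f_half[OF assms] f_M[OF assms(2)]] by simp
qed

lemma f_cong:
 assumes "x:N" "i < m"
 shows "ev (ip mu x - ip (f i) x)"
proof (cases "i = 0")
 case False
 have "ip ((1/2) *r (f 0 - f i)) x:\<int>" using f_half_diff[of 0 i] assms False M_N_int by blast
 from ev_double[OF this] have "ev (ip (f 0 - f i) x)" by (simp add:ip_sl)
 hence "ev (ip (f 0) x - ip (f i) x)" by (simp add:ip_dl)
 from ev_add[OF f_mu[OF assms(1)] this] show ?thesis by simp
qed (use f_mu assms in simp)

lemma ev_f:"x:N ==> i < m ==> ev (ip mu x) <-> ev (ip (f i) x)" by (rule ev_cong[OF f_cong])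

definition "proot s i t j = (1/2) *r (s *r f i + t *r f j)"

lemma ip_proot:"ip (proot s i t j) x = (s * ip (f i) x + t * ip (f j) x) / 2"
 by (simp add:proot_def ip_sl ip_addl)

lemma proot:
 assumes ij:"i < m" "j < m" "i ~= j" and st:"s = 1 \<or> s = - 1" "t = 1 \<or> t = - 1"
 shows "proot s i t j:Ph"
  using assms f_half[OF ij] f_half_diff[OF ij] st M_minus ij by (force simp:proot_def scaleR_add_right scaleR_diff_right ip_simps f_ip root_iff)

lemma center_ip:"ip (cvec T) x = (SUM i<m. sg T i * ip (f i) x) / 2"
 by (simp add:cvec_def ip_sl ip_suml)

lemma f_center:"i < m ==> ip (f i) (cvec T) = 2 * sg T i"
proof -
 assume i:"i < m"
 have "ip (f i) (cvec T) = (SUM k<m. sg T k * ip (f k) (f i)) / 2" unfolding ip_com[of "f i"] by (rule center_ip)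
 also have "(SUM k<m. sg T k * ip (f k) (f i)) = (SUM k<m. if k = i then sg T i * 4 else 0)"
  using i by (intro sum.cong) (auto simp:f_ip)
 finally show ?thesis using i by simp
qed

lemma center_empty:"cvec {} = om b0 j0" using p0 by (simp add:cvec_def sg_def)

lemma center_flip:
 assumes "T <= {..<m}"
 shows "cvec T = cvec {} - (SUM i:T. f i)"
proof -
 have "(SUM i<m. sg T i *r f i) = (SUM i<m. f i - (if i:T then 2 *r f i else 0))"
  by (intro sum.cong) (auto simp:sg_def scaleR_2)
 also have "... = (SUM i<m. f i) - (SUM i:T. 2 *r f i)" using assms by (simp add:sum_subtractf sum.If_cases Int_absorb1)
 also have "(SUM i:T. 2 *r f i) = 2 *r (SUM i:T. f i)" by (simp add:scaleR_sum_right)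
 finally show ?thesis by (simp add:cvec_def sg_def scaleR_diff_right)
qed

lemma center_parity:
 assumes T:"T <= {..<m}" and be:"be:Ph"
 shows "ev (ip be (cvec T) - (1 + card T) * ip be mu)"
proof -
 have beN:"be:N" using be root_M M_N by blast
 have "ev (SUM i:T. ip mu be - ip (f i) be)" using T f_cong[OF beN] by (intro ev_sum) auto
 hence 1:"ev (card T * ip be mu - ip be (SUM i:T. f i))" by (simp add:sum_subtractf ip_suml ip_com[of be])
 have i:"real (card T) * ip be mu:\<int>" using mu_N_int[OF beN] by (simp add:ip_com)
 have "ip be (cvec T) - (1 + card T) * ip be mu =
   (ip be (om b0 j0) - ip be mu) + (card T * ip be mu - ip be (SUM i:T. f i)) - 2 * (card T * ip be mu)"
  unfolding center_flip[OF T] center_empty by (simp add:ip_dr algebra_simps)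
 thus ?thesis using ev_diff[OF ev_add[OF par0[OF be] 1] ev_double[OF i]] by simp
qed

lemma center_even:
 assumes T:"T <= {..<m}" "even (card T)" and be:"be:Ph"
 shows "ev (ip be (cvec T) - ip be mu)"
proof -
 obtain k where k:"card T = 2 * k" using T(2) by blast
 have i:"real k * ip be mu:\<int>" using be root_M M_N mu_N_int[of be] by (force simp:ip_com)
 from ev_add[OF center_parity[OF T(1) be] ev_double[OF i]] show ?thesis unfolding k by (simp add:algebra_simps)
qed

lemma center_odd:
 assumes T:"T <= {..<m}" "odd (card T)"
 shows "(1/2) *r cvec T:N" unfolding N_def
proof (intro CollectI ballI)
 fix be assume be:"be:Ph"
 obtain k where k:"card T = 2 * k + 1" using T(2) by (rule oddE)
 have "be:N" using be root_M M_N by blast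
 hence i:"real (k + 1) * ip be mu:\<int>" using mu_N_int[of be] by (intro Ints_mult) (simp_all add:ip_com)
 from ev_add[OF center_parity[OF T(1) be] ev_double[OF i]] show "ip be ((1/2) *r cvec T):\<int>"
  by (auto simp:k algebra_simps ev_def ip_sr)
qed

text \<open>An even root has even products with the frame, and half their sum is even too. Two
  nonzero products lead to a root (+-f a +- f b)/2 whose product with the given one is at least 2,
  which forces equality; a single nonzero product would be at least 4 in absolute value and lead to
  such a root as well, a contradiction.\<close>

lemma even_root_cases:
 assumes ga:"ga:Ph" "ev (ip ga mu)"
 obtains "!!i. i < m ==> ip (f i) ga = 0"
 | s a t b where "a < m" "b < m" "a ~= b" "s = 1 \<or> s = - 1" "t = 1 \<or> t = - 1" "ga = proot s a t b"
proof -
 have gaN:"ga:N" using ga root_M M_N by blast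
 have g:"ev (ip (f i) ga)" if "i < m" for i using ev_f[OF gaN that] ga(2) by (simp add:ip_com)
 have "ev (ip ga (cvec {}))" using ev_cong[OF center_even[of "{}", OF _ _ ga(1)]] ga(2) by simp
 hence tot:"ev ((SUM i<m. ip (f i) ga) / 2)" unfolding ip_com[of ga] center_ip by (simp add:sg_def)
 have big:"x >= 2 \<or> x <= - 2" if x:"ev x" "x ~= 0" for x :: real using that by (auto simp:ev_def)
 show ?thesis
 proof (cases "!i<m. ip (f i) ga = 0")
  case True
  thus ?thesis using that(1) by blast
 next
  case False
  then obtain a where a:"a < m" "ip (f a) ga ~= 0" by blast
  define s :: real where "s = sgn (ip (f a) ga)"
  have s:"s = 1 \<or> s = - 1" "s * ip (f a) ga >= 2" using big[OF g[OF a(1)] a(2)] by (auto simp:s_def)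
  have "EX b<m. b ~= a & ip (f b) ga ~= 0"
  proof (rule ccontr)
   assume none:"~ ?thesis"
   hence "(SUM i<m. ip (f i) ga) = (SUM i<m. if i = a then ip (f a) ga else 0)" by (intro sum.cong) auto
   hence 4:"s * ip (f a) ga >= 4" using a big[of "ip (f a) ga / 2"] tot s by auto
   define b where "b = (if a = 0 then 1 else (0::nat))"
   have b:"b < m" "b ~= a" using m by (auto simp:b_def)
   hence b0:"ip (f b) ga = 0" using none by blast
   have r:"proot s a 1 b:Ph" using proot[OF a(1) b(1)] b(2) s(1) by blast
   have "ip (proot s a 1 b) ga >= 2" using 4 b0 by (simp add:ip_proot)
   hence "ip (proot s a 1 b) (f b) = 0" using root_eqI[OF r ga(1)] b0 by (simp add:ip_com)
   thus False using a(1) b by (simp add:ip_proot f_ip)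
  qed
  then obtain b where b:"b < m" "b ~= a" "ip (f b) ga ~= 0" by blast
  define t :: real where "t = sgn (ip (f b) ga)"
  have t:"t = 1 \<or> t = - 1" "t * ip (f b) ga >= 2" using big[OF g[OF b(1)] b(3)] by (auto simp:t_def)
  have r:"proot s a t b:Ph" using proot[OF a(1) b(1)] b(2) s(1) t(1) by blast
  have "ga = proot s a t b" using s(2) t(2) root_eqI[OF r ga(1)] by (simp add:ip_proot)
  thus ?thesis using that(2)[of a b s t] a b s(1) t(1) by blast
 qed
qed

text \<open>Half of \<open>cvec T\<close> is a vector d in \<open>N\<close> with odd product with
  mu. If v were even, each component of the odd nodes would give an even root orthogonal to v; as
  all signed coordinates of v are positive, such a root is orthogonal to d. Then the sum of the odd
  simple roots, which is congruent to mu, would be orthogonal to d.\<close>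

lemma even_vertex_positive:
 assumes T:"T <= {..<m}" "odd (card T)" and v:"{v}:K" and pos:"!!i. i < m ==> sg T i * ip (f i) v > 0"
 shows "~ev (ip mu v)"
proof
 assume evv:"ev (ip mu v)"
 obtain b j where b:"b:bases" and j:"j:NN" "v = om b j" using v by (auto simp:K_def verts_def)
 let ?d = "(1/2) *r cvec T" and ?S = "oddn b"
 have dN:"?d:N" by (rule center_odd[OF T])
 have Sn:"?S <= NN" "j ~: ?S" using evv j by (auto simp:oddn_def)
 have finS:"finite ?S" using finite_subset[OF Sn(1)] by simp
 have zero:"ip ga ?d = 0" if ga:"ga:Ph" "ev (ip ga mu)" "ip ga v = 0" for ga using even_root_cases[OF ga(1,2)]
 proof cases
  case 1
  thus ?thesis by (simp add:ip_sr ip_com[of ga] center_ip)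
 next
  case (2 s a t b)
  have "s * ip (f a) v + t * ip (f b) v = 0" using ga(3) 2 by (simp add:ip_proot)
  hence "s * sg T a + t * sg T b = 0"
   using pos[OF 2(1)] pos[OF 2(2)] 2(4,5) sg_cases[of T a] sg_cases[of T b] by (elim disjE) simp_all
  thus ?thesis using 2 by (simp add:ip_sr ip_proot f_center)
 qed
 \<comment> \<open>S' runs through the unions of connected components of the odd nodes, and one
   component is split off at a time.\<close>
 have "ip (nsum b S') ?d = 0" if "S' <= ?S" "!!i k. i:S' ==> k:?S - S' ==> ip (b i) (b k) = 0" for S' using that
 proof (induction "card S'" arbitrary:S' rule:less_induct)
  case less
  have finS':"finite S'" using less.prems(1) finS finite_subset by blast
  show ?case
  proof (cases "S' = {}")
   case True
   thus ?thesis by (simp add:nsum_def ip_0_left)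
  next
   case False
   then obtain i where i:"i:S'" by blast
   have S'n:"S' <= NN" using less.prems(1) Sn(1) by blast
   obtain C where C:"C <= S'" "i:C" "nsum b C:Ph" "!!k. k:S' - C ==> ip (b k) (nsum b C) = 0"
    by (rule component[OF b S'n i], rule that)
   have Cn:"C <= NN" "finite C" using C(1) S'n finS' finite_subset by auto
   have orth:"ip (b k) (nsum b C) = 0" if "k:?S - C" for k
   proof (cases "k:S'")
    case True
    thus ?thesis using C(4) that by blast
   next
    case False
    hence "ip (b k) (b i) = 0" if "i:C" for i
     using less.prems(2)[of i k] C(1) that \<open>k : ?S - C\<close> by (auto simp:ip_com)
    thus ?thesis by (simp add:nsum_def ip_sumr)
   qed
   have CS:"C <= ?S" using C(1) less.prems(1) by blast
   have "ip (nsum b C) ?d = 0"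
  using zero[OF C(3)] even_component[OF b CS C(3) orth] node_sum_om[OF b Cn(1) j(1)] j(2) CS Sn(2) by force
   moreover have "ip (nsum b (S' - C)) ?d = 0"
   proof (rule less.hyps)
    show "card (S' - C) < card S'" using finS' C(1,2) by (intro psubset_card_mono) auto
    show "S' - C <= ?S" using less.prems(1) by blast
    fix l k assume l:"l:S' - C" and k:"k:?S - (S' - C)"
    show "ip (b l) (b k) = 0"
    proof (cases "k:S'")
     case False
     thus ?thesis using less.prems(2) l k by blast
    next
     case True
     hence kC:"k:C" using k by blast
     have "(SUM i:C. - ip (b l) (b i)) = 0" using C(4)[OF l] by (simp add:nsum_def ip_sumr sum_negf)
     moreover have "- ip (b l) (b i) >= 0" if "i:C" for i
  using that l S'n Cn gram[OF b, of l i] E_cartan_nonpos[of l i] by force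
     ultimately show ?thesis using sum_nonneg_eq_0_iff[OF Cn(2), of "%i. - ip (b l) (b i)"] kC by auto
    qed
   qed
   moreover have "nsum b S' = nsum b C + nsum b (S' - C)"
    unfolding nsum_def using sum.subset_diff[OF C(1) finS'] by (simp add:add.commute)
   ultimately show ?thesis by (simp add:ip_addl)
  qed
 qed
 from this[of ?S] show False
  using ev_nsum_odd[OF b dN] ev_f[OF dN, of 0] m f_center[of 0 T] sg_cases[of T 0] not_ev_1 ev_minus_iff[of 1] by (auto simp:ip_sr)
qed

text \<open>When A has at least two elements, these roots cut out the set on which the signed
  coordinates at A are nonnegative and equal to the smallest signed coordinate.\<close>

definition "wroots T A = {proot (sg T k) k (- sg T a) a |k a. a:A & k < m & k ~= a} Un {proot (sg T a) a (sg T b) b |a b. a:A & b:A & a ~= b}"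

definition "wall T A = rcells (wroots T A)"

lemma wall_roots_roots:"A <= {..<m} ==> wroots T A <= Ph"
 unfolding wroots_def using sg_cases proot by (auto, (metis lessThan_iff minus_minus subsetD)+)

lemma region_wall:
 assumes A:"A <= {..<m}" "card A >= 2"
 shows "x:region (wroots T A) <->
  (!a:A. sg T a * ip (f a) x >= 0 & (!k<m. sg T a * ip (f a) x <= sg T k * ip (f k) x))"
proof -
 have 1:"x:region (wroots T A) <->
  (!a:A. !k<m. k ~= a --> sg T a * ip (f a) x <= sg T k * ip (f k) x) &
  (!a:A. !b:A. a ~= b --> sg T a * ip (f a) x + sg T b * ip (f b) x >= 0)" (is "_ <-> ?P & ?Q")
 proof
  assume x:"x:region (wroots T A)"
  have "sg T a * ip (f a) x <= sg T k * ip (f k) x" if "a:A" "k < m" "k ~= a" for a k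
  using that x by (force simp:wroots_def region_def ip_proot)
  moreover have "sg T a * ip (f a) x + sg T b * ip (f b) x >= 0" if "a:A" "b:A" "a ~= b" for a b
  proof -
   have "proot (sg T a) a (sg T b) b:wroots T A" using that unfolding wroots_def by blast
   thus ?thesis using x by (auto simp:region_def ip_proot)
  qed
  ultimately show "?P & ?Q" by blast
 next
  assume "?P & ?Q"
  thus "x:region (wroots T A)" unfolding region_def wroots_def by (auto simp:ip_proot)
 qed
 have other:"EX b:A. b ~= a" if "a:A" for a
 proof (rule ccontr)
  assume "~ ?thesis"
  hence "A = {a}" using that by blast
  thus False using A(2) by simp
 qed
 show ?thesis
 proof
  assume "x:region (wroots T A)"
  hence P:?P and Q:?Q using 1 by blast+
  show "!a:A. sg T a * ip (f a) x >= 0 & (!k<m. sg T a * ip (f a) x <= sg T k * ip (f k) x)"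
  proof
   fix a assume a:"a:A"
   then obtain b where b:"b:A" "b ~= a" using other by blast
   have "b < m" "a < m" using a b A(1) by auto
   hence "sg T a * ip (f a) x = sg T b * ip (f b) x" using P a b by (metis antisym)
   hence "sg T a * ip (f a) x >= 0" using Q a b by force
   thus "sg T a * ip (f a) x >= 0 & (!k<m. sg T a * ip (f a) x <= sg T k * ip (f k) x)" using P a by force
  qed
 next
  assume *: "!a:A. sg T a * ip (f a) x >= 0 & (!k<m. sg T a * ip (f a) x <= sg T k * ip (f k) x)"
  hence ?P by blast
  moreover have ?Q using * by simp
  ultimately show "x:region (wroots T A)" using 1 by blast
 qed
qed

lemma wall_iff:
 assumes "A <= {..<m}" "card A >= 2"
 shows "ta:wall T A <-> ta:K & (!x:ta. !a:A. sg T a * ip (f a) x >= 0 &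
  (!k<m. sg T a * ip (f a) x <= sg T k * ip (f k) x))" unfolding wall_def rcells_def using region_wall[OF assms] by blast

text \<open>On the wall the signed coordinate at a in A is nonnegative and smallest. If it is
  positive at a vertex, then all signed coordinates are, and the vertex is odd; so it can serve as
  the functional of \<open>h_region_acyclic\<close>.\<close>

lemma h_wall:
 assumes T:"T <= {..<m}" "odd (card T)" and A:"A <= {..<m}" "card A >= 2"
 shows "h (wall T A) k = 0"
proof -
 obtain a where a:"a:A" using A(2) by force
 hence am:"a < m" using A(1) by blast
 let ?d = "(1/2) *r cvec T"
 have d:"sg T i * ip (f i) ?d = 1" if "i < m" for i using f_center[OF that] by (simp add:ip_sr)
 show ?thesis unfolding wall_def
 proof (rule h_region_acyclic[OF wall_roots_roots[OF A(1)], where t = "sg T a *r f a" and q = ?d])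
  show "ip (sg T a *r f a) x >= 0" if "x:region (wroots T A)" for x
   using that a by (simp add:region_wall[OF A] ip_sl)
  show "?d:region (wroots T A)" unfolding region_wall[OF A] using d A(1) by auto
  show "ip (sg T a *r f a) ?d > 0" using d[OF am] by (simp add:ip_sl)
  show "ip (sg T a *r f a) v = 0" if v:"{v}:rcells (wroots T A)" "ev (ip mu v)" for v
  proof (rule ccontr)
   assume nz:"ip (sg T a *r f a) v ~= 0"
   have vr:"!a:A. sg T a * ip (f a) v >= 0 & (!k<m. sg T a * ip (f a) v <= sg T k * ip (f k) v)"
    using v(1) region_wall[OF A] unfolding rcells_def by blast
   hence "sg T a * ip (f a) v >= 0" using a by blast
   moreover have "sg T a * ip (f a) v ~= 0" using nz by (simp add:ip_sl)
   ultimately have "sg T a * ip (f a) v > 0" by linarith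
   hence "sg T i * ip (f i) v > 0" if "i < m" for i using vr a that by force
   thus False using even_vertex_positive[OF T] v unfolding rcells_def by blast
  qed
 qed
qed

lemma complex_wall:"complex (wall T A)" unfolding wall_def by (rule cplx_rc)

text \<open>An intersection of walls is the wall of the union of the index sets, hence acyclic
  again.\<close>

lemma h_Union_walls:
 assumes T:"T <= {..<m}" "odd (card T)" and J:"J ~= {}" "!!A. A:J ==> A <= {..<m} & card A >= 2"
 shows "h (UN A:J. wall T A) k = 0"
proof (rule h_Union_acyclic[OF _ J(1) complex_wall])
 have "J <= Pow {..<m}" using J(2) by blast
 thus "finite J" using finite_subset by blast
 fix I k assume I:"I <= J" "I ~= {}"
 have U:"\<Union>I <= {..<m}" using I J(2) by blast
 obtain A where A:"A:I" using I(2) by blast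
 have c:"card (\<Union>I) >= 2" using J(2)[of A] A I(1) card_mono[of "\<Union>I" A] finite_subset[OF U] by fastforce
 have "(INT A:I. wall T A) = wall T (\<Union>I)"
 proof (intro equalityI subsetI)
  fix ta assume t:"ta:(INT A:I. wall T A)"
  have K:"ta:K" using t A wall_iff[of A] J(2) I(1) by blast
  have "!x:ta. !a:\<Union>I. sg T a * ip (f a) x >= 0 & (!k<m. sg T a * ip (f a) x <= sg T k * ip (f k) x)"
  proof (intro ballI)
   fix x a assume x:"x:ta" and "a:\<Union>I"
   then obtain B where B:"B:I" "a:B" by blast
   hence BB:"B <= {..<m}" "card B >= 2" using J(2) I(1) by blast+
   have "ta:wall T B" using t B(1) by blast
   thus "sg T a * ip (f a) x >= 0 & (!k<m. sg T a * ip (f a) x <= sg T k * ip (f k) x)"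
    unfolding wall_iff[OF BB] using x B(2) by blast
  qed
  thus "ta:wall T (\<Union>I)" unfolding wall_iff[OF U c] using K by blast
 next
  fix ta assume t:"ta:wall T (\<Union>I)"
  show "ta:(INT A:I. wall T A)"
  proof
   fix B assume B:"B:I"
   hence BB:"B <= {..<m}" "card B >= 2" using J(2) I(1) by blast+
   show "ta:wall T B" unfolding wall_iff[OF BB] using t B unfolding wall_iff[OF U c] by blast
  qed
 qed
 thus "h (INT A:I. wall T A) k = 0" using h_wall[OF T U c] by simp
qed

end

context E_frame
begin

lemma sg_differ:
 assumes "T <= {..<m}" "U <= {..<m}" "T ~= U"
 obtains i where "i < m" "sg T i = - sg U i"
proof -
 obtain i where "(i:T) ~= (i:U)" using assms(3) by blast
 hence "i < m" "sg T i = - sg U i" using assms by (auto simp:sg_def)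
 thus ?thesis using that by blast
qed

definition part :: "nat set=>'a set set" where
 "part T = rcells (evab (cvec T))"

lemma root_N:"be:Ph ==> be:N" using root_M M_N by blast

lemma region_part:
 assumes T:"T <= {..<m}" "even (card T)"
 shows "x:region (evab (cvec T)) <->
  (!i<m. !j<m. i ~= j --> sg T i * ip (f i) x + sg T j * ip (f j) x >= 0)"
proof
 assume x:"x:region (evab (cvec T))"
 show "!i<m. !j<m. i ~= j --> sg T i * ip (f i) x + sg T j * ip (f j) x >= 0"
 proof (intro allI impI)
  fix i j assume ij:"i < m" "j < m" "i ~= j"
  let ?ga = "proot (sg T i) i (sg T j) j"
  have ga:"?ga:Ph" by (rule proot[OF ij sg_cases sg_cases])
  have 2:"ip ?ga (cvec T) = 2" using ij by (simp only:ip_proot f_center mult.left_commute[of _ 2]) simp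
  thus "sg T i * ip (f i) x + sg T j * ip (f j) x >= 0"
  using ev_2 ev_cong[OF center_even[OF T ga]] ga x by (auto simp:evab_def region_def ip_proot)
 qed
next
 assume *: "!i<m. !j<m. i ~= j --> sg T i * ip (f i) x + sg T j * ip (f j) x >= 0"
 show "x:region (evab (cvec T))" unfolding region_def
 proof (intro CollectI ballI)
  fix ga assume "ga:evab (cvec T)"
  hence ga:"ga:Ph" "ev (ip ga mu)" "ip ga (cvec T) > 0" by (auto simp:evab_def)
  from ga(1,2) show "ip ga x >= 0"
  proof (cases rule:even_root_cases)
   case 1
   hence "ip (cvec T) ga = 0" by (simp add:center_ip)
   thus ?thesis using ga(3) by (simp add:ip_com)
  next
   case (2 s a t b)
   have "s * sg T a + t * sg T b > 0" using ga(3) 2 by (simp add:ip_proot f_center)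
   hence "s = sg T a" "t = sg T b" using 2(4,5) sg_cases[of T a] sg_cases[of T b] by (elim disjE; simp)+
   thus ?thesis using * 2 by (simp add:ip_proot)
  qed
 qed
qed

lemma part_iff:
 assumes "T <= {..<m}" "even (card T)"
 shows "ta:part T <-> ta:K & (!x:ta. !i<m. !j<m. i ~= j --> sg T i * ip (f i) x + sg T j * ip (f j) x >= 0)"
 unfolding part_def rcells_def using region_part[OF assms] by blast

lemma complex_part:"complex (part T)" unfolding part_def by (rule cplx_rc)

lemma K_vertex_N:"ta:K ==> v:ta ==> v:N" unfolding K_def verts_def using om_N by auto

lemma even_if_0:"ta:K ==> v:ta ==> i < m ==> ip (f i) v = 0 ==> ev (ip mu v)" using ev_f[OF K_vertex_N] ev_0 by metis

definition "ecells = {ta:K. !v:ta. ev (ip mu v)}"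

lemma complex_even_cells:"complex ecells" unfolding subcx_def ecells_def using K_face K_nonempty by blast

lemma all_even_even_cells:"all_even ecells" by (simp add:all_even_def ecells_def)

definition flips :: "nat set=>nat=>nat set" where
 "flips T i = sym_diff T {i}"

lemma flips:
 assumes "T <= {..<m}" "i < m"
 shows "flips T i <= {..<m}" "odd (card (flips T i)) <-> even (card T)"
  "sg (flips T i) i = - sg T i" "k ~= i ==> sg (flips T i) k = sg T k"
proof -
 have fin:"finite T" using assms finite_subset by blast
 show "flips T i <= {..<m}" using assms by (auto simp:flips_def)
 show "sg (flips T i) i = - sg T i" "k ~= i ==> sg (flips T i) k = sg T k" by (auto simp:flips_def sg_def)
 show "odd (card (flips T i)) <-> even (card T)" using fin by (cases "i:T") (auto simp:flips_def)
qed

definition "walls T = (UN A:{A. A <= {..<m} & card A = 2}. wall T A)"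

text \<open>For even T this is the part of the boundary of \<open>part T\<close> on which the signed
  coordinate i is nonpositive and cancels the smallest of the others.\<close>

definition "wallsat T i = (UN A:{A. A <= {..<m} & card A = 2 & i:A}. wall (flips T i) A)"

definition "odd_sets = {T. T <= {..<m} & odd (card T)}"

definition "evens = {T. T <= {..<m} & even (card T)}"

lemma pair_at:"i < m ==> EX A. A <= {..<m} & card A = 2 & i:A" using m by (intro exI[of _ "{i,if i = 0 then 1 else 0}"]) auto

lemma h_walls:"T:odd_sets ==> h (walls T) k = 0" and complex_walls:"complex (walls T)"
proof -
 have ne:"{A. A <= {..<m} & card A = 2} ~= {}" using pair_at[of 0] m by auto
 show "h (walls T) k = 0" if "T:odd_sets"
  unfolding walls_def by (rule h_Union_walls[OF _ _ ne]) (use that in \<open>auto simp:odd_sets_def\<close>)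
 show "complex (walls T)" unfolding walls_def by (rule complex_UN[OF ne complex_wall])
qed

lemma h_walls_at:
 assumes "T:evens" "i < m"
 shows "h (wallsat T i) k = 0" and "complex (wallsat T i)"
proof -
 have ne:"{A. A <= {..<m} & card A = 2 & i:A} ~= {}" using pair_at[OF assms(2)] by auto
 show "h (wallsat T i) k = 0"
  unfolding wallsat_def by (rule h_Union_walls[OF _ _ ne]) (use assms flips in \<open>auto simp:evens_def\<close>)
 show "complex (wallsat T i)" unfolding wallsat_def by (rule complex_UN[OF ne complex_wall])
qed

lemma wall_nonneg:
 assumes "A <= {..<m}" "card A = 2" "ta:wall T A" "x:ta" "i < m"
 shows "sg T i * ip (f i) x >= 0"
proof -
 obtain a where a:"a:A" using assms(2) by force
 have "sg T a * ip (f a) x >= 0" "sg T a * ip (f a) x <= sg T i * ip (f i) x" using assms a wall_iff[of A ta T] by auto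
 thus ?thesis by linarith
qed

text \<open>The signed coordinates are nonnegative for both sign patterns, so where the patterns
  differ the coordinate is 0; a vertex with a zero coordinate is even.\<close>

lemma walls_disjoint:
 assumes "A <= {..<m}" "card A = 2" "ta:wall T A" "A' <= {..<m}" "card A' = 2" "ta:wall T' A'"
  "T <= {..<m}" "T' <= {..<m}" "T ~= T'" "v:ta"
 shows "ev (ip mu v)"
proof -
 obtain i where i:"i < m" "sg T i = - sg T' i" by (rule sg_differ[OF assms(7-9)])
 show ?thesis
  using wall_nonneg[OF assms(1-3,10) i(1)] wall_nonneg[OF assms(4-6,10) i(1)] i(2) sg_cases[of T' i] assms(3) even_if_0 assms(10) i(1) by (auto simp:wall_def rcells_def)
qed

definition "skel = ecells Un (UN T:odd_sets. walls T)"

lemma finite_sets [simp]:"finite odd_sets" "finite evens" by (auto simp:odd_sets_def evens_def)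

lemma card_even_odd:"card odd_sets = 2 ^ (m - 1)" "card evens = 2 ^ (m - 1)"
proof -
 have "bij_betw (%T. flips T 0) evens odd_sets"
 proof (rule bij_betw_byWitness[where f' = "%T. flips T 0"])
  have "flips T 0 <= {..<m}" "odd (card (flips T 0)) <-> even (card T)" if "T <= {..<m}" for T
   using flips(1,2)[OF that, of 0] m by simp_all
  thus "(%T. flips T 0) ` evens <= odd_sets" "(%T. flips T 0) ` odd_sets <= evens"
   unfolding odd_sets_def evens_def by blast+
 qed (auto simp:flips_def)
 hence eq:"card evens = card odd_sets" by (rule bij_betw_same_card)
 have "evens Un odd_sets = Pow {..<m}" "evens Int odd_sets = {}" by (auto simp:odd_sets_def evens_def)
 hence "card evens + card odd_sets = 2 ^ m" using card_Un_disjoint[of evens odd_sets] by (simp add:card_Pow)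
 moreover have "(2::nat) ^ m = 2 * 2 ^ (m - 1)" using m by (cases m) auto
 ultimately show "card odd_sets = 2 ^ (m - 1)" "card evens = 2 ^ (m - 1)" using eq by auto
qed

text \<open>A star around the even cells, with one arm for each odd T; two arms meet in even cells
  only.\<close>

lemma h_skeleton:"h skel k = conc 1 (2 ^ (m - 1) - 1) k" and complex_skeleton:"complex skel"
proof -
 have ne:"odd_sets ~= {}" using card_even_odd(1) by force
 have "all_even (walls T Int walls T')" if "T:odd_sets" "T':odd_sets" "T ~= T'" for T T'
  using that walls_disjoint unfolding all_even_def walls_def odd_sets_def by blast
 thus "h skel k = conc 1 (2 ^ (m - 1) - 1) k"
  using h_star[OF complex_even_cells all_even_even_cells _ ne complex_walls h_walls] by (auto simp:skel_def card_even_odd)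
 show "complex skel" unfolding skel_def by (intro complex_Un complex_even_cells complex_UN ne complex_walls)
qed

lemma walls_at_part:
 assumes T:"T:evens" and i:"i < m"
 shows "wallsat T i <= part T"
proof
 fix ta assume "ta:wallsat T i"
 then obtain A where A:"A <= {..<m}" "card A = 2" "i:A" "ta:wall (flips T i) A" by (auto simp:wallsat_def)
 have Tm:"T <= {..<m}" "even (card T)" using T by (auto simp:evens_def)
 note fl = flips[OF Tm(1) i]
 have w:"ta:K" "!!x k. x:ta ==> k < m ==> - (sg T i * ip (f i) x) <= sg (flips T i) k * ip (f k) x"
 proof -
  have A2:"card A >= 2" using A(2) by simp
  show "ta:K" using A(4) unfolding wall_iff[OF A(1) A2] by blast
  fix x k assume "x:ta" "k < m"
  hence "sg (flips T i) i * ip (f i) x <= sg (flips T i) k * ip (f k) x" using A(3,4) unfolding wall_iff[OF A(1) A2] by blast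
  thus "- (sg T i * ip (f i) x) <= sg (flips T i) k * ip (f k) x" using fl(3) by simp
 qed
 show "ta:part T" unfolding part_iff[OF Tm]
 proof (intro conjI ballI allI impI w(1))
  fix x k l assume x:"x:ta" and kl:"k < m" "l < m" "k ~= l"
  have nn:"sg (flips T i) k' * ip (f k') x >= 0" if "k' < m" for k' by (rule wall_nonneg[OF A(1,2,4) x that])
  consider "k = i" | "l = i" | "k ~= i" "l ~= i" by blast
  thus "sg T k * ip (f k) x + sg T l * ip (f l) x >= 0"
  proof cases
   case 1
   thus ?thesis using w(2)[OF x kl(2)] fl(4)[of l] kl by simp
  next
   case 2
   thus ?thesis using w(2)[OF x kl(1)] fl(4)[of k] kl by simp
  next
   case 3
   thus ?thesis using nn[OF kl(1)] nn[OF kl(2)] fl(4)[of k] fl(4)[of l] by simp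
  qed
 qed
qed

text \<open>If the sign patterns differ in two places, the inequalities make the coordinates there
  vanish on the cell, which is then even. Otherwise U is T with a single sign flipped, and the cell
  lies on a wall through that index.\<close>

lemma walls_part:
 assumes T:"T:evens" and U:"U:odd_sets" and ta:"ta:walls U" "ta:part T"
 shows "ta:ecells \<or> (EX i<m. ta:wallsat T i)"
proof -
 have Tm:"T <= {..<m}" "even (card T)" and Um:"U <= {..<m}" "odd (card U)" using T U by (auto simp:evens_def odd_sets_def)
 obtain A where A:"A <= {..<m}" "card A = 2" "ta:wall U A" using ta(1) by (auto simp:walls_def)
 have K:"ta:K" and p:"!!x i j. x:ta ==> i < m ==> j < m ==> i ~= j ==> sg T i * ip (f i) x + sg T j * ip (f j) x >= 0"
  using ta(2) part_iff[OF Tm] by blast+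
 have nn:"sg U i * ip (f i) x >= 0" if "x:ta" "i < m" for x i by (rule wall_nonneg[OF A that])
 obtain i where i:"i < m" "sg T i = - sg U i" using sg_differ[OF Tm(1) Um(1)] Tm(2) Um(2) by metis
 show ?thesis
 proof (cases "EX j<m. j ~= i & sg T j = - sg U j")
  case True
  then obtain j where j:"j < m" "j ~= i" "sg T j = - sg U j" by blast
  have "ip (f i) x = 0" if x:"x:ta" for x
  using p[OF x i(1) j(1)] i(2) j(2,3) nn[OF x i(1)] nn[OF x j(1)] sg_cases[of U i] by auto
  thus ?thesis using even_if_0[OF K _ i(1)] K by (simp add:ecells_def)
 next
  case False
  hence same:"sg T j = sg U j" if "j < m" "j ~= i" for j using that sg_cases[of T j] sg_cases[of U j] by auto
  have U_eq:"U = flips T i"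
  proof
   show "U <= flips T i" using same i Um(1) by (force simp:flips_def sg_def split:if_splits)
   show "flips T i <= U" using same i Tm(1) by (force simp:flips_def sg_def split:if_splits)
  qed
  obtain a where a:"a:A" "a ~= i" using A(2) card_mono[of "{i}" A] by auto
  have am:"a < m" using a A(1) by blast
  have le:"sg U i * ip (f i) x <= sg U k * ip (f k) x" if x:"x:ta" and k:"k < m" for x k
   using p[OF x i(1) k] i(2) same[OF k] by (cases "k = i") auto
  have le2:"sg U a * ip (f a) x <= sg U k * ip (f k) x" if "x:ta" "k < m" for x k using A a(1) that wall_iff[of A ta U] by auto
  have B:"{i,a} <= {..<m}" "card {i,a} >= 2" using i(1) am a(2) by auto
  have "ta:wall U {i,a}" unfolding wall_iff[OF B] using K le le2 nn i(1) am by blast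
  moreover have "card {i,a} = 2" using a(2) by simp
  ultimately show ?thesis using U_eq B(1) by (auto simp:wallsat_def)
 qed
qed

text \<open>Two even patterns differ in at least two places. A third place makes coordinates vanish
  on the cell. With exactly two, i and j, the signed coordinates cancel and are smallest in absolute
  value, and the sign of one root on the whole cell decides which of the two boundary pieces
  contains it.\<close>

lemma part_part:
 assumes T:"T:evens" and U:"U:evens" "U ~= T" and ta:"ta:part U" "ta:part T"
 shows "ta:ecells \<or> (EX i<m. ta:wallsat T i)"
proof -
 have Tm:"T <= {..<m}" "even (card T)" and Um:"U <= {..<m}" "even (card U)" using T U by (auto simp:evens_def)
 have K:"ta:K" and p:"!!x i j. x:ta ==> i < m ==> j < m ==> i ~= j ==> sg T i * ip (f i) x + sg T j * ip (f j) x >= 0"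
  using ta(2) part_iff[OF Tm] by blast+
 have q:"sg U i * ip (f i) x + sg U j * ip (f j) x >= 0" if "x:ta" "i < m" "j < m" "i ~= j" for x i j
  using ta(1) part_iff[OF Um] that by blast
 have fin:"finite T" "finite U" using Tm Um finite_subset by blast+
 obtain i where i:"i < m" "sg U i = - sg T i" by (rule sg_differ[OF Um(1) Tm(1) U(2)])
 have "EX j<m. j ~= i & sg U j = - sg T j"
 proof (rule ccontr)
  assume none:"~ ?thesis"
  have same:"sg U j = sg T j" if "j < m" "j ~= i" for j using none that sg_cases[of T j] sg_cases[of U j] by auto
  have "U = flips T i"
  proof
   show "U <= flips T i" using same i Um(1) by (force simp:flips_def sg_def split:if_splits)
   show "flips T i <= U" using same i Tm(1) by (force simp:flips_def sg_def split:if_splits)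
  qed
  thus False using flips(2)[OF Tm(1) i(1)] Tm Um by blast
 qed
 then obtain j where j:"j < m" "j ~= i" "sg U j = - sg T j" by blast
 have ji:"sg T j * ip (f j) x = - (sg T i * ip (f i) x)" if x:"x:ta" for x
  using p[OF x i(1) j(1)] q[OF x i(1) j(1)] i(2) j(2,3) by simp
 show ?thesis
 proof (cases "EX l<m. l ~= i & l ~= j & sg U l = - sg T l")
  case True
  then obtain l where l:"l < m" "l ~= i" "l ~= j" "sg U l = - sg T l" by blast
  have "ip (f i) x = 0" if x:"x:ta" for x
  using p[OF x i(1) l(1)] q[OF x i(1) l(1)] i(2) l(2,4) p[OF x j(1) l(1)] q[OF x j(1) l(1)] j(3) l(3,4) ji[OF x] sg_cases[of T i] by auto
  thus ?thesis using even_if_0[OF K _ i(1)] K by (simp add:ecells_def)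
 next
  case False
  have le:"\<bar>ip (f i) x\<bar> <= sg T k * ip (f k) x" if x:"x:ta" and k:"k < m" "k ~= i" "k ~= j" for x k
  proof -
   have e:"sg U k = sg T k" using False k sg_cases[of T k] sg_cases[of U k] by auto
   show ?thesis using p[OF x i(1) k(1)] q[OF x i(1) k(1)] i(2) e k(2) sg_cases[of T i] by auto
  qed
  let ?be = "proot (sg T i) i (- sg T j) j"
  have be:"?be:Ph" using sg_cases[of T j] by (intro proot[OF i(1) j(1) _ sg_cases]) (use j(2) in auto)
  have bex:"ip ?be x = sg T i * ip (f i) x" if "x:ta" for x using ji[OF that] by (simp add:ip_proot)
  have main:"ta:wallsat T i'"
   if i':"i' < m" "j' < m" "i' ~= j'" and s:"{i',j'} = {i,j}" and neg:"!!x. x:ta ==> sg T i' * ip (f i') x <= 0" for i' j'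
  proof -
   have ji':"sg T j' * ip (f j') x = - (sg T i' * ip (f i') x)" if "x:ta" for x
    using ji[OF that] s by (auto simp:doubleton_eq_iff)
   note fl = flips[OF Tm(1) i'(1)]
   have v:"sg (flips T i') a * ip (f a) x = - (sg T i' * ip (f i') x)" if "x:ta" "a:{i',j'}" for x a
    using that ji' fl(3) fl(4)[of j'] i'(3) by auto
   have abs:"\<bar>ip (f i) x\<bar> = - (sg T i' * ip (f i') x)" if "x:ta" for x
  using ji[OF that] s sg_cases[of T i] neg[OF that] by (auto simp:doubleton_eq_iff)
   have B:"{i',j'} <= {..<m}" "card {i',j'} >= 2" using i' by auto
   have "ta:wall (flips T i') {i',j'}" unfolding wall_iff[OF B]
   proof (intro conjI ballI allI impI K)
    fix x a assume x:"x:ta" and a:"a:{i',j'}"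
    show "sg (flips T i') a * ip (f a) x >= 0" using v[OF x a] neg[OF x] by simp
    fix k assume k:"k < m"
    show "sg (flips T i') a * ip (f a) x <= sg (flips T i') k * ip (f k) x"
    proof (cases "k:{i',j'}")
     case True
     thus ?thesis using v[OF x a] v[OF x True] by simp
    next
     case False
     hence k':"k ~= i" "k ~= j" "k ~= i'" using s by auto
     show ?thesis using v[OF x a] le[OF x k k'(1,2)] abs[OF x] fl(4)[OF k'(3)] by simp
    qed
   qed
   moreover have "card {i',j'} = 2" using i'(3) by simp
   ultimately show ?thesis unfolding wallsat_def using B(1) by blast
  qed
  show ?thesis using cell_coherent[OF K be] main[of j i] i(1) j(1,2) bex ji main[of i j] by auto
 qed
qed

text \<open>Whichever regions have been added before, \<open>part T\<close> meets the rest in its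
  even cells and the m boundary pieces \<open>wallsat T i\<close>, which is a star again.\<close>

lemma h_skeleton_part:
 assumes T:"T:evens" and \<T>: "\<T> <= evens" "T ~: \<T>"
 shows "h ((skel Un (UN U:\<T>. part U)) Int part T) k = conc 1 (m - 1) k"
proof -
 have Tm:"T <= {..<m}" "even (card T)" using T by (auto simp:evens_def)
 have "(skel Un (UN U:\<T>. part U)) Int part T = (ecells Int part T) Un (UN i:{..<m}. wallsat T i)"
 proof
  show "(skel Un (UN U:\<T>. part U)) Int part T <= (ecells Int part T) Un (UN i:{..<m}. wallsat T i)"
  proof
   fix ta assume ta:"ta:(skel Un (UN U:\<T>. part U)) Int part T"
   then consider "ta:ecells" | U where "U:odd_sets" "ta:walls U" | U where "U:\<T>" "ta:part U"
    unfolding skel_def by blast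
   thus "ta:(ecells Int part T) Un (UN i:{..<m}. wallsat T i)"
   proof cases
    case 1
    thus ?thesis using ta by blast
   next
    case 2
    thus ?thesis using walls_part[OF T 2] ta by auto
   next
    case 3
    thus ?thesis using \<T> part_part[OF T, of U ta] ta by auto
   qed
  qed
  have "wallsat T i <= skel" if "i < m" for i
  using flips(1,2)[OF Tm(1) that] Tm(2) by (auto simp:odd_sets_def wallsat_def walls_def skel_def)
  thus "(ecells Int part T) Un (UN i:{..<m}. wallsat T i) <= (skel Un (UN U:\<T>. part U)) Int part T"
   using walls_at_part[OF T] unfolding skel_def by blast
 qed
 moreover have "h ((ecells Int part T) Un (UN i:{..<m}. wallsat T i)) k = conc 1 (card {..<m} - 1) k"
 proof (rule h_star)
  show "complex (ecells Int part T)" by (rule complex_Int[OF complex_even_cells complex_part])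
  show "all_even (ecells Int part T)" using all_even_even_cells by (auto simp:all_even_def)
  show "{..<m} ~= {}" using m by (simp add:lessThan_empty_iff)
  show "complex (wallsat T i)" if "i:{..<m}" for i using h_walls_at(2)[OF T] that by simp
  show "h (wallsat T i) k = 0" if "i:{..<m}" for i k using h_walls_at(1)[OF T] that by simp
  show "all_even (wallsat T i Int wallsat T j)" if ij:"i:{..<m}" "j:{..<m}" "i ~= j" for i j
  proof -
   have "flips T i ~= flips T j" using ij(3) by (auto simp:flips_def)
   moreover have "flips T i <= {..<m}" "flips T j <= {..<m}" using flips(1)[OF Tm(1)] ij by auto
   ultimately show ?thesis using walls_disjoint unfolding all_even_def wallsat_def by blast
  qed
 qed simp
 ultimately show ?thesis by simp
qed

text \<open>The signs of the coordinates at the centre of a cell give a pattern; if it is odd, the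
  sign of the coordinate of least absolute value is flipped.\<close>

lemma K_parts:"K = skel Un (UN U:evens. part U)"
proof
 show "skel Un (UN U:evens. part U) <= K" using complex_skeleton complex_part unfolding subcx_def by blast
 show "K <= skel Un (UN U:evens. part U)"
 proof
  fix ta assume ta:"ta:K"
  let ?x = "center ta"
  define D where "D = {i. i < m & ip (f i) ?x < 0}"
  have Dm:"D <= {..<m}" by (auto simp:D_def)
  have sgD:"sg D k * ip (f k) ?x = \<bar>ip (f k) ?x\<bar>" if "k < m" for k using that by (auto simp:sg_def D_def)
  have "EX T:evens. !i<m. !j<m. i ~= j --> sg T i * ip (f i) ?x + sg T j * ip (f j) ?x >= 0"
  proof (cases "even (card D)")
   case True
   thus ?thesis using Dm sgD by (intro bexI[of _ D]) (auto simp:evens_def)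
  next
   case False
   have "finite ((%k. \<bar>ip (f k) ?x\<bar>) ` {..<m})" "(%k. \<bar>ip (f k) ?x\<bar>) ` {..<m} ~= {}"
    using m by (simp_all add:lessThan_empty_iff)
   hence "Min ((%k. \<bar>ip (f k) ?x\<bar>) ` {..<m}):(%k. \<bar>ip (f k) ?x\<bar>) ` {..<m}"
    "!k<m. Min ((%k. \<bar>ip (f k) ?x\<bar>) ` {..<m}) <= \<bar>ip (f k) ?x\<bar>" by (rule Min_in, auto)
   then obtain i where i:"i < m" "Min ((%k. \<bar>ip (f k) ?x\<bar>) ` {..<m}) = \<bar>ip (f i) ?x\<bar>"
    and "!k<m. Min ((%k. \<bar>ip (f k) ?x\<bar>) ` {..<m}) <= \<bar>ip (f k) ?x\<bar>" by blast
   hence i:"i < m" "!k<m. \<bar>ip (f i) ?x\<bar> <= \<bar>ip (f k) ?x\<bar>" by simp_all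
   note fl = flips[OF Dm i(1)]
   have "sg (flips D i) k * ip (f k) ?x + sg (flips D i) l * ip (f l) ?x >= 0" if kl:"k < m" "l < m" "k ~= l" for k l
   proof -
    have "sg (flips D i) k' * ip (f k') ?x = (if k' = i then - \<bar>ip (f i) ?x\<bar> else \<bar>ip (f k') ?x\<bar>)" if "k' < m" for k'
     using fl(3) fl(4)[of k'] sgD[OF that] by auto
    thus ?thesis using kl i(2) by auto
   qed
   thus ?thesis using fl(1,2) False by (auto simp:evens_def)
  qed
  then obtain T where T:"T:evens"
   "!i<m. !j<m. i ~= j --> sg T i * ip (f i) ?x + sg T j * ip (f j) ?x >= 0" by blast
  hence Tm:"T <= {..<m}" "even (card T)" by (auto simp:evens_def)
  have "ip ga v >= 0" if "ga:evab (cvec T)" "v:ta" for ga v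
  proof -
   have "?x:region (evab (cvec T))" using region_part[OF Tm] T(2) by blast
   thus ?thesis using root_center(1)[OF ta, of ga] evab_roots that unfolding region_def by blast
  qed
  thus "ta:skel Un (UN U:evens. part U)" using ta T(1) by (force simp:part_def rcells_def region_def)
 qed
qed

text \<open>The difference of the dimensions in degrees 2 and 1 starts at - (2^(m-1) - 1) for the
  skeleton, and each region raises it by m - 1.\<close>

theorem h_frame:
 assumes hp:"!!T k. T:evens ==> h (part T) k = conc 4 c' k" and h1:"h K 1 = 0"
 shows "h K k = conc 2 (nat (int (2 ^ (m - 1) * (m - 1)) - int (2 ^ (m - 1) - 1))) k + conc 4 (2 ^ (m - 1) * c') k"
proof -
 have step:"complex (skel Un (UN U:\<T>. part U)) &
   (!k. k ~: {1,2,4} --> h (skel Un (UN U:\<T>. part U)) k = 0) &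
   h (skel Un (UN U:\<T>. part U)) 4 = card \<T> * c' &
   int (h (skel Un (UN U:\<T>. part U)) 2) - int (h (skel Un (UN U:\<T>. part U)) 1) =
    int (card \<T> * (m - 1)) - int (2 ^ (m - 1) - 1)"
  if "finite \<T>" "\<T> <= evens" for \<T> using that
 proof (induction \<T> rule:finite_induct)
  case empty
  thus ?case using complex_skeleton h_skeleton by (simp add:conc_def)
 next
  case (insert T \<T>)
  let ?A = "skel Un (UN U:\<T>. part U)"
  have IH:"complex ?A" "!!k. k ~: {1,2,4} ==> h ?A k = 0" "h ?A 4 = card \<T> * c'"
   "int (h ?A 2) - int (h ?A 1) = int (card \<T> * (m - 1)) - int (2 ^ (m - 1) - 1)" using insert by auto
  have T:"T:evens" using insert.prems by blast
  have eq:"skel Un (UN U:insert T \<T>. part U) = ?A Un part T" by blast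
  have I:"h (?A Int part T) k = conc 1 (m - 1) k" for k by (rule h_skeleton_part[OF T]) (use insert in auto)
  note bub = attach_bubble[OF IH(1) complex_part I hp[OF T] IH(2,3,4)]
  have c:"card (insert T \<T>) = Suc (card \<T>)" using insert.hyps by simp
  show ?case unfolding eq c
  proof (intro conjI)
   show "complex (?A Un part T)" by (rule complex_Un[OF IH(1) complex_part])
   show "!k. k ~: {1,2,4} --> h (?A Un part T) k = 0" using bub by blast
   show "h (?A Un part T) 4 = Suc (card \<T>) * c'" using bub by simp
   show "int (h (?A Un part T) 2) - int (h (?A Un part T) 1) =
     int (Suc (card \<T>) * (m - 1)) - int (2 ^ (m - 1) - 1)" using bub by simp
  qed
 qed
 note K = step[OF finite_sets(2) subset_refl, folded K_parts, unfolded card_even_odd]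
 have h2:"h K 2 = nat (int (2 ^ (m - 1) * (m - 1)) - int (2 ^ (m - 1) - 1))" using K h1 by linarith
 consider "k = 1" | "k = 2" | "k = 4" | "k ~: {1,2,4}" by blast
 thus ?thesis using h1 K by (auto simp:conc_def h2)
qed

text \<open>The reflection in (f i + f j)/2 flips two signs, so all even patterns belong to one Weyl
  orbit.\<close>

lemma center_coweight:
 assumes "T:evens"
 shows "EX b:bases. cvec T = om b j0"
proof -
 have "EX b:bases. cvec T = om b j0" if "card T = 2 * k" "T <= {..<m}" for k T using that
 proof (induction k arbitrary:T)
  case 0
  thus ?case using finite_subset center_empty b0 by fastforce
 next
  case (Suc k)
  have fin:"finite T" using Suc.prems finite_subset by blast
  obtain i j T' where T:"T = insert i (insert j T')" "i ~= j" "i ~: T'" "j ~: T'" "card T' = 2 * k"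
  proof -
   obtain i where i:"i:T" using Suc.prems(1) by fastforce
   hence c:"card (T - {i}) = 2 * k + 1" using Suc.prems(1) by simp
   hence "T - {i} ~= {}" by (metis card.empty add_is_0 one_neq_zero)
   then obtain j where j:"j:T - {i}" by blast
   hence "card (T - {i} - {j}) = 2 * k" using c by simp
   thus ?thesis using that[of i j "T - {i} - {j}"] i j by auto
  qed
  obtain b where b:"b:bases" "cvec T' = om b j0" using Suc.IH[of T'] T Suc.prems(2) by auto
  have ij:"i < m" "j < m" using T Suc.prems(2) by auto
  let ?be = "proot 1 i 1 j"
  have be:"?be:Ph" using proot[OF ij T(2)] by blast
  have "ip ?be (cvec T') = 2" using ij T(3,4) by (simp add:ip_proot f_center sg_def)
  hence "refl ?be (cvec T') = cvec T' - f i - f j" by (simp add:refl_def proot_def)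
  also have "... = cvec T"
  proof -
   have "T' <= {..<m}" "finite T'" using T(1) Suc.prems(2) fin by auto
   moreover have "(SUM i:T. f i) = f i + (f j + (SUM i:T'. f i))" unfolding T(1) using T(2-4) \<open>finite T'\<close> by simp
   ultimately show ?thesis unfolding center_flip[OF Suc.prems(2)] center_flip[OF \<open>T' <= {..<m}\<close>] by simp
  qed
  finally show ?case by (metis b(2) rbase[OF be b(1)] om_rbase)
 qed
 thus ?thesis using assms unfolding evens_def by (metis (mono_tags, lifting) evenE mem_Collect_eq)
qed

text \<open>Without odd nodes mu would be even on all of \<open>N\<close>, against its parity on
  \<open>b0 j0\<close>. A single one would make \<open>f 0\<close>, of norm 4, congruent to a root
  modulo 2M, but vectors congruent to a root have norm 2 modulo 4.\<close>

lemma odd_nodes_ge_2: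
 assumes b:"b:bases"
 shows "card (oddn b) >= 2"
proof (rule ccontr)
 assume "~ ?thesis"
 moreover have fin:"finite (oddn b)" by (simp add:oddn_def)
 ultimately have "card (oddn b) = 0 \<or> card (oddn b) = 1" by linarith
 then consider "oddn b = {}" | i where "oddn b = {i}" using fin by (auto simp:card_1_singleton_iff)
 thus False
 proof cases
  case 1
  have "b0 j0:Ph" by (rule b_root[OF b0 j0])
  hence "ev (ip mu (b0 j0))" using ev_nsum_odd[OF b root_N] 1 by (simp add:nsum_def ip_0_left)
  thus False by (metis ev_cong[OF par0] \<open>b0 j0 : Ph\<close> b_om[OF b0 j0 j0] not_ev_1 ip_com)
 next
  case 2
  hence i:"i:NN" by (auto simp:oddn_def)
  have "ev (ip (f 0 - b i) x)" if "x:N" for x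
   using ev_diff[OF ev_nsum_odd[OF b that] f_mu[OF that]] 2 by (simp add:nsum_def ip_dl)
  hence z:"(1/2) *r (f 0 - b i):M" (is "?z:M") by (rule half_M)
  have "f 0 = b i + 2 *r ?z" by simp
  moreover have "ip (b i + 2 *r z) (b i + 2 *r z) = ip (b i) (b i) + 4 * ip (b i) z + 4 * ip z z" for z
   by (simp only:ip_addl ip_addr ip_sl ip_sr ip_com[of z "b i"]) simp
  ultimately have "ip (f 0) (f 0) = ip (b i) (b i) + 4 * ip (b i) ?z + 4 * ip ?z ?z" by metis
  moreover have "ip (b i) ?z:\<int>" "ip ?z ?z:\<int>" using M_M_int z root_M[OF b_root[OF b i]] by blast+
  then obtain u v where "ip (b i) ?z = of_int u" "ip ?z ?z = of_int v" by (elim Ints_cases)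
  ultimately have "real_of_int 4 = real_of_int (2 + 4 * u + 4 * v)" using f_ip[of 0 0] m root_norm[OF b_root[OF b i]] by simp
  thus False by presburger
 qed
qed

text \<open>The whole complex is shelled, ignoring the walls; every critical cell has at least two
  descents because every base has at least two odd nodes.\<close>

lemma h_K_1:"h K 1 = 0"
proof -
 have e:"region {} = UNIV" by (simp add:region_def)
 hence K:"rcells {} = K" by (simp add:rcells_def)
 obtain l where l:"l:region {}" "generic {} l" by (rule exists_generic[of 0 "{}"], simp add:e, rule that)
 have cells:"gcells {} = verts ` {b:bases. verts b <= region {}}"
 proof (rule generic_cell_verts)
  show "EX y:region {}. ip be y ~= 0" if "be:Ph" for be using root_norm[OF that] e by (intro bexI[of _ be]) auto
 qed
 have "card (descs l C) >= 2" if C:"C:gcells {}" "descs l C = odds C" for C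
 proof -
  obtain b where b:"b:bases" "C = verts b" using C(1) cells by blast
  have "odds C = om b ` oddn b" using b(2) by (auto simp:odds_def oddn_def verts_def)
  moreover have "inj_on (om b) (oddn b)" using om_inj[OF b(1)] by (rule inj_on_subset) (auto simp:oddn_def)
  ultimately show ?thesis using C(2) odd_nodes_ge_2[OF b(1)] by (simp add:card_image)
 qed
 from h_shelling_low[OF shelling_region[OF empty_subsetI l] gcells_ne[OF empty_subsetI l] this]
 show ?thesis unfolding Union_generic_cells[OF empty_subsetI l] K by blast
qed

end

lemma lengths:"length [a,b,c] = 3" "length [a,b,c,d] = 4" by simp_all

lemma even_if:"even (if P then - 1 else 0 :: int) <-> ~P" "even (if P then 2 else 0 :: int)" by auto

lemma even_degree:
 assumes "S <= nodes n"
 shows "even (SUM k:S. E_cartan i k) <-> even (SUM k:nodes n. if k:S then E_cartan i k else 0)"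
 using sum.inter_restrict[OF finite_nodes[of n], of "E_cartan i" S] assms by (simp add:Int_absorb1)

text \<open>A linear system over the field with two elements. Its solution is unique because the
  Cartan matrix of E8 has determinant 1.\<close>

lemma odd_degree_E8:
 assumes "S <= nodes 8" "!!i. i:nodes 8 ==> even (SUM k:S. E_cartan i k) <-> i ~= 2"
 shows "S = {1,4,6,8}"
proof -
 note * = assms(2)[unfolded even_degree[OF assms(1)]]
 from *[of 1] *[of 2] *[of 3] *[of 4] *[of 5] *[of 6] *[of 7] *[of 8]
 have "3 ~: S" "4:S" "1:S <-> 4:S" "(2:S <-> 3:S) <-> 5 ~: S" "4:S <-> 6:S" "5:S <-> 7:S" "6:S <-> 8:S" "7 ~: S"
  by (simp_all add:cartan_code E_edges_def nodes8 even_if cong:if_cong)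
 thus ?thesis using assms(1) unfolding nodes8 by blast
qed

text \<open>The Cartan matrix of E7 has determinant 2; the two solutions differ by {2,5,7}, which
  spans its kernel modulo 2.\<close>

lemma odd_degree_E7:
 assumes "S <= nodes 7" "!!i. i:nodes 7 ==> even (SUM k:S. E_cartan i k) <-> i ~= 3"
 shows "S = {1} \<or> S = {1,2,5,7}"
proof -
 note * = assms(2)[unfolded even_degree[OF assms(1)]]
 from *[of 1] *[of 2] *[of 3] *[of 4] *[of 5] *[of 6]
 have "3 ~: S" "4 ~: S" "1:S <-> 4 ~: S" "(2:S <-> 3:S) <-> 5 ~: S" "4:S <-> 6:S" "5:S <-> 7:S" "6 ~: S"
  by (simp_all add:cartan_code E_edges_def nodes7 even_if cong:if_cong)
 thus ?thesis using assms(1) unfolding nodes7 by blast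
qed

lemma even_degree_E7:
 assumes "S <= nodes 7" "!!i. i:nodes 7 ==> even (SUM k:S. E_cartan i k)"
 shows "S = {} \<or> S = {2,5,7}"
proof -
 note * = assms(2)[unfolded even_degree[OF assms(1)]]
 from *[of 1] *[of 2] *[of 3] *[of 4] *[of 5] *[of 6]
 have "3 ~: S" "4 ~: S" "1:S <-> 4:S" "(2:S <-> 3:S) <-> 5 ~: S" "4:S <-> 6:S" "5:S <-> 7:S" "6 ~: S"
  by (simp_all add:cartan_code E_edges_def nodes7 even_if cong:if_cong del:One_nat_def)
 thus ?thesis using assms(1) unfolding nodes7 by blast
qed

context E_roots
begin

lemma dominant_om:
 assumes b:"b:bases" and b0:"b0:bases" and j:"j:NN"
 shows "dominant b (om b0 j) <-> om b j = om b0 j" using dom_vertex[OF b b0 j] b_om[OF b _ j] by (auto simp:dominant_def)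

text \<open>Dominance for a fundamental weight means sharing that vertex, so the bases counted form
  a class for the other nodes; at j itself l is positive.\<close>

lemma card_dominant:
 assumes b0:"b0:bases" and j:"j:NN" and X:"set X = NN - {j}" "distinct X" "worder X = w" "w ~= 0"
  and PS:"set P Un set S = NN - {j}" "set P Int set S = {}" "sign_ok P S"
  and l:"!!be. be:Ph ==> ip be l ~= 0" "!!be. be:Ph ==> ip be (om b0 j) > 0 ==> ip be l > 0"
 shows "int (card {b:bases. dominant b (om b0 j) & {i:NN. ip (b i) l < 0} = set S}) = scount w P S"
proof -
 let ?I = "NN - {j}"
 have "{b:bases. dominant b (om b0 j) & {i:NN. ip (b i) l < 0} = set S} =
   {b:fclass b0 ?I. pos_on l (set P) b & (!i:set S. ip (b i) l < 0)}" (is "?L = ?R")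
 proof (rule Set.set_eqI)
  fix b
  have "{i:NN. ip (b i) l < 0} = set S <-> pos_on l (set P) b & (!i:set S. ip (b i) l < 0)"
   if bf:"b:fclass b0 ?I"
  proof -
   have b:"b:bases" "om b j = om b0 j" using bf j by (auto simp:fclass_def)
   have jl:"ip (b j) l > 0" using l(2)[OF b_root[OF b(1) j]] b_om[OF b(1) j j] b(2) by simp
   have nz:"ip (b i) l ~= 0" if "i:NN" for i using l(1)[OF b_root[OF b(1) that]] .
   show ?thesis
   proof
    assume a:"{i:NN. ip (b i) l < 0} = set S"
    have "ip (b i) l > 0" if "i:set P" for i
    proof -
     have "i:NN" "i ~: set S" using that PS by auto
     thus ?thesis using a nz[of i] by force
    qed
    thus "pos_on l (set P) b & (!i:set S. ip (b i) l < 0)" using a by (auto simp:pos_on_def)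
   next
    assume a:"pos_on l (set P) b & (!i:set S. ip (b i) l < 0)"
    show "{i:NN. ip (b i) l < 0} = set S"
    proof
     show "set S <= {i:NN. ip (b i) l < 0}" using a PS(1) by blast
     show "{i:NN. ip (b i) l < 0} <= set S"
     proof
      fix i assume i:"i:{i:NN. ip (b i) l < 0}"
      hence "i ~= j" "i ~: set P" using jl a by (auto simp:pos_on_def)
      thus "i:set S" using i PS(1) by blast
     qed
    qed
   qed
  qed
  thus "b:?L <-> b:?R" using dominant_om[OF _ b0 j] j by (auto simp:fclass_def)
 qed
 moreover have "int (card (fclass b0 ?I)) = w" using card_face_class[OF b0, of X] X by auto
 ultimately show ?thesis using card_signs[OF b0 _ _ PS(3) l(1), of ?I] PS(1) by simp
qed

end

context E_roots
begin

text \<open>At node 8 of E8 and node 1 of E7 this applies: there the fundamental weight is the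
  highest root.\<close>

lemma even_row_root:
 assumes b:"b:bases" and j:"j:NN" and row:"!i:NN. even (E_inv n j i)" "E_inv n j j = 4"
 shows "om b j:Ph"
proof -
 have "ip (om b i) (om b j):\<int>" if i:"i:NN" for i using that row(1) om_om[OF b j i] by (force simp:ip_com)
 hence "om b j:M" by (simp add:M_iff[OF b])
 thus ?thesis using om_om[OF b j j] row(2) by (simp add:root_iff)
qed

end

context E_class
begin

lemma odd_nodes_degree:
 assumes b:"b:bases" and i:"i:NN"
 shows "even (SUM k:oddn b. E_cartan i k) <-> ev (ip (b i) mu)"
proof -
 have biN:"b i:N" using b_root[OF b i] root_M M_N by blast
 have "ip (nsum b (oddn b)) (b i) = (SUM k:oddn b. of_int (E_cartan i k))"
  unfolding nsum_def ip_suml using gram[OF b _ i] E_cartan_sym by (intro sum.cong) (auto simp:oddn_def)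
 hence "ip (nsum b (oddn b)) (b i) = of_int (SUM k:oddn b. E_cartan i k)" by simp
 thus ?thesis using ev_cong[OF ev_nsum_odd[OF b biN]] by (simp add:ip_com[of mu] del:of_int_sum)
qed

lemma h_coweight_region:
 assumes b0:"b0:bases" and j:"j:NN" and X:"set X = NN - {j}" "distinct X" "worder X = w" "w ~= 0"
  and PS:"set P Un set S = NN - {j}" "set P Int set S = {}" "sign_ok P S" "distinct S" "S ~= []"
  and par:"!!be. be:Ph ==> ev (ip be (om b0 j) - ip be mu)"
  and odd:"!!b. b:bases ==> om b j = om b0 j ==> oddn b = set S"
 shows "h (rcells (evab (om b0 j))) k = conc (length S) (nat (scount w P S)) k"
proof -
 have S:"oddn b = set S" if "b:bases" "dominant b (om b0 j)" for b using odd that dominant_om[OF _ b0 j] by blast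
 have d:"card (set S) >= 1" using PS(5) by (simp add:Suc_le_eq card_gt_0_iff)
 obtain l where l:"!!be. be:Ph ==> ip be l ~= 0" "!!be. be:Ph ==> ip be (om b0 j) > 0 ==> ip be l > 0"
  "!!k. h (rcells (evab (om b0 j))) k = conc (card (set S))
   (card {b:bases. dominant b (om b0 j) & {i:NN. ip (b i) l < 0} = set S}) k"
  by (rule h_region[of "om b0 j", OF par S d], assumption, assumption, assumption, rule that)
 have "card {b:bases. dominant b (om b0 j) & {i:NN. ip (b i) l < 0} = set S} = nat (scount w P S)"
  using card_dominant[OF b0 j X PS(1-3) l(1,2)] by simp
 thus ?thesis using l(3) distinct_card[OF PS(4)] by simp
qed

lemma h_K_zero:
 assumes "!!x. x:N ==> ev (ip mu x)"
 shows "h K k = conc 0 1 k"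
proof (rule h_all_even)
 show "complex K" using complex_K K_nonempty by blast
 have "v:N" if "ta:K" "v:ta" for ta v using that om_N unfolding K_def verts_def by blast
 thus "all_even K" using assms unfolding all_even_def by blast
qed

lemma h_root:
 assumes b0:"b0:bases" and j:"j:NN" and al:"om b0 j:Ph"
  and cong:"!x:N. ev (ip mu x - ip (om b0 j) x)"
  and h:"!b k. b:bases --> (!x:N. ev (ip mu x - ip (om b j) x)) -->
   h (rcells (evab (om b j))) k = conc 3 c' k"
 shows "h K k = conc 1 1 k + conc 3 (2 * c') k"
proof -
 let ?al = "om b0 j"
 \<comment> \<open>Reflection in the root itself makes its negative a fundamental weight, so the
   hypothesis on regions covers the opposite half as well.\<close>
 define b1 where "b1 = rbase ?al b0"
 have b1:"b1:bases" "om b1 j = - ?al"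
  using rbase[OF al b0] root_norm[OF al] by (simp_all add:b1_def om_rbase refl_def scaleR_2)
 have cong1:"!x:N. ev (ip mu x - ip (om b1 j) x)"
 proof
  fix x assume x:"x:N"
  have "ip ?al x:\<int>" using x al by (simp add:N_def)
  from ev_add[OF bspec[OF cong x] ev_double[OF this]] show "ev (ip mu x - ip (om b1 j) x)"
   using b1(2) by (simp add:ip_ml add.commute)
 qed
 have above:"evab be = {be}" if be:"be:Ph" "!x:N. ev (ip mu x - ip be x)" for be
 proof -
  have "ga = be" if ga:"ga:Ph" "ev (ip ga mu)" "ip ga be > 0" for ga
  using that root_M M_N ev_cong[OF bspec[OF be(2)]] root_eqI[OF ga(1) be(1)] by (force simp:ip_com ev_def)
  moreover have "ev (ip be mu)"
  using be(1) root_M M_N ev_cong[OF bspec[OF be(2)], of be] root_norm[OF be(1)] ev_2 by (auto simp:ip_com)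
  ultimately show ?thesis using root_norm[OF be(1)] be(1) by (auto simp:evab_def)
 qed
 let ?A = "rcells {?al}" and ?B = "rcells {- ?al}"
 have hA:"h ?A k = conc 3 c' k" for k using h b0 cong above[OF al cong] by fastforce
 have hB:"h ?B k = conc 3 c' k" for k using h b1(1) cong1 above[OF _ cong1] root_minus[OF al] b1(2) by auto
 have "K = ?A Un ?B" using cell_coherent[OF _ al] by (auto simp:rcells_def region_def ip_ml)
 moreover have "h (?A Int ?B) k = conc 0 1 k" for k
 proof (rule h_all_even[OF complex_Int[OF cplx_rc cplx_rc]])
  have "ev (ip mu v)" if "ta:?A" "ta:?B" "v:ta" for ta v
  using that om_N ev_cong[OF bspec[OF cong]] ev_0 by (force simp:rcells_def K_def verts_def region_def ip_ml)
  thus "all_even (?A Int ?B)" by (auto simp:all_even_def)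
 qed
 ultimately show ?thesis using glue_conc[OF cplx_rc cplx_rc _ hA hB, of k] by (simp add:mult_2)
qed

text \<open>On the vertex i, mu has the parity of its product with \<open>om b j\<close>, which is
  half an entry of \<open>E_inv\<close>; hence the divisibility by 4.\<close>

lemma odd_nodes_om:
 assumes b:"b:bases" and j:"j:NN" and cong:"!x:N. ev (ip mu x - ip al x)"
  and al:"om b j = al"
 shows "oddn b = {i:NN. ~4 dvd E_inv n j i}"
proof -
 have "ev (ip mu (om b i)) <-> 4 dvd E_inv n j i" if i:"i:NN" for i
 proof -
  have "ev (ip mu (om b i)) <-> ev (of_int (E_inv n j i) / 2)"
   using ev_cong[OF bspec[OF cong om_N[OF b i]]] om_om[OF b j i] unfolding al by metis
  also have "... <-> (EX k. E_inv n j i = 4 * k)" unfolding ev_def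
  proof (intro iff_exI iffI)
   fix k assume "real_of_int (E_inv n j i) / 2 = 2 * real_of_int k"
   thus "E_inv n j i = 4 * k" by (simp only:)
  qed simp
  finally show ?thesis by auto
 qed
 thus ?thesis by (auto simp:oddn_def)
qed

text \<open>The stabiliser of the highest root is the Weyl group of E7, of order 2903040; each half
  contributes 28855, together 57710.\<close>

theorem h_root_E8:
 assumes n:"n = 8" and b0:"b0:bases" and cong:"!x:N. ev (ip mu x - ip (om b0 8) x)"
 shows "h K k = conc 1 1 k + conc 3 57710 k"
proof -
 have j:"8:NN" by (simp add:n nodes8)
 have X:"set [7,6,5,4,3,2,1] = NN - {8}" and PS:"set [1,3,4,6] Un set [2,5,7] = NN - {8}" unfolding n nodes8 by auto
 have row:"{i:NN. ~4 dvd E_inv n 8 i} = set [2,5,7]" unfolding n nodes8 by (auto simp:E_inv_def E_inverse_def)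
 have root:"om b 8:Ph" if "b:bases" for b using even_row_root[OF that j] by (auto simp:n nodes8 E_inv_def E_inverse_def)
 have part:"h (rcells (evab (om b 8))) k = conc 3 28855 k"
  if b:"b:bases" and cong_b:"!x:N. ev (ip mu x - ip (om b 8) x)" for b k
 proof -
  have "h (rcells (evab (om b 8))) k = conc (length ([2,5,7] :: nat list)) (nat (scount 2903040 [1,3,4,6] [2,5,7])) k"
  proof (rule h_coweight_region[OF b j X _ weyl_orders_E7(8) _ PS])
   fix be assume "be:Ph"
   hence "be:N" using root_M M_N by blast
   from ev_minus[OF bspec[OF cong_b this]] show "ev (ip be (om b 8) - ip be mu)" by (simp add:ip_com)
  next
   fix b' assume "b':bases" "om b' 8 = om b 8"
   thus "oddn b' = set [2,5,7]" using odd_nodes_om[OF _ j cong_b] row by simp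
  qed (use sign_count_E7 in \<open>simp_all del:sign_ok.simps\<close>)
  thus ?thesis unfolding lengths sign_count_E7 by simp
 qed
 have "h K k = conc 1 1 k + conc 3 (2 * 28855) k" using part by (intro h_root[OF b0 j root[OF b0] cong]) blast
 thus ?thesis by simp
qed

text \<open>Here the stabiliser has type D6 and order 23040, and 1622 is twice 811.\<close>

theorem h_root_E7:
 assumes n:"n = 7" and b0:"b0:bases" and cong:"!x:N. ev (ip mu x - ip (om b0 1) x)"
 shows "h K k = conc 1 1 k + conc 3 1622 k"
proof -
 have j:"1:NN" by (simp add:n nodes7)
 have X:"set [7,6,5,4,3,2] = NN - {1}" and PS:"set [2,4,6] Un set [3,5,7] = NN - {1}" unfolding n nodes7 by auto
 have row:"{i:NN. ~4 dvd E_inv n 1 i} = set [3,5,7]" unfolding n nodes7 by (auto simp:E_inv_def E_inverse_def)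
 have root:"om b 1:Ph" if "b:bases" for b using even_row_root[OF that j] by (auto simp:n nodes7 E_inv_def E_inverse_def)
 have part:"h (rcells (evab (om b 1))) k = conc 3 811 k"
  if b:"b:bases" and cong_b:"!x:N. ev (ip mu x - ip (om b 1) x)" for b k
 proof -
  have "h (rcells (evab (om b 1))) k = conc (length ([3,5,7] :: nat list)) (nat (scount 23040 [2,4,6] [3,5,7])) k"
  proof (rule h_coweight_region[OF b j X _ weyl_orders_D6(8) _ PS])
   fix be assume "be:Ph"
   hence "be:N" using root_M M_N by blast
   from ev_minus[OF bspec[OF cong_b this]] show "ev (ip be (om b 1) - ip be mu)" by (simp add:ip_com)
  next
   fix b' assume "b':bases" "om b' 1 = om b 1"
   thus "oddn b' = set [3,5,7]" using odd_nodes_om[OF _ j cong_b] row by simp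
  qed (use sign_count_D6 in \<open>simp_all del:sign_ok.simps\<close>)
  thus ?thesis unfolding lengths sign_count_D6 by simp
 qed
 show ?thesis using part h_root[OF b0 j root[OF b0] cong] by force
qed

text \<open>All roots are even, so p = 0 has the right parities and leaves no walls: the region is
  the whole space, every base is dominant, and the signs are counted over the full Weyl group of
  E7.\<close>

theorem h_radical:
 assumes n:"n = 7" and even:"!!be. be:Ph ==> ev (ip be mu)" and x:"x:N" "~ev (ip mu x)"
 shows "h K k = conc 3 28855 k"
proof -
 have nn:"NN = {1,2,3,4,5,6,7}" by (simp add:n nodes7)
 have S:"oddn b = {2,5,7}" if b:"b:bases" for b
 proof -
  have "oddn b <= NN" by (auto simp:oddn_def)
  moreover have "even (SUM k:oddn b. E_cartan i k)" if "i:NN" for i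
   using even odd_nodes_degree[OF b that] b_root[OF b that] by simp
  ultimately have "oddn b = {} \<or> oddn b = {2,5,7}" using even_degree_E7 unfolding n by blast
  moreover have "oddn b ~= {}" using ev_nsum_odd[OF b x(1)] x(2) by (auto simp:nsum_def ip_0_left)
  ultimately show ?thesis by blast
 qed
 have par:"ev (ip be 0 - ip be mu)" if "be:Ph" for be using even[OF that] by (simp add:ip_0_right ev_minus)
 have above:"evab 0 = {}" by (simp add:evab_def ip_0_right)
 have dom:"dominant b 0" for b by (simp add:dominant_def ip_0_right)
 have K:"rcells (evab 0) = K" by (simp add:above rcells_def region_def)
 have d:"card {2,5,7::nat} >= 1" by simp
 obtain l where l:"!!be. be:Ph ==> ip be l ~= 0"
  "!!k. h (rcells (evab 0)) k = conc (card {2,5,7::nat})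
   (card {b:bases. dominant b 0 & {i:NN. ip (b i) l < 0} = {2,5,7}}) k"
  by (rule h_region[of 0, OF par S d], assumption, assumption, rule that)
 have cls:"bases = fclass a0 (NN)" by (auto simp:fclass_def)
 have signs:"{i:NN. ip (b i) l < 0} = {2,5,7} <->
   pos_on l (set [1,3,4,6]) b & (!i:set [2,5,7]. ip (b i) l < 0)" if b:"b:bases" for b
 proof -
  have nz:"ip (b i) l > 0 <-> ~ip (b i) l < 0" if "i:NN" for i using l(1)[OF b_root[OF b that]] by linarith
  have "{i:NN. ip (b i) l < 0} = {2,5,7} <-> (!i:NN. ip (b i) l < 0 <-> i:{2,5,7})" using nn by blast
  also have "... <-> (!i:{1,3,4,6}. ~ip (b i) l < 0) & (!i:{2,5,7}. ip (b i) l < 0)" unfolding nn by (simp) blast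
  also have "(!i:{1,3,4,6}. ~ip (b i) l < 0) <-> (!i:{1,3,4,6}. ip (b i) l > 0)" using nz unfolding nn by blast
  finally show ?thesis by (simp add:pos_on_def)
 qed
 have "{b:bases. dominant b 0 & {i:NN. ip (b i) l < 0} = {2,5,7}} =
   {b:fclass a0 (NN). pos_on l (set [1,3,4,6]) b & (!i:set [2,5,7]. ip (b i) l < 0)}" unfolding cls[symmetric]
 proof (rule Collect_cong)
  fix b
  show "(b:bases & dominant b 0 & {i:NN. ip (b i) l < 0} = {2,5,7}) <->
    (b:bases & pos_on l (set [1,3,4,6]) b & (!i:set [2,5,7]. ip (b i) l < 0))" using signs dom by auto
 qed
 moreover have "int (card (fclass a0 (NN))) = 2903040"
 proof -
  have "set [7,6,5,4,3,2,1] = NN" unfolding nn by auto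
  thus ?thesis using card_face_class[OF a0_base, of "[7,6,5,4,3,2,1]"] unfolding weyl_orders_E7 by simp
 qed
 moreover have "set [1,3,4,6] Un set [2,5,7] <= NN" unfolding nn by auto
 ultimately have "int (card {b:bases. dominant b 0 & {i:NN. ip (b i) l < 0} = {2,5,7}}) = 28855"
  using card_signs[OF a0_base subset_refl _ sign_count_E7(1) l(1)] sign_count_E7(2) by presburger
 hence "card {b:bases. dominant b 0 & {i:NN. ip (b i) l < 0} = {2,5,7}} = 28855" by linarith
 moreover have "card {2,5,7::nat} = 3" by simp
 ultimately show ?thesis using l(2)[of k] unfolding K by presburger
qed

end

context E_frame
begin

lemma h_part:
 assumes X:"set X = NN - {j0}" "distinct X" "worder X = w" "w ~= 0"
  and PS:"set P Un set S = NN - {j0}" "set P Int set S = {}" "sign_ok P S" "distinct S" "S ~= []"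
  and odd:"!!b. b:bases ==> (!!i. i:NN ==> even (SUM k:oddn b. E_cartan i k) <-> i ~= j0) ==> oddn b = set S"
  and T:"T:evens"
 shows "h (part T) k = conc (length S) (nat (scount w P S)) k"
proof -
 obtain b where b:"b:bases" "cvec T = om b j0" using center_coweight[OF T] by blast
 have Tm:"T <= {..<m}" "even (card T)" using T by (auto simp:evens_def)
 have par:"ev (ip be (om b j0) - ip be mu)" if "be:Ph" for be using center_even[OF Tm that] b(2) by simp
 show ?thesis unfolding part_def b(2)
 proof (rule h_coweight_region[OF b(1) j0 X PS par])
  fix b' assume b':"b':bases" "om b' j0 = om b j0"
  show "oddn b' = set S"
  proof (rule odd[OF b'(1)])
   fix i assume i:"i:NN"
   have "ev (ip (b' i) mu) <-> ev (ip (b' i) (om b' j0))" using ev_cong[OF par[OF b_root[OF b'(1) i]]] b'(2) by simp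
   also have "... <-> i ~= j0" using b_om[OF b'(1) i j0] ev_0 not_ev_1 by simp
   finally show "even (SUM k:oddn b'. E_cartan i k) <-> i ~= j0" unfolding odd_nodes_degree[OF b'(1) i] .
  qed
 qed
qed

text \<open>The vertex at node 2 has a stabiliser of type A7. There are 2^7 regions with 1385
  critical chambers each, and 128 * 1385 = 177280.\<close>

theorem h_frame_E8:
 assumes n:"n = 8" "m = 8" "j0 = 2"
 shows "h K k = conc 2 769 k + conc 4 177280 k"
proof -
 have X:"set [8,7,6,5,4,3,1] = NN - {j0}" and PS:"set [3,5,7] Un set [1,4,6,8] = NN - {j0}"
  unfolding n nodes8 by auto
 have odd:"oddn b = set [1,4,6,8]"
  if b:"b:bases" and deg:"!!i. i:NN ==> even (SUM k:oddn b. E_cartan i k) <-> i ~= j0" for b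
 proof -
  have sub:"oddn b <= NN" by (auto simp:oddn_def)
  show ?thesis using odd_degree_E8[of "oddn b"] sub deg unfolding n by auto
 qed
 have "h (part T) k = conc 4 1385 k" if "T:evens" for T k
 proof -
  have "h (part T) k = conc (length ([1,4,6,8] :: nat list)) (nat (scount 40320 [3,5,7] [1,4,6,8])) k"
   by (rule h_part[OF X _ weyl_orders_A7(16) _ PS _ _ _ _ odd that])
    (use sign_count_A7 in \<open>simp_all del:sign_ok.simps\<close>)
  thus ?thesis unfolding lengths sign_count_A7 by simp
 qed
 from h_frame[OF this h_K_1, of k] show ?thesis unfolding n by simp
qed

theorem h_frame_E7:
 assumes n:"n = 7" "m = 6" "j0 = 3"
 shows "h K k = conc 2 129 k + conc 4 1952 k"
proof -
 have X:"set [7,6,5,4,2,1] = NN - {j0}" and PS:"set [4,6] Un set [1,2,5,7] = NN - {j0}" unfolding n nodes7 by auto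
 have odd:"oddn b = set [1,2,5,7]"
  if b:"b:bases" and deg:"!!i. i:NN ==> even (SUM k:oddn b. E_cartan i k) <-> i ~= j0" for b
 proof -
  have sub:"oddn b <= NN" by (auto simp:oddn_def)
  \<comment> \<open>The parities on the simple roots leave {1} and {1,2,5,7}; a single odd node is
    excluded for a frame.\<close>
  show ?thesis using odd_degree_E7[of "oddn b"] sub deg odd_nodes_ge_2[OF b] unfolding n by auto
 qed
 have "h (part T) k = conc 4 61 k" if "T:evens" for T k
 proof -
  have "h (part T) k = conc (length ([1,2,5,7] :: nat list)) (nat (scount 1440 [4,6] [1,2,5,7])) k"
   by (rule h_part[OF X _ weyl_orders_A5(16) _ PS _ _ _ _ odd that])
    (use sign_count_A5 in \<open>simp_all del:sign_ok.simps\<close>)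
  thus ?thesis unfolding lengths sign_count_A5 by simp
 qed
 from h_frame[OF this h_K_1, of k] show ?thesis unfolding n by simp
qed

end

section \<open>The sign action and the homology of unions of strata\<close>

context E_roots
begin

text \<open>An element w of \<open>N\<close> gives a point of order at most 2 in the torus; this is
  the value of the character m at that point.\<close>

definition sign_of :: "'a=>'a=>real" where
 "sign_of w m = (if ev (ip m w) then 1 else - 1)"

definition "nwt s = (SUM i:s. om a0 i)"

definition cspace :: "(nat=>real) set" where
 "cspace = {z. !k. k ~: NN --> z k = 0}"

lemma N_add:"x:N ==> y:N ==> x + y:N" and N_0:"0:N" by (auto simp:N_def ip_addr ip_0_right)

lemma N_sum:"(!!i. i:A ==> f i:N) ==> sum f A:N" by (induction A rule:infinite_finite_induct) (auto intro:N_add N_0)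

lemma nwt_N:"s <= NN ==> nwt s:N" unfolding nwt_def using om_N[OF a0_base] by (intro N_sum) auto

lemma sign_of_cases:"sign_of w m = 1 \<or> sign_of w m = - 1" by (simp add:sign_of_def)

lemma ev_add_iff:"x:\<int> ==> y:\<int> ==> ev (x + y) <-> (ev x <-> ev y)" by (auto elim!:Ints_cases simp flip:of_int_add)

lemma sign_of_add:"w:N ==> m:M ==> m':M ==> sign_of w (m + m') = sign_of w m * sign_of w m'"
 using ev_add_iff[OF M_N_int[of m w] M_N_int[of m' w]] by (auto simp:sign_of_def ip_addl)

lemma sign_of_add_left:"w:N ==> w':N ==> m:M ==> sign_of (w + w') m = sign_of w m * sign_of w' m"
 using ev_add_iff[OF M_N_int[of m w] M_N_int[of m w']] by (auto simp:sign_of_def ip_addr)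

lemma sign_of_0 [simp]:"sign_of w 0 = 1" "sign_of 0 m = 1" by (simp_all add:sign_of_def ip_0_left ip_0_right ev_0)

lemma sign_of_sum:
 assumes "w:N" "!!i. i:A ==> f i:M"
 shows "sign_of w (SUM i:A. f i) = (PROD i:A. sign_of w (f i))" using assms(2)
proof (induction A rule:infinite_finite_induct)
 case (insert i A)
 thus ?case using sign_of_add[OF assms(1)] M_sum[of A f] by simp
qed simp_all

lemma sign_of_cong:"w:N ==> w':N ==> m:M ==> ev (ip m w - ip m w') ==> sign_of w m = sign_of w' m"
 using ev_cong[of "ip m w" "ip m w'"] by (simp add:sign_of_def)

lemma node_weight_base:"s <= NN ==> i:NN ==> ip (a0 i) (nwt s) = (if i:s then 1 else 0)"
proof -
 assume s:"s <= NN" and i:"i:NN"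
 have "ip (a0 i) (nwt s) = (SUM k:s. if k = i then 1 else 0)"
  unfolding nwt_def ip_sumr using b_om[OF a0_base i] s by (intro sum.cong) auto
 thus ?thesis using finite_subset[OF s] by simp
qed

lemma exists_node_weight:
 assumes w:"w:N"
 obtains s where "s <= NN" "!!m. m:M ==> sign_of (nwt s) m = sign_of w m"
proof -
 define s where "s = {i:NN. ~ev (ip (a0 i) w)}"
 have s:"s <= NN" by (auto simp:s_def)
 have "sign_of (nwt s) m = sign_of w m" if m:"m:M" for m
 proof (rule sign_of_cong[OF nwt_N[OF s] w m])
  have "ip m (nwt s) - ip m w = (SUM i:NN. (ip (a0 i) (nwt s) - ip (a0 i) w) * ip (om a0 i) m)"
   unfolding ip_expand[OF a0_base, of m] sum_subtractf[symmetric] by (intro sum.cong refl) (simp add:algebra_simps)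
  moreover have "ev ((ip (a0 i) (nwt s) - ip (a0 i) w) * ip (om a0 i) m)" if i:"i:NN" for i
  using that ev_mult w N_iff[OF a0_base] not_ev ev_minus[of "ip (a0 i) w - 1"] ev_minus[of "ip (a0 i) w"] m M_eq by (auto simp:node_weight_base s_def)
  ultimately show "ev (ip m (nwt s) - ip m w)" by (simp add:ev_sum)
 qed
 thus ?thesis using that s by blast
qed

text \<open>The group acts on the coordinates of every chart by all sign changes, not only in the
  chart of \<open>a0\<close>, through which its elements are indexed.\<close>

lemma exists_signs:
 assumes b:"b:bases" and D:"D <= NN"
 obtains s where "s <= NN" "!!k. k:NN ==> sign_of (nwt s) (b k) = (if k:D then - 1 else 1)"
  "!!m. m:M ==> sign_of (nwt s) m = (if ev (SUM k:D. ip m (om b k)) then 1 else - 1)"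
proof -
 have w:"(SUM k:D. om b k):N" using om_N[OF b] D by (intro N_sum) auto
 obtain s where s:"s <= NN" "!!m. m:M ==> sign_of (nwt s) m = sign_of (SUM k:D. om b k) m"
  using exists_node_weight[OF w] by metis
 have "sign_of (nwt s) (b k) = (if k:D then - 1 else 1)" if k:"k:NN" for k
 proof -
  have "ip (b k) (SUM k:D. om b k) = (SUM i:D. if i = k then 1 else 0)"
   unfolding ip_sumr using b_om[OF b k] D by (intro sum.cong) auto
  also have "... = (if k:D then 1 else 0)" using finite_subset[OF D] by simp
  finally show ?thesis using s(2)[OF root_M[OF b_root[OF b k]]] not_ev_1 ev_0 by (simp add:sign_of_def)
 qed
 thus ?thesis using that s by (simp add:sign_of_def ip_sumr)
qed

end

text \<open>What the homological part needs of the real toric variety: \<open>orb\<close> gives the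
  cone of the torus orbit of a point, and each base gives a chart onto R^n, with coordinates
  \<open>co\<close> and inverse \<open>pt\<close>, in which the orbit is read off from the vanishing
  coordinates.\<close>

locale rtspace = E_roots +
 fixes X :: "'x topology" and orb :: "'x=>'a set" and co :: "(nat=>'a)=>'x=>nat=>real"
  and pt :: "(nat=>'a)=>(nat=>real)=>'x" and act :: "nat set=>'x=>'x"
 assumes orb_K:"x:topspace X ==> orb x:K"
  and open_chart:"b:bases ==> openin X {x:topspace X. orb x <= verts b}"
  and co_continuous:"b:bases ==> continuous_map (subtop X {x:topspace X. orb x <= verts b}) (top_of_set cspace) (co b)"
  and pt_continuous:"b:bases ==> continuous_map (top_of_set cspace) X (pt b)"
  and co_pt:"b:bases ==> z:cspace ==> co b (pt b z) = z"
  and pt_co:"b:bases ==> x:topspace X ==> orb x <= verts b ==> pt b (co b x) = x"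
  and orb_pt:"b:bases ==> z:cspace ==> orb (pt b z) = {om b k |k. k:nodes n & z k = 0}"
  and act_cont:"s <= nodes n ==> continuous_map X X (act s)"
  and orb_act:"s <= nodes n ==> x:topspace X ==> orb (act s x) = orb x"
  and co_act:"s <= nodes n ==> x:topspace X ==> b:bases ==> orb x <= verts b ==> k:nodes n ==>
   co b (act s x) k = sign_of (nwt s) (b k) * co b x k"
begin

lemma act_top:"s <= NN ==> x:topspace X ==> act s x:topspace X" using act_cont by (auto simp:continuous_map_def)

lemma co_space:"b:bases ==> x:topspace X ==> orb x <= verts b ==> co b x:cspace"
 using co_continuous[of b] by (auto simp:continuous_map_def)

lemma pt_top:"b:bases ==> z:cspace ==> pt b z:topspace X" using pt_continuous[of b] by (auto simp:continuous_map_def)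

lemma co_eqI:
 assumes "b:bases" "x:topspace X" "y:topspace X" "orb x <= verts b" "orb y <= verts b"
  "!!k. k:NN ==> co b x k = co b y k"
 shows "x = y"
proof -
 have "co b x = co b y"
  using assms(6) co_space[OF assms(1,2,4)] co_space[OF assms(1,3,5)] by (auto simp:cspace_def fun_eq_iff) metis
 thus ?thesis using pt_co[OF assms(1,2,4)] pt_co[OF assms(1,3,5)] by metis
qed

lemma orb_base:
 assumes "x:topspace X"
 obtains b where "b:bases" "orb x <= verts b" using orb_K[OF assms] by (auto simp:K_def)

sublocale signed_action X "NN" act
proof
 fix x assume x:"x:topspace X"
 obtain b where b:"b:bases" "orb x <= verts b" by (rule orb_base[OF x])
 show "act {} x = x"
 proof (rule co_eqI[OF b(1) act_top[OF _ x] x _ b(2)])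
  show "orb (act {} x) <= verts b" using orb_act[of "{}" x] x b by simp
  show "co b (act {} x) k = co b x k" if "k:NN" for k using co_act[of "{}", OF _ x b that] by (simp add:nwt_def)
 qed simp
 fix s t assume s:"s <= NN" and t:"t <= NN"
 have st:"sym_diff s t <= NN" using s t by blast
 show "act s (act t x) = act (sym_diff s t) x"
 proof (rule co_eqI[OF b(1) act_top[OF s act_top[OF t x]] act_top[OF st x]])
  show o1:"orb (act s (act t x)) <= verts b" "orb (act (sym_diff s t) x) <= verts b"
   using orb_act[OF s act_top[OF t x]] orb_act[OF t x] orb_act[OF st x] b(2) by auto
  fix k assume k:"k:NN"
  have o2:"orb (act t x) <= verts b" using orb_act[OF t x] b(2) by simp
  have bk:"b k:M" by (rule root_M[OF b_root[OF b(1) k]])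
  have fin:"finite s" "finite t" using finite_subset[OF s] finite_subset[OF t] by simp_all
  \<comment> \<open>The sum counts the intersection twice, and twice an element of \<open>N\<close>
    has trivial signs.\<close>
  have "nwt s + nwt t = nwt (sym_diff s t) + (nwt (s Int t) + nwt (s Int t))"
  using fin sum.Int_Diff[of s "om a0" t] sum.Int_Diff[of t "om a0" s] sum.union_disjoint[of "s - t" "t - s" "om a0"] by (force simp:nwt_def Int_commute)
  moreover have "sign_of (nwt (s Int t) + nwt (s Int t)) (b k) = 1"
  proof -
   have "s Int t <= NN" using s by blast
   from sign_of_add_left[OF nwt_N[OF this] nwt_N[OF this] bk] show ?thesis
    using sign_of_cases[of "nwt (s Int t)" "b k"] by auto
  qed
  ultimately show "co b (act s (act t x)) k = co b (act (sym_diff s t) x) k"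
  using sign_of_add_left[OF nwt_N[OF s] nwt_N[OF t] bk] sign_of_add_left[OF nwt_N[OF st] N_add[OF nwt_N nwt_N] bk, of "s Int t" "s Int t"] le_infI1[OF s] co_act[OF s act_top[OF t x] b(1) o2 k] co_act[OF t x b k] co_act[OF st x b k] by auto
 qed
qed (use act_cont in auto)

definition "strat A = {x:topspace X. orb x:A}"

lemma st_strat:"stable (strat A)" unfolding stable_def strat_def using act_top orb_act by auto

lemma strata_K:"strat K = topspace X" unfolding strat_def using orb_K by blast

definition "cchart b ta = {z:cspace. !k:NN. om b k ~: ta --> z k ~= 0}"

lemma pt_strata:
 assumes "b:bases" "z:cchart b ta"
 shows "pt b z:strat (Pow ta)" using assms pt_top orb_pt by (auto simp:cchart_def strat_def)

lemma co_zero: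
 assumes "b:bases" "x:topspace X" "orb x <= verts b" "k:NN"
 shows "co b x k = 0 <-> om b k:orb x"
  using assms orb_pt[OF assms(1) co_space[OF assms(1-3)]] pt_co[OF assms(1-3)] inj_onD[OF om_inj[OF assms(1)]] by auto

lemma co_cch:
 assumes "b:bases" "ta <= verts b" "x:strat (Pow ta)"
 shows "co b x:cchart b ta" using assms co_space[OF assms(1)] co_zero[OF assms(1)] by (auto simp:strat_def cchart_def)

lemma open_strata:
 assumes "subcx K A"
 shows "openin X (strat A)"
proof -
 have "openin X (strat (Pow ta))" if "ta:K" for ta
 proof -
  obtain b where b:"b:bases" "ta <= verts b" using \<open>ta : K\<close> by (auto simp:K_def)
  let ?U = "{x:topspace X. orb x <= verts b}"
  have "cchart b ta = cspace Int (INT k:{k:NN. om b k ~: ta}. {z. z k ~= 0})" by (auto simp:cchart_def)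
  moreover have "open (INT k:{k:NN. om b k ~: ta}. {z::nat=>real. z k ~= 0})"
   by (intro open_INT finite_Collect_conjI disjI1 ballI open_Collect_neq continuous_on_product_coordinates continuous_on_const)
    (auto)
  ultimately have "openin (top_of_set cspace) (cchart b ta)" by (simp add:openin_open_Int)
  hence "openin (subtop X ?U) {x:topspace (subtop X ?U). co b x:cchart b ta}"
   using co_continuous[OF b(1)] openin_continuous_map_preimage by blast
  moreover have "{x:topspace (subtop X ?U). co b x:cchart b ta} = strat (Pow ta)"
  proof
   show "{x:topspace (subtop X ?U). co b x:cchart b ta} <= strat (Pow ta)"
   proof
    fix x assume "x:{x:topspace (subtop X ?U). co b x:cchart b ta}"
    hence x:"x:topspace X" "orb x <= verts b" "co b x:cchart b ta" by auto
    thus "x:strat (Pow ta)" using pt_strata[OF b(1) x(3)] pt_co[OF b(1) x(1,2)] by simp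
   qed
   show "strat (Pow ta) <= {x:topspace (subtop X ?U). co b x:cchart b ta}"
    using co_cch[OF b] b(2) by (auto simp:strat_def)
  qed
  ultimately show ?thesis using open_chart[OF b(1)] openin_trans_full by metis
 qed
 moreover have "strat A = (UN ta:A. strat (Pow ta))" using assms by (auto simp:strat_def subcx_def)
 moreover have "A <= K" using assms by (simp add:subcx_def)
 ultimately show ?thesis by (auto intro!:openin_Union)
qed

lemma path_segment:
 assumes b:"b:bases" and z:"z:cspace" "z':cspace"
  and A:"!!t. 0 <= t ==> t <= 1 ==> pt b (%k. (1 - t) * z k + t * z' k):A"
 shows "path_component_of (subtop X A) (pt b z) (pt b z')"
proof -
 let ?g = "%t k. (1 - t) * z k + t * z' k"
 have "continuous_on {0..1} ?g" by (intro continuous_on_coordinatewise_then_product continuous_intros)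
 hence "continuous_map (top_of_set {0..1}) (top_of_set cspace) ?g" using z by (auto simp:cspace_def)
 hence "continuous_map (top_of_set {0..1}) X (pt b \<circ> ?g)" using pt_continuous[OF b] continuous_map_compose by blast
 thus ?thesis using A by (auto simp:pathin_def continuous_map_in_subtopology path_component_of_def)
qed

lemma path_cell:
 assumes b:"b:bases" and ta:"ta <= verts b" and x:"x:strat (Pow ta)" and z:"z:cchart b ta"
  and same:"!!k. k:NN ==> om b k ~: ta ==> co b x k * z k > 0"
 shows "path_component_of (subtop X (strat (Pow ta))) x (pt b z)"
proof -
 have xt:"x:topspace X" "orb x <= verts b" using x ta by (auto simp:strat_def)
 have c:"co b x:cchart b ta" by (rule co_cch[OF b ta x])
 have "path_component_of (subtop X (strat (Pow ta))) (pt b (co b x)) (pt b z)"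
 proof (rule path_segment[OF b])
  show "co b x:cspace" "z:cspace" using c z by (auto simp:cchart_def)
  fix t :: real assume t:"0 <= t" "t <= 1"
  show "pt b (%k. (1 - t) * co b x k + t * z k):strat (Pow ta)"
  proof (rule pt_strata[OF b])
   have "(1 - t) * co b x k + t * z k ~= 0" if "k:NN" "om b k ~: ta" for k
   proof -
    have "co b x k > 0 & z k > 0 \<or> co b x k < 0 & z k < 0" using same[OF that] by (simp add:zero_less_mult_iff)
    thus ?thesis
    proof
     assume p:"co b x k > 0 & z k > 0"
     have "(1 - t) * co b x k + t * z k > 0"
     proof (cases "t = 0")
      case False
      hence "t * z k > 0" "(1 - t) * co b x k >= 0" using t p by auto
      thus ?thesis by linarith
     qed (use p in simp)
     thus ?thesis by simp
    next
     assume p:"co b x k < 0 & z k < 0"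
     have "(1 - t) * co b x k + t * z k < 0"
     proof (cases "t = 0")
      case False
      hence "t * z k < 0" "(1 - t) * co b x k <= 0" using t p by (auto simp:mult_pos_neg mult_nonneg_nonpos)
      thus ?thesis by linarith
     qed (use p in simp)
     thus ?thesis by simp
    qed
   qed
   thus "(%k. (1 - t) * co b x k + t * z k):cchart b ta" using c z by (auto simp:cchart_def cspace_def)
  qed
 qed
 thus ?thesis using pt_co[OF b xt] by simp
qed

text \<open>Replacing the vanishing coordinates by 1 joins a point to the open orbit, which belongs
  to every subcomplex.\<close>

lemma rdim_strata_0:
 assumes m:"m <= NN" and A:"subcx K A" and B:"subcx K B" and AB:"A <= B"
 shows "rdim m (strat B) (strat A) 0 = 0"
proof (rule rdim_0[OF st_strat st_strat _ m])
 show "strat A <= strat B" using AB by (auto simp:strat_def)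
 fix x assume x:"x:strat B"
 hence xt:"x:topspace X" "orb x:B" by (auto simp:strat_def)
 obtain b where b:"b:bases" "orb x <= verts b" by (rule orb_base[OF xt(1)])
 let ?z = "%k. if k:NN & co b x k = 0 then 1 else co b x k"
 have z:"?z:cchart b (orb x)" "?z:cchart b {}"
  using co_space[OF b(1) xt(1) b(2)] by (auto simp:cchart_def cspace_def)
 have "path_component_of (subtop X (strat (Pow (orb x)))) x (pt b ?z)"
 proof (rule path_cell[OF b _ z(1)])
  show "x:strat (Pow (orb x))" using xt by (simp add:strat_def)
  show "co b x k * ?z k > 0" if "k:NN" "om b k ~: orb x" for k
   using co_zero[OF b(1) xt(1) b(2) that(1)] that(2) by (simp add:zero_less_mult_iff) linarith
 qed
 moreover have "strat (Pow (orb x)) <= strat B" using B xt(2) by (auto simp:strat_def subcx_def)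
 ultimately have "path_component_of (subtop X (strat B)) x (pt b ?z)"
  unfolding path_component_of_def pathin_subtopology by blast
 moreover have "pt b ?z:strat A" using pt_strata[OF b(1) z(2)] A by (auto simp:strat_def subcx_def)
 ultimately show "EX y:strat A. path_component_of (subtop X (strat B)) x y" by blast
qed

text \<open>A coordinate at a vertex outside \<open>ta\<close> does not vanish on the stratum, and
  the singular simplex is connected.\<close>

lemma simplex_signs:
 assumes b:"b:bases" and ta:"ta <= verts b" and g:"singular_simplex p (subtop X (strat (Pow ta))) g"
  and k:"k:NN" "om b k ~: ta" and z:"z:standard_simplex p" "z':standard_simplex p"
 shows "sgn (co b (g z) k) = sgn (co b (g z') k)"
proof -
 let ?S = "subtop (powertop_real UNIV) (standard_simplex p)" and ?U = "strat (Pow ta)"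
 have gc:"continuous_map ?S (subtop X ?U) g" using g by (simp add:singular_simplex_def)
 have "?U <= {x:topspace X. orb x <= verts b}" using ta by (auto simp:strat_def)
 hence "continuous_map (subtop X ?U) (top_of_set cspace) (co b)"
  using co_continuous[OF b] continuous_map_from_subtopology_mono by blast
 hence "continuous_map ?S (top_of_set cspace) (co b \<circ> g)" using gc continuous_map_compose by blast
 moreover have "continuous_map (top_of_set cspace) euclideanreal (%z. z k)"
  using continuous_on_subset[OF continuous_on_product_coordinates[of k] subset_UNIV] by simp
 ultimately have f:"continuous_map ?S euclideanreal (%x. co b (g x) k)"
  using continuous_map_compose[of ?S _ "co b \<circ> g" _ "%z. z k"] by (simp add:comp_def)
 have I:"is_interval ((%x. co b (g x) k) ` standard_simplex p)"
  using connectedin_standard_simplex connectedin_continuous_map_image[OF f] by (simp add:is_interval_connected_1)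
 have nz:"co b (g x) k ~= 0" if "x:standard_simplex p" for x
  using that gc co_cch[OF b ta] k by (auto simp:continuous_map_def cchart_def)
 show ?thesis
 proof (rule ccontr)
  assume "sgn (co b (g z) k) ~= sgn (co b (g z') k)"
  hence "co b (g z) k <= 0 & 0 <= co b (g z') k \<or> co b (g z') k <= 0 & 0 <= co b (g z) k"
   by (auto simp:sgn_real_def split:if_splits)
  hence "0:(%x. co b (g x) k) ` standard_simplex p" using I z unfolding is_interval_1 by blast
  thus False using nz by force
 qed
qed

text \<open>In coordinates the stratum is a product of lines, for the vertices in \<open>ta\<close>,
  and of punctured lines for the others. The straight homotopy \<open>H\<close> contracts it to a
  finite set of sign vectors, so the end map is constant on every singular simplex.\<close>

lemma hdim_cell_pos:
 assumes m:"m <= NN" and taK:"ta:K" and k:"k > 0"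
 shows "hdim m (strat (Pow ta)) k = 0"
proof -
 obtain b where b:"b:bases" "ta <= verts b" using taK by (auto simp:K_def)
 let ?U = "strat (Pow ta)" and ?W = "cchart b ta"
 define rt :: "(nat=>real)=>nat=>real" where "rt z k = (if k:NN & om b k ~: ta then sgn (z k) else 0)" for z k
 define H :: "real \<times> (nat=>real)=>nat=>real" where "H p k = (1 - fst p) * snd p k + fst p * rt (snd p) k" for p k
 have sub:"?U <= {x:topspace X. orb x <= verts b}" using b(2) by (auto simp:strat_def)
 have co:"continuous_map (subtop X ?U) (top_of_set ?W) (co b)"
  using co_continuous[OF b(1)] continuous_map_from_subtopology_mono[OF _ sub] co_cch[OF b] by (auto simp:continuous_map_in_subtopology)
 have pt:"continuous_map (top_of_set ?W) (subtop X ?U) (pt b)"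
  using pt_continuous[OF b(1)] continuous_map_from_subtopology_mono pt_strata[OF b(1)] by (fastforce simp:cchart_def continuous_map_in_subtopology)
 have "homotopic_with (%_. True) (top_of_set ?W) (top_of_set ?W) id rt" unfolding homotopic_with_def
 proof (intro exI[of _ H] conjI ballI allI)
  have "continuous_on ({0..1} \<times> ?W) H"
  proof (rule continuous_on_coordinatewise_then_product)
   fix k
   have c:"continuous_on ({0..1} \<times> ?W) (%p. snd p k)"
    using continuous_on_compose2[OF continuous_on_product_coordinates[of k] continuous_on_snd[OF continuous_on_id]] by auto
   have "continuous_on ({0..1} \<times> ?W) (%p. rt (snd p) k)"
   proof (cases "k:NN & om b k ~: ta")
    case True
    thus ?thesis unfolding rt_def using c by (auto intro!:continuous_on_sgn simp:cchart_def)
   next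
    case False
    thus ?thesis by (auto simp:rt_def)
   qed
   thus "continuous_on ({0..1} \<times> ?W) (%p. H p k)" unfolding H_def using c by (intro continuous_intros)
  qed
  moreover have "H p:?W" if p:"p:{0..1} \<times> ?W" for p
  proof -
   have t:"0 <= fst p" "fst p <= 1" and w:"snd p:?W" using p by auto
   have "H p k ~= 0" if k:"k:NN" "om b k ~: ta" for k
   proof -
    have nz:"snd p k ~= 0" using w k by (auto simp:cchart_def)
    have "H p k = sgn (snd p k) * ((1 - fst p) * \<bar>snd p k\<bar> + fst p)"
    proof -
     have "(1 - fst p) * snd p k = (1 - fst p) * (sgn (snd p k) * \<bar>snd p k\<bar>)" by (simp add:sgn_mult_abs)
     moreover have "rt (snd p) k = sgn (snd p k)" using k by (simp add:rt_def)
     ultimately show ?thesis unfolding H_def by (simp add:algebra_simps)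
    qed
    moreover have "(1 - fst p) * \<bar>snd p k\<bar> + fst p > 0"
    proof (cases "fst p = 0")
     case False
     hence "(1 - fst p) * \<bar>snd p k\<bar> >= 0" "fst p > 0" using t by auto
     thus ?thesis by linarith
    qed (use nz in simp)
    ultimately show ?thesis using nz by (simp add:sgn_real_def)
   qed
   thus ?thesis using w by (auto simp:cchart_def cspace_def H_def rt_def)
  qed
  ultimately show "continuous_map (prod_topology (top_of_set {0..1}) (top_of_set ?W)) (top_of_set ?W) H" by auto
 qed (auto simp:H_def)
 from homotopic_with_compose_continuous_map_left[OF homotopic_with_compose_continuous_map_right[OF this co] pt, of "%_. True" "%_. True"]
 have "homotopic_with (%_. True) (subtop X ?U) (subtop X ?U) (pt b \<circ> (id \<circ> co b)) (pt b \<circ> (rt \<circ> co b))"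
  by simp
 hence hom:"homotopic_with (%_. True) (subtop X ?U) (subtop X ?U) id (pt b \<circ> (rt \<circ> co b))"
 proof (rule homotopic_with_eq)
  show "id x = (pt b \<circ> (id \<circ> co b)) x" if "x:topspace (subtop X ?U)" for x
   using that pt_co[OF b(1)] sub by auto
 qed auto
 show ?thesis
 proof (rule hdim_retract[OF st_strat m hom _ k])
  fix p g assume g:"singular_simplex p (subtop X ?U) g"
  obtain z0 where z0:"z0:standard_simplex p" using nonempty_standard_simplex by blast
  have "rt (co b (g z)) = rt (co b (g z0))" if "z:standard_simplex p" for z
   using simplex_signs[OF b g _ _ that z0] by (auto simp:rt_def)
  thus "EX x. !z:standard_simplex p. (pt b \<circ> (rt \<circ> co b)) (g z) = x" by auto
 qed
qed

text \<open>The class of M / 2M that corresponds to the character indexed by m.\<close>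

definition "node_root m = nsum a0 m"

lemma node_root_M:"m <= NN ==> node_root m:M"
 unfolding node_root_def nsum_def using root_M b_root[OF a0_base] by (intro M_sum) auto

lemma sgn_char_sign_of:
 assumes "m <= NN" "s <= NN"
 shows "sgch m s = (if sign_of (nwt s) (node_root m) = 1 then 1 else - 1)"
proof -
 have "ip (node_root m) (nwt s) = (SUM i:m. if i:s then 1 else 0)"
  unfolding node_root_def nsum_def ip_suml using node_weight_base[OF assms(2)] assms(1) by (intro sum.cong) auto
 also have "... = of_int (int (card (m Int s)))" using finite_subset[OF assms(1)] by (simp add:sum.If_cases)
 finally show ?thesis unfolding sgch_def sign_of_def by (simp add:minus_one_power_iff del:of_int_of_nat_eq)
qed

text \<open>Changing the sign of the coordinate at v stays in the path component, because this
  coordinate may pass through 0; but the character of m takes the value -1 on the change.\<close>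

lemma hdim_cell_0_odd:
 assumes m:"m <= NN" and taK:"ta:K" and v:"v:ta" "~ev (ip (node_root m) v)"
 shows "hdim m (strat (Pow ta)) 0 = 0"
proof -
 obtain b where b:"b:bases" "ta <= verts b" using taK by (auto simp:K_def)
 then obtain j where j:"j:NN" "v = om b j" using v by (auto simp:verts_def)
 obtain s where s:"s <= NN" "!!k. k:NN ==> sign_of (nwt s) (b k) = (if k:{j} then - 1 else 1)"
  "!!m. m:M ==> sign_of (nwt s) m = (if ev (SUM k:{j}. ip m (om b k)) then 1 else - 1)"
  using exists_signs[OF b(1), of "{j}"] j(1) by blast
 show ?thesis
 proof (rule hdim_0_odd[OF st_strat m s(1)])
  show "sgch m s = - 1" unfolding sgn_char_sign_of[OF m s(1)] using s(3)[OF node_root_M[OF m]] v(2) j(2) by simp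
  fix x assume x:"x:strat (Pow ta)"
  hence xt:"x:topspace X" "orb x <= verts b" using b(2) by (auto simp:strat_def)
  have ax:"act s x:strat (Pow ta)" using st_strat s(1) x unfolding stable_def by blast
  hence axt:"act s x:topspace X" "orb (act s x) <= verts b" using b(2) by (auto simp:strat_def)
  have cx:"co b x:cchart b ta" by (rule co_cch[OF b x])
  have "path_component_of (subtop X (strat (Pow ta))) x (pt b (co b (act s x)))"
  proof (rule path_cell[OF b x co_cch[OF b ax]])
   fix k assume k:"k:NN" "om b k ~: ta"
   thus "co b x k * co b (act s x) k > 0"
  using v(1) j(2) co_act[OF s(1) xt(1) b(1) xt(2) k(1)] s(2)[OF k(1)] cx by (auto simp:cchart_def zero_less_mult_iff)
  qed
  thus "path_component_of (subtop X (strat (Pow ta))) x (act s x)" using pt_co[OF b(1) axt] by simp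
 qed
qed

text \<open>As all vertices of \<open>ta\<close> are even, the character of m only involves
  coordinates that do not vanish on the stratum. The product of their signs is locally constant and
  transforms by that character.\<close>

lemma hdim_cell_0_even:
 assumes m:"m <= NN" and taK:"ta:K" and even:"!!v. v:ta ==> ev (ip (node_root m) v)"
 shows "hdim m (strat (Pow ta)) 0 = 1"
proof -
 obtain b where b:"b:bases" "ta <= verts b" using taK by (auto simp:K_def)
 let ?U = "strat (Pow ta)" and ?a = "node_root m"
 define L where "L = {k:NN. om b k ~: ta & ~ev (ip ?a (om b k))}"
 have finL:"finite L" "L <= NN" by (auto simp:L_def)
 define q where "q x = (PROD k:L. sgn (co b x k))" for x
 define ph :: "'x=>rat" where "ph x = (if q x > 0 then 1 else - 1)" for x
 let ?z0 = "%k. if k:NN then 1 else (0::real)"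
 have z0:"?z0:cchart b ta" by (auto simp:cchart_def cspace_def)
 have z0c:"?z0:cspace" by (auto simp:cspace_def)
 have x0:"pt b ?z0:?U" by (rule pt_strata[OF b(1) z0])
 have aM:"?a:M" by (rule node_root_M[OF m])
 have sgL:"sign_of w ?a = (PROD k:L. sign_of w (b k))" if w:"w:N" for w
 proof -
  have "ip ?a w - ip (SUM k:L. b k) w = (SUM k:NN. (ip (om b k) ?a - (if k:L then 1 else 0)) * ip (b k) w)"
  proof -
   have "ip (SUM k:L. b k) w = (SUM k:NN. (if k:L then 1 else 0) * ip (b k) w)"
    unfolding ip_suml by (rule sum.mono_neutral_cong_left) (use finL in auto)
   thus ?thesis unfolding ip_expand[OF b(1), of ?a w] by (simp add:sum_subtractf left_diff_distrib)
  qed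
  moreover have "ev ((ip (om b k) ?a - (if k:L then 1 else 0)) * ip (b k) w)" if k:"k:NN" for k
  using that ev_mult aM M_iff[OF b(1)] not_ev even[of "om b k"] w N_iff[OF b(1)] by (auto simp:L_def ip_com)
  ultimately have "ev (ip ?a w - ip (SUM k:L. b k) w)" by (simp add:ev_sum)
  hence "sign_of w ?a = sign_of w (SUM k:L. b k)" using ev_cong by (simp add:sign_of_def)
  also have "... = (PROD k:L. sign_of w (b k))" using finL root_M b_root[OF b(1)] by (intro sign_of_sum[OF w]) auto
  finally show ?thesis .
 qed
 have q_cases:"q x = 1 \<or> q x = - 1" if x:"x:?U" for x
 proof -
  have sg:"sgn (co b x k) = 1 \<or> sgn (co b x k) = - 1" if "k:L" for k
   using co_cch[OF b x] that by (auto simp:L_def cchart_def sgn_real_def)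
  have "prod u B = 1 \<or> prod u B = - 1" if "finite B" "!k:B. u k = 1 \<or> u k = - 1" for u :: "nat=>real" and B
   using that by (induction B rule:finite_induct) auto
  from this[of L "%k. sgn (co b x k)"] show ?thesis unfolding q_def using finL(1) sg by blast
 qed
 show ?thesis
 proof (rule hdim_0_even[OF st_strat m x0, where ph = ph])
  show "ph (pt b ?z0) ~= 0" by (simp add:ph_def)
  show "ph (g z) = ph (g z')" if "singular_simplex p (subtop X ?U) g" "z:standard_simplex p" "z':standard_simplex p" for p g z z'
  proof -
   have "q (g z) = q (g z')" unfolding q_def
    using simplex_signs[OF b that(1) _ _ that(2,3)] by (intro prod.cong) (auto simp:L_def)
   thus ?thesis by (simp add:ph_def)
  qed
  show "ph (act s x) = sgch m s * ph x" if s:"s <= NN" and x:"x:?U" for s x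
  proof -
   have xt:"x:topspace X" "orb x <= verts b" using x b(2) by (auto simp:strat_def)
   have "sgn (sign_of (nwt s) (b k)) = sign_of (nwt s) (b k)" for k
    using sign_of_cases[of "nwt s" "b k"] by auto
   hence "q (act s x) = (PROD k:L. sign_of (nwt s) (b k) * sgn (co b x k))"
    unfolding q_def using co_act[OF s xt(1) b(1) xt(2)] finL(2) by (intro prod.cong) (auto simp:sgn_mult)
   also have "... = sign_of (nwt s) ?a * q x" unfolding q_def sgL[OF nwt_N[OF s]] by (rule prod.distrib)
   finally have "q (act s x) = sign_of (nwt s) ?a * q x" .
   thus ?thesis unfolding ph_def sgn_char_sign_of[OF m s] using q_cases[OF x] sign_of_cases[of "nwt s" ?a] by auto
  qed
  show "EX s. s <= NN & path_component_of (subtop X ?U) x (act s (pt b ?z0))" if x:"x:?U" for x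
  proof -
   define D where "D = {k:NN. co b x k < 0}"
   obtain s where s:"s <= NN" "!!k. k:NN ==> sign_of (nwt s) (b k) = (if k:D then - 1 else 1)"
   proof -
    have "D <= NN" by (auto simp:D_def)
    from exists_signs[OF b(1) this] show ?thesis using that by metis
   qed
   have ax:"act s (pt b ?z0):?U" using st_strat s(1) x0 unfolding stable_def by blast
   have x0t:"pt b ?z0:topspace X" "orb (pt b ?z0) <= verts b"
    "act s (pt b ?z0):topspace X" "orb (act s (pt b ?z0)) <= verts b" using x0 ax b(2) by (auto simp:strat_def)
   have "path_component_of (subtop X ?U) x (pt b (co b (act s (pt b ?z0))))"
   proof (rule path_cell[OF b x co_cch[OF b ax]])
    fix k assume k:"k:NN" "om b k ~: ta"
    show "co b x k * co b (act s (pt b ?z0)) k > 0"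
  using co_cch[OF b x] k co_act[OF s(1) x0t(1) b(1) x0t(2) k(1)] s(2)[OF k(1)] co_pt[OF b(1) z0c] by (auto simp:cchart_def D_def)
   qed
   thus ?thesis using pt_co[OF b(1) x0t(3,4)] s(1) by auto
  qed
 qed
qed

theorem homology_function_strata:
 assumes m:"m <= NN"
 shows "homfun K (%v. ~ev (ip (node_root m) v)) (%A k. the_enat (hdim m (strat A) k))
   (%B A k. the_enat (rdim m (strat B) (strat A) k))"
  and "hdim m (topspace X) k ~= \<infinity>"
proof -
 have simplex:"hdim m (strat (Pow si)) k = (if k = 0 & (!v:si. ~ ~ev (ip (node_root m) v)) then 1 else 0)"
  if "si:K" for si k
  using hdim_cell_pos[OF m that] hdim_cell_0_odd[OF m that] hdim_cell_0_even[OF m that] by (cases "k = 0") auto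
 have exact:"EX u v w. u 0 = 0 & (!k. hdim m (strat A) k = u (Suc k) + v k & hdim m (strat B) k = v k + w k &
   rdim m (strat B) (strat A) k = w k + u k)" if "A <= B" for A B
  by (rule hdim_exact) (use that in \<open>auto simp:strat_def\<close>)
 have excision:"rdim m (strat (A Un B)) (strat A) k = rdim m (strat B) (strat (A Int B)) k"
  if "subcx K A" "subcx K B" for A B k
 proof -
  have "strat (A Un B) = strat A Un strat B" "strat (A Int B) = strat A Int strat B" by (auto simp:strat_def)
  thus ?thesis using rdim_excision[OF open_strata[OF that(1)] st_strat open_strata[OF that(2)] st_strat m] by simp
 qed
 note hf = K_finite K_cfin K_face simplex
 show "homfun K (%v. ~ev (ip (node_root m) v)) (%A k. the_enat (hdim m (strat A) k))
   (%B A k. the_enat (rdim m (strat B) (strat A) k))"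
  by (rule homology_function_the_enat[where hE = "%A. hdim m (strat A)" and rE = "%B A. rdim m (strat B) (strat A)", OF hf])
   (use exact rdim_strata_0[OF m] excision in blast)+
 have "subcx K K" using K_face K_nonempty unfolding subcx_def by blast
 hence "hdim m (strat K) k ~= \<infinity>"
  by (intro hE_finite[where hE = "%A. hdim m (strat A)" and rE = "%B A. rdim m (strat B) (strat A)", OF hf])
   (use exact rdim_strata_0[OF m] excision in blast)+
 thus "hdim m (topspace X) k ~= \<infinity>" by (simp add:strata_K)
qed

end

section \<open>Cones, monoid homomorphisms and glueing classes\<close>

context E_roots
begin

definition cone :: "'a set=>'a set" where
 "cone ta = {SUM v:ta. t v *r v |t. !v:ta. t v >= 0}"

text \<open>The coweight lattice for the original inner product. As \<open>ip\<close> carries the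
  factor 2 / c, \<open>N\<close> is c / 2 times this lattice.\<close>

definition "cowts = {x. !be:Ph. be \<bullet> x:\<int>}"

definition smg :: "'a set=>'a set" where
 "smg ta = {m:M. !v:ta. ip m v >= 0}"

lemma coweights_N:"x:N <-> (2 / c) *r x:cowts" by (simp add:N_def cowts_def ip_def)

lemma dual_lattice_coweights:"dual_lattice cowts = M"
proof (intro equalityI subsetI)
 fix m assume m:"m:dual_lattice cowts"
 show "m:M" unfolding M_eq
 proof (intro CollectI ballI)
  fix i assume "i:NN"
  thus "ip (om a0 i) m:\<int>" using om_N[OF a0_base] coweights_N m by (force simp:dual_lattice_def ip_def inner_commute)
 qed
next
 fix m assume m:"m:M"
 show "m:dual_lattice cowts" unfolding dual_lattice_def
 proof (intro CollectI ballI)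
  fix u assume "u:cowts"
  thus "m \<bullet> u:\<int>" using coweights_N[of "(c / 2) *r u"] c M_N_int[OF m] by (force simp:ip_def)
 qed
qed

lemma cone_gen:"finite ta ==> v:ta ==> v:cone ta"
proof -
 assume "finite ta" "v:ta"
 hence "(SUM w:ta. (if w = v then 1 else 0) *r w) = v" by (simp add:if_distrib[of "%t. t *r _"] cong:if_cong)
 thus ?thesis unfolding cone_def by (intro CollectI exI[of _ "%w. if w = v then 1 else 0"]) auto
qed

lemma cone_smg:
 assumes "ta:K"
 shows "cone_semigroup cowts (cone ta) = smg ta"
  using cone_gen[OF K_cfin[OF assms]] c by (auto simp:ip_def zero_le_divide_iff cone_def inner_sum_right sum_nonneg cone_semigroup_def dual_lattice_coweights smg_def)

lemma carrier_unique:
 assumes ta:"ta:K" "ta':K" and f:"!v:ta. f v > 0" "!v:ta'. f' v > 0"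
  and eq:"(SUM v:ta. f v *r v) = (SUM v:ta'. f' v *r v)"
 shows "ta = ta'"
proof -
 obtain b where b:"b:bases" "dominant b (SUM v:ta. f v *r v)" using dominant_base unfolding dominant_def by blast
 show ?thesis using cone_rep(1)[OF ta(1) f(1) b] cone_rep(1)[OF ta(2) f(2) b(1)] b(2) unfolding eq by metis
qed

lemma cone_support:
 assumes ta:"ta:K" and x:"x:cone ta"
 obtains rh f where "rh <= ta" "!v:rh. f v > 0" "x = (SUM v:rh. f v *r v)"
proof -
 obtain t where t:"!v:ta. t v >= 0" "x = (SUM v:ta. t v *r v)" using x by (auto simp:cone_def)
 have "x = (SUM v:{v:ta. t v > 0}. t v *r v)"
  unfolding t(2) using K_cfin[OF ta] t(1) by (intro sum.mono_neutral_right) (auto)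
 thus ?thesis by (intro that[of "{v:ta. t v > 0}" t]) auto
qed

lemma cone_mono:
 assumes "ta:K" "rh <= ta"
 shows "cone rh <= cone ta"
proof
 fix x assume "x:cone rh"
 then obtain t where t:"!v:rh. t v >= 0" "x = (SUM v:rh. t v *r v)" by (auto simp:cone_def)
 have "x = (SUM v:ta. (if v:rh then t v else 0) *r v)"
  unfolding t(2) using K_cfin[OF assms(1)] assms(2) by (intro sum.mono_neutral_cong_left) auto
 thus "x:cone ta" unfolding cone_def using t(1) by (intro CollectI exI[of _ "%v. if v:rh then t v else 0"]) auto
qed

text \<open>A common point is a positive combination of a unique cell, and this cell is a face of
  both.\<close>

lemma cone_Int:
 assumes ta:"ta:K" "ta':K"
 shows "cone ta Int cone ta' = cone (ta Int ta')"
proof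
 show "cone ta Int cone ta' <= cone (ta Int ta')"
 proof
  fix x assume x:"x:cone ta Int cone ta'"
  obtain rh f where rh:"rh <= ta" "!v:rh. f v > 0" "x = (SUM v:rh. f v *r v)" using cone_support[OF ta(1)] x by blast
  obtain rh' f' where rh':"rh' <= ta'" "!v:rh'. f' v > 0" "x = (SUM v:rh'. f' v *r v)"
   using cone_support[OF ta(2)] x by blast
  have sub:"rh <= ta Int ta'"
  using carrier_unique[OF K_face[OF ta(1) rh(1)] K_face[OF ta(2) rh'(1)] rh(2) rh'(2)] rh(3) rh'(3) rh(1) rh'(1) by blast
  have "x:cone rh" unfolding cone_def using rh(2,3) by (auto intro:less_imp_le)
  thus "x:cone (ta Int ta')" using cone_mono[OF K_face[OF ta(1)] sub] by blast
 qed
 show "cone (ta Int ta') <= cone ta Int cone ta'"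
  using cone_mono[OF ta(1), of "ta Int ta'"] cone_mono[OF ta(2), of "ta Int ta'"] by blast
qed

lemma cone_subset_imp:
 assumes ta:"ta:K" "ta':K" and sub:"cone ta <= cone ta'"
 shows "ta <= ta'"
proof
 fix v assume v:"v:ta"
 then obtain rh f where rh:"rh <= ta'" "!v:rh. f v > 0" "v = (SUM v:rh. f v *r v)"
  using sub cone_gen[OF K_cfin[OF ta(1)]] cone_support[OF ta(2)] by blast
 show "v:ta'"
  using carrier_unique[OF K_face[OF ta(1), of "{v}"] K_face[OF ta(2) rh(1)] _ rh(2), of "%_. 1"] v rh(3) rh(1) by auto
qed

lemma cone_eq_iff:"ta:K ==> ta':K ==> cone ta = cone ta' <-> ta = ta'" using cone_subset_imp by blast

subsection \<open>Monoid homomorphisms in coordinates\<close>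

definition points :: "'a set=>('a=>complex) set" where
 "points ta = {ga:extensional (smg ta). ga 0 = 1 &
  (!m:smg ta. !m':smg ta. ga (m + m') = ga m * ga m')}"

lemma atp_eq:"ta:K ==> affine_toric_points cowts (cone ta) = points ta"
 by (simp add:affine_toric_points_def points_def cone_smg)

definition "expo b m k = \<lfloor>ip m (om b k)\<rfloor>"

definition mono_at :: "(nat=>'a)=>(nat=>complex)=>'a=>complex" where
 "mono_at b z m = (PROD k:NN. z k powi expo b m k)"

lemma exponent_eq:"b:bases ==> m:M ==> k:NN ==> of_int (expo b m k) = ip m (om b k)"
 using M_iff[of b m] unfolding expo_def by (auto simp:ip_com[of m])

lemma exponent_add:"b:bases ==> m:M ==> m':M ==> k:NN ==> expo b (m + m') k = expo b m k + expo b m' k"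
 using exponent_eq[of b m k] exponent_eq[of b m' k] exponent_eq[of b "m + m'" k] M_add[of m m'] by (simp add:ip_addl)

lemma exponent_nonneg:"b:bases ==> m:smg ta ==> om b k:ta ==> expo b m k >= 0"
 by (auto simp:expo_def smg_def)

lemma exponent_base:"b:bases ==> i:NN ==> k:NN ==> expo b (b i) k = (if i = k then 1 else 0)"
 by (simp add:expo_def b_om)

lemma b_smg:
 assumes "b:bases" "ta <= verts b" "k:NN"
 shows "b k:smg ta"
 using assms root_M[OF b_root[OF assms(1,3)]] b_om[OF assms(1,3)] unfolding smg_def verts_def by force

lemma semigroup_mono:"rh <= ta ==> smg ta <= smg rh" by (auto simp:smg_def)

lemma semigroup_add:"m:smg ta ==> m':smg ta ==> m + m':smg ta"
 by (auto simp:smg_def M_add ip_addl)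

lemma semigroup_0:"0:smg ta" by (auto simp:smg_def M_0 ip_0_left)

definition admis :: "(nat=>'a)=>'a set=>(nat=>complex)=>bool" where
 "admis b ta z <-> (!k:NN. om b k ~: ta --> z k ~= 0)"

lemma monomial_add:
 assumes b:"b:bases" and z:"admis b ta z" and m:"m:smg ta" "m':smg ta"
 shows "mono_at b z (m + m') = mono_at b z m * mono_at b z m'"
proof -
 have mM:"m:M" "m':M" using m by (auto simp:smg_def)
 have "z k powi expo b (m + m') k = z k powi expo b m k * z k powi expo b m' k" if k:"k:NN" for k
 proof (cases "z k = 0")
  case True
  hence "expo b m k >= 0" "expo b m' k >= 0" using z k exponent_nonneg[OF b] m by (auto simp:admis_def)
  thus ?thesis using exponent_add[OF b mM k] True
   by (cases "expo b m k + expo b m' k = 0") (auto simp:power_int_0_left_if)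
 next
  case False
  thus ?thesis using exponent_add[OF b mM k] by (simp add:power_int_add)
 qed
 thus ?thesis unfolding mono_at_def by (simp add:prod.distrib)
qed

lemma monomial_0:"b:bases ==> mono_at b z 0 = 1" by (simp add:mono_at_def expo_def ip_0_left)

lemma monomial_base:"b:bases ==> k:NN ==> mono_at b z (b k) = z k"
proof -
 assume b:"b:bases" and k:"k:NN"
 have "mono_at b z (b k) = (PROD i:NN. if i = k then z k else 1)"
  unfolding mono_at_def using exponent_base[OF b k] by (intro prod.cong) auto
 thus ?thesis using k by simp
qed

lemma monomial_points:
 assumes "b:bases" "admis b ta z"
 shows "restrict (mono_at b z) (smg ta):points ta"
 using monomial_add[OF assms] monomial_0[OF assms(1)] semigroup_add semigroup_0 by (auto simp:points_def)

lemma points_power: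
 assumes ga:"ga:points ta" and m:"m:smg ta"
 shows "of_nat j *r m:smg ta & ga (of_nat j *r m) = ga m ^ j"
  using assms semigroup_0 m semigroup_add by (induction j) (auto simp:points_def scaleR_add_left)

text \<open>A homomorphism is determined by its values on the basis b of the lattice. At a vertex
  outside \<open>ta\<close> the semigroup also contains \<open>- b k\<close>, so the value at
  \<open>b k\<close> is invertible and negative exponents make sense.\<close>

lemma pts_mono:
 assumes ga:"ga:points ta" and b:"b:bases" "ta <= verts b"
 shows "admis b ta (%k. ga (b k))" and "ga = restrict (mono_at b (%k. ga (b k))) (smg ta)"
proof -
 have mult:"ga (m + m') = ga m * ga m'" if "m:smg ta" "m':smg ta" for m m'
  using ga that by (simp add:points_def)
 have one:"ga 0 = 1" using ga by (simp add:points_def)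
 have neg:"- b k:smg ta" "ga (b k) ~= 0" "ga (- b k) = inverse (ga (b k))" if k:"k:NN" "om b k ~: ta" for k
 proof -
  have "ip (b k) v = 0" if "v:ta" for v using that b(2) b_om[OF b(1) k(1)] k(2) by (auto simp:verts_def)
  thus n:"- b k:smg ta" using root_M[OF b_root[OF b(1) k(1)]] by (auto simp:smg_def M_minus ip_ml)
  show "ga (b k) ~= 0" "ga (- b k) = inverse (ga (b k))"
  using mult[OF b_smg[OF b k(1)] n] one by (auto dest:inverse_unique)
 qed
 thus "admis b ta (%k. ga (b k))" by (auto simp:admis_def)
 have single:"of_int e *r b k:smg ta & ga (of_int e *r b k) = ga (b k) powi e"
  if k:"k:NN" and e:"om b k:ta ==> e >= 0" for k e
 proof (cases "e >= 0")
  case True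
  thus ?thesis using points_power[OF ga b_smg[OF b k], of "nat e"] by (simp add:power_int_def)
 next
  case False
  hence nk:"om b k ~: ta" using e by blast
  show ?thesis using False points_power[OF ga neg(1)[OF k nk], of "nat (- e)"] neg(3)[OF k nk] by (simp add:power_int_def)
 qed
 have sum:"(SUM k:B. of_int (e k) *r b k):smg ta & ga (SUM k:B. of_int (e k) *r b k) = (PROD k:B. ga (b k) powi e k)"
  if "finite B" "B <= NN" "!k:B. om b k:ta --> e k >= 0" for B e using that
 proof (induction B rule:finite_induct)
  case empty
  thus ?case using semigroup_0 one by simp
 next
  case (insert k B)
  hence IH:"(SUM k:B. of_int (e k) *r b k):smg ta" "ga (SUM k:B. of_int (e k) *r b k) = (PROD k:B. ga (b k) powi e k)"
   by auto
  have s:"of_int (e k) *r b k:smg ta" "ga (of_int (e k) *r b k) = ga (b k) powi e k"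
   using single[of k "e k"] insert.prems by auto
  show ?case using insert.hyps IH s mult[OF s(1) IH(1)] semigroup_add[OF s(1) IH(1)] by simp
 qed
 have "ga m = mono_at b (%k. ga (b k)) m" if m:"m:smg ta" for m
 proof -
  have mM:"m:M" using m by (simp add:smg_def)
  have "m = (SUM k:NN. of_int (expo b m k) *r b k)"
   by (subst b_exp(2)[OF b(1), of m]) (intro sum.cong refl, simp add:exponent_eq[OF b(1) mM] ip_com[of m])
  thus ?thesis unfolding mono_at_def using sum[of "NN" "expo b m"] exponent_nonneg[OF b(1) m] by auto
 qed
 moreover have "ga:extensional (smg ta)" using ga by (simp add:points_def)
 ultimately show "ga = restrict (mono_at b (%k. ga (b k))) (smg ta)" by (intro extensionalityI[of _ "smg ta"]) auto
qed

lemma points_restrict: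
 assumes "ep:points rh" "rh <= ta"
 shows "restrict ep (smg ta):points ta"
proof -
 have "m:smg rh" if "m:smg ta" for m using semigroup_mono[OF assms(2)] that by blast
 thus ?thesis using assms(1) semigroup_add semigroup_0 unfolding points_def by auto
qed

subsection \<open>The points of the toric variety\<close>

text \<open>Every glueing class has a unique representative that vanishes off the annihilator of its cone;
  that cone indexes the torus orbit of the point.\<close>

definition "pure rh ep <-> rh:K & ep:points rh & (!m:smg rh. ep m ~= 0 --> (!v:rh. ip m v = 0))"

definition zcell :: "(nat=>'a)=>(nat=>complex)=>'a set" where
 "zcell b z = {om b k |k. k:NN & z k = 0}"

lemma pure_mono:
 assumes b:"b:bases"
 shows "pure (zcell b z) (restrict (mono_at b z) (smg (zcell b z)))"
proof -
 have adm:"admis b (zcell b z) z" by (auto simp:admis_def zcell_def)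
 have "ip m v = 0" if m:"m:smg (zcell b z)" "mono_at b z m ~= 0" and v:"v:zcell b z" for m v
 proof -
  obtain k where k:"k:NN" "z k = 0" "v = om b k" using v by (auto simp:zcell_def)
  show ?thesis using m(2) k(1) k(2) exponent_eq[OF b _ k(1), of m] m(1) k(3) by (auto simp:mono_at_def smg_def)
 qed
 moreover have "zcell b z:K" using b by (auto simp:K_def zcell_def verts_def)
 ultimately show ?thesis using monomial_points[OF b adm] by (auto simp:pure_def)
qed

lemma pure_zero:
 assumes p:"pure rh ep" and b:"b:bases" "rh <= verts b"
 shows "zcell b (%k. ep (b k)) = rh" and "ep = restrict (mono_at b (%k. ep (b k))) (smg rh)"
proof -
 have ep:"ep:points rh" using p by (simp add:pure_def)
 show "ep = restrict (mono_at b (%k. ep (b k))) (smg rh)" by (rule pts_mono(2)[OF ep b])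
 show "zcell b (%k. ep (b k)) = rh"
 proof
  show "zcell b (%k. ep (b k)) <= rh" using pts_mono(1)[OF ep b] by (auto simp:zcell_def admis_def)
  show "rh <= zcell b (%k. ep (b k))"
  proof
   fix v assume v:"v:rh"
   then obtain k where k:"k:NN" "v = om b k" using b(2) by (auto simp:verts_def)
   show "v:zcell b (%k. ep (b k))"
  using p b_smg[OF b k(1)] v b_om[OF b(1) k(1) k(1)] k by (auto simp:pure_def zcell_def)
  qed
 qed
qed

abbreviation glue :: "(('a set \<times> ('a=>complex)) \<times> ('a set \<times> ('a=>complex))) set" where
 "glue == toric_glueing cowts (cone ` K)"

text \<open>The glueing class of a pure point: its restrictions to the charts of all cones that
  contain its own.\<close>

definition pclass :: "'a set=>('a=>complex)=>('a set \<times> ('a=>complex)) set" where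
 "pclass rh ep = {(cone ta,restrict ep (smg ta)) |ta. ta:K & rh <= ta}"

lemma rr_smg:"rh <= ta ==> restrict (restrict ep (smg rh)) (smg ta) = restrict ep (smg ta)"
 using semigroup_mono[of rh ta] by (auto simp:fun_eq_iff)

lemma pts_self:"ep:points rh ==> restrict ep (smg rh) = ep" by (simp add:points_def extensional_restrict)

text \<open>The cone of the orbit is spanned by the vertices whose coordinates vanish. The same
  monomials, read on its larger semigroup, give the pure representative, and every point glued to
  the given one restricts to them.\<close>

lemma glue_class:
 assumes ta:"ta:K" and b:"b:bases" "ta <= verts b" and ga:"ga:points ta"
 defines "z == %k. ga (b k)"
 shows "glue `` {(cone ta,ga)} = pclass (zcell b z) (restrict (mono_at b z) (smg (zcell b z)))"
proof -
 let ?rh = "zcell b z" and ?ep = "restrict (mono_at b z) (smg (zcell b z))"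
 have adm:"admis b ta z" and ga_eq:"ga = restrict (mono_at b z) (smg ta)"
  unfolding z_def by (rule pts_mono[OF ga b])+
 have rhta:"?rh <= ta" using adm by (auto simp:admis_def zcell_def)
 have admz:"admis b ta' z" if "?rh <= ta'" for ta' using that by (auto simp:admis_def zcell_def)
 show ?thesis
 proof (intro equalityI subsetI)
  fix q assume "q:glue `` {(cone ta,ga)}"
  then obtain ta' de ep where q:"q = (cone ta',de)" "ta':K" "ep:affine_toric_points cowts (cone ta Int cone ta')"
   "ga = restrict ep (cone_semigroup cowts (cone ta))" "de = restrict ep (cone_semigroup cowts (cone ta'))"
   by (auto simp:toric_glueing_def)
  have K2:"ta Int ta':K" using K_face[OF ta] by blast
  have ep:"ep:points (ta Int ta')" using q(3) unfolding cone_Int[OF ta q(2)] atp_eq[OF K2] .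
  have gaep:"ga = restrict ep (smg ta)" and de:"de = restrict ep (smg ta')"
   using q(4,5) by (simp_all add:cone_smg[OF ta] cone_smg[OF q(2)])
  have b2:"ta Int ta' <= verts b" using b(2) by blast
  have "ep (b k) = z k" if "k:NN" for k unfolding z_def gaep using b_smg[OF b that] by simp
  hence mon:"mono_at b (%k. ep (b k)) = mono_at b z" by (intro ext) (simp add:mono_at_def)
  have e:"ep = restrict (mono_at b z) (smg (ta Int ta'))" using pts_mono(2)[OF ep b(1) b2] unfolding mon .
  have "?rh <= ta'"
  using pts_mono(1)[OF ep b(1) b2] \<open>!!k. k : NN ==> ep (b k) = z k\<close> by (auto simp:zcell_def admis_def)
  moreover have "de = restrict ?ep (smg ta')"
   unfolding de e rr_smg[OF \<open>?rh <= ta'\<close>] by (rule rr_smg) blast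
  ultimately show "q:pclass ?rh ?ep" using q(1,2) by (auto simp:pclass_def)
 next
  fix q assume "q:pclass ?rh ?ep"
  then obtain ta' where q:"q = (cone ta',restrict ?ep (smg ta'))" "ta':K" "?rh <= ta'" by (auto simp:pclass_def)
  have K2:"ta Int ta':K" using K_face[OF ta] by blast
  let ?de = "restrict (mono_at b z) (smg (ta Int ta'))"
  have e1:"?de:affine_toric_points cowts (cone ta Int cone ta')"
   unfolding cone_Int[OF ta q(2)] atp_eq[OF K2] by (rule monomial_points[OF b(1) admz]) (use rhta q(3) in blast)
  have e2:"ga = restrict ?de (cone_semigroup cowts (cone ta))"
   unfolding cone_smg[OF ta] ga_eq by (rule rr_smg[symmetric]) blast
  have "restrict ?ep (smg ta') = restrict (mono_at b z) (smg ta')" by (rule rr_smg[OF q(3)])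
  moreover have "restrict ?de (smg ta') = restrict (mono_at b z) (smg ta')"
   by (rule rr_smg) blast
  ultimately have e3:"restrict ?ep (smg ta') = restrict ?de (cone_semigroup cowts (cone ta'))"
   by (simp only:cone_smg[OF q(2)])
  have "((cone ta,ga),q):glue" unfolding q(1) toric_glueing_def
   by (intro CollectI exI conjI, rule refl, use ta q(2) in \<open>simp, simp, intro bexI[OF _ e1] conjI e2 e3\<close>)
  thus "q:glue `` {(cone ta,ga)}" by blast
 qed
qed

lemma point_class_inj:
 assumes "pure rh ep" "pure rh' ep'" "pclass rh ep = pclass rh' ep'"
 shows "rh = rh' & ep = ep'"
proof -
 have sub:"rh' <= rh & ep = restrict ep' (smg rh)" if p:"pure rh ep" "pure rh' ep'" "pclass rh ep = pclass rh' ep'" for rh rh' ep ep'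
 proof -
  have rh:"rh:K" "ep:points rh" using p(1) by (auto simp:pure_def)
  have "(cone rh,restrict ep (smg rh)):pclass rh ep" using rh by (auto simp:pclass_def)
  then obtain ta where ta:"cone rh = cone ta" "restrict ep (smg rh) = restrict ep' (smg ta)" "ta:K" "rh' <= ta"
   unfolding p(3) by (auto simp:pclass_def)
  thus ?thesis using cone_eq_iff[OF rh(1)] pts_self[OF rh(2)] by auto
 qed
 show ?thesis using sub[OF assms] sub[OF assms(2,1) assms(3)[symmetric]] by auto
qed

definition "rep C = (THE p. pure (fst p) (snd p) & C = pclass (fst p) (snd p))"

lemma rep_class:"pure rh ep ==> rep (pclass rh ep) = (rh,ep)"
 unfolding rep_def by (rule the_equality) (use point_class_inj in \<open>auto simp:prod_eq_iff\<close>)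

end

lemma topspace_quotient_topology:"topspace (quotient_topology X r) = topspace X // r"
proof -
 have "{x:topspace X. r `` {x}:topspace X // r} = topspace X" by (auto simp:quotient_def)
 hence "openin (quotient_topology X r) (topspace X // r)" by (simp add:openin_quotient_topology)
 moreover have "topspace (quotient_topology X r) <= topspace X // r"
  using openin_quotient_topology[of X r "topspace (quotient_topology X r)"] by simp
 ultimately show ?thesis using openin_subset by blast
qed

section \<open>Charts and coordinates of the toric variety and its real locus\<close>

context E_roots
begin

abbreviation TV :: "('a set \<times> ('a=>complex)) set topology" where
 "TV == toric_variety cowts (cone ` K)"

abbreviation RTV :: "('a set \<times> ('a=>complex)) set topology" where
 "RTV == real_toric_variety cowts (cone ` K)"

definition "ctop ta = affine_toric_variety cowts (cone ta)"

definition "inch ta ga = glue `` {(cone ta,ga)}"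

definition "cpt b z = pclass (zcell b z) (restrict (mono_at b z) (smg (zcell b z)))"

lemma chart_top_eq:"ta:K ==> ctop ta = subtop (product_topology (%_. euclidean) (smg ta)) (points ta)"
 by (simp add:ctop_def affine_toric_variety_def cone_smg atp_eq)

lemma top_ctop:"ta:K ==> topspace (ctop ta) = points ta" by (auto simp:chart_top_eq points_def extensional_def)

lemma K_base:
 assumes "ta:K"
 obtains b where "b:bases" "ta <= verts b" using assms by (auto simp:K_def)

lemma topspace_TV:"topspace TV = {inch ta ga |ta ga. ta:K & ga:points ta}"
 unfolding toric_variety_def topspace_quotient_topology quotient_def inch_def
 using top_ctop by (auto simp:ctop_def; blast)

lemma openin_TV:"openin TV U <-> U <= topspace TV & (!ta:K. openin (ctop ta) {ga:points ta. inch ta ga:U})"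
proof -
 let ?S = "sum_topology (affine_toric_variety cowts) (cone ` K)"
 have "{ga. (cone ta,ga):{x:topspace ?S. glue `` {x}:U}} = {ga:points ta. inch ta ga:U}" if "ta:K" for ta
  using top_ctop[OF that] that by (auto simp:inch_def ctop_def)
 hence "openin ?S {x:topspace ?S. glue `` {x}:U} <-> (!ta:K. openin (ctop ta) {ga:points ta. inch ta ga:U})"
  by (subst openin_sum_topology) (auto simp:ctop_def)
 moreover have "topspace TV = topspace ?S // glue" by (simp only:toric_variety_def topspace_quotient_topology)
 ultimately show ?thesis unfolding toric_variety_def openin_quotient_topology by simp
qed

lemma in_chart_TV:"ta:K ==> ga:points ta ==> inch ta ga:topspace TV" unfolding topspace_TV by blast

lemma in_chart_continuous:
 assumes "ta:K"
 shows "continuous_map (ctop ta) TV (inch ta)" unfolding continuous_map_def top_ctop[OF assms]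
 using in_chart_TV[OF assms] assms openin_TV by auto

text \<open>Openness in the quotient is tested in every chart, so continuity on an open set can be
  tested there too.\<close>

lemma continuous_map_TV:
 assumes U:"openin TV U"
  and f:"!!ta. ta:K ==> continuous_map (subtop (ctop ta) {ga:points ta. inch ta ga:U}) Y (%ga. f (inch ta ga))"
 shows "continuous_map (subtop TV U) Y f"
proof -
 have top:"topspace (subtop TV U) = U" using openin_subset[OF U] by auto
 have V:"openin (ctop ta) {ga:points ta. inch ta ga:U}" if "ta:K" for ta using U that by (simp add:openin_TV)
 show ?thesis unfolding continuous_map_def top
 proof (intro conjI allI impI)
  show "f:U \<rightarrow> topspace Y"
  using openin_subset[OF U] f by (auto simp:topspace_TV continuous_map_def top_ctop)
  fix W assume W:"openin Y W"
  have "openin TV {C:U. f C:W}" unfolding openin_TV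
  proof (intro conjI ballI)
   show "{C:U. f C:W} <= topspace TV" using openin_subset[OF U] by blast
   fix ta assume ta:"ta:K"
   let ?V = "{ga:points ta. inch ta ga:U}"
   have "openin (ctop ta) {ga:topspace (subtop (ctop ta) ?V). f (inch ta ga):W}"
  using openin_continuous_map_preimage[OF f[OF ta] W] V[OF ta] openin_trans_full by auto
   moreover have "{ga:topspace (subtop (ctop ta) ?V). f (inch ta ga):W} = {ga:points ta. inch ta ga:{C:U. f C:W}}"
    using top_ctop[OF ta] by auto
   ultimately show "openin (ctop ta) {ga:points ta. inch ta ga:{C:U. f C:W}}" by simp
  qed
  thus "openin (subtop TV U) {C:U. f C:W}" by (subst openin_open_subtopology[OF U]) auto
 qed
qed

lemma zero_cell_verts:"zcell b z <= verts b" by (auto simp:zcell_def verts_def)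

lemma inch_cpt:"ta:K ==> b:bases ==> ta <= verts b ==> ga:points ta ==> inch ta ga = cpt b (%k. ga (b k))"
 unfolding inch_def cpt_def by (rule glue_class)

lemma monomial_cong:"(!!k. k:NN ==> z k = z' k) ==> mono_at b z = mono_at b z'" by (intro ext) (auto simp:mono_at_def)

lemma cpt_cong:
 assumes "!!k. k:NN ==> z k = z' k"
 shows "cpt b z = cpt b z'"
proof -
 have "zcell b z = zcell b z'" using assms by (auto simp:zcell_def)
 thus ?thesis unfolding cpt_def using monomial_cong[OF assms] by simp
qed

lemma class_chart_point:
 assumes p:"pure rh ep" and b:"b:bases" "rh <= verts b"
 shows "pclass rh ep = cpt b (%k. ep (b k))" unfolding cpt_def using pure_zero[OF p b] by simp

lemma inch_cl:
 assumes p:"pure rh ep" and ta:"ta:K" "rh <= ta"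
 shows "inch ta (restrict ep (smg ta)) = pclass rh ep"
proof -
 obtain b where b:"b:bases" "ta <= verts b" using K_base[OF ta(1)] .
 have "restrict ep (smg ta):points ta" using p ta(2) by (intro points_restrict) (auto simp:pure_def)
 hence "inch ta (restrict ep (smg ta)) = cpt b (%k. restrict ep (smg ta) (b k))"
  by (rule inch_cpt[OF ta(1) b])
 also have "... = cpt b (%k. ep (b k))" using b_smg[OF b] by (intro cpt_cong) simp
 finally show ?thesis using class_chart_point[OF p b(1)] b(2) ta(2) by simp
qed

lemma class_TV:
 assumes p:"pure rh ep"
 shows "pclass rh ep:topspace TV"
  using assms inch_cl[OF p, of rh] pts_self[of ep rh] in_chart_TV[of rh ep] by (auto simp:pure_def)

lemma TV_cases:
 assumes "C:topspace TV"
 obtains rh ep where "pure rh ep" "C = pclass rh ep"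
proof -
 obtain ta ga where ta:"ta:K" "ga:points ta" "C = inch ta ga" using assms unfolding topspace_TV by blast
 obtain b where b:"b:bases" "ta <= verts b" using K_base[OF ta(1)] .
 show ?thesis by (rule that[OF pure_mono[OF b(1), of "%k. ga (b k)"]])
   (simp only:ta(3) inch_cpt[OF ta(1) b ta(2)] cpt_def)
qed

definition "ocell C = fst (rep C)"

definition "coord b C k = (if k:NN then snd (rep C) (b k) else 0)"

lemma ocell_cl:"pure rh ep ==> ocell (pclass rh ep) = rh" by (simp add:ocell_def rep_class)

lemma coord_class:"pure rh ep ==> k:NN ==> coord b (pclass rh ep) k = ep (b k)" by (simp add:coord_def rep_class)

lemma orbit_cell_chart:"b:bases ==> ocell (cpt b z) = zcell b z"
 unfolding cpt_def by (rule ocell_cl[OF pure_mono])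

lemma coord_chart:
 assumes "b:bases" "b':bases" "zcell b' z <= verts b" "k:NN"
 shows "coord b (cpt b' z) k = mono_at b' z (b k)"
 unfolding cpt_def coord_class[OF pure_mono[OF assms(2)] assms(4)] using b_smg[OF assms(1,3,4)] by simp

lemma coord_chart_self:"b:bases ==> k:NN ==> coord b (cpt b z) k = z k"
 using coord_chart[OF _ _ zero_cell_verts] monomial_base by simp

lemma chart_coord:
 assumes C:"C:topspace TV" and b:"b:bases" "ocell C <= verts b"
 shows "cpt b (coord b C) = C"
proof -
 obtain rh ep where C:"pure rh ep" "C = pclass rh ep" using TV_cases[OF C] .
 hence "C = cpt b (%k. ep (b k))" using b(2) ocell_cl class_chart_point[OF C(1) b(1)] by simp
 also have "... = cpt b (coord b C)" using coord_class[OF C(1)] C(2) by (intro cpt_cong) simp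
 finally show ?thesis by simp
qed

subsection \<open>Continuity\<close>

lemma eval_continuous:
 assumes "ta:K" "m:smg ta"
 shows "continuous_map (ctop ta) euclidean (%ga. ga m)" unfolding chart_top_eq[OF assms(1)]
 by (rule continuous_map_from_subtopology[OF continuous_map_product_projection[OF assms(2)]])

lemma exponent_verts:
 assumes "b:bases" "v:verts b" "k:NN"
 shows "ip (b k) v >= 0" using assms b_om[OF assms(1,3)] by (auto simp:verts_def)

lemma monomial_continuous_on:
 assumes "!!k w. k:NN ==> w:A ==> w k ~= 0 \<or> expo b m k >= 0"
 shows "continuous_on A (%w. mono_at b w m)" unfolding mono_at_def
proof (rule continuous_on_prod)
 fix k assume k:"k:NN"
 have c:"continuous_on A (%w. w k)" using continuous_on_subset[OF continuous_on_product_coordinates] by auto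
 show "continuous_on A (%w. w k powi expo b m k)" using assms[OF k] by (intro continuous_on_power_int c) auto
qed

lemma ocell_inch:
 assumes "ta:K" "b':bases" "ta <= verts b'" "ga:points ta"
 shows "ocell (inch ta ga) = zcell b' (%k. ga (b' k))"
 using inch_cpt[OF assms] orbit_cell_chart[OF assms(2)] by simp

lemma open_chart_TV:
 assumes b:"b:bases"
 shows "openin TV {C:topspace TV. ocell C <= verts b}" unfolding openin_TV
proof (intro conjI ballI)
 fix ta assume ta:"ta:K"
 obtain b' where b':"b':bases" "ta <= verts b'" using K_base[OF ta] .
 let ?L = "{k:NN. om b' k ~: verts b}"
 have "{ga:points ta. inch ta ga:{C:topspace TV. ocell C <= verts b}} = points ta Int (INT k:?L. {ga:points ta. ga (b' k) : - {0}})"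
  using ocell_inch[OF ta b'] in_chart_TV[OF ta] by (auto simp:zcell_def)
 moreover have "openin (ctop ta) {ga:points ta. ga (b' k) : - {0}}" if "k:?L" for k
  using openin_continuous_map_preimage[OF eval_continuous[OF ta b_smg[OF b', of k]], of "- {0}"] that top_ctop[OF ta] open_delete[OF open_UNIV, of "0 :: complex"]
  by (simp add:Compl_eq_Diff_UNIV)
 moreover have "openin (ctop ta) (points ta)" using openin_topspace[of "ctop ta"] top_ctop[OF ta] by simp
 ultimately show "openin (ctop ta) {ga:points ta. inch ta ga:{C:topspace TV. ocell C <= verts b}}"
  by (cases "?L = {}") (auto intro!:openin_Inter)
qed auto

text \<open>Seen from the chart of b', the coordinate is a Laurent monomial. Its exponents can be
  negative only at vertices outside those of b, and there the coordinates do not vanish on the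
  overlap.\<close>

lemma coord_continuous:
 assumes b:"b:bases" and k:"k:NN"
 shows "continuous_map (subtop TV {C:topspace TV. ocell C <= verts b}) euclidean (%C. coord b C k)"
proof (rule continuous_map_TV[OF open_chart_TV[OF b]])
 fix ta assume ta:"ta:K"
 obtain b' where b':"b':bases" "ta <= verts b'" using K_base[OF ta] .
 let ?V = "{ga:points ta. inch ta ga:{C:topspace TV. ocell C <= verts b}}"
 let ?g = "%ga i. if i:NN then ga (b' i) else (0::complex)"
 define A where "A = {w :: nat=>complex. !i:NN. om b' i ~: verts b --> w i ~= 0}"
 have "continuous_map (subtop (ctop ta) ?V) euclidean (%ga. ?g ga i)" for i by (cases "i:NN")
   (auto intro!:continuous_map_from_subtopology eval_continuous[OF ta] b_smg[OF b'])
 hence "continuous_map (subtop (ctop ta) ?V) euclidean ?g"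
  by (simp add:continuous_map_componentwise_UNIV flip:euclidean_product_topology)
 moreover have "?g ga:A" if "ga:?V" for ga using that ocell_inch[OF ta b', of ga] by (auto simp:A_def zcell_def)
 ultimately have g:"continuous_map (subtop (ctop ta) ?V) (top_of_set A) ?g"
  by (auto simp:continuous_map_in_subtopology)
 have "continuous_on A (%w. mono_at b' w (b k))"
 proof (rule monomial_continuous_on)
  fix i w assume i:"i:NN" and w:"w:A"
  show "w i ~= 0 \<or> expo b' (b k) i >= 0"
  proof (cases "om b' i:verts b")
   case True
   thus ?thesis using exponent_verts[OF b _ k] by (simp add:expo_def)
  qed (use w i in \<open>auto simp:A_def\<close>)
 qed
 hence "continuous_map (top_of_set A) euclidean (%w. mono_at b' w (b k))" by simp
 from continuous_map_compose[OF g this]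
 show "continuous_map (subtop (ctop ta) ?V) euclidean (%ga. coord b (inch ta ga) k)"
 proof (rule continuous_map_eq)
  fix ga assume "ga:topspace (subtop (ctop ta) ?V)"
  hence ga:"ga:points ta" "ocell (inch ta ga) <= verts b" by auto
  have "mono_at b' (?g ga) = mono_at b' (%k. ga (b' k))" by (rule monomial_cong) simp
  thus "((%w. mono_at b' w (b k)) \<circ> ?g) ga = coord b (inch ta ga) k"
   using inch_cpt[OF ta b' ga(1)] coord_chart[OF b b'(1) _ k] ga(2) ocell_inch[OF ta b' ga(1)] by simp
 qed
qed

lemma cpt_inch:
 assumes b:"b:bases"
 shows "cpt b z = inch (verts b) (restrict (mono_at b z) (smg (verts b)))"
  and "restrict (mono_at b z) (smg (verts b)):points (verts b)"
proof -
 have adm:"admis b (verts b) z" by (auto simp:admis_def verts_def)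
 show p:"restrict (mono_at b z) (smg (verts b)):points (verts b)" by (rule monomial_points[OF b adm])
 show "cpt b z = inch (verts b) (restrict (mono_at b z) (smg (verts b)))"
  unfolding inch_cpt[OF verts_K[OF b] b subset_refl p]
  using b_smg[OF b subset_refl] monomial_base[OF b] by (intro cpt_cong) simp
qed

lemma chart_point_continuous:
 assumes b:"b:bases"
 shows "continuous_map euclidean TV (cpt b)"
proof -
 have "continuous_map euclidean (ctop (verts b)) (%z. restrict (mono_at b z) (smg (verts b)))"
  unfolding chart_top_eq[OF verts_K[OF b]] continuous_map_in_subtopology continuous_map_componentwise
 proof (intro conjI ballI)
  fix m assume m:"m:smg (verts b)"
  have "continuous_on UNIV (%w. mono_at b w m)"
   using exponent_nonneg[OF b m] by (intro monomial_continuous_on) (auto simp:verts_def)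
  thus "continuous_map euclidean euclidean (%z. restrict (mono_at b z) (smg (verts b)) m)" by simp
 qed (use cpt_inch(2)[OF b] in auto)
 from continuous_map_compose[OF this in_chart_continuous[OF verts_K[OF b]]]
 show ?thesis by (simp add:comp_def cpt_inch(1)[OF b, symmetric])
qed

subsection \<open>Real points and the action of the sign vectors\<close>

text \<open>Complex conjugation and multiplication by signs both act on the values of the
  homomorphisms; this covers the two at once.\<close>

definition twist :: "('a=>complex=>complex)=>('a set \<times> ('a=>complex)) set=>('a set \<times> ('a=>complex)) set" where
 "twist h C = (%(si,ga). (si,restrict (%m. h m (ga m)) (cone_semigroup cowts si))) ` C"

lemma toric_conjugation_twist:"toric_conjugation cowts = twist (%_. cnj)"
 by (intro ext) (simp add:toric_conjugation_def twist_def)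

lemma twist_class:"twist h (pclass rh ep) = pclass rh (restrict (%m. h m (ep m)) (smg rh))"
proof -
 have "(cone ta,restrict (%m. h m (restrict ep (smg ta) m)) (cone_semigroup cowts (cone ta))) =
  (cone ta,restrict (restrict (%m. h m (ep m)) (smg rh)) (smg ta))" if "ta:K" "rh <= ta" for ta
  unfolding cone_smg[OF that(1)] rr_smg[OF that(2)] by auto
 hence "(%(si,ga). (si,restrict (%m. h m (ga m)) (cone_semigroup cowts si))) ` (%ta. (cone ta,restrict ep (smg ta))) ` {ta:K. rh <= ta} =
   (%ta. (cone ta,restrict (restrict (%m. h m (ep m)) (smg rh)) (smg ta))) ` {ta:K. rh <= ta}"
  unfolding image_image by (intro image_cong refl) simp
 moreover have "pclass rh ep = (%ta. (cone ta,restrict ep (smg ta))) ` {ta:K. rh <= ta}" for ep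
  by (auto simp:pclass_def)
 ultimately show ?thesis by (simp add:twist_def)
qed

definition sign_like :: "('a=>complex=>complex)=>bool" where
 "sign_like h <-> h 0 1 = 1 & (!m. h m 0 = 0) &
  (!m:M. !m':M. !x y. h (m + m') (x * y) = h m x * h m' y)"

lemma points_twist:
 assumes h:"sign_like h" and ga:"ga:points ta"
 shows "restrict (%m. h m (ga m)) (smg ta):points ta"
proof -
 have "m:M" if "m:smg ta" for m using that by (simp add:smg_def)
 thus ?thesis using h ga semigroup_0 semigroup_add unfolding points_def sign_like_def by auto
qed

lemma pure_twist:
 assumes h:"sign_like h" and p:"pure rh ep"
 shows "pure rh (restrict (%m. h m (ep m)) (smg rh))" using assms points_twist[OF h] by (auto simp:sign_like_def pure_def)

lemma twist_in_chart:
 assumes h:"sign_like h" and ta:"ta:K" and ga:"ga:points ta"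
 shows "twist h (inch ta ga) = inch ta (restrict (%m. h m (ga m)) (smg ta))"
proof -
 obtain b where b:"b:bases" "ta <= verts b" using K_base[OF ta] .
 let ?z = "%k. ga (b k)"
 let ?ep = "restrict (mono_at b ?z) (smg (zcell b ?z))"
 have adm:"admis b ta ?z" and ga_eq:"ga = restrict (mono_at b ?z) (smg ta)" by (rule pts_mono[OF ga b])+
 have sub:"zcell b ?z <= ta" using adm by (auto simp:admis_def zcell_def)
 have p:"pure (zcell b ?z) ?ep" by (rule pure_mono[OF b(1)])
 have "ga = restrict ?ep (smg ta)" using ga_eq unfolding rr_smg[OF sub] .
 hence gam:"ga m = ?ep m" if "m:smg ta" for m using that by (metis restrict_apply')
 have "twist h (inch ta ga) = pclass (zcell b ?z) (restrict (%m. h m (?ep m)) (smg (zcell b ?z)))"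
  unfolding inch_cpt[OF ta b ga] cpt_def twist_class ..
 also have "... = inch ta (restrict (restrict (%m. h m (?ep m)) (smg (zcell b ?z))) (smg ta))"
  by (rule inch_cl[OF pure_twist[OF h p] ta sub, symmetric])
 also have "restrict (restrict (%m. h m (?ep m)) (smg (zcell b ?z))) (smg ta) = restrict (%m. h m (?ep m)) (smg ta)"
  by (rule rr_smg[OF sub])
 also have "... = restrict (%m. h m (ga m)) (smg ta)" by (rule restrict_ext) (simp only:gam)
 finally show ?thesis .
qed

lemma twist_continuous:
 assumes h:"sign_like h" and hc:"!!m. continuous_on UNIV (h m)"
 shows "continuous_map TV TV (twist h)"
proof -
 have "continuous_map (subtop TV (topspace TV)) TV (twist h)"
 proof (rule continuous_map_TV)
  fix ta assume ta:"ta:K"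
  have V:"{ga:points ta. inch ta ga:topspace TV} = topspace (ctop ta)"
   using in_chart_TV[OF ta] top_ctop[OF ta] by auto
  have "continuous_map (ctop ta) (ctop ta) (%ga. restrict (%m. h m (ga m)) (smg ta))"
  proof -
   have "continuous_map (ctop ta) euclidean (%ga. restrict (%m. h m (ga m)) (smg ta) m)" if m:"m:smg ta" for m
   proof -
    have "continuous_map euclidean euclidean (h m)" using hc by simp
    from continuous_map_compose[OF eval_continuous[OF ta m] this] show ?thesis by (simp add:comp_def)
   qed
   moreover have "(%ga. restrict (%m. h m (ga m)) (smg ta)):topspace (ctop ta) \<rightarrow> points ta"
    using points_twist[OF h] top_ctop[OF ta] by auto
   ultimately show ?thesis
    by (subst (2) chart_top_eq[OF ta]) (auto simp:continuous_map_in_subtopology continuous_map_componentwise)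
  qed
  from continuous_map_compose[OF this in_chart_continuous[OF ta]]
  have "continuous_map (ctop ta) TV (%ga. twist h (inch ta ga))"
   by (rule continuous_map_eq) (use twist_in_chart[OF h ta] top_ctop[OF ta] in auto)
  thus "continuous_map (subtop (ctop ta) {ga:points ta. inch ta ga:topspace TV}) TV (%ga. twist h (inch ta ga))"
   unfolding V by simp
 qed simp
 thus ?thesis by simp
qed

lemma conjugation_like:"sign_like (%_. cnj)" by (simp add:sign_like_def)

lemma RTV_class:
 assumes p:"pure rh ep"
 shows "pclass rh ep:topspace RTV <-> (!m:smg rh. cnj (ep m) = ep m)"
proof -
 have "pclass rh ep:topspace RTV <-> pclass rh (restrict (%m. cnj (ep m)) (smg rh)) = pclass rh ep"
  using class_TV[OF p] by (simp add:real_toric_variety_def toric_conjugation_twist twist_class)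
 also have "... <-> restrict (%m. cnj (ep m)) (smg rh) = ep"
  using point_class_inj[OF pure_twist[OF conjugation_like p] p] by auto
 also have "... <-> (!m:smg rh. cnj (ep m) = ep m)" using p by (auto simp:extensional_def fun_eq_iff pure_def points_def)
 finally show ?thesis .
qed

lemma RTV_TV:"x:topspace RTV ==> x:topspace TV" by (simp add:real_toric_variety_def)

lemma coord_real:
 assumes C:"C:topspace RTV" and b:"b:bases" "ocell C <= verts b" and k:"k:NN"
 shows "of_real (Re (coord b C k)) = coord b C k"
  using assms TV_cases[OF RTV_TV[OF C]] ocell_cl b_smg[OF b(1) _ k] C RTV_class coord_class by (metis Reals_cnj_iff of_real_Re)

lemma chart_point_RTV:
 assumes b:"b:bases"
 shows "cpt b (%k. of_real (z k)):topspace RTV" unfolding cpt_def RTV_class[OF pure_mono[OF b]]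
proof
 fix m assume m:"m:smg (zcell b (%k. of_real (z k) :: complex))"
 have "cnj (of_real (z k) powi e) = of_real (z k) powi e" for k e by simp
 thus "cnj (restrict (mono_at b (%k. of_real (z k))) (smg (zcell b (%k. of_real (z k)))) m) =
   restrict (mono_at b (%k. of_real (z k))) (smg (zcell b (%k. of_real (z k)))) m" using m by (auto simp:mono_at_def)
qed

definition "sign_act s = twist (%m x. of_real (sign_of (nwt s) m) * x)"

lemma sign_act_like:"s <= NN ==> sign_like (%m x. of_real (sign_of (nwt s) m) * x)"
 unfolding sign_like_def using sign_of_add[OF nwt_N] by auto

lemma sign_act_RTV:
 assumes s:"s <= NN" and C:"C:topspace RTV"
 shows "sign_act s C:topspace RTV"
proof -
 obtain rh ep where p:"pure rh ep" "C = pclass rh ep" using TV_cases[OF RTV_TV[OF C]] .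
 show ?thesis unfolding sign_act_def p(2) twist_class RTV_class[OF pure_twist[OF sign_act_like[OF s] p(1)]]
  using C[unfolded p(2) RTV_class[OF p(1)]] by simp
qed

lemma real_toric_space_RTV:
 "rtspace Ph n c a0 RTV ocell (%b C k. Re (coord b C k)) (%b z. cpt b (%k. of_real (z k))) sign_act"
proof
 fix x assume x:"x:topspace RTV"
 obtain rh ep where p:"pure rh ep" "x = pclass rh ep" using TV_cases[OF RTV_TV[OF x]] .
 show "ocell x:K" using p ocell_cl by (simp add:pure_def)
 fix s assume s:"s <= NN"
 have q:"pure rh (restrict (%m. of_real (sign_of (nwt s) m) * ep m) (smg rh))"
  by (rule pure_twist[OF sign_act_like[OF s] p(1)])
 have sx:"sign_act s x = pclass rh (restrict (%m. of_real (sign_of (nwt s) m) * ep m) (smg rh))"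
  unfolding sign_act_def p(2) by (rule twist_class)
 show "ocell (sign_act s x) = ocell x" unfolding sx ocell_cl[OF q] by (simp add:p(2) ocell_cl[OF p(1)])
 fix b k assume b:"b:bases" "ocell x <= verts b" and k:"k:NN"
 have "b k:smg rh" using b_smg[OF b(1) _ k] b(2) ocell_cl p by simp
 thus "Re (coord b (sign_act s x) k) = sign_of (nwt s) (b k) * Re (coord b x k)"
  unfolding sx coord_class[OF q k] by (simp add:p(2) coord_class[OF p(1) k])
next
 fix b assume b:"b:bases"
 let ?U = "{x:topspace TV. ocell x <= verts b}" and ?V = "{x:topspace RTV. ocell x <= verts b}"
 have V:"?V = topspace RTV Int ?U" using RTV_TV by blast
 have "openin RTV ({x. toric_conjugation cowts x = x} Int ?U)"
  unfolding real_toric_variety_def by (rule openin_subtopology_Int2[OF open_chart_TV[OF b]])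
 moreover have "{x. toric_conjugation cowts x = x} Int ?U = ?V" by (auto simp:real_toric_variety_def)
 ultimately show "openin RTV ?V" by simp
 have sub:"subtop RTV ?V = subtop (subtop TV ?U) ?V"
  unfolding real_toric_variety_def subtopology_subtopology by (rule arg_cong[where f = "subtop TV"]) auto
 have "continuous_map (subtop RTV ?V) euclidean (%C. Re (coord b C k))" for k
 proof (cases "k:NN")
  case True
  have re:"continuous_map euclidean euclidean Re" by (simp add:continuous_on_Re)
  from continuous_map_compose[OF coord_continuous[OF b True] re] show ?thesis
   unfolding sub by (simp add:comp_def continuous_map_from_subtopology)
 qed (simp add:coord_def)
 hence "continuous_map (subtop RTV ?V) euclidean (%C k. Re (coord b C k))"
  by (simp add:continuous_map_componentwise_UNIV flip:euclidean_product_topology)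
 thus "continuous_map (subtop RTV ?V) (top_of_set cspace) (%C k. Re (coord b C k))"
  by (auto simp:continuous_map_in_subtopology cspace_def coord_def)
 have "continuous_map (top_of_set cspace) euclidean (%z k. of_real (z k) :: complex)"
  by (auto intro!:continuous_intros intro:continuous_on_subset[OF continuous_on_product_coordinates])
 from continuous_map_compose[OF this chart_point_continuous[OF b]]
 show "continuous_map (top_of_set cspace) RTV (%z. cpt b (%k. of_real (z k)))" using chart_point_RTV[OF b]
  by (auto simp:comp_def real_toric_variety_def continuous_map_in_subtopology)
 show "(%k. Re (coord b (cpt b (%k. of_real (z k))) k)) = z" if "z:cspace" for z
 proof
  show "Re (coord b (cpt b (%k. of_real (z k))) k) = z k" for k
   using that coord_chart_self[OF b, of k] by (cases "k:NN") (auto simp:cspace_def coord_def)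
 qed
 show "cpt b (%k. of_real (Re (coord b x k))) = x" if x:"x:topspace RTV" "ocell x <= verts b" for x
 proof -
  have "cpt b (%k. of_real (Re (coord b x k))) = cpt b (coord b x)"
   using coord_real[OF x(1) b x(2)] by (rule cpt_cong)
  thus ?thesis using chart_coord[OF RTV_TV[OF x(1)] b x(2)] by simp
 qed
 show "ocell (cpt b (%k. of_real (z k))) = {om b k |k. k:NN & z k = 0}" for z
  unfolding orbit_cell_chart[OF b] by (simp add:zcell_def)
next
 fix s assume s:"s <= NN"
 have "continuous_map TV TV (sign_act s)"
  unfolding sign_act_def by (rule twist_continuous[OF sign_act_like[OF s]]) (intro continuous_intros)
 thus "continuous_map RTV RTV (sign_act s)" using sign_act_RTV[OF s] continuous_map_from_subtopology
  by (auto simp:real_toric_variety_def continuous_map_in_subtopology)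
qed

end

section \<open>The Weyl fan consists of the cones of the complex\<close>

context E_roots
begin

definition "ochamb b = {x. !i:NN. ip (b i) x > 0}"

abbreviation regular :: "'a set" where
 "regular == UNIV - (UN be:Ph. {x. be \<bullet> x = 0})"

lemma cone_verts:
 assumes b:"b:bases"
 shows "cone (verts b) = {x. !i:NN. ip (b i) x >= 0}"
proof (intro equalityI subsetI CollectI ballI)
 fix x i assume x:"x:cone (verts b)" and i:"i:NN"
 then obtain t where "!v:verts b. t v >= 0" "x = (SUM v:verts b. t v *r v)" by (auto simp:cone_def)
 thus "ip (b i) x >= 0" using b_om[OF b i] by (auto simp:ip_sumr ip_sr verts_def intro!:sum_nonneg)
next
 fix x assume x:"x:{x. !i:NN. ip (b i) x >= 0}"
 have inj:"inj_on (om b) (NN)" using om_inj[OF b] by auto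
 hence inv:"the_inv_into (NN) (om b) (om b i) = i" if "i:NN" for i using that by (rule the_inv_into_f_f)
 have "x = (SUM v:om b ` NN. ip (b (the_inv_into (NN) (om b) v)) x *r v)"
  using inj inv by (subst b_exp(1)[OF b, of x]) (simp add:sum.reindex)
 thus "x:cone (verts b)"
  unfolding cone_def verts_def using x inv by (intro CollectI exI[of _ "%v. ip (b (the_inv_into (NN) (om b) v)) x"]) auto
qed

lemma ip_0_iff:"ip be x = 0 <-> be \<bullet> x = 0"
 and ip_pos_iff:"ip be x > 0 <-> be \<bullet> x > 0"
 and ip_nonneg_iff:"ip be x >= 0 <-> be \<bullet> x >= 0"
 using c by (simp_all add:ip_def zero_less_divide_iff zero_le_divide_iff)

lemma open_chamber_regular:
 assumes b:"b:bases"
 shows "ochamb b <= regular"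
proof -
 have "ip be x ~= 0" if be:"be:Ph" and x:"x:ochamb b" for be x
 proof
  assume 0:"ip be x = 0"
  obtain k :: "nat=>int" where k:"!i:NN. ip (om b i) be = of_int (k i)" "(!i:NN. 0 <= k i) \<or> (!i:NN. k i <= 0)"
   using root_coherent[OF b be] by blast
  have s:"(SUM i:NN. of_int (k i) * ip (b i) x) = 0" using ip_expand[OF b, of be x] 0 k(1) by simp
  have "!i:NN. of_int (k i) * ip (b i) x = 0" using k(2)
  proof
   assume "!i:NN. 0 <= k i"
   thus ?thesis using s x by (subst (asm) sum_nonneg_eq_0_iff) (auto simp:ochamb_def)
  next
   assume "!i:NN. k i <= 0"
   thus ?thesis
  using s x sum_nonneg_eq_0_iff[of "NN" "%i. - (of_int (k i) * ip (b i) x)"] by (auto simp:ochamb_def less_imp_le mult_nonpos_nonneg sum_negf)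
  qed
  hence "!i:NN. k i = 0" using x by (force simp:ochamb_def)
  thus False using b_exp(2)[OF b, of be] k(1) root_nonzero[OF be] by simp
 qed
 thus ?thesis by (auto simp:ip_0_iff)
qed

lemma ochamb_center:"b:bases ==> (SUM j:NN. om b j):ochamb b"
 using base_sum_om[of b _ "%_. 1"] by (auto simp:ochamb_def)

text \<open>An open chamber is convex, and a connected set that leaves it meets the hyperplane of a
  simple root.\<close>

lemma open_chamber_component:
 assumes b:"b:bases" and x:"x:ochamb b"
 shows "connected_component_set regular x = ochamb b"
proof
 have "ochamb b = (INT i:NN. {x. b i \<bullet> x > 0})" by (auto simp:ochamb_def ip_pos_iff)
 thus "ochamb b <= connected_component_set regular x"
  by (metis x open_chamber_regular[OF b] connected_component_maximal convex_connected convex_INT convex_halfspace_gt)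
 show "connected_component_set regular x <= ochamb b"
 proof
  fix y assume "y:connected_component_set regular x"
  then obtain T where T:"connected T" "T <= regular" "x:T" "y:T" by (auto simp:connected_component_def)
  have "ip (b i) y > 0" if i:"i:NN" for i
  proof (rule ccontr)
   assume "~ip (b i) y > 0"
   hence "b i \<bullet> y <= 0" "0 <= b i \<bullet> x" using x i by (auto simp:ochamb_def ip_pos_iff)
   then obtain z where "z:T" "b i \<bullet> z = 0" using connected_ivt_hyperplane[OF T(1,4,3)] by blast
   thus False using T(2) b_root[OF b i] by blast
  qed
  thus "y:ochamb b" by (simp add:ochamb_def)
 qed
qed

lemma components_regular:"components regular = ochamb ` bases"
proof (intro equalityI subsetI)
 fix C assume "C:components regular"
 then obtain x where x:"x:regular" "C = connected_component_set regular x" by (auto simp:components_def)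
 obtain b where b:"b:bases" "!i:NN. ip (b i) x >= 0" using dominant_base by blast
 have "ip (b i) x ~= 0" if "i:NN" for i using x(1) b_root[OF b(1) that] by (auto simp:ip_0_iff)
 thus "C:ochamb ` bases" using b(2) open_chamber_component[OF b(1)] b(1) x(2) by (auto simp:ochamb_def less_le)
next
 fix C assume "C:ochamb ` bases"
 then obtain b where b:"b:bases" "C = ochamb b" by blast
 thus "C:components regular"
  using open_chamber_component[OF b(1) ochamb_center[OF b(1)]] open_chamber_regular[OF b(1)] ochamb_center[OF b(1)]
  by (auto simp:components_def)
qed

lemma cone_verts_halfspaces:"b:bases ==> cone (verts b) = (INT i:NN. {x. b i \<bullet> x >= 0})"
 using cone_verts by (auto simp:ip_nonneg_iff)

lemma closure_open_chamber:
 assumes b:"b:bases"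
 shows "closure (ochamb b) = cone (verts b)"
proof
 have "closed (cone (verts b))" unfolding cone_verts_halfspaces[OF b] by (intro closed_INT ballI closed_halfspace_ge)
 moreover have "ochamb b <= cone (verts b)" unfolding cone_verts[OF b] by (auto simp:ochamb_def)
 ultimately show "closure (ochamb b) <= cone (verts b)" by (rule closure_minimal[rotated])
 show "cone (verts b) <= closure (ochamb b)"
 proof
  fix x assume x:"x:cone (verts b)"
  let ?r = "SUM j:NN. om b j"
  have "x + inverse (of_nat (Suc j)) *r ?r:ochamb b" for j
   using x ochamb_center[OF b] unfolding cone_verts[OF b] ochamb_def
   by (auto simp:ip_addr ip_sr intro!:add_nonneg_pos)
  moreover have "(%j. x + inverse (of_nat (Suc j)) *r ?r) \<longlonglongrightarrow> x + 0 *r ?r"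
   by (intro tendsto_intros LIMSEQ_inverse_real_of_nat)
  ultimately show "x:closure (ochamb b)" unfolding closure_sequential by (intro exI[of _ "%j. x + inverse (of_nat (Suc j)) *r ?r"]) (simp)
 qed
qed

lemma cone_conic:
 assumes "x:cone ta" "r >= 0"
 shows "r *r x:cone ta" using assms(1) assms(2) CollectI exI by (auto simp:cone_def scaleR_sum_right)

text \<open>The sum of the simple roots at the vertices outside \<open>ta\<close> is a supporting
  functional of the chamber, and its zeros there form the cone of \<open>ta\<close>.\<close>

lemma cone_face:
 assumes b:"b:bases" and ta:"ta <= verts b"
 shows "cone ta face_of cone (verts b)"
proof -
 define L where "L = {i:NN. om b i ~: ta}"
 let ?a = "SUM i:L. b i"
 have sum:"ip ?a x = (SUM i:L. ip (b i) x)" for x by (simp add:ip_suml)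
 have L:"finite L" "L <= NN" by (auto simp:L_def)
 have "ip ?a x >= 0" if "x:cone (verts b)" for x using that L unfolding sum cone_verts[OF b] by (auto intro!:sum_nonneg)
 hence pos:"?a \<bullet> x >= 0" if "x:cone (verts b)" for x using that ip_nonneg_iff[of ?a x] by blast
 have convex:"convex (cone (verts b))" unfolding cone_verts_halfspaces[OF b] by (intro convex_INT convex_halfspace_ge)
 have "cone (verts b) Int {x. ?a \<bullet> x = 0} face_of cone (verts b)"
  by (rule face_of_Int_supporting_hyperplane_ge[OF convex pos])
 moreover have "cone (verts b) Int {x. ?a \<bullet> x = 0} = cone ta"
 proof (intro equalityI subsetI)
  fix x assume x:"x:cone (verts b) Int {x. ?a \<bullet> x = 0}"
  hence "(SUM i:L. ip (b i) x) = 0" using sum[of x] ip_0_iff[of ?a x] by simp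
  moreover have nn:"!i:NN. ip (b i) x >= 0" using x by (simp add:cone_verts[OF b])
  ultimately have 0:"ip (b i) x = 0" if "i:L" for i using that L by (subst (asm) sum_nonneg_eq_0_iff) auto
  obtain rh f where rh:"rh <= verts b" "!v:rh. f v > 0" "x = (SUM v:rh. f v *r v)"
   using cone_support[OF verts_K[OF b]] x by blast
  have fin:"finite rh" using finite_subset[OF rh(1) finite_verts] .
  have "rh <= ta"
  proof
   fix v assume v:"v:rh"
   then obtain i where i:"i:NN" "v = om b i" using rh(1) by (auto simp:verts_def)
   have "ip (b i) x = (SUM w:rh. f w * ip (b i) w)" unfolding rh(3) by (simp add:ip_sumr ip_sr)
   moreover have "(SUM w:rh. f w * ip (b i) w) >= f v * ip (b i) v"
   proof (rule member_le_sum[OF v _ fin])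
    fix w assume "w:rh - {v}"
    thus "0 <= f w * ip (b i) w" using rh(1,2) exponent_verts[OF b _ i(1), of w] by (auto intro!:mult_nonneg_nonneg)
   qed
   moreover have "ip (b i) v = 1" using b_om[OF b i(1) i(1)] i(2) by simp
   ultimately show "v:ta" using rh(2) v 0[of i] i by (force simp:L_def)
  qed
  moreover have "x:cone rh" unfolding cone_def using rh(2,3) by (auto intro:less_imp_le)
  ultimately show "x:cone ta" using cone_mono[OF K_face[OF verts_K[OF b] ta]] by blast
 next
  fix x assume x:"x:cone ta"
  then obtain t where t:"!v:ta. t v >= 0" "x = (SUM v:ta. t v *r v)" by (auto simp:cone_def)
  have "ip (b i) v = 0" if iv:"i:L" "v:ta" for i v
  proof -
   obtain j where j:"j:NN" "v = om b j" using iv(2) ta by (auto simp:verts_def)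
   thus ?thesis using b_om[OF b _ j(1), of i] iv by (auto simp:L_def)
  qed
  hence "ip (b i) x = 0" if "i:L" for i using that unfolding t(2) ip_sumr ip_sr by (intro sum.neutral) auto
  thus "x:cone (verts b) Int {x. ?a \<bullet> x = 0}"
  using cone_mono[OF verts_K[OF b] ta] x ip_0_iff[of ?a x] by (auto simp:sum)
 qed
 ultimately show ?thesis by simp
qed

text \<open>A nonempty face is closed under sums and nonnegative multiples and contains the terms of
  any positive combination that lies in it; so it is generated by the vertices that it
  contains.\<close>

lemma face_cone:
 assumes b:"b:bases" and F:"F face_of cone (verts b)" "F ~= {}"
 shows "EX ta<=verts b. F = cone ta"
proof -
 let ?P = "cone (verts b)"
 have sub:"F <= ?P" and conv:"convex F" using F(1) by (auto simp:face_of_def)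
 have split:"p:F & q:F" if "p:?P" "q:?P" "(1/2) *r (p + q):F" for p q
 proof (cases "p = q")
  case True
  hence "(1/2) *r (p + q) = p" by simp
  thus ?thesis using that(3) True by simp
 next
  case False
  have "(1/2) *r (p + q):open_segment p q"
   using False unfolding in_segment by (intro conjI exI[of _ "1/2"]) (auto simp:scaleR_add_right)
  thus ?thesis using F(1) that unfolding face_of_def by blast
 qed
 have P0:"0:?P" unfolding cone_verts[OF b] by (simp add:ip_0_right)
 have scale:"r *r x:F" if x:"x:F" and r:"r >= 0" for x r
 proof -
  have xP:"x:?P" using x sub by blast
  have 0:"0:F" using split[OF P0 cone_conic[OF xP, of 2]] x by simp
  have double:"2 *r x:F" if "x:F" for x using split[OF P0 cone_conic[of x _ 2]] that sub by auto
  \<comment> \<open>Doubling reaches all multiples by powers of 2; convexity with 0 fills in the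
    remaining ones.\<close>
  have pow:"2 ^ j *r x:F" for j
  proof (induction j)
   case (Suc j)
   thus ?case using double[of "2 ^ j *r x"] by simp
  qed (use x in simp)
  obtain j where j:"r < 2 ^ j" using real_arch_pow[of 2 r] by auto
  show ?thesis using convexD_alt[OF conv 0 pow[of j], of "r / 2 ^ j"] r j by simp
 qed
 have add:"x + y:F" if "x:F" "y:F" for x y
 proof -
  have "(1/2) *r x + (1/2) *r y:F" using convexD[OF conv that, of "1/2" "1/2"] by simp
  from scale[OF this, of 2] show ?thesis by (simp add:scaleR_add_right)
 qed
 have F0:"0:F" using F(2) scale[of _ 0] by auto
 have sum:"(SUM v:A. g v):F" if "finite A" "!v:A. g v:F" for A and g :: "'a=>'a"
  using that by (induction A rule:finite_induct) (auto intro:add F0)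
 let ?ta = "{v:verts b. v:F}"
 have "F = cone ?ta"
 proof (intro equalityI subsetI)
  fix x assume x:"x:F"
  obtain rh f where rh:"rh <= verts b" "!v:rh. f v > 0" "x = (SUM v:rh. f v *r v)"
   using cone_support[OF verts_K[OF b]] x sub by blast
  have fin:"finite rh" using finite_subset[OF rh(1) finite_verts] .
  have "v:F" if v:"v:rh" for v
  proof -
   let ?r = "SUM w:rh-{v}. f w *r w"
   have xs:"x = f v *r v + ?r" unfolding rh(3) using fin v by (rule sum.remove)
   have vP:"v:?P" using cone_gen[OF finite_verts] v rh(1) by blast
   have rP:"?r:?P"
   proof -
    have "?r:cone (rh - {v})" unfolding cone_def using rh(2) by (auto intro:less_imp_le)
    thus ?thesis using cone_mono[OF verts_K[OF b], of "rh - {v}"] rh(1) by blast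
   qed
   have "(2 * f v) *r v:F"
  using split[OF cone_conic[OF vP, of "2 * f v"] cone_conic[OF rP, of 2]] x rh(2) v by (auto simp:xs scaleR_add_right)
   from scale[OF this, of "1 / (2 * f v)"] show ?thesis using rh(2) v by force
  qed
  hence "rh <= ?ta" using rh(1) by blast
  moreover have "x:cone rh" unfolding cone_def using rh(2,3) by (auto intro:less_imp_le)
  ultimately show "x:cone ?ta" using cone_mono[OF K_face[OF verts_K[OF b], of ?ta]] by blast
 next
  fix x assume "x:cone ?ta"
  then obtain t where "!v:?ta. t v >= 0" "x = (SUM v:?ta. t v *r v)" by (auto simp:cone_def)
  thus "x:F" using finite_verts[of b] scale by (auto intro!:sum)
 qed
 thus ?thesis by (intro exI[of _ ?ta]) auto
qed

lemma weyl_fan_cones:"weyl_fan Ph = cone ` K"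
proof -
 have ch:"weyl_chambers Ph = (%b. cone (verts b)) ` bases"
  unfolding weyl_chambers_def components_regular using closure_open_chamber by auto
 have ne:"cone ta ~= {}" for ta unfolding cone_def by auto
 show ?thesis
 proof (intro equalityI subsetI)
  fix F assume "F:weyl_fan Ph"
  then obtain b where "b:bases" "F face_of cone (verts b)" "F ~= {}" by (auto simp:weyl_fan_def ch)
  then obtain ta where "ta <= verts b" "F = cone ta" using face_cone by blast
  thus "F:cone ` K" using \<open>b : bases\<close> by (auto simp:K_def)
 next
  fix F assume "F:cone ` K"
  then obtain ta b where "b:bases" "ta <= verts b" "F = cone ta" by (auto simp:K_def)
  thus "F:weyl_fan Ph" using cone_face ne by (auto simp:weyl_fan_def ch)
 qed
qed

end

subsection \<open>Simple roots and coweights\<close>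

lemma simple_roots_basis:
 fixes al :: "nat=>'a::euclidean_space"
 assumes "simple_roots Ph al"
 shows "span (al ` {1..DIM('a)}) = UNIV"
  using assms card_ge_dim_independent[of "al ` {1..DIM('a)}" UNIV] by (auto simp:simple_roots_def card_image)

lemma simple_roots_unique:
 fixes al :: "nat=>'a::euclidean_space"
 assumes sr:"simple_roots Ph al" and eq:"(SUM i=1..DIM('a). f i *r al i) = (SUM i=1..DIM('a). g i *r al i)" and i:"i:{1..DIM('a)}"
 shows "f i = g i"
proof -
 have ind:"independent (al ` {1..DIM('a)})" and inj:"inj_on al {1..DIM('a)}" using sr by (auto simp:simple_roots_def)
 let ?h = "%v. f (the_inv_into {1..DIM('a)} al v) - g (the_inv_into {1..DIM('a)} al v)"
 have inv:"the_inv_into {1..DIM('a)} al (al j) = j" if "j:{1..DIM('a)}" for j using inj that by (rule the_inv_into_f_f)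
 have "(SUM v:al ` {1..DIM('a)}. ?h v *r v) = (SUM j=1..DIM('a). (f j - g j) *r al j)"
  using inv inj by (simp add:sum.reindex)
 also have "... = 0" using eq by (simp add:scaleR_diff_left sum_subtractf)
 finally show ?thesis using independentD[OF ind, of "al ` {1..DIM('a)}" ?h "al i"] i inv[OF i] by force
qed

lemma fundamental_coweight:
 fixes al :: "nat=>'a::euclidean_space"
 assumes sr:"simple_roots Ph al" and ij:"i:{1..DIM('a)}" "j:{1..DIM('a)}"
 shows "al i \<bullet> fundamental_coweight al j = (if i = j then 1 else 0)"
proof -
 have ind:"independent (al ` {1..DIM('a)})" and inj:"inj_on al {1..DIM('a)}" using sr by (auto simp:simple_roots_def)
 obtain f :: "'a=>real" where f:"linear f" "!x:al ` {1..DIM('a)}. f x = (if x = al j then 1 else 0)"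
  using linear_independent_extend[OF ind, of "%x. if x = al j then 1 else 0"] by auto
 let ?w = "adjoint f 1"
 have w:"al i \<bullet> ?w = (if i = j then 1 else 0)" if "i:{1..DIM('a)}" for i
  using adjoint_works[OF f(1), of "al i" 1] f(2) that inj_on_eq_iff[OF inj that ij(2)] by simp
 have "fundamental_coweight al j = ?w" unfolding fundamental_coweight_def
 proof (rule the_equality)
  fix v assume v:"!i:{1..DIM('a)}. al i \<bullet> v = (if i = j then 1 else 0)"
  have "x \<bullet> (v - ?w) = 0" if "x:span (al ` {1..DIM('a)})" for x
   using that v w by (induction rule:span_induct_alt) (auto simp:inner_add_left inner_diff_right)
  hence "(v - ?w) \<bullet> (v - ?w) = 0" using simple_roots_basis[OF sr] by blast
  thus "v = ?w" by simp
 qed (use w in blast)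
 thus ?thesis using w ij by simp
qed

text \<open>The fundamental coweights are dual to the simple roots, and every root is an integral
  combination of these. So the lattice depends on the roots only, and the simple system of the
  theorem need not be the one used in the proof.\<close>

lemma coweight_lattice_eq:
 fixes al :: "nat=>'a::euclidean_space"
 assumes sr:"simple_roots Ph al"
 shows "coweight_lattice al = {x. !be:Ph. be \<bullet> x:\<int>}"
proof (intro equalityI subsetI)
 fix x assume "x:coweight_lattice al"
 then obtain k :: "nat=>int" where x:"x = (SUM j=1..DIM('a). of_int (k j) *r fundamental_coweight al j)"
  by (auto simp:coweight_lattice_def)
 have a:"al i \<bullet> x:\<int>" if "i:{1..DIM('a)}" for i
  unfolding x using fundamental_coweight[OF sr that] by (auto simp:inner_sum_right)
 show "x:{x. !be:Ph. be \<bullet> x:\<int>}"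
 proof (intro CollectI ballI)
  fix be assume "be:Ph"
  then obtain l :: "nat=>int" where "be = (SUM i=1..DIM('a). of_int (l i) *r al i)"
   using sr unfolding simple_roots_def by blast
  thus "be \<bullet> x:\<int>" using a by (auto simp:inner_sum_left)
 qed
next
 fix x assume x:"x:{x. !be:Ph. be \<bullet> x:\<int>}"
 have sub:"al ` {1..DIM('a)} <= Ph" using sr by (simp add:simple_roots_def)
 hence int:"of_int \<lfloor>al i \<bullet> x\<rfloor> = al i \<bullet> x" if "i:{1..DIM('a)}" for i
  using x that by (intro of_int_floor) blast
 let ?y = "SUM j=1..DIM('a). of_int \<lfloor>al j \<bullet> x\<rfloor> *r fundamental_coweight al j"
 have ay:"al i \<bullet> (x - ?y) = 0" if i:"i:{1..DIM('a)}" for i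
 proof -
  have "al i \<bullet> ?y = (SUM j=1..DIM('a). if j = i then al i \<bullet> x else 0)"
   unfolding inner_sum_right using fundamental_coweight[OF sr i] int by (intro sum.cong) auto
  thus ?thesis using i by (simp add:inner_diff_right)
 qed
 have "z \<bullet> (x - ?y) = 0" if "z:span (al ` {1..DIM('a)})" for z
  using that ay by (induction rule:span_induct_alt) (auto simp:inner_add_left)
 hence "(x - ?y) \<bullet> (x - ?y) = 0" using simple_roots_basis[OF sr] by blast
 thus "x:coweight_lattice al" using exI[of _ "%j. \<lfloor>al j \<bullet> x\<rfloor>"] by (auto simp:coweight_lattice_def)
qed

lemma reflection_root:
 assumes "root_system Ph" "al:Ph" "be:Ph"
 shows "root_reflection al be:Ph" using assms unfolding root_system_def by blast

lemma reflection_norm:"al ~= 0 ==> root_reflection al x \<bullet> root_reflection al x = x \<bullet> x"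
 by (simp add:root_reflection_def inner_diff inner_commute)

lemma minus_root:
 assumes "root_system Ph" "be:Ph"
 shows "- be:Ph"
proof -
 have "be ~= 0" using assms by (auto simp:root_system_def)
 thus ?thesis using reflection_root[OF assms(1,2,2)] by (simp add:root_reflection_def scaleR_2)
qed

lemma sum_update:
 fixes al :: "nat=>'a::real_vector"
 assumes "finite A" "i:A"
 shows "(SUM j:A. of_int ((k(i := k i - e)) j) *r al j) = (SUM j:A. of_int (k j) *r al j) - of_int e *r al i"
  and "(SUM j:A. (k(i := k i - e)) j) = (SUM j:A. k j) - (e::int)"
proof -
 have "(SUM j:A. of_int ((k(i := k i - e)) j) *r al j) = of_int (k i - e) *r al i + (SUM j:A-{i}. of_int (k j) *r al j)"
  using assms by (subst sum.remove[of A i]) (auto)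
 also have "... = (SUM j:A. of_int (k j) *r al j) - of_int e *r al i"
  using sum.remove[OF assms, of "%j. of_int (k j) *r al j"] by (simp add:scaleR_diff_left)
 finally show "(SUM j:A. of_int ((k(i := k i - e)) j) *r al j) = (SUM j:A. of_int (k j) *r al j) - of_int e *r al i" .
 have "(SUM j:A. (k(i := k i - e)) j) = (k i - e) + (SUM j:A-{i}. k j)" using assms by (subst sum.remove[of A i]) (auto)
 thus "(SUM j:A. (k(i := k i - e)) j) = (SUM j:A. k j) - e" using assms by (simp add:sum.remove[of A i])
qed

lemma positive_part:
 fixes al :: "nat=>'a::euclidean_space"
 assumes v:"v = (SUM i:A. of_int (k i) *r al i)" and nn:"!i:A. k i >= 0" and pos:"v \<bullet> v > 0"
 shows "EX i:A. k i > 0 & al i \<bullet> v > 0"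
proof (rule ccontr)
 assume neg:"~ ?thesis"
 have "v \<bullet> v = (SUM i:A. of_int (k i) * (al i \<bullet> v))" by (subst (1) v) (simp add:inner_sum_left)
 also have "... <= 0"
 proof (rule sum_nonpos)
  fix i assume "i:A"
  thus "of_int (k i) * (al i \<bullet> v) <= 0" using nn neg by (force simp:mult_nonneg_nonpos)
 qed
 finally show False using pos by simp
qed

locale E_simple_roots =
 fixes Ph :: "'a::euclidean_space set" and n :: nat and al :: "nat=>'a"
 assumes n:"n = 7 \<or> n = 8" and dim:"DIM('a) = n" and rs:"root_system Ph" and sr:"simple_roots Ph al"
  and cartan:"i:nodes n ==> j:nodes n ==> cartan_number (al i) (al j) = of_int (E_cartan i j)"
begin

lemma al_root:"i:nodes n ==> al i:Ph" using sr unfolding simple_roots_def dim nodes_def by blast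

lemma al_pos:"i:nodes n ==> al i \<bullet> al i > 0" using al_root[of i] rs unfolding root_system_def by force

lemma coeffs:
 assumes "be:Ph"
 obtains k :: "nat=>int" where "be = (SUM i:nodes n. of_int (k i) *r al i)" "(!i:nodes n. 0 <= k i) \<or> (!i:nodes n. k i <= 0)"
 using sr assms unfolding simple_roots_def dim nodes_def by blast

lemma coeffs_unique:
 fixes k l :: "nat=>int"
 assumes "(SUM i:nodes n. of_int (k i) *r al i) = (SUM i:nodes n. of_int (l i) *r al i)" "i:nodes n"
 shows "k i = l i" using simple_roots_unique[OF sr, of "%i. of_int (k i)" "%i. of_int (l i)" i] assms by (simp add:dim nodes_def)

definition nrm :: real where
 "nrm = al 1 \<bullet> al 1"

lemma edge_norm:
 assumes "i:nodes n" "j:nodes n" "E_cartan i j = - 1"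
 shows "al i \<bullet> al i = al j \<bullet> al j"
  using assms cartan[OF assms(1,2)] cartan[OF assms(2,1)] E_cartan_sym[of j i] al_pos[OF assms(1)] by (auto simp:cartan_number_def field_simps inner_commute)

lemma al_norm:"i:nodes n ==> al i \<bullet> al i = nrm"
proof -
 assume i:"i:nodes n"
 have e:"al 1 \<bullet> al 1 = al 3 \<bullet> al 3" "al 3 \<bullet> al 3 = al 4 \<bullet> al 4" "al 2 \<bullet> al 2 = al 4 \<bullet> al 4"
  "al 4 \<bullet> al 4 = al 5 \<bullet> al 5" "al 5 \<bullet> al 5 = al 6 \<bullet> al 6" "al 6 \<bullet> al 6 = al 7 \<bullet> al 7"
  using n by (auto intro!:edge_norm simp:nodes_def cartan_code E_edges_def)
 have e8:"n = 8 ==> al 7 \<bullet> al 7 = al 8 \<bullet> al 8"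
  by (auto intro!:edge_norm simp:nodes_def cartan_code E_edges_def)
 have "i:{1,2,3,4,5,6,7} \<or> n = 8 & i = 8" using i n by (auto simp:nodes_def)
 thus ?thesis unfolding nrm_def using e e8 by auto
qed

lemma nrm_pos:"nrm > 0" using al_pos[of 1] n by (auto simp:nrm_def nodes_def)

lemma gram:"i:nodes n ==> j:nodes n ==> 2 / nrm * (al i \<bullet> al j) = of_int (E_cartan i j)"
 using cartan[of i j] al_norm[of j] by (simp add:cartan_number_def)

text \<open>Induction on the height: reflection in a simple root with positive product lowers the
  height, and coherence keeps the coefficients nonnegative unless the root is itself simple.\<close>

lemma positive_root_norm:
 fixes k :: "nat=>int"
 assumes "be:Ph" "be = (SUM i:nodes n. of_int (k i) *r al i)" "!i:nodes n. k i >= 0"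
 shows "be \<bullet> be = nrm" using assms
proof (induction "nat (SUM i:nodes n. k i)" arbitrary:k be rule:less_induct)
 case less
 note be = less.prems(1) and k = less.prems(2,3)
 obtain i where i:"i:nodes n" "k i > 0" "al i \<bullet> be > 0" using be rs positive_part[OF k] by (auto simp:root_system_def)
 show ?case
 proof (cases "!j:nodes n. j ~= i --> k j = 0")
  case True
  have "be = (SUM j:nodes n. if j = i then of_int (k i) *r al i else 0)" unfolding k(1) using True by (intro sum.cong) auto
  hence b:"be = of_int (k i) *r al i" using i(1) by simp
  have "!al:Ph. !r. r *r al:Ph --> r = 1 \<or> r = - 1" using rs unfolding root_system_def by blast
  thus ?thesis using al_root[OF i(1)] be b i al_norm by force
 next
  case False
  then obtain j where j:"j:nodes n" "j ~= i" "k j > 0" using k(2) by force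
  obtain e :: int where e:"cartan_number be (al i) = of_int e" by (metis rs be al_root[OF i(1)] root_system_def Ints_cases)
  moreover have "cartan_number be (al i) > 0" using i(3) al_pos[OF i(1)] by (simp add:cartan_number_def inner_commute)
  ultimately have e0:"e > 0" by simp
  let ?k = "k(i := k i - e)"
  have r:"root_reflection (al i) be = (SUM j:nodes n. of_int (?k j) *r al j)"
   unfolding sum_update(1)[OF finite_nodes i(1)] k(1)[symmetric] root_reflection_def e[symmetric] cartan_number_def ..
  have rr:"root_reflection (al i) be:Ph" by (rule reflection_root[OF rs al_root[OF i(1)] be])
  obtain l :: "nat=>int" where l:"root_reflection (al i) be = (SUM i:nodes n. of_int (l i) *r al i)"
   "(!i:nodes n. 0 <= l i) \<or> (!i:nodes n. l i <= 0)" using coeffs[OF rr] by blast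
  have kl:"?k m = l m" if "m:nodes n" for m by (rule coeffs_unique[OF _ that]) (use r l(1) in simp)
  have nn:"!m:nodes n. ?k m >= 0" using kl[OF j(1)] j(2,3) l(2) j(1) kl by force
  have "(SUM m:nodes n. ?k m) = (SUM m:nodes n. k m) - e" by (rule sum_update(2)[OF finite_nodes i(1)])
  moreover have "(SUM m:nodes n. ?k m) >= 0" using nn by (intro sum_nonneg) blast
  ultimately have "nat (SUM m:nodes n. ?k m) < nat (SUM m:nodes n. k m)" using e0 by simp
  from less.hyps[OF this rr r nn] show ?thesis using reflection_norm[of "al i" be] al_pos[OF i(1)] by simp
 qed
qed

lemma root_norm:
 assumes be:"be:Ph"
 shows "be \<bullet> be = nrm"
proof -
 obtain k :: "nat=>int" where k:"be = (SUM i:nodes n. of_int (k i) *r al i)" "(!i:nodes n. 0 <= k i) \<or> (!i:nodes n. k i <= 0)"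
  using coeffs[OF be] .
 from k(2) show ?thesis
  using positive_root_norm[OF be k(1)] k(1) positive_root_norm[OF minus_root[OF rs be], of "%i. - k i"] by (auto simp:sum_negf)
qed

lemma int_inner:
 assumes "i:nodes n" "A <= nodes n"
 shows "EX e. 2 / nrm * (al i \<bullet> (SUM j:A. of_int (k j) *r al j)) = of_int e"
proof -
 have "2 / nrm * (al i \<bullet> (SUM j:A. of_int (k j) *r al j)) = (SUM j:A. of_int (k j) * (2 / nrm * (al i \<bullet> al j)))"
  by (simp add:inner_sum_right sum_distrib_left algebra_simps)
 also have "... = (SUM j:A. of_int (k j) * of_int (E_cartan i j))"
  using gram[OF assms(1)] assms(2) by (intro sum.cong arg_cong2[where f = "(*)"] refl) auto
 also have "... = of_int (SUM j:A. k j * E_cartan i j)" by simp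
 finally show ?thesis by blast
qed

text \<open>Some simple root has product \<open>e * nrm / 2\<close> with v, with a positive integer
  e. For e = 1 the reflected vector is v minus that root and has smaller height; for e > 1 this
  difference has norm at most 0, so v is the simple root.\<close>

lemma positive_norm_root:
 fixes k :: "nat=>int"
 assumes "v = (SUM i:nodes n. of_int (k i) *r al i)" "!i:nodes n. k i >= 0" "v \<bullet> v = nrm"
 shows "v:Ph" using assms
proof (induction "nat (SUM i:nodes n. k i)" arbitrary:k v rule:less_induct)
 case less
 note k = less.prems(1,2) and v = less.prems(3)
 obtain i where i:"i:nodes n" "k i > 0" "al i \<bullet> v > 0" using positive_part[OF k] v nrm_pos by auto
 obtain e where e:"2 / nrm * (al i \<bullet> v) = of_int e" using int_inner[OF i(1), of "nodes n" k] unfolding k(1) by blast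
 have "2 / nrm * (al i \<bullet> v) > 0" using i(3) nrm_pos by simp
 hence e0:"e > 0" unfolding e by simp
 have av:"al i \<bullet> v = of_int e * nrm / 2" using e nrm_pos by (simp add:field_simps)
 show ?case
 proof (cases "e = 1")
  case True
  let ?k = "k(i := k i - 1)"
  have av1:"2 * (al i \<bullet> v) = nrm" using av True by simp
  have r:"root_reflection (al i) v = v - al i"
   unfolding root_reflection_def inner_commute[of v] av1 al_norm[OF i(1)] using nrm_pos by simp
  have vk:"v - al i = (SUM j:nodes n. of_int (?k j) *r al j)"
   using sum_update(1)[OF finite_nodes i(1), of k 1 al] k(1) by simp
  have nn:"!m:nodes n. ?k m >= 0" using k(2) i(2) by simp
  have "(SUM m:nodes n. ?k m) = (SUM m:nodes n. k m) - 1" by (rule sum_update(2)[OF finite_nodes i(1)])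
  moreover have "(SUM m:nodes n. ?k m) >= 0" using nn by (intro sum_nonneg) blast
  ultimately have "nat (SUM m:nodes n. ?k m) < nat (SUM m:nodes n. k m)" by simp
  moreover have "(v - al i) \<bullet> (v - al i) = nrm" using reflection_norm[of "al i" v] r v al_pos[OF i(1)] by simp
  ultimately have "root_reflection (al i) (v - al i):Ph" using less.hyps vk nn reflection_root[OF rs al_root[OF i(1)]] by blast
  moreover have "2 * ((v - al i) \<bullet> al i) = - nrm"
   using av1 al_norm[OF i(1)] by (simp add:inner_diff_left inner_commute[of v])
  hence "root_reflection (al i) (v - al i) = v" unfolding root_reflection_def al_norm[OF i(1)] using nrm_pos by simp
  ultimately show ?thesis by simp
 next
  case False
  hence "of_int e * nrm / 2 >= nrm" using e0 nrm_pos by simp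
  hence "(v - al i) \<bullet> (v - al i) <= 0" using av v al_norm[OF i(1)] by (simp add:inner_diff inner_commute)
  thus ?thesis using al_root[OF i(1)] by (simp add:antisym_conv)
 qed
qed

lemma even_norm:
 assumes "finite A" "A <= nodes n"
 shows "EX e. (SUM j:A. of_int (k j) *r al j) \<bullet> (SUM j:A. of_int (k j) *r al j) = of_int e * nrm"
 using assms
proof (induction A rule:finite_induct)
 case empty
 thus ?case by (intro exI[of _ 0]) simp
next
 case (insert i A)
 let ?x = "SUM j:A. of_int (k j) *r al j"
 obtain e where e:"?x \<bullet> ?x = of_int e * nrm" using insert by auto
 obtain f where "2 / nrm * (al i \<bullet> ?x) = of_int f" using int_inner[of i A k] insert.prems by auto
 hence f:"2 * (al i \<bullet> ?x) = of_int f * nrm" using nrm_pos by (simp add:field_simps)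
 have "(of_int (k i) *r al i + ?x) \<bullet> (of_int (k i) *r al i + ?x) = (of_int (k i))\<^sup>2 * (al i \<bullet> al i) + of_int (k i) * (2 * (al i \<bullet> ?x)) + ?x \<bullet> ?x"
  by (simp add:inner_commute power2_eq_square algebra_simps)
 also have "... = of_int ((k i)\<^sup>2 + k i * f + e) * nrm"
  using al_norm[of i] insert.prems unfolding f e by (simp add:algebra_simps)
 finally show ?case using insert.hyps by (intro exI[of _ "(k i)\<^sup>2 + k i * f + e"]) simp
qed

text \<open>The positive and the negative part of v have nonpositive product, so their norms add up
  to at most \<open>nrm\<close>. Both norms are multiples of \<open>nrm\<close>, hence one part is
  0.\<close>

lemma norm_root:
 fixes k :: "nat=>int"
 assumes v:"v = (SUM i:nodes n. of_int (k i) *r al i)" and nv:"v \<bullet> v = nrm"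
 shows "v:Ph"
proof -
 define p where "p = (SUM i:nodes n. of_int (max (k i) 0) *r al i)"
 define m where "m = (SUM i:nodes n. of_int (max (- k i) 0) *r al i)"
 have "of_int (max (k i) 0) - of_int (max (- k i) 0) = (of_int (k i) :: real)" for i by simp
 hence vpm:"v = p - m" unfolding v p_def m_def sum_subtractf[symmetric] scaleR_diff_left[symmetric] by simp
 have "2 / nrm * (p \<bullet> m) = (SUM i:nodes n. SUM j:nodes n. of_int (max (k i) 0) * of_int (max (- k j) 0) * (2 / nrm * (al i \<bullet> al j)))"
  unfolding p_def m_def inner_sum_left inner_sum_right by (subst sum.swap) (simp add:sum_distrib_left algebra_simps)
 also have "... = (SUM i:nodes n. SUM j:nodes n. of_int (max (k i) 0 * max (- k j) 0 * E_cartan i j))"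
  using gram by (intro sum.cong refl) (auto simp del:times_divide_eq_left)
 also have "... <= 0"
 proof (intro sum_nonpos)
  fix i j
  have "max (k i) 0 * max (- k j) 0 * E_cartan i j <= 0"
  proof (cases "i = j")
   case True
   thus ?thesis by simp
  next
   case False
   thus ?thesis by (intro mult_nonneg_nonpos) (auto simp:cartan_code)
  qed
  thus "(of_int (max (k i) 0 * max (- k j) 0 * E_cartan i j) :: real) <= 0" by (simp only:)
 qed
 finally have le:"p \<bullet> p + m \<bullet> m <= nrm"
  using nrm_pos nv by (auto simp:divide_le_0_iff vpm inner_diff inner_commute)
 obtain e f where e:"p \<bullet> p = of_int e * nrm" and f:"m \<bullet> m = of_int f * nrm"
  using even_norm[OF finite_nodes subset_refl] unfolding p_def m_def by metis
 have "e >= 0" "f >= 0"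
  using e f inner_ge_zero[of p] inner_ge_zero[of m] nrm_pos by (auto simp:zero_le_mult_iff simp del:inner_ge_zero)
 moreover have "of_int (e + f) * nrm <= 1 * nrm" using le e f by (simp add:algebra_simps)
 hence "e + f <= 1" using nrm_pos by (subst (asm) mult_le_cancel_right_pos) (auto simp flip:of_int_add)
 ultimately have "e = 0 \<or> f = 0" by linarith
 hence "p = 0 \<or> m = 0" using e f by auto
 thus ?thesis
  using positive_norm_root[of v "%i. max (k i) 0"] nv vpm positive_norm_root[of m "%i. max (- k i) 0"] minus_root[OF rs] unfolding p_def m_def by auto
qed

lemma E_roots:"E_roots Ph n nrm (restrict al (nodes n))"
proof
 have s:"(SUM i:nodes n. f i *r restrict al (nodes n) i) = (SUM i:nodes n. f i *r al i)" for f
  by (intro sum.cong) auto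
 show "Ph = {v:int_span n (restrict al (nodes n)). 2 / nrm * (v \<bullet> v) = 2}"
 proof (intro equalityI subsetI CollectI conjI)
  fix v assume v:"v:Ph"
  show "2 / nrm * (v \<bullet> v) = 2" using root_norm[OF v] nrm_pos by simp
  obtain k :: "nat=>int" where "v = (SUM i:nodes n. of_int (k i) *r al i)" using coeffs[OF v] .
  thus "v:int_span n (restrict al (nodes n))" using int_spanI[of k "restrict al (nodes n)" n] by simp
 next
  fix v assume "v:{v:int_span n (restrict al (nodes n)). 2 / nrm * (v \<bullet> v) = 2}"
  then obtain k :: "nat=>int" where "v = (SUM i:nodes n. of_int (k i) *r al i)" "2 / nrm * (v \<bullet> v) = 2"
   unfolding int_span_def s by blast
  thus "v:Ph" using nrm_pos by (intro norm_root[of v k]) (simp_all add:field_simps)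
 qed
 fix be assume "be:Ph"
 thus "EX k :: nat=>int. be = (SUM i:nodes n. of_int (k i) *r restrict al (nodes n) i) &
   ((!i:nodes n. 0 <= k i) \<or> (!i:nodes n. k i <= 0))" unfolding s using coeffs by metis
next
 show "finite Ph" using rs by (simp add:root_system_def)
qed (use n dim nrm_pos gram in auto)

end

lemma exists_E_roots:
 fixes Ph :: "'a::euclidean_space set"
 assumes "root_system_of_type_E n Ph" "n = 7 \<or> n = 8"
 obtains c a0 where "E_roots Ph n c a0"
proof -
 obtain al where "E_simple_roots Ph n al"
  using assms unfolding root_system_of_type_E_def irreducible_root_system_def E_simple_roots_def nodes_def by blast
 thus ?thesis using that E_simple_roots.E_roots by blast
qed

subsection \<open>Classes modulo \<open>2M\<close>\<close>

text \<open>Boolean lists of length 9 are vectors of \<open>M / 2M\<close> in the coordinates of a base; the entry 0 is not used.\<close>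

definition "odd_nbrs i l = foldr (%k p. l ! k ~= p) (nbrs i) False"

definition "move i l = (if odd_nbrs i l then l[i := ~l ! i] else l)"

text \<open>A certificate for an orbit: the step \<open>(p, i)\<close> applies the simple reflection \<open>i\<close> to the vector that was
  reached \<open>p\<close> steps before the last one.\<close>

fun walk :: "(nat \<times> nat) list=>bool list list=>bool list list" where
 "walk [] ls = ls"
| "walk ((p,i) # steps) ls = walk steps (case drop p ls of []=>ls | l # _=>move i l # ls)"

text \<open>A test for distinctness that splits the list by its first bit; at fixed word length its
  cost is linear in the number of entries instead of quadratic.\<close>

primrec separated :: "nat=>bool list list=>bool" where
 "separated 0 L = (case L of []=>True | _ # L'=>L' = [])"
| "separated (Suc d) L = (separated d (map tl (filter hd L)) & separated d (map tl (filter (%l. ~hd l) L)))"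

lemma distinct_filters:"distinct (filter P L) ==> distinct (filter (%l. ~P l) L) ==> distinct L"
 by (induction L) (auto split:if_splits)

lemma separated_distinct:"!l:set L. length l = d ==> separated d L ==> distinct L"
proof (induction d arbitrary:L)
 case 0
 thus ?case by (auto split:list.splits)
next
 case (Suc d)
 have "distinct (map tl (filter hd L))" "distinct (map tl (filter (%l. ~hd l) L))" using Suc.prems by (auto intro!:Suc.IH)
 thus ?case by (intro distinct_filters[of hd L]) (simp_all add:distinct_map)
qed

text \<open>A start vector: the fundamental weight of node 8 modulo 2, half the last row of
  \<open>E_inverse 8\<close>. The start vectors of the frames are the first rows of
  \<open>E_frame_coeffs\<close> modulo 2.\<close>

definition "E8_root = [False,False,True,False,False,True,False,True,False]"

definition E8_root_steps :: "(nat \<times> nat) list" where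
 "E8_root_steps =
  [(0,8),(0,7),(0,6),(0,5),(0,4),(0,2),(0,3),(0,1),(0,2),(0,1),(2,4),(0,1),(0,5),(0,
1),(0,3),(0,4),(0,2),(0,6),(0,2),(0,4),(0,3),(0,1),(0,7),(0,1),(0,3),(0,4),(0,2),
(0,5),(0,2),(0,6),(0,2),(0,4),(0,3),(0,1),(0,5),(0,1),(0,3),(0,8),(0,3),(0,1),(0,
4),(0,1),(0,2),(0,1),(0,3),(0,2),(0,7),(0,2),(0,3),(0,1),(0,2),(0,1),(0,4),(0,1),
(0,3),(0,5),(0,3),(0,1),(0,7),(0,1),(0,3),(0,4),(0,2),(0,6),(0,2),(0,4),(0,3),(0,
1),(0,8),(0,1),(0,3),(0,7),(0,3),(0,1),(2,4),(0,2),(11,5),(0,2),(0,4),(0,3),(0,1),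
(18,7),(0,2),(28,6),(0,3),(0,1),(0,4),(0,1),(0,2),(0,1),(0,3),(0,2),(0,5),(0,2),(0,
3),(0,1),(0,2),(0,1),(2,4),(0,1),(1,3),(8,4),(11,4),(0,6),(0,5),(0,7),(0,5),(0,8),
(0,4),(0,2),(0,3),(0,1),(0,2),(0,1),(6,5),(0,6),(0,7),(1,8),(103,5)]"

definition "E8_frame = [False,True,False,False,True,False,True,False,True]"

definition E8_frame_steps :: "(nat \<times> nat) list" where
 "E8_frame_steps =
  [(0,2),(0,4),(0,3),(0,1),(0,5),(0,1),(0,3),(0,6),(0,3),(0,1),(0,4),(0,1),(0,2),(0,
1),(0,3),(0,2),(0,5),(0,2),(0,3),(0,1),(0,2),(0,1),(0,7),(0,1),(0,2),(0,1),(0,3),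
(0,2),(0,4),(0,6),(0,4),(0,2),(0,3),(0,1),(0,2),(0,1),(0,8),(0,1),(0,2),(0,1),(0,
3),(0,2),(0,4),(0,5),(0,7),(0,5),(0,4),(0,2),(0,3),(0,1),(0,2),(0,1),(2,4),(0,1),
(0,5),(0,1),(0,3),(0,4),(0,2),(0,6),(0,2),(0,4),(0,3),(0,1),(3,5),(0,2),(0,4),(0,
3),(0,1),(10,7),(0,2),(0,4),(0,3),(0,1),(0,5),(0,1),(0,3),(0,6),(0,3),(0,1),(0,4),
(0,1),(0,2),(0,1),(0,3),(0,2),(0,5),(0,2),(0,3),(0,1),(0,2),(0,1),(0,8),(0,1),(0,
2),(0,1),(0,3),(0,2),(0,4),(0,7),(0,6),(0,4),(0,2),(0,3),(0,1),(0,2),(0,1),(6,5),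
(9,8),(13,4),(0,1),(0,3),(0,8),(0,3),(0,1),(30,4),(36,8),(0,1),(0,3),(0,6),(0,3),(0,
1),(0,5),(0,1),(0,3),(0,4),(0,2),(8,7),(0,3),(0,1),(53,7),(86,6),(88,8),(104,7)]"

definition "E7_root = [False,False,False,True,False,True,False,True,False]"

definition E7_root_steps :: "(nat \<times> nat) list" where
 "E7_root_steps =
  [(0,1),(0,3),(0,4),(0,2),(0,5),(0,2),(0,6),(0,2),(0,4),(0,3),(0,1),(0,5),(0,1),(0,
3),(0,7),(0,3),(0,1),(0,4),(0,1),(0,2),(0,1),(0,3),(0,2),(0,6),(0,2),(0,3),(0,1),
(0,2),(0,1),(0,4),(0,1),(0,3),(3,5),(0,1),(0,2),(0,1),(0,3),(0,2),(0,4),(3,4),(0,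
1),(0,3),(17,4),(0,6),(0,5),(0,7),(0,5),(0,4),(0,2),(0,3),(0,1),(0,2),(0,1),(7,6),
(37,5),(0,1),(0,3),(0,4),(0,2),(48,6),(0,1),(0,3)]"

definition "E7_frame = [False,True,True,False,False,True,False,True,False]"

definition E7_frame_steps :: "(nat \<times> nat) list" where
 "E7_frame_steps =
  [(0,3),(0,1),(0,4),(0,1),(0,2),(0,1),(0,3),(0,2),(0,5),(0,2),(0,3),(0,1),(0,2),(0,
1),(0,6),(0,1),(0,2),(0,1),(0,3),(0,2),(0,4),(0,5),(0,7),(0,5),(0,4),(0,2),(0,3),
(0,1),(0,2),(0,1),(2,4),(0,1),(0,5),(0,1),(0,3),(0,4),(0,2),(0,6),(0,2),(0,4),(0,
3),(0,1),(3,5),(0,2),(0,4),(0,3),(0,1),(10,7),(0,2),(0,4),(0,3),(0,1),(0,5),(0,1),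
(0,3),(0,6),(0,3),(0,1),(3,7),(36,6),(39,6),(54,4)]"

text \<open>The sum of the simple roots 2, 5 and 7, the nonzero element of the radical of the form
  on M / 2M.\<close>

definition "E7_radical = [False,False,True,False,False,True,False,True,False]"

definition proper_steps :: "nat list=>(nat \<times> nat) list=>bool" where
 "proper_steps ns steps <-> list_all (%(p,i). i:set ns) steps"

lemma E8_steps:"proper_steps [1,2,3,4,5,6,7,8] E8_root_steps" "proper_steps [1,2,3,4,5,6,7,8] E8_frame_steps"
 by code_simp+

lemma E7_steps:"proper_steps [1,2,3,4,5,6,7] E7_root_steps" "proper_steps [1,2,3,4,5,6,7] E7_frame_steps"
 by code_simp+

lemma E8_separated:
 "separated 9 (replicate 9 False # walk E8_root_steps [E8_root] @ walk E8_frame_steps [E8_frame])" by code_simp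

lemma E8_lengths:"int_length (walk E8_root_steps [E8_root]) = 120" "int_length (walk E8_frame_steps [E8_frame]) = 135"
 by code_simp+

lemma E7_separated:
 "separated 9 (replicate 9 False # E7_radical # walk E7_root_steps [E7_root] @ walk E7_frame_steps [E7_frame])" by code_simp

lemma E7_lengths:"int_length (walk E7_root_steps [E7_root]) = 63" "int_length (walk E7_frame_steps [E7_frame]) = 63"
 by code_simp+

text \<open>Consecutive vectors differ by twice the simple roots of the chain 8, 7, 6, 5, 4, 3, 1
  for E8 and 7, 6, 5, 4, 2 for E7, so they are congruent modulo 2M. Half their sum is the
  fundamental weight of node 2, respectively 3.\<close>

definition E_frame_coeffs :: "nat=>int list list" where
 "E_frame_coeffs n = (if n = 7 then
  [[0,1,1,2,2,1,0,- 1,0],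
[0,1,1,2,2,1,0,1,0],
[0,1,1,2,2,1,2,1,0],
[0,1,1,2,2,3,2,1,0],
[0,1,1,2,4,3,2,1,0],
[0,1,3,2,4,3,2,1,0]]
 else
  [[0,1,2,2,3,2,1,0,- 1],
[0,1,2,2,3,2,1,0,1],
[0,1,2,2,3,2,1,2,1],
[0,1,2,2,3,2,3,2,1],
[0,1,2,2,3,4,3,2,1],
[0,1,2,2,5,4,3,2,1],
[0,1,2,4,5,4,3,2,1],
[0,3,2,4,5,4,3,2,1]])"

text \<open>With first argument 0 the delta term of \<open>pairing\<close> vanishes at every node
  and minus the product with a simple root remains; hence -4 for vectors of norm 4.\<close>

definition "frame_ok n ns j l <-> (let F = E_frame_coeffs n; ms = [0..<length F] in
  list_all (%u. u ! 0 = 0 & length u = 9 & (8:set ns \<or> u ! 8 = 0)) F &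
  list_all (%a. list_all (%b.
   sum_list (map (%i. F ! a ! i * pairing 0 i (F ! b)) ns) = (if a = b then - 4 else 0) &
   list_all (%i. even (F ! a ! i + F ! b ! i)) ns) ms) ms &
  list_all (%i. (l ! i <-> odd (F ! 0 ! i)) & sum_list (map (%u. u ! i) F) = E_inv n j i &
   even ((if i = j then 1 else 0) + pairing 0 i (F ! 0))) ns)"

lemma E8_frame_ok:"frame_ok 8 [1,2,3,4,5,6,7,8] 2 E8_frame" by code_simp

lemma E7_frame_ok:"frame_ok 7 [1,2,3,4,5,6,7] 3 E7_frame" by code_simp

definition "root_ok n ns j l <-> list_all (%i. (E_inv n j i + (if l ! i then 2 else 0)) mod 4 = 0) ns"

lemma E_root_ok:"root_ok 8 [1,2,3,4,5,6,7,8] 8 E8_root" "root_ok 7 [1,2,3,4,5,6,7] 1 E7_root" by code_simp+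

context E_roots
begin

definition congr :: "'a=>'a=>bool" where
 "congr x y <-> (!w:N. ev (ip x w - ip y w))"

lemma congruent_trans:"congr x y ==> congr y z ==> congr x z" unfolding congr_def using ev_add by force

lemma refl_adjoint:"be:Ph ==> ip (refl be x) w = ip x (refl be w)" by (simp add:refl_def ip_simps ip_com)

lemma refl_N:
 assumes "be:Ph" "w:N"
 shows "refl be w:N"
proof -
 have "ip ga (refl be w):\<int>" if "ga:Ph" for ga
  using M_N_int[OF root_M[OF refl_root[OF assms(1) that]] assms(2)] refl_adjoint[OF assms(1)] by simp
 thus ?thesis by (simp add:N_def)
qed

lemma congruent_reflect:"be:Ph ==> congr x y ==> congr (refl be x) (refl be y)"
 unfolding congr_def using refl_N by (simp add:refl_adjoint)

definition "refl_inv P <-> (!x y. congr x y --> P y --> P x) & (!be:Ph. !x. P x --> P (refl be x))"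

definition "rtcl j x <-> (EX b:bases. congr x (om b j))"

definition frdata :: "nat=>nat=>'a=>(nat=>'a)=>(nat=>'a)=>bool" where
 "frdata k j x f b <-> (!i<k. f i:M) & (!i<k. !l<k. ip (f i) (f l) = (if i = l then 4 else 0)) &
  (!i<k. !l<k. i ~= l --> (1/2) *r (f i + f l):M) & congr x (f 0) &
  b:bases & (1/2) *r (SUM i<k. f i) = om b j & (!be:Ph. ev (ip be (om b j) - ip be x))"

definition "frcl k j x <-> (EX f b. frdata k j x f b)"

lemma root_class_invariant:"refl_inv (rtcl j)" unfolding refl_inv_def
proof (intro conjI ballI allI impI)
 show "rtcl j x" if "congr x y" "rtcl j y" for x y using that congruent_trans unfolding rtcl_def by blast
 fix be x assume be:"be:Ph" and "rtcl j x"
 then obtain b where b:"b:bases" "congr x (om b j)" unfolding rtcl_def by blast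
 thus "rtcl j (refl be x)" by (metis congruent_reflect[OF be] om_rbase rbase[OF be b(1)] rtcl_def)
qed

lemma frame_class_invariant:"refl_inv (frcl k j)" unfolding refl_inv_def
proof (intro conjI ballI allI impI)
 fix x y assume xy:"congr x y" and "frcl k j y"
 then obtain f b where "frdata k j y f b" unfolding frcl_def by blast
 note f = this[unfolded frdata_def]
 have "ev (ip be (om b j) - ip be x)" if be:"be:Ph" for be
 proof -
  have "ev (ip x be - ip y be)" using root_M[OF be] M_N xy by (auto simp:congr_def)
  moreover have "ev (ip be (om b j) - ip be y)" using f be by blast
  ultimately show ?thesis using ev_diff[rotated] by (force simp:ip_com)
 qed
 moreover have "congr x (f 0)" using f congruent_trans[OF xy] by blast
 ultimately have "frdata k j x f b" unfolding frdata_def using f by blast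
 thus "frcl k j x" unfolding frcl_def by blast
next
 fix ga x assume ga:"ga:Ph" and "frcl k j x"
 then obtain f b where "frdata k j x f b" unfolding frcl_def by blast
 note f = this[unfolded frdata_def]
 have add:"refl ga (u + v) = refl ga u + refl ga v" and scale:"refl ga (r *r u) = r *r refl ga u" for u v r
  by (simp_all add:refl_def ip_simps algebra_simps)
 have b:"b:bases" and p:"(1/2) *r (SUM i<k. f i) = om b j" using f by blast+
 have "(1/2) *r (SUM i<k. refl ga (f i)) = refl ga ((1/2) *r (SUM i<k. f i))"
  using refl_linear[of ga "%_. 1" f "{..<k}"] by (simp add:scale)
 also have "... = om (rbase ga b) j" unfolding p om_rbase ..
 finally have s:"(1/2) *r (SUM i<k. refl ga (f i)) = om (rbase ga b) j" .
 have half:"!i<k. !l<k. i ~= l --> (1/2) *r (refl ga (f i) + refl ga (f l)):M"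
 proof (intro allI impI)
  fix i l assume "i < k" "l < k" "i ~= l"
  thus "(1/2) *r (refl ga (f i) + refl ga (f l)):M"
  using f refl_M[OF ga, of "(1/2) *r (f i + f l)"] by (simp add:add scale)
 qed
 have par:"!be:Ph. ev (ip be (om (rbase ga b) j) - ip be (refl ga x))"
  using f refl_root[OF ga] unfolding om_rbase refl_adjoint[OF ga, symmetric] by blast
 have "frdata k j (refl ga x) (%i. refl ga (f i)) (rbase ga b)" unfolding frdata_def refl_ip[OF ga]
 proof (intro conjI half par s rbase[OF ga b])
  show "!i<k. refl ga (f i):M" using f refl_M[OF ga] by blast
  show "congr (refl ga x) (refl ga (f 0))" using f congruent_reflect[OF ga] by blast
 qed (use f in blast)
 thus "frcl k j (refl ga x)" unfolding frcl_def by blast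
qed

definition "bits l = {i:nodes 8. l ! i}"

definition "ccode l <-> length l = 9 & ~l ! 0 & bits l <= NN"

lemma nodes_8:"NN <= nodes 8" using n by (auto simp:nodes_def)

lemma node_root_bits:
 assumes "ccode l"
 shows "nsum a0 (bits l) = (SUM k:NN. of_int (if l ! k then 1 else 0) *r a0 k)"
proof -
 have "bits l = {k:NN. l ! k}" using assms nodes_8 by (auto simp:ccode_def bits_def)
 hence "nsum a0 (bits l) = (SUM k:NN. if l ! k then a0 k else 0)"
  unfolding nsum_def using sum.inter_filter[of "NN" a0 "%k. l ! k"] by simp
 also have "... = (SUM k:NN. of_int (if l ! k then 1 else 0) *r a0 k)" by (rule sum.cong) auto
 finally show ?thesis .
qed

lemma congruent_coeffs:
 assumes "!!k. k:NN ==> even (x k - y k)"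
 shows "congr (SUM k:NN. of_int (x k) *r a0 k) (SUM k:NN. of_int (y k) *r a0 k)" unfolding congr_def
proof
 fix w assume w:"w:N"
 have "ip (SUM k:NN. of_int (x k) *r a0 k) w - ip (SUM k:NN. of_int (y k) *r a0 k) w =
   (SUM k:NN. of_int (x k - y k) * ip (a0 k) w)" by (simp add:ip_suml ip_sl left_diff_distrib sum_subtractf)
 moreover have "ev (SUM k:NN. of_int (x k - y k) * ip (a0 k) w)"
  using assms w N_iff[OF a0_base] by (intro ev_sum ev_mult) (auto simp del:of_int_diff)
 ultimately show "ev (ip (SUM k:NN. of_int (x k) *r a0 k) w - ip (SUM k:NN. of_int (y k) *r a0 k) w)" by simp
qed

lemma ip_base_sum:
 assumes i:"i:NN"
 shows "ip (a0 i) (SUM k:NN. of_int (x k) *r a0 k) = of_int (SUM k:NN. x k * E_cartan i k)"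
 using gram[OF a0_base i] by (simp add:ip_sumr ip_sr)

lemma odd_nbrs_iff:"i:nodes 8 ==> odd_nbrs i l <-> odd (SUM k:nodes 8. (if l ! k then 1 else 0) * E_cartan i k)"
 unfolding nodes8 by (elim insertE emptyE; hypsubst) (simp_all add:odd_nbrs_def nbrs_def cartan_code E_edges_def)

lemma sum_nodes_8:"(!!k. k:nodes 8 - NN ==> x k = 0) ==> (SUM k:NN. x k * E_cartan i k) = (SUM k:nodes 8. x k * E_cartan i k)"
 using nodes_8 by (intro sum.mono_neutral_left) auto

lemma move_class_code:
 assumes i:"i:NN" and l:"ccode l"
 shows "ccode (move i l)"
proof -
 have "i > 0" "i <= 8" using i nodes_8 by (auto simp:nodes_def)
 hence "k ~= i ==> move i l ! k = l ! k" "length (move i l) = length l" for k by (auto simp:move_def)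
 moreover have "k:NN" if "k:nodes 8" "move i l ! k" for k
  using calculation(1)[of k] that i l by (cases "k = i") (auto simp:ccode_def bits_def)
 moreover have "0 ~= i" using \<open>i > 0\<close> by simp
 ultimately show ?thesis using l by (auto simp:ccode_def bits_def)
qed

text \<open>A simple reflection changes a single coefficient. Modulo 2 the diagonal entry of the
  Cartan matrix drops out, so the change is the parity of the neighbours.\<close>

lemma move_congruent:
 assumes i:"i:NN" and l:"ccode l"
 shows "congr (nsum a0 (bits (move i l))) (refl (a0 i) (nsum a0 (bits l)))"
proof -
 let ?x = "%k. if l ! k then 1 else 0 :: int"
 let ?p = "SUM k:NN. ?x k * E_cartan i k"
 have p:"?p = (SUM k:nodes 8. ?x k * E_cartan i k)" using l by (intro sum_nodes_8) (auto simp:ccode_def bits_def)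
 have i8:"i:nodes 8" using i nodes_8 by blast
 have "refl (a0 i) (nsum a0 (bits l)) = (SUM k:NN. of_int (?x k) *r a0 k) - of_int ?p *r a0 i"
  unfolding node_root_bits[OF l] refl_def ip_base_sum[OF i] ..
 also have "of_int ?p *r a0 i = (SUM k:NN. if k = i then of_int ?p *r a0 i else 0)" using i by simp
 also have "(SUM k:NN. of_int (?x k) *r a0 k) - ... = (SUM k:NN. of_int (?x k - (if k = i then ?p else 0)) *r a0 k)"
  unfolding sum_subtractf[symmetric] by (intro sum.cong) (auto simp:scaleR_diff_left)
 finally have r:"refl (a0 i) (nsum a0 (bits l)) = (SUM k:NN. of_int (?x k - (if k = i then ?p else 0)) *r a0 k)" .
 have len:"i < length l" using i8 l by (auto simp:ccode_def nodes_def)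
 show ?thesis unfolding r node_root_bits[OF move_class_code[OF i l]]
 proof (rule congruent_coeffs)
  fix k assume "k:NN"
  have "odd_nbrs i l <-> odd ?p" unfolding odd_nbrs_iff[OF i8] p ..
  thus "even ((if move i l ! k then 1 else 0) - (?x k - (if k = i then ?p else 0)))"
   using len by (cases "k = i") (auto simp:move_def)
 qed
qed

lemma walk_invariant:
 assumes P:"refl_inv P" and st:"proper_steps ns steps" "set ns <= NN"
  and ls:"!l:set ls. ccode l & P (nsum a0 (bits l))"
 shows "!l:set (walk steps ls). ccode l & P (nsum a0 (bits l))" using st(1) ls
proof (induction steps ls rule:walk.induct)
 case (2 p i steps ls)
 have i:"i:NN" using 2(2) st(2) by (auto simp:proper_steps_def)
 have "proper_steps ns steps" using 2(2) by (simp add:proper_steps_def)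
 moreover have "!l:set (case drop p ls of []=>ls | l # _=>move i l # ls). ccode l & P (nsum a0 (bits l))"
 proof (cases "drop p ls")
  case (Cons l L)
  hence "l:set ls" by (metis in_set_dropD list.set_intros(1))
  hence l:"ccode l" "P (nsum a0 (bits l))" using 2(3) by blast+
  have "P (nsum a0 (bits (move i l)))"
  using P l(2) b_root[OF a0_base i] move_congruent[OF i l(1)] by (auto simp:refl_inv_def)
  thus ?thesis using Cons 2(3) move_class_code[OF i l(1)] by auto
 qed (use 2(3) in auto)
 ultimately show ?case unfolding walk.simps by (rule 2(1))
qed simp

lemma root_ok_class:
 assumes ok:"root_ok n ns j l" and ns:"set ns = NN" and l:"ccode l" and j:"j:NN"
 shows "rtcl j (nsum a0 (bits l))"
proof -
 have e:"even (E_inv n j i)" "even ((if l ! i then 1 else 0) - E_inv n j i div 2)" if "i:NN" for i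
 proof -
  have "(E_inv n j i + (if l ! i then 2 else 0)) mod 4 = 0" using ok that ns unfolding root_ok_def list_all_iff by blast
  thus "even (E_inv n j i)" "even ((if l ! i then 1 else 0) - E_inv n j i div 2)" by (cases "l ! i"; simp only:; presburger)+
 qed
 have "om a0 j = (SUM k:NN. of_int (E_inv n j k div 2) *r a0 k)"
  unfolding om_def using e(1) by (intro sum.cong refl) (simp add:real_of_int_div)
 hence "congr (nsum a0 (bits l)) (om a0 j)" unfolding node_root_bits[OF l] using congruent_coeffs[OF e(2)] by simp
 thus ?thesis unfolding rtcl_def using a0_base by blast
qed

lemma frame_ok_class:
 assumes ok:"frame_ok n ns j l" and ns:"set ns = NN" "distinct ns" and l:"ccode l" and j:"j:NN"
  and k:"k = length (E_frame_coeffs n)" "k > 0"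
 shows "frcl k j (nsum a0 (bits l))"
proof -
 define F where "F i = E_frame_coeffs n ! i" for i
 define f where "f i = (SUM k:NN. of_int (F i ! k) *r a0 k)" for i
 have sl:"sum_list (map x ns) = (SUM i:NN. x i)" for x :: "nat=>int" using ns by (simp add:sum_list_distinct_conv_sum_set)
 have ok1:"!u:set (E_frame_coeffs n). 8:NN \<or> u ! 8 = 0"
  and ok2:"!a:{0..<k}. !b:{0..<k}. sum_list (map (%i. F a ! i * pairing 0 i (F b)) ns) = (if a = b then - 4 else 0) &
   (!i:NN. even (F a ! i + F b ! i))"
  and ok3:"!i:NN. (l ! i <-> odd (F 0 ! i)) & sum_list (map (%u. u ! i) (E_frame_coeffs n)) = E_inv n j i &
   even ((if i = j then 1 else 0) + pairing 0 i (F 0))"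
  using ok unfolding frame_ok_def Let_def list_all_iff set_upt ns(1) F_def k(1) by blast+
 have z:"F a ! i = 0" if "a < k" "i:nodes 8 - NN" for a i
 proof -
  have "i = 8" "8 ~: NN" using that(2) n by (auto simp:nodes_def)
  thus ?thesis using ok1 that(1) k(1) by (auto simp:F_def)
 qed
 have g:"(SUM i:NN. F a ! i * pairing 0 i (F b)) = (if a = b then - 4 else 0)"
  "i:NN ==> even (F a ! i + F b ! i)" if "a < k" "b < k" for a b i
  using bspec[OF bspec[OF ok2], of a b] that unfolding sl by auto
 have h:"l ! i <-> odd (F 0 ! i)" "sum_list (map (%u. u ! i) (E_frame_coeffs n)) = E_inv n j i"
  "even ((if i = j then 1 else 0) + pairing 0 i (F 0))" if "i:NN" for i using ok3 that by blast+
 have lab:"ip (a0 i) (f a) = of_int (- pairing 0 i (F a))" if "i:NN" "a < k" for i a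
 proof -
  have i8:"i:nodes 8" "i ~= 0" using that nodes_8 by (auto simp:nodes_def)
  show ?thesis unfolding f_def ip_base_sum[OF that(1)] pairing_E_cartan[OF i8(1)]
   using sum_nodes_8[of "%k. F a ! k" i] z[OF that(2)] i8(2) by simp
 qed
 have fM:"f a:M" for a unfolding f_def using root_M b_root[OF a0_base] by (intro M_sum M_scale) auto
 have ff:"ip (f a) (f b) = (if a = b then 4 else 0)" if "a < k" "b < k" for a b
 proof -
  have "ip (f a) (f b) = (SUM i:NN. of_int (F a ! i) * ip (a0 i) (f b))" by (simp add:f_def[of a] ip_suml ip_sl)
  also have "... = - of_int (SUM i:NN. F a ! i * pairing 0 i (F b))" using lab[OF _ that(2)] by (simp add:sum_negf)
  finally show ?thesis unfolding g(1)[OF that] by simp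
 qed
 have half:"(1/2) *r (f a + f b):M" if "a < k" "b < k" for a b
 proof -
  have "(1/2) *r (f a + f b) = (SUM i:NN. of_int ((F a ! i + F b ! i) div 2) *r a0 i)"
   unfolding f_def sum.distrib[symmetric] scaleR_sum_right using g(2)[OF that]
   by (intro sum.cong refl) (simp add:real_of_int_div scaleR_add_left[symmetric])
  thus ?thesis using root_M b_root[OF a0_base] by (auto intro!:M_sum M_scale)
 qed
 have p:"(1/2) *r (SUM a<k. f a) = om a0 j"
 proof -
  have "(SUM a<k. F a ! i) = E_inv n j i" if "i:NN" for i
   using h(2)[OF that] unfolding F_def k by (simp add:sum_list_sum_nth atLeast0LessThan)
  hence "(SUM a<k. real_of_int (F a ! i)) = of_int (E_inv n j i)" if "i:NN" for i using that by (metis of_int_sum)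
  thus ?thesis unfolding f_def om_def by (subst sum.swap) (simp add:scaleR_sum_left[symmetric] scaleR_sum_right)
 qed
 have c:"congr (nsum a0 (bits l)) (f 0)" unfolding node_root_bits[OF l] f_def using h(1) by (intro congruent_coeffs) auto
 have par:"ev (ip be (om a0 j) - ip be (nsum a0 (bits l)))" if be:"be:Ph" for be
 proof -
  have "ev (ip be (om a0 j) - ip be (f 0))"
  proof -
   have "ip be (om a0 j) - ip be (f 0) = (SUM i:NN. (ip (a0 i) (om a0 j) - ip (a0 i) (f 0)) * ip (om a0 i) be)"
    unfolding ip_expand[OF a0_base, of be] sum_subtractf[symmetric] by (intro sum.cong refl) (simp add:algebra_simps)
   moreover have "ev ((ip (a0 i) (om a0 j) - ip (a0 i) (f 0)) * ip (om a0 i) be)" if i:"i:NN" for i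
   proof (rule ev_mult)
    have eq:"ip (a0 i) (om a0 j) - ip (a0 i) (f 0) = of_int ((if i = j then 1 else 0) + pairing 0 i (F 0))"
     using lab[OF i k(2)] b_om[OF a0_base i j] by simp
    show "ev (ip (a0 i) (om a0 j) - ip (a0 i) (f 0))" unfolding eq ev_of_int by (rule h(3)[OF i])
    show "ip (om a0 i) be:\<int>" using root_M[OF be] i M_eq by blast
   qed
   ultimately show ?thesis by (simp add:ev_sum)
  qed
  moreover have "ev (ip (nsum a0 (bits l)) be - ip (f 0) be)" using root_M[OF be] M_N c by (auto simp:congr_def)
  ultimately show ?thesis using ev_diff by (force simp:ip_com)
 qed
 have "frdata k j (nsum a0 (bits l)) f a0" unfolding frdata_def using fM ff half c a0_base p par by blast
 thus ?thesis unfolding frcl_def by blast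
qed

lemma bits_inj:
 assumes "ccode l" "ccode l'" "bits l = bits l'"
 shows "l = l'"
proof (rule nth_equalityI)
 fix i assume "i < length l"
 hence "i = 0 \<or> i:nodes 8" using assms(1) by (auto simp:ccode_def nodes_def)
 thus "l ! i = l' ! i" using assms by (auto simp:ccode_def bits_def)
qed (use assms in \<open>simp add:ccode_def\<close>)

text \<open>As there are 2^n subsets, 2^n distinct codes exhaust them, and a sum over all characters
  becomes a sum over the list.\<close>

lemma sum_Pow_codes:
 fixes F :: "nat set=>'b::comm_monoid_add"
 assumes L:"!l:set L. ccode l" "separated 9 L" "length L = 2 ^ n"
 shows "(SUM m:Pow (NN). F m) = sum_list (map (%l. F (bits l)) L)"
proof -
 have d:"distinct L" using L(1,2) by (intro separated_distinct) (auto simp:ccode_def)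
 have inj:"inj_on bits (set L)" using L(1) bits_inj by (auto simp:inj_on_def)
 have "bits ` set L = Pow (NN)"
 proof (rule card_subset_eq)
  show "bits ` set L <= Pow (NN)" using L(1) by (auto simp:ccode_def)
  show "card (bits ` set L) = card (Pow (NN))" using d L(3) by (simp add:card_image[OF inj] distinct_card card_Pow)
 qed simp
 thus ?thesis using sum.reindex[OF inj, of F] d by (simp add:sum_list_distinct_conv_sum_set)
qed

lemma sum_list_constant:
 fixes F :: "'b=>nat"
 assumes "!l:set L. F l = a"
 shows "sum_list (map F L) = length L * a" using assms by (induction L) auto

lemma zero_code:"ccode (replicate 9 False)" "bits (replicate 9 False) = {}"
 by (auto simp:ccode_def bits_def nodes_def)

text \<open>The count is 1 + 120 + 135 = 256: zero, the 240 roots up to sign, and the 2160 vectors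
  of norm 4 in frames of 16 with signs.\<close>

theorem sum_classes_E8:
 fixes F :: "nat set=>nat"
 assumes n_eq:"n = 8" and 0:"F {} = a"
  and r:"!!m. m <= NN ==> rtcl 8 (nsum a0 m) ==> F m = b"
  and f:"!!m. m <= NN ==> frcl 8 2 (nsum a0 m) ==> F m = d"
 shows "(SUM m:Pow (NN). F m) = a + 120 * b + 135 * d"
proof -
 let ?ns = "[1,2,3,4,5,6,7,8]" and ?R = "walk E8_root_steps [E8_root]" and ?S = "walk E8_frame_steps [E8_frame]"
 have N:"NN = nodes 8" by (simp only:n_eq)
 have ns:"set ?ns = NN" unfolding N nodes8 by auto
 have j:"2:NN" "8:NN" unfolding N by (simp_all add:nodes_def)
 have code:"ccode E8_root" "ccode E8_frame"
  unfolding ccode_def bits_def N by (auto simp:E8_root_def E8_frame_def)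
 have R:"!l:set ?R. ccode l & rtcl 8 (nsum a0 (bits l))"
 proof (rule walk_invariant[OF root_class_invariant E8_steps(1)])
  show "!l:set [E8_root]. ccode l & rtcl 8 (nsum a0 (bits l))"
  using E_root_ok root_ok_class[OF _ ns code(1) j(2)] code(1) by (auto simp:n_eq)
 qed (simp only:ns)
 have "frcl 8 2 (nsum a0 (bits E8_frame))"
 proof (rule frame_ok_class[OF _ ns _ code(2) j(1)])
  show "frame_ok n ?ns 2 E8_frame" unfolding n_eq by (rule E8_frame_ok)
  show "8 = length (E_frame_coeffs n)" unfolding n_eq by (simp add:E_frame_coeffs_def)
 qed simp_all
 hence S:"!l:set ?S. ccode l & frcl 8 2 (nsum a0 (bits l))"
  using code(2) by (intro walk_invariant[OF frame_class_invariant E8_steps(2)]) (simp only:ns, simp)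
 have len:"length ?R = 120" "length ?S = 135" using E8_lengths by (simp_all add:int_length)
 have sub:"bits l <= NN" if "ccode l" for l using that by (simp add:ccode_def)
 have "(SUM m:Pow (NN). F m) = sum_list (map (%l. F (bits l)) (replicate 9 False # ?R @ ?S))"
  using R S zero_code(1) E8_separated len by (intro sum_Pow_codes) (auto simp:n_eq)
 also have "... = F {} + (sum_list (map (%l. F (bits l)) ?R) + sum_list (map (%l. F (bits l)) ?S))" by (simp add:zero_code(2))
 also have "sum_list (map (%l. F (bits l)) ?R) = length ?R * b" using R r sub by (intro sum_list_constant) blast
 also have "sum_list (map (%l. F (bits l)) ?S) = length ?S * d" using S f sub by (intro sum_list_constant) blast
 finally show ?thesis by (simp add:len 0)
qed

text \<open>The count is 1 + 1 + 63 + 63 = 128: zero, the radical, the 126 roots up to sign, and the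
  756 vectors of norm 4 in frames of 12 with signs.\<close>

theorem sum_classes_E7:
 fixes F :: "nat set=>nat"
 assumes n_eq:"n = 7" and 0:"F {} = a"
  and r:"!!m. m <= NN ==> rtcl 1 (nsum a0 m) ==> F m = b"
  and f:"!!m. m <= NN ==> frcl 6 3 (nsum a0 m) ==> F m = d"
  and rad:"F {2,5,7} = e"
 shows "(SUM m:Pow (NN). F m) = a + e + 63 * b + 63 * d"
proof -
 let ?ns = "[1,2,3,4,5,6,7]" and ?R = "walk E7_root_steps [E7_root]" and ?S = "walk E7_frame_steps [E7_frame]"
 have N:"NN = nodes 7" by (simp only:n_eq)
 have ns:"set ?ns = NN" unfolding N nodes7 by auto
 have j:"3:NN" "1:NN" unfolding N by (simp_all add:nodes_def)
 have code:"ccode E7_root" "ccode E7_frame" "ccode E7_radical" and bits:"bits E7_radical = {2,5,7}"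
  unfolding ccode_def bits_def N nodes7 nodes8 by (auto simp:E7_root_def E7_frame_def E7_radical_def)
 have R:"!l:set ?R. ccode l & rtcl 1 (nsum a0 (bits l))"
 proof (rule walk_invariant[OF root_class_invariant E7_steps(1)])
  show "!l:set [E7_root]. ccode l & rtcl 1 (nsum a0 (bits l))"
  using E_root_ok root_ok_class[OF _ ns code(1) j(2)] code(1) by (auto simp:n_eq)
 qed (simp only:ns)
 have "frcl 6 3 (nsum a0 (bits E7_frame))"
 proof (rule frame_ok_class[OF _ ns _ code(2) j(1)])
  show "frame_ok n ?ns 3 E7_frame" unfolding n_eq by (rule E7_frame_ok)
  show "6 = length (E_frame_coeffs n)" unfolding n_eq by (simp add:E_frame_coeffs_def)
 qed simp_all
 hence S:"!l:set ?S. ccode l & frcl 6 3 (nsum a0 (bits l))"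
  using code(2) by (intro walk_invariant[OF frame_class_invariant E7_steps(2)]) (simp only:ns, simp)
 have len:"length ?R = 63" "length ?S = 63" using E7_lengths by (simp_all add:int_length)
 have sub:"bits l <= NN" if "ccode l" for l using that by (simp add:ccode_def)
 have "(SUM m:Pow (NN). F m) = sum_list (map (%l. F (bits l)) (replicate 9 False # E7_radical # ?R @ ?S))"
  using R S zero_code(1) E7_separated len code(3) by (intro sum_Pow_codes) (auto simp:n_eq)
 also have "... = F {} + (F {2,5,7} + (sum_list (map (%l. F (bits l)) ?R) + sum_list (map (%l. F (bits l)) ?S)))"
  by (simp add:zero_code(2) bits)
 also have "sum_list (map (%l. F (bits l)) ?R) = length ?R * b" using R r sub by (intro sum_list_constant) blast
 also have "sum_list (map (%l. F (bits l)) ?S) = length ?S * d" using S f sub by (intro sum_list_constant) blast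
 finally show ?thesis by (simp add:len 0 rad)
qed

end

lemma sum_enat:"(SUM i:A. enat (f i)) = enat (SUM i:A. f i)" by (simp flip:of_nat_eq_enat)

section \<open>Assembly of the Betti numbers\<close>

context E_roots
begin

interpretation T:rtspace Ph n c a0 RTV ocell "%b C k. Re (coord b C k)" "%b z. cpt b (%k. of_real (z k))" sign_act
 by (rule real_toric_space_RTV)

definition "ibetti k m = the_enat (T.hdim m (topspace RTV) k)"

lemma rational_betti_RTV:"rational_betti k RTV = enat (SUM m:Pow (NN). ibetti k m)"
proof (rule rational_betti_eq)
 have "T.hdim m (topspace RTV) k = enat (ibetti k m)" if "m:Pow (NN)" for m
  using T.homology_function_strata(2)[of m k] that by (auto simp:ibetti_def)
 thus "rc.qdim (rat_cycles k RTV) (rat_boundaries k RTV) = enat (SUM m:Pow (NN). ibetti k m)"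
  unfolding T.quot_dim_decomposition sum_enat[symmetric] by (rule sum.cong[OF refl])
qed

lemma iso_class:
 assumes "m <= NN"
 obtains h r where "E_class Ph n c a0 (nsum a0 m) h r" "!!k. ibetti k m = h K k"
proof (rule that)
 show "E_class Ph n c a0 (nsum a0 m) (%A k. the_enat (T.hdim m (T.strat A) k))
   (%B A k. the_enat (T.rdim m (T.strat B) (T.strat A) k))"
  using T.homology_function_strata(1)[OF assms] T.node_root_M[OF assms]
  unfolding T.node_root_def by (intro E_class.intro[OF E_roots_axioms] E_class_axioms.intro)
qed (simp add:ibetti_def T.strata_K)

lemma isotypic_zero:"ibetti k {} = conc 0 1 k"
proof -
 obtain h r where h:"E_class Ph n c a0 (nsum a0 {}) h r" "!!k. ibetti k {} = h K k"
  using iso_class[of "{}"] by blast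
 then interpret C:E_class Ph n c a0 "nsum a0 {}" h r by blast
 show ?thesis unfolding h(2) by (rule C.h_K_zero) (simp add:nsum_def ip_0_left ev_0)
qed

lemma isotypic_root_E8:
 assumes "n = 8" "m <= NN" "rtcl 8 (nsum a0 m)"
 shows "ibetti k m = conc 1 1 k + conc 3 57710 k"
  by (metis assms iso_class[OF assms(2)] assms(3) E_class.h_root_E8 rtcl_def congr_def)

lemma isotypic_root_E7:
 assumes "n = 7" "m <= NN" "rtcl 1 (nsum a0 m)"
 shows "ibetti k m = conc 1 1 k + conc 3 1622 k"
  by (metis assms iso_class[OF assms(2)] assms(3) E_class.h_root_E7 rtcl_def congr_def)

lemma isotypic_frame:
 assumes "m <= NN" "frcl l j (nsum a0 m)" "l >= 2" "j:NN"
 obtains h r f b where "E_frame Ph n c a0 (nsum a0 m) h r l f b j" "!!k. ibetti k m = h K k"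
proof -
 obtain h r where h:"E_class Ph n c a0 (nsum a0 m) h r" "!!k. ibetti k m = h K k"
  using iso_class[OF assms(1)] by blast
 then interpret C:E_class Ph n c a0 "nsum a0 m" h r by blast
 obtain f b where "frdata l j (nsum a0 m) f b" using assms(2) by (auto simp:frcl_def)
 note f = this[unfolded frdata_def congr_def]
 have "E_frame Ph n c a0 (nsum a0 m) h r l f b j" by unfold_locales (use f assms(3,4) in blast)+
 thus ?thesis using that h(2) by blast
qed

lemma isotypic_radical:
 assumes n:"n = 7"
 shows "ibetti k {2,5,7} = conc 3 28855 k"
proof -
 have N:"NN = nodes 7" by (simp only:n)
 have sub:"{2,5,7} <= NN" unfolding N by (simp add:nodes_def)
 obtain h r where h:"E_class Ph n c a0 (nsum a0 {2,5,7}) h r" "!!k. ibetti k {2,5,7} = h K k"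
  using iso_class[OF sub] by blast
 have base:"ev (ip (a0 i) (nsum a0 {2,5,7}))" if i:"i:NN" for i
 proof -
  have j:"2:NN" "5:NN" "7:NN" using sub by auto
  have "ip (a0 i) (nsum a0 {2,5,7}) = of_int (E_cartan i 2 + E_cartan i 5 + E_cartan i 7)"
   using gram[OF a0_base i j(1)] gram[OF a0_base i j(2)] gram[OF a0_base i j(3)] by (simp add:nsum_def ip_addr)
  moreover have "even (E_cartan i 2 + E_cartan i 5 + E_cartan i 7)"
   using i unfolding N nodes7 by (elim insertE emptyE; hypsubst) (simp_all add:cartan_code E_edges_def)
  ultimately show ?thesis by (simp only:ev_of_int)
 qed
 have "ev (ip be (nsum a0 {2,5,7}))" if be:"be:Ph" for be
 proof -
  have "ev (SUM i:NN. ip (a0 i) (nsum a0 {2,5,7}) * ip (om a0 i) be)"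
   using base root_M[OF be] M_eq by (intro ev_sum ev_mult) auto
  thus ?thesis unfolding ip_expand[OF a0_base, of be] by (simp add:mult.commute)
 qed
 moreover have "~ev (ip (nsum a0 {2,5,7}) (om a0 2))"
  using b_om[OF a0_base, of _ 2] sub by (auto simp:nsum_def ip_addl not_ev_1)
 moreover have "om a0 2:N" using om_N[OF a0_base] sub by simp
 ultimately show ?thesis unfolding h(2) by (intro E_class.h_radical[OF h(1) n])
qed

text \<open>In degrees 1 to 4 the values are 120, 135 * 769 = 103815, 120 * 57710 = 6925200 and 135
  * 177280 = 23932800.\<close>

lemma rational_betti_E8:
 assumes n:"n = 8"
 shows "rational_betti k RTV = enat (conc 0 1 k + 120 * (conc 1 1 k + conc 3 57710 k) + 135 * (conc 2 769 k + conc 4 177280 k))"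
proof -
 have j:"2:NN" unfolding n by (simp add:nodes_def)
 have "ibetti k m = conc 2 769 k + conc 4 177280 k" if m:"m <= NN" "frcl 8 2 (nsum a0 m)" for m
  using isotypic_frame[OF m _ j] E_frame.h_frame_E8[OF _ n refl refl] by (metis numeral_le_iff semiring_norm(68,71))
 thus ?thesis
  unfolding rational_betti_RTV using sum_classes_E8[where F = "ibetti k", OF n isotypic_zero isotypic_root_E8[OF n]] by simp
qed

text \<open>In degrees 1 to 4 the values are 63, 63 * 129 = 8127, 28855 + 63 * 1622 = 131041 and 63
  * 1952 = 122976.\<close>

lemma rational_betti_E7:
 assumes n:"n = 7"
 shows "rational_betti k RTV = enat (conc 0 1 k + conc 3 28855 k + 63 * (conc 1 1 k + conc 3 1622 k) + 63 * (conc 2 129 k + conc 4 1952 k))"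
proof -
 have j:"3:NN" unfolding n by (simp add:nodes_def)
 have "ibetti k m = conc 2 129 k + conc 4 1952 k" if m:"m <= NN" "frcl 6 3 (nsum a0 m)" for m
  using isotypic_frame[OF m _ j] E_frame.h_frame_E7[OF _ n refl refl] by (metis numeral_le_iff semiring_norm(68,71))
 thus ?thesis
  unfolding rational_betti_RTV using sum_classes_E7[where F = "ibetti k", OF n isotypic_zero isotypic_root_E7[OF n] _ isotypic_radical[OF n]] by simp
qed

lemma weyl_variety:"simple_roots Ph al ==> weyl_real_toric_variety Ph al = RTV"
 by (simp add:weyl_real_toric_variety_def weyl_fan_cones coweight_lattice_eq cowts_def)

end
theorem theorem1p1:
  fixes \<Phi>7 :: "'a::euclidean_space set" and \<alpha>7 :: "nat \<Rightarrow> 'a"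
    and \<Phi>8 :: "'b::euclidean_space set" and \<alpha>8 :: "nat \<Rightarrow> 'b"
  assumes "root_system_of_type_E 7 \<Phi>7" and "simple_roots \<Phi>7 \<alpha>7"
    and "root_system_of_type_E 8 \<Phi>8" and "simple_roots \<Phi>8 \<alpha>8"
  shows "(\<forall>k. rational_betti k (weyl_real_toric_variety \<Phi>7 \<alpha>7) =
           (if k = 0 then 1
            else if k = 1 then 63
            else if k = 2 then 8127
            else if k = 3 then 131041
            else if k = 4 then 122976
            else 0)) \<and>
         (\<forall>k. rational_betti k (weyl_real_toric_variety \<Phi>8 \<alpha>8) =
           (if k = 0 then 1
            else if k = 1 then 120
            else if k = 2 then 103815
            else if k = 3 then 6925200
            else if k = 4 then 23932800
            else 0))"
proof (intro conjI allI)
  fix k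
  obtain c a where E: "E_roots \<Phi>7 7 c a" using exists_E_roots[OF assms(1)] by blast
  show "rational_betti k (weyl_real_toric_variety \<Phi>7 \<alpha>7) = (if k = 0 then 1 else if k = 1 then 63
      else if k = 2 then 8127 else if k = 3 then 131041 else if k = 4 then 122976 else 0)"
    unfolding E_roots.weyl_variety[OF E assms(2)] E_roots.rational_betti_E7[OF E refl]
    by (simp add: conc_def one_enat_def zero_enat_def numeral_eq_enat)
next
  fix k
  obtain c a where E: "E_roots \<Phi>8 8 c a" using exists_E_roots[OF assms(3)] by blast
  show "rational_betti k (weyl_real_toric_variety \<Phi>8 \<alpha>8) = (if k = 0 then 1 else if k = 1 then 120
      else if k = 2 then 103815 else if k = 3 then 6925200 else if k = 4 then 23932800 else 0)"
    unfolding E_roots.weyl_variety[OF E assms(4)] E_roots.rational_betti_E8[OF E refl]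
    by (simp add: conc_def one_enat_def zero_enat_def numeral_eq_enat)
qed

end
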